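(* Let $n\geqslant 1$ and let $H^n\subset\mathbb{R}^{n+1}$ be a local analytic, affinely homogeneous hypersurface having constant Hessian rank $1$. Then there exist an integer $1\leqslant n_H\leqslant n$ and affine coordinates $(x_1,\dots,x_n,u)$ on $\mathbb{R}^{n+1}$, centered at the base point of $H^n$, in which (locally) $$H^n=H^{n_H}\times\mathbb{R}^{n-n_H}_{x_{n_H+1},\dots,x_n}$$ is the product of an affinely homogeneous hypersurface $H^{n_H}\subset\mathbb{R}^{n_H+1}_{x_1,\dots,x_{n_H},u}$ with $\mathbb{R}^{n-n_H}$, and is graphed as $$u=\frac{x_1^2}{2}+\frac{x_1^2x_2}{2}+\sum_{m=3}^{n_H}\Big(\frac{x_1^mx_m}{m!}+x_1^{m-1}\sum_{\substack{i,j\geqslant 2\\ i+j=m+1}}\frac12\,\frac{x_ix_j}{(i-1)!(j-1)!}+O_{x_2,\dots,x_{m-1}}(3)\Big)+\sum_{m=n_H+2}^{\infty}E^m(x_1,\dots,x_{n_H}),$$ where the term $\frac{x_1^2x_2}{2}$ is present only when $n_H\geqslant 2$; the graphing function $F=F(x_1,\dots,x_{n_H})$ is thus independent of $x_{n_H+1},\dots,x_n$.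
   Context: All hypersurfaces are local and real analytic; neighborhoods may be shrunk finitely many times. Affine coordinates are related to the original ones by an invertible affine transformation of $\mathbb{R}^{n+1}$. Constant Hessian rank $1$: in affine coordinates in which $H$ is a graph $u=F(x_1,\dots,x_n)$, the Hessian matrix $\big(F_{x_ix_j}(x)\big)_{1\leqslant i,j\leqslant n}$ has rank $1$ for every $x$ near the base point (this is affinely invariant). Affinely homogeneous: an affine vector field on $\mathbb{R}^{n+1}$ is one whose coefficients are polynomials of degree $\leqslant 1$ in the coordinates. Let $\mathfrak{sym}(H)$ be the Lie algebra of affine vector fields $L$ such that $L|_H$ is tangent to $H$. The local hypersurface $H$ with base point $p_0$ is (locally) affinely homogeneous if $T_{p_0}H=\mathrm{Span}_{\mathbb{R}}\{L|_{p_0}: L\in\mathfrak{sym}(H)\}$. $O_{x_2,\dots,x_{m-1}}(3)$ inside the $m$-th parenthesis denotes a homogeneous polynomial of degree $m+1$ in $(x_1,\dots,x_{m-1})$ all of whose monomials have degree $\geqslant 3$ in $(x_2,\dots,x_{m-1})$. $E^m$ is a homogeneous polynomial of degree $m$ in $(x_1,\dots,x_{n_H})$. Empty sums are zero. *)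

theory Defs
  imports "HOL-Analysis.Analysis" "Jordan_Normal_Form.DL_Rank"
begin

text \<open>
  Since the number of effective variables is existentially quantified in the theorem, dimensions
  are terms: the space with coordinates \<open>(x\<^sub>1, \<dots>, x\<^sub>n, u)\<close> is the library's
  \<^term>\<open>Euclidean_space (Suc n)\<close>, whose points are functions \<^typ>\<open>nat \<Rightarrow> real\<close> vanishing from
  index \<open>Suc n\<close> on. The coordinate \<open>u\<close> sits at index \<open>0\<close> and \<open>x\<^sub>i\<close> at index \<open>i\<close>, for
  \<open>1 \<le> i \<le> n\<close>; hence \<open>\<real>\<^bsup>k+1\<^esup>\<close> with coordinates \<open>(x\<^sub>1, \<dots>, x\<^sub>k, u)\<close> is literally a subspace
  when \<open>k \<le> n\<close>. A function of \<open>x\<^sub>1, \<dots>, x\<^sub>n\<close> is a function on \<^typ>\<open>nat \<Rightarrow> real\<close> which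
  (near the point in question) depends on the entries \<open>1, \<dots>, n\<close> only.
\<close>

type_synonym point = "nat \<Rightarrow> real"


subsection \<open>Polynomials and analytic functions of \<open>x\<^sub>1, \<dots>, x\<^sub>k\<close>\<close>

definition multi_indices :: "nat \<Rightarrow> (nat \<Rightarrow> nat) set" where
  "multi_indices k = {\<alpha>. \<forall>i. i \<notin> {1..k} \<longrightarrow> \<alpha> i = 0}"

definition multi_degree :: "nat set \<Rightarrow> (nat \<Rightarrow> nat) \<Rightarrow> nat" where
  "multi_degree I \<alpha> = (\<Sum>i\<in>I. \<alpha> i)"

definition monomial_at :: "nat \<Rightarrow> (nat \<Rightarrow> nat) \<Rightarrow> point \<Rightarrow> real" where
  "monomial_at k \<alpha> x = (\<Prod>i\<in>{1..k}. x i ^ \<alpha> i)"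

lemma finite_multi_indices_degree:
  "finite {\<alpha> \<in> multi_indices k. multi_degree {1..k} \<alpha> = d}"
proof (rule finite_subset)
  show "{\<alpha> \<in> multi_indices k. multi_degree {1..k} \<alpha> = d}
      \<subseteq> {\<alpha>. \<forall>i. (i \<in> {1..k} \<longrightarrow> \<alpha> i \<in> {..d}) \<and> (i \<notin> {1..k} \<longrightarrow> \<alpha> i = 0)}"
  proof (clarsimp simp: multi_indices_def multi_degree_def)
    fix \<alpha> :: "nat \<Rightarrow> nat" and i
    assume "Suc 0 \<le> i" "i \<le> k"
    then show "\<alpha> i \<le> sum \<alpha> {Suc 0..k}"
      by (intro member_le_sum) auto
  qed
  show "finite {\<alpha>::nat \<Rightarrow> nat. \<forall>i. (i \<in> {1..k} \<longrightarrow> \<alpha> i \<in> {..d}) \<and> (i \<notin> {1..k} \<longrightarrow> \<alpha> i = 0)}"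
    by (rule finite_set_of_finite_funs) auto
qed

text \<open>
  Homogeneous of degree \<open>d\<close> in \<open>x\<^sub>1, \<dots>, x\<^sub>k\<close>, the zero polynomial included; in the second
  version all monomials have degree at least \<open>e\<close> in the variables \<open>x\<^sub>i\<close> with \<open>i \<in> I\<close>.
\<close>

definition homogeneous_poly :: "nat \<Rightarrow> nat \<Rightarrow> (point \<Rightarrow> real) \<Rightarrow> bool" where
  "homogeneous_poly k d P \<longleftrightarrow>
     (\<exists>c. \<forall>x. P x = (\<Sum>\<alpha> | \<alpha> \<in> multi_indices k \<and> multi_degree {1..k} \<alpha> = d.
                        c \<alpha> * monomial_at k \<alpha> x))"

definition homogeneous_poly_ord ::
    "nat \<Rightarrow> nat \<Rightarrow> nat set \<Rightarrow> nat \<Rightarrow> (point \<Rightarrow> real) \<Rightarrow> bool" where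
  "homogeneous_poly_ord k d I e P \<longleftrightarrow>
     (\<exists>c. \<forall>x. P x = (\<Sum>\<alpha> | \<alpha> \<in> multi_indices k \<and> multi_degree {1..k} \<alpha> = d
                             \<and> multi_degree I \<alpha> \<ge> e. c \<alpha> * monomial_at k \<alpha> x))"

definition xbox :: "nat \<Rightarrow> point \<Rightarrow> real \<Rightarrow> point set" where
  "xbox k a r = {x. \<forall>i\<in>{1..k}. \<bar>x i - a i\<bar> < r}"

text \<open>
  A (necessarily absolutely) convergent power series at \<open>a\<close>. As \<^const>\<open>xbox\<close> restricts only the
  entries \<open>1, \<dots>, k\<close>, this includes that \<open>F\<close> is near \<open>a\<close> a function of \<open>x\<^sub>1, \<dots>, x\<^sub>k\<close> alone.
\<close>

definition analytic_at :: "nat \<Rightarrow> (point \<Rightarrow> real) \<Rightarrow> point \<Rightarrow> bool" where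
  "analytic_at k F a \<longleftrightarrow>
     (\<exists>c. \<exists>r>0. \<forall>x\<in>xbox k a r.
        ((\<lambda>\<alpha>. c \<alpha> * monomial_at k \<alpha> (\<lambda>i. x i - a i)) has_sum F x) (multi_indices k))"

definition partial :: "nat \<Rightarrow> (point \<Rightarrow> real) \<Rightarrow> point \<Rightarrow> real" where
  "partial i F x = deriv (\<lambda>t. F (x(i := t))) (x i)"

text \<open>Matrix indices start at \<open>0\<close> and variable indices at \<open>1\<close>.\<close>

definition hessian :: "nat \<Rightarrow> (point \<Rightarrow> real) \<Rightarrow> point \<Rightarrow> real Matrix.mat" where
  "hessian n F x = Matrix.mat n n (\<lambda>(i, j). partial (Suc j) (partial (Suc i) F) x)"


subsection \<open>Local hypersurfaces in affine coordinates\<close>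

text \<open>Affine maps of \<open>\<real>\<^sup>N\<close> into itself; read as vector fields, these are the affine vector fields.\<close>

definition affine_map :: "nat \<Rightarrow> (point \<Rightarrow> point) \<Rightarrow> bool" where
  "affine_map N f \<longleftrightarrow>
     (\<exists>M b. \<forall>p i. f p i = (if i < N then b i + (\<Sum>j<N. M i j * p j) else 0))"

definition affine_coordinates :: "nat \<Rightarrow> (point \<Rightarrow> point) \<Rightarrow> bool" where
  "affine_coordinates N \<phi> \<longleftrightarrow>
     affine_map N \<phi> \<and>
     bij_betw \<phi> (topspace (Euclidean_space N)) (topspace (Euclidean_space N))"

definition locally_equal :: "nat \<Rightarrow> point \<Rightarrow> point set \<Rightarrow> point set \<Rightarrow> bool" where
  "locally_equal N p A B \<longleftrightarrow> (\<exists>U. openin (Euclidean_space N) U \<and> p \<in> U \<and> A \<inter> U = B \<inter> U)"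

definition graph_of :: "nat \<Rightarrow> (point \<Rightarrow> real) \<Rightarrow> point set" where
  "graph_of n F = {p \<in> topspace (Euclidean_space (Suc n)). p 0 = F p}"

definition graphed_in ::
    "nat \<Rightarrow> point set \<Rightarrow> point \<Rightarrow> (point \<Rightarrow> point) \<Rightarrow> (point \<Rightarrow> real) \<Rightarrow> bool" where
  "graphed_in n H p \<phi> F \<longleftrightarrow>
     affine_coordinates (Suc n) \<phi> \<and> analytic_at n F (\<phi> p) \<and>
     locally_equal (Suc n) (\<phi> p) (\<phi> ` H) (graph_of n F)"

text \<open>A local hypersurface is a set \<open>H\<close> with a base point \<open>p\<close>; only its germ at \<open>p\<close> matters.\<close>

definition local_analytic_hypersurface :: "nat \<Rightarrow> point set \<Rightarrow> point \<Rightarrow> bool" where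
  "local_analytic_hypersurface n H p \<longleftrightarrow>
     H \<subseteq> topspace (Euclidean_space (Suc n)) \<and> p \<in> H \<and> (\<exists>\<phi> F. graphed_in n H p \<phi> F)"

text \<open>By affine invariance of the rank, the choice of the graphing coordinates is immaterial.\<close>

definition constant_hessian_rank :: "nat \<Rightarrow> point set \<Rightarrow> point \<Rightarrow> nat \<Rightarrow> bool" where
  "constant_hessian_rank n H p r \<longleftrightarrow>
     (\<exists>\<phi> F. graphed_in n H p \<phi> F \<and>
        (\<exists>\<epsilon>>0. \<forall>x\<in>xbox n (\<phi> p) \<epsilon>. vec_space.rank n (hessian n F x) = r))"


subsection \<open>Affine homogeneity\<close>

text \<open>The velocities at \<open>p\<close> of the curves in \<open>H\<close> through \<open>p\<close>.\<close>

definition tangent_space :: "point set \<Rightarrow> point \<Rightarrow> point set" where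
  "tangent_space H p =
     {v. \<exists>\<gamma>. \<gamma> 0 = p \<and> (\<forall>\<^sub>F t in nhds (0::real). \<gamma> t \<in> H) \<and>
             (\<forall>i. ((\<lambda>t. \<gamma> t i) has_real_derivative v i) (at 0))}"

definition sym_algebra :: "nat \<Rightarrow> point set \<Rightarrow> point \<Rightarrow> (point \<Rightarrow> point) set" where
  "sym_algebra n H p0 =
     {L. affine_map (Suc n) L \<and>
         (\<exists>U. openin (Euclidean_space (Suc n)) U \<and> p0 \<in> U \<and>
              (\<forall>p\<in>H \<inter> U. L p \<in> tangent_space H p))}"

definition real_span :: "point set \<Rightarrow> point set" where
  "real_span S = {\<lambda>i. \<Sum>v\<in>T. c v * v i | T c. finite T \<and> T \<subseteq> S}"

definition affinely_homogeneous :: "nat \<Rightarrow> point set \<Rightarrow> point \<Rightarrow> bool" where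
  "affinely_homogeneous n H p0 \<longleftrightarrow>
     tangent_space H p0 = real_span {L p0 | L. L \<in> sym_algebra n H p0}"


subsection \<open>Products with a coordinate subspace\<close>

definition truncate :: "nat \<Rightarrow> point \<Rightarrow> point" where
  "truncate k p = (\<lambda>i. if i \<le> k then p i else 0)"

text \<open>
  The product of \<open>K \<subseteq> \<real>\<^bsup>k+1\<^esup>\<close>, with coordinates \<open>(x\<^sub>1, \<dots>, x\<^sub>k, u)\<close>, and \<open>\<real>\<^bsup>n-k\<^esup>\<close>, with
  coordinates \<open>(x\<^bsub>k+1\<^esub>, \<dots>, x\<^sub>n)\<close>.
\<close>

definition cylinder :: "nat \<Rightarrow> nat \<Rightarrow> point set \<Rightarrow> point set" where
  "cylinder n k K = {p \<in> topspace (Euclidean_space (Suc n)). truncate k p \<in> K}"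

end

theory Submission
  imports Defs
begin

text \<open>
  After an affine change of coordinates \<open>H\<close> is the graph of a function \<open>G\<close> with vanishing \<open>1\<close>-jet.
  Since the Hessian has rank one, the gradient of \<open>G\<close> and the Legendre expression
  \<open>\<Sum> x\<^sub>i G\<^sub>i - G\<close> are locally functions of a single parameter \<open>\<theta>\<close>, and are determined by their
  restrictions \<open>\<gamma>\<close> and \<open>\<eta>\<close> to a coordinate axis. A symmetry transversal to the level sets of \<open>\<theta>\<close>
  yields an operator \<open>\<kappa> d/d\<theta> + \<mu>\<close> with \<open>\<kappa>(0) \<noteq> 0\<close> which preserves the span of \<open>1\<close> and the
  components of \<open>\<gamma>\<close>. It lowers orders of vanishing by one, so the orders occurring in this span
  are exactly \<open>0, \<dots>, N\<close>; hence after a linear change of the variables \<open>\<gamma>\<^sub>i = \<tau>\<^sup>i / i!\<close> and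
  \<open>\<eta> = \<tau>\<^sup>2 / 2\<close> up to higher order, with \<open>\<gamma>\<^sub>i = 0\<close> for \<open>i > N\<close>, and \<open>n\<^sub>H = N\<close>. On the ray
  \<open>t \<mapsto> t x\<close> this becomes \<open>\<tau> = t \<psi>(\<tau>)\<close> with \<open>\<psi> = \<Sum> x\<^sub>i X\<^bsup>i-1\<^esup> / (i-1)!\<close>, and Lagrange inversion
  identifies the part of degree \<open>d \<le> N + 1\<close> of \<open>G\<close> with the coefficient of \<open>X\<^bsup>d-2\<^esup>\<close> in
  \<open>\<psi>\<^sup>d / (d (d - 1))\<close>. Expanding in powers of \<open>x\<^sub>1\<close> gives the displayed terms.
\<close>

text \<open>Two obstacles shape the proof. First, the parameter theta of a level set is found
  pointwise, by an intermediate value argument, and nothing is known of it but a bound linear in the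
  distance from the base point. This bound is enough: divisibility by \<open>fps_X ^ m\<close> on
  the axis is an estimate of order m, the estimate survives the substitution of theta, and on a ray
  it gives divisibility back. Second, vanishing to high order does not remove a variable from the
  graphing function. Here closure under the operator helps: a nonzero series left over beyond index
  N would be lowered to one of order exactly N + 1, against the maximality of N. So the left-over
  series are identically zero, and the product splitting is exact although the normal form is only a
  jet. The gradient is normalized modulo \<open>fps_X ^ (N + 1)\<close> and the Legendre expression
  modulo \<open>fps_X ^ (N + 2)\<close>; this fixes the degrees up to N + 1 and leaves the terms
  from degree N + 2 on unspecified. The square root of the Legendre expression requires a positive
  second derivative, hence a possible reflection of u at the start.\<close>

declare One_nat_def [simp del]

subsection \<open>Lagrange inversion\<close>

text \<open>Agreement of two series up to a given order is expressed as divisibility of their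
  difference by \<open>fps_X ^ m\<close>; this is the passage to coefficients.\<close>

lemma fps_X_power_dvd_iff_nth:
  fixes a :: "'a::field fps"
  shows "fps_X ^ m dvd a \<longleftrightarrow> (\<forall>q<m. fps_nth a q = 0)"
proof (cases "a = 0")
  case False
  have "fps_X ^ m dvd a \<longleftrightarrow> m \<le> subdegree a"
    using False by (simp add: fps_dvd_iff)
  also have "\<dots> \<longleftrightarrow> (\<forall>q<m. fps_nth a q = 0)"
    using False by (meson le_less_trans linorder_not_le nth_less_subdegree_zero nth_subdegree_nonzero)
  finally show ?thesis .
qed simp

lemma fps_X_power_dvd_deriv:
  fixes a :: "'a::field fps"
  assumes "fps_X ^ Suc m dvd a"
  shows "fps_X ^ m dvd fps_deriv a"
  using assms unfolding fps_X_power_dvd_iff_nth by simp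

lemma fps_X_power_dvd_mult_unit:
  fixes a u :: "'a::field fps"
  assumes "fps_X ^ m dvd a * u" "fps_nth u 0 \<noteq> 0"
  shows "fps_X ^ m dvd a"
proof -
  have "fps_X ^ m dvd (a * u) * inverse u"
    using assms(1) by (rule dvd_mult2)
  moreover have "u * inverse u = 1"
    using assms(2) by (metis inverse_mult_eq_1 mult.commute)
  ultimately show ?thesis by (simp add: mult.assoc)
qed

lemma fps_X_power_dvd_compose:
  fixes a b :: "'a::field fps"
  assumes "fps_X ^ m dvd a" "fps_nth b 0 = 0"
  shows "fps_X ^ m dvd a oo b"
  using assms startsby_zero_power_prefix[of b]
  by (auto simp: fps_X_power_dvd_iff_nth fps_compose_nth intro!: sum.neutral)

lemma diff_dvd_power_diff:
  fixes a b :: "'a::comm_ring_1"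
  shows "a - b dvd a ^ i - b ^ i"
  by (metis dvd_triv_left power_diff_sumr2)

lemma fps_X_power_dvd_compose_diff:
  fixes h a b :: "'a::field fps"
  assumes "fps_X ^ m dvd a - b"
  shows "fps_X ^ m dvd (h oo a) - (h oo b)"
proof -
  have *: "fps_nth (a ^ i) q = fps_nth (b ^ i) q" if "q < m" for i q
    using dvd_trans[OF assms diff_dvd_power_diff[of a b i]] that
    by (auto simp: fps_X_power_dvd_iff_nth)
  show ?thesis
    unfolding fps_X_power_dvd_iff_nth by (auto simp: fps_compose_nth *)
qed

text \<open>
  Both sides are linear in the power series being composed, and only its powers up to the
  \<open>n\<close>-th contribute; for the single powers \<open>\<sigma>\<^sup>j\<close> of \<open>\<sigma> = X / \<psi>\<close> the identity
  \<open>\<sigma>' \<psi>\<^sup>2 = \<psi> - X \<psi>'\<close> makes the right-hand side explicit.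
\<close>

lemma fps_lagrange_inversion:
  fixes h \<psi> :: "real fps"
  assumes \<psi>0: "fps_nth \<psi> 0 \<noteq> 0" and n: "n \<ge> 1"
  shows "real n * fps_nth h n
       = fps_nth (fps_deriv (h oo (fps_X * inverse \<psi>)) * \<psi> ^ n) (n - 1)"
proof -
  define \<sigma> where "\<sigma> = fps_X * inverse \<psi>"
  have inv: "inverse \<psi> * \<psi> = 1"
    using \<psi>0 by (rule inverse_mult_eq_1)
  have \<sigma>\<psi>: "\<sigma> * \<psi> = fps_X"
    by (simp add: \<sigma>_def mult.assoc inv)
  have \<sigma>0: "fps_nth \<sigma> 0 = 0" by (simp add: \<sigma>_def)
  have d1: "fps_deriv \<sigma> * \<psi> = 1 - \<sigma> * fps_deriv \<psi>"
    using arg_cong[OF \<sigma>\<psi>, of fps_deriv] by (simp add: algebra_simps)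
  have d2: "fps_deriv \<sigma> * \<psi> ^ 2 = \<psi> - fps_X * fps_deriv \<psi>"
  proof -
    have "fps_deriv \<sigma> * \<psi> ^ 2 = (fps_deriv \<sigma> * \<psi>) * \<psi>" by (simp add: power2_eq_square)
    also have "\<dots> = \<psi> - (\<sigma> * \<psi>) * fps_deriv \<psi>"
      unfolding d1 by (simp add: algebra_simps)
    finally show ?thesis by (simp add: \<sigma>\<psi>)
  qed
  have pow: "fps_nth (fps_deriv (\<sigma> ^ j) * \<psi> ^ n) (n - 1) = (if j = n then real n else 0)"
    if j: "j \<le> n" for j
  proof (cases j)
    case 0
    then show ?thesis using n by simp
  next
    case (Suc i)
    have E: "fps_deriv (\<sigma> ^ j) = of_nat j * fps_deriv \<sigma> * \<sigma> ^ i"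
      unfolding fps_deriv_power fps_of_nat Suc by simp
    obtain k where k: "n = Suc i + k" using j Suc le_Suc_ex by blast
    \<comment> \<open>Since sigma psi = X, the factors sigma^i psi^i only shift the index:
      coefficient n - 1 becomes coefficient k = n - j of the remaining product.\<close>
    have E2: "fps_deriv (\<sigma> ^ j) * \<psi> ^ n = of_nat j * fps_X ^ i * (fps_deriv \<sigma> * \<psi> ^ Suc k)"
    proof -
      have "fps_deriv (\<sigma> ^ j) * \<psi> ^ n = of_nat j * (\<sigma> * \<psi>) ^ i * (fps_deriv \<sigma> * \<psi> ^ Suc k)"
        unfolding E k by (simp add: power_add power_mult_distrib algebra_simps)
      then show ?thesis by (simp add: \<sigma>\<psi>)
    qed
    have E3: "fps_nth (fps_deriv (\<sigma> ^ j) * \<psi> ^ n) (n - 1)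
        = real j * fps_nth (fps_deriv \<sigma> * \<psi> ^ Suc k) k"
      unfolding E2 by (simp add: mult.assoc fps_of_nat[symmetric] fps_X_power_mult_nth k)
    show ?thesis
    proof (cases "k = 0")
      case True
      then show ?thesis using E3 Suc k by (simp add: d1 \<sigma>0)
    next
      case False
      then obtain l where l: "k = Suc l" by (cases k) auto
      \<comment> \<open>Multiplication by k turns the product into k psi^k - X (psi^k)', whose
        coefficient at X^k cancels. This is the vanishing residue behind Lagrange inversion.\<close>
      have "of_nat k * (fps_deriv \<sigma> * \<psi> ^ Suc k) = of_nat k * (fps_deriv \<sigma> * \<psi> ^ 2) * \<psi> ^ l"
        by (simp add: l power2_eq_square algebra_simps)
      also have "\<dots> = of_nat k * \<psi> ^ k - fps_X * (of_nat k * fps_deriv \<psi> * \<psi> ^ l)"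
        by (simp add: d2 l algebra_simps)
      also have "of_nat k * fps_deriv \<psi> * \<psi> ^ l = fps_deriv (\<psi> ^ k)"
        unfolding fps_deriv_power by (simp add: l fps_of_nat del: of_nat_Suc)
      finally have "fps_nth (of_nat k * (fps_deriv \<sigma> * \<psi> ^ Suc k)) k
          = fps_nth (of_nat k * \<psi> ^ k - fps_X * fps_deriv (\<psi> ^ k)) k" by simp
      moreover have "fps_nth (of_nat k * g - fps_X * fps_deriv g) k = 0" for g :: "real fps"
        by (simp add: l One_nat_def fps_of_nat[symmetric] del: of_nat_Suc)
      ultimately have "real k * fps_nth (fps_deriv \<sigma> * \<psi> ^ Suc k) k = 0"
        by (simp only: fps_of_nat[symmetric] fps_mult_left_const_nth)
      then show ?thesis using False E3 Suc k by simp
    qed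
  qed
  define P where "P = (\<Sum>j\<le>n. fps_const (fps_nth h j) * \<sigma> ^ j)"
  have "fps_nth (h oo \<sigma>) q = fps_nth P q" if "q \<le> n" for q
  proof -
    have "fps_nth P q = (\<Sum>j\<le>n. fps_nth h j * fps_nth (\<sigma> ^ j) q)"
      by (simp add: P_def fps_sum_nth)
    also have "\<dots> = (\<Sum>j=0..q. fps_nth h j * fps_nth (\<sigma> ^ j) q)"
      using that startsby_zero_power_prefix[OF \<sigma>0]
      by (intro sum.mono_neutral_right) auto
    finally show ?thesis by (simp add: fps_compose_nth)
  qed
  then have "fps_nth (fps_deriv (h oo \<sigma>) * \<psi> ^ n) (n - 1)
      = fps_nth (fps_deriv P * \<psi> ^ n) (n - 1)"
    using n by (auto simp: fps_mult_nth intro!: sum.cong)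
  also have "fps_deriv P * \<psi> ^ n
      = (\<Sum>j\<le>n. fps_const (fps_nth h j) * (fps_deriv (\<sigma> ^ j) * \<psi> ^ n))"
    by (simp add: P_def fps_deriv_sum sum_distrib_right mult.assoc del: fps_deriv_mult)
  also have "fps_nth \<dots> (n - 1) = (\<Sum>j\<le>n. fps_nth h j * (if j = n then real n else 0))"
    unfolding fps_sum_nth fps_mult_left_const_nth by (rule sum.cong) (simp_all only: pow atMost_iff)
  also have "\<dots> = (\<Sum>j\<le>n. if j = n then real n * fps_nth h n else 0)"
    by (rule sum.cong) simp_all
  also have "\<dots> = real n * fps_nth h n" by simp
  finally show ?thesis by (simp add: \<sigma>_def)
qed

lemma fps_deriv_sum_powers:
  "fps_deriv (\<Sum>i=1..N. fps_const (x i / fact i) * fps_X ^ i)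
     = (\<Sum>i=1..N. fps_const (x i / fact (i - 1)) * fps_X ^ (i - 1) :: real fps)"
proof -
  have "fps_deriv (fps_const (x i / fact i) * fps_X ^ i)
      = fps_const (x i / fact (i - 1)) * fps_X ^ (i - 1)" if i: "i \<in> {1..N}" for i
  proof -
    obtain l where l: "i = Suc l" using i by (cases i) simp_all
    show ?thesis
    proof (rule fps_ext)
      fix k
      have "fps_nth (fps_deriv (fps_const (x i / fact i) * fps_X ^ i)) k
          = real (Suc k) * (x i / fact i * (if Suc k = i then 1 else 0))"
        by (simp only: fps_deriv_nth fps_mult_left_const_nth fps_X_power_nth Suc_eq_plus1)
      also have "\<dots> = x i / fact (i - 1) * (if k = i - 1 then 1 else 0)"
        by (simp add: l divide_simps del: of_nat_Suc)
      finally show "fps_nth (fps_deriv (fps_const (x i / fact i) * fps_X ^ i)) k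
          = fps_nth (fps_const (x i / fact (i - 1)) * fps_X ^ (i - 1)) k"
        by (simp only: fps_mult_left_const_nth fps_X_power_nth)
    qed
  qed
  then show ?thesis unfolding fps_deriv_sum by (rule sum.cong[OF refl])
qed

lemma fps_compose_sum_powers:
  fixes \<tau> :: "real fps"
  assumes "fps_nth \<tau> 0 = 0"
  shows "(\<Sum>i\<in>I. fps_const (c i) * fps_X ^ e i) oo \<tau> = (\<Sum>i\<in>I. fps_const (c i) * \<tau> ^ e i)"
  using assms
  by (simp add: fps_compose_sum_distrib fps_compose_mult_distrib fps_compose_power[symmetric])

text \<open>
  \<open>f\<close> is the restriction of the graphing function to the ray through \<open>x\<close>, \<open>\<tau>\<close> and \<open>\<phi> i\<close>
  are those of its first derivatives. Comparing the derivatives of the two relations between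
  them gives \<open>\<tau> = X \<psi>(\<tau>)\<close> up to the given order.
\<close>

lemma ray_coefficients:
  fixes f \<tau> :: "real fps" and \<phi> :: "nat \<Rightarrow> real fps" and x :: "nat \<Rightarrow> real"
    and N :: nat
  defines "\<psi> \<equiv> (\<Sum>i=1..N. fps_const (x i / fact (i - 1)) * fps_X ^ (i - 1))"
  assumes N: "N \<ge> 1"
    and f': "fps_deriv f = (\<Sum>i=1..N. fps_const (x i) * \<phi> i)"
    and \<phi>: "\<And>i. i \<in> {1..N} \<Longrightarrow> fps_X ^ Suc N dvd \<phi> i - fps_const (1 / fact i) * \<tau> ^ i"
    and leg: "fps_X ^ Suc (Suc N) dvd fps_X * fps_deriv f - f - fps_const (1/2) * \<tau> ^ 2"
    and \<tau>0: "fps_nth \<tau> 0 = 0" and \<tau>1: "fps_nth \<tau> 1 = x 1" and x1: "x 1 \<noteq> 0"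
    and d: "2 \<le> d" "d \<le> Suc N"
  shows "fps_nth f d = fps_nth (\<psi> ^ d) (d - 2) / (real d * real (d - 1))"
proof -
  define \<Psi> :: "real fps" where "\<Psi> = (\<Sum>i=1..N. fps_const (x i / fact i) * fps_X ^ i)"
  have \<Psi>': "fps_deriv \<Psi> = \<psi>"
    unfolding \<Psi>_def \<psi>_def by (simp only: fps_deriv_sum_powers)
  have \<psi>0: "fps_nth \<psi> 0 = x 1"
  proof -
    have "fps_nth \<psi> 0 = (\<Sum>i=1..N. if i = 1 then x 1 else 0)"
      unfolding \<psi>_def fps_sum_nth fps_mult_left_const_nth fps_X_power_nth by (rule sum.cong) auto
    then show ?thesis using N by simp
  qed
  have \<Psi>\<tau>: "\<Psi> oo \<tau> = (\<Sum>i=1..N. fps_const (x i / fact i) * \<tau> ^ i)"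
    unfolding \<Psi>_def
    using fps_compose_sum_powers[OF \<tau>0, of "\<lambda>i. x i / fact i" "\<lambda>i. i" "{1..N}"] by (simp only:)
  \<comment> \<open>The derivative along the ray is the sum of the x_i phi_i with phi_i close to
    tau^i / i!, hence it is the antiderivative Psi of psi evaluated at tau.\<close>
  have A: "fps_X ^ Suc N dvd fps_deriv f - (\<Psi> oo \<tau>)"
  proof -
    have "fps_deriv f - (\<Psi> oo \<tau>)
        = (\<Sum>i=1..N. fps_const (x i) * (\<phi> i - fps_const (1 / fact i) * \<tau> ^ i))"
      unfolding f' \<Psi>\<tau> sum_subtractf[symmetric]
    proof (rule sum.cong)
      show "fps_const (x i) * \<phi> i - fps_const (x i / fact i) * \<tau> ^ i
          = fps_const (x i) * (\<phi> i - fps_const (1 / fact i) * \<tau> ^ i)" for i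
        by (simp add: right_diff_distrib mult.assoc[symmetric])
    qed simp
    then show ?thesis using \<phi> by (simp only: dvd_sum dvd_mult)
  qed
  have A': "fps_X ^ N dvd fps_deriv (fps_deriv f) - (\<psi> oo \<tau>) * fps_deriv \<tau>"
    using fps_X_power_dvd_deriv[OF A] by (simp add: fps_compose_deriv[OF \<tau>0] \<Psi>')
  have B: "fps_X ^ Suc N dvd fps_X * fps_deriv (fps_deriv f) - \<tau> * fps_deriv \<tau>"
  proof -
    have "fps_deriv (fps_const (1/2) * \<tau> ^ 2) = fps_const (1/2) * (2 * (\<tau> * fps_deriv \<tau>))"
      by (simp add: power2_eq_square algebra_simps)
    also have "\<dots> = \<tau> * fps_deriv \<tau>"
      by (simp add: fps_eq_iff)
    finally show ?thesis using fps_X_power_dvd_deriv[OF leg] by simp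
  qed
  \<comment> \<open>Differentiation cost one order in \<open>A'\<close>; the factor X restores it.
    Subtraction from \<open>B\<close> eliminates the second derivative of f and leaves (X psi(tau) -
    tau) tau', where tau' is a unit because \<open>x 1\<close> is not zero.\<close>
  have "fps_X ^ Suc N dvd fps_X * (fps_deriv (fps_deriv f) - (\<psi> oo \<tau>) * fps_deriv \<tau>)"
    unfolding power_Suc by (rule mult_dvd_mono[OF dvd_refl A'])
  moreover have "(X * a - t * d) - X * (a - p * d) = (X * p - t) * d"
    for X a t d p :: "real fps"
    by (simp add: algebra_simps)
  ultimately have "fps_X ^ Suc N dvd (fps_X * (\<psi> oo \<tau>) - \<tau>) * fps_deriv \<tau>"
    using dvd_diff[OF B] by metis
  then have C: "fps_X ^ Suc N dvd fps_X * (\<psi> oo \<tau>) - \<tau>"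
    by (rule fps_X_power_dvd_mult_unit) (use \<tau>1 x1 in simp)
  \<comment> \<open>For the compositional inverse rho of tau the relation tau = X psi(tau) reads rho
    psi = X, so rho agrees with sigma = X / psi, the series of Lagrange inversion.\<close>
  define \<rho> where "\<rho> = fps_inv \<tau>"
  have \<tau>\<rho>: "\<tau> oo \<rho> = fps_X"
    unfolding \<rho>_def by (rule fps_inv_right) (use \<tau>0 \<tau>1 x1 in auto)
  have \<rho>0: "fps_nth \<rho> 0 = 0" by (simp add: \<rho>_def fps_inv_def)
  have comp: "(a oo \<tau>) oo \<rho> = a" for a
    using fps_compose_assoc[OF \<rho>0 \<tau>0, of a] by (simp add: \<tau>\<rho>)
  have "(fps_X * (\<psi> oo \<tau>) - \<tau>) oo \<rho> = \<rho> * \<psi> - fps_X"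
    by (simp add: fps_compose_sub_distrib fps_compose_mult_distrib[OF \<rho>0] comp \<tau>\<rho> \<rho>0)
  with fps_X_power_dvd_compose[OF C \<rho>0] have "fps_X ^ Suc N dvd \<rho> * \<psi> - fps_X"
    by (simp only:)
  moreover define \<sigma> where "\<sigma> = fps_X * inverse \<psi>"
  have "\<sigma> * \<psi> = fps_X"
    using \<psi>0 x1 by (simp add: \<sigma>_def mult.assoc inverse_mult_eq_1)
  ultimately have "fps_X ^ Suc N dvd (\<rho> - \<sigma>) * \<psi>"
    by (simp only: left_diff_distrib)
  then have "fps_X ^ Suc N dvd \<rho> - \<sigma>"
    by (rule fps_X_power_dvd_mult_unit) (use \<psi>0 x1 in simp)
  then have "fps_X ^ Suc N dvd (fps_deriv f oo \<rho>) - (fps_deriv f oo \<sigma>)"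
    by (rule fps_X_power_dvd_compose_diff)
  moreover have "fps_X ^ Suc N dvd (fps_deriv f oo \<rho>) - \<Psi>"
    using fps_X_power_dvd_compose[OF A \<rho>0] by (simp add: fps_compose_sub_distrib comp)
  ultimately have "fps_X ^ Suc N dvd ((fps_deriv f oo \<rho>) - \<Psi>)
      - ((fps_deriv f oo \<rho>) - (fps_deriv f oo \<sigma>))"
    by (rule dvd_diff[rotated])
  moreover have "(a - b) - (a - c) = c - b" for a b c :: "real fps"
    by simp
  ultimately have "fps_X ^ Suc N dvd (fps_deriv f oo \<sigma>) - \<Psi>"
    by metis
  from fps_X_power_dvd_deriv[OF this]
  have "fps_X ^ N dvd fps_deriv (fps_deriv f oo \<sigma>) - \<psi>"
    unfolding fps_deriv_sub \<Psi>' .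
  then have E: "fps_nth (fps_deriv (fps_deriv f oo \<sigma>)) q = fps_nth \<psi> q" if "q < N" for q
    using that unfolding fps_X_power_dvd_iff_nth fps_sub_nth by simp
  \<comment> \<open>Lagrange inversion is applied to f' at index d - 1. There the derivative of f'
    composed with sigma is psi up to the order read off, which completes psi^(d-1) to psi^d; the
    factor d - 1 comes from the inversion formula and d from differentiating f.\<close>
  define n where "n = d - 1"
  have n: "n \<ge> 1" "n \<le> N" "d = Suc n" using d by (auto simp: n_def)
  have "real n * fps_nth (fps_deriv f) n
      = fps_nth (fps_deriv (fps_deriv f oo \<sigma>) * \<psi> ^ n) (n - 1)"
    unfolding \<sigma>_def by (rule fps_lagrange_inversion) (use \<psi>0 x1 n in auto)
  also have "\<dots> = fps_nth (\<psi> * \<psi> ^ n) (n - 1)"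
    using n E by (auto simp: fps_mult_nth intro!: sum.cong)
  finally have "real n * (real (Suc n) * fps_nth f (Suc n)) = fps_nth (\<psi> ^ d) (d - 2)"
    using n by (simp add: One_nat_def)
  moreover have "real n \<noteq> 0" "real (Suc n) \<noteq> 0" using n by simp_all
  ultimately have "fps_nth f (Suc n) = fps_nth (\<psi> ^ d) (d - 2) / (real (Suc n) * real n)"
    by (simp add: divide_simps mult_ac del: of_nat_Suc power_Suc)
  then show ?thesis using n by simp
qed

subsection \<open>Convergent power series\<close>

abbreviation deg :: "nat \<Rightarrow> (nat \<Rightarrow> nat) \<Rightarrow> nat" where
  "deg k \<equiv> multi_degree {1..k}"

definition degree_indices :: "nat \<Rightarrow> nat \<Rightarrow> (nat \<Rightarrow> nat) set" where
  "degree_indices k d = {\<alpha> \<in> multi_indices k. deg k \<alpha> = d}"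

definition hom_part :: "nat \<Rightarrow> ((nat \<Rightarrow> nat) \<Rightarrow> real) \<Rightarrow> nat \<Rightarrow> point \<Rightarrow> real" where
  "hom_part k c d x = (\<Sum>\<alpha>\<in>degree_indices k d. c \<alpha> * monomial_at k \<alpha> x)"

definition power_series :: "nat \<Rightarrow> ((nat \<Rightarrow> nat) \<Rightarrow> real) \<Rightarrow> point \<Rightarrow> real" where
  "power_series k c x = (\<Sum>\<^sub>\<infinity>\<alpha>\<in>multi_indices k. c \<alpha> * monomial_at k \<alpha> x)"

text \<open>Absolute convergence at the corner with all coordinates equal to R, whose monomials
  dominate those at every point of the closed box.\<close>

definition converges :: "nat \<Rightarrow> ((nat \<Rightarrow> nat) \<Rightarrow> real) \<Rightarrow> real \<Rightarrow> bool" where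
  "converges k c R \<longleftrightarrow> 0 < R \<and> (\<lambda>\<alpha>. \<bar>c \<alpha>\<bar> * R ^ deg k \<alpha>) summable_on multi_indices k"

definition deriv_coeffs :: "nat \<Rightarrow> ((nat \<Rightarrow> nat) \<Rightarrow> real) \<Rightarrow> (nat \<Rightarrow> nat) \<Rightarrow> real" where
  "deriv_coeffs i c \<alpha> = real (Suc (\<alpha> i)) * c (\<alpha>(i := Suc (\<alpha> i)))"

definition cbox_at_0 :: "nat \<Rightarrow> real \<Rightarrow> point set" where
  "cbox_at_0 k r = {x. \<forall>i\<in>{1..k}. \<bar>x i\<bar> \<le> r}"

lemma finite_degree_indices [simp]: "finite (degree_indices k d)"
  unfolding degree_indices_def by (rule finite_multi_indices_degree)

lemma monomial_at_const: "monomial_at k \<alpha> (\<lambda>_. R) = R ^ deg k \<alpha>"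
  by (simp add: monomial_at_def multi_degree_def power_sum)

lemma abs_monomial_at_le:
  assumes "x \<in> cbox_at_0 k R"
  shows "\<bar>monomial_at k \<alpha> x\<bar> \<le> R ^ deg k \<alpha>"
proof -
  have "\<bar>monomial_at k \<alpha> x\<bar> = (\<Prod>i\<in>{1..k}. \<bar>x i\<bar> ^ \<alpha> i)"
    by (simp add: monomial_at_def abs_prod power_abs)
  also have "\<dots> \<le> (\<Prod>i\<in>{1..k}. R ^ \<alpha> i)"
    using assms by (intro prod_mono) (auto simp: cbox_at_0_def intro: power_mono)
  finally show ?thesis by (simp add: multi_degree_def power_sum)
qed

lemma converges_mono:
  assumes "converges k c R" "0 < R'" "R' \<le> R"
  shows "converges k c R'"
proof -
  have "(\<lambda>\<alpha>. \<bar>c \<alpha>\<bar> * R ^ deg k \<alpha>) summable_on multi_indices k"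
    using assms(1) by (simp add: converges_def)
  then have "(\<lambda>\<alpha>. \<bar>c \<alpha>\<bar> * R' ^ deg k \<alpha>) summable_on multi_indices k"
    by (rule summable_on_comparison_test)
      (use assms(2,3) in \<open>simp_all add: mult_left_mono power_mono\<close>)
  then show ?thesis using assms(2) by (simp add: converges_def)
qed

lemma power_series_has_sum:
  assumes "converges k c R" "x \<in> cbox_at_0 k R"
  shows "((\<lambda>\<alpha>. c \<alpha> * monomial_at k \<alpha> x) has_sum power_series k c x) (multi_indices k)"
proof -
  have "(\<lambda>\<alpha>. norm (c \<alpha> * monomial_at k \<alpha> x)) summable_on multi_indices k"
  proof (rule Infinite_Sum.abs_summable_on_comparison_test')
    show "(\<lambda>\<alpha>. \<bar>c \<alpha>\<bar> * R ^ deg k \<alpha>) summable_on multi_indices k"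
      using assms by (simp add: converges_def)
    show "norm (c \<alpha> * monomial_at k \<alpha> x) \<le> \<bar>c \<alpha>\<bar> * R ^ deg k \<alpha>" for \<alpha>
      using mult_left_mono[OF abs_monomial_at_le[OF assms(2)] abs_ge_zero] by (simp add: abs_mult)
  qed
  then show ?thesis
    unfolding power_series_def by (rule has_sum_infsum[OF Infinite_Sum.abs_summable_summable])
qed

text \<open>Summability of reals over an arbitrary index set is automatically absolute, so one
  positive corner point is enough.\<close>

lemma converges_if_has_sum:
  assumes "0 < R" and "((\<lambda>\<alpha>. c \<alpha> * monomial_at k \<alpha> (\<lambda>_. R)) has_sum S) (multi_indices k)"
  shows "converges k c R"
proof -
  have "(\<lambda>\<alpha>. c \<alpha> * R ^ deg k \<alpha>) summable_on multi_indices k"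
    using assms(2) by (auto simp: monomial_at_const summable_on_def)
  then have "(\<lambda>\<alpha>. norm (c \<alpha> * R ^ deg k \<alpha>)) summable_on multi_indices k"
    by (rule summable_on_iff_abs_summable_on_real[THEN iffD1])
  then show ?thesis
    using assms(1) by (simp add: converges_def abs_mult)
qed

lemma bij_betw_degree_indices:
  "bij_betw snd (SIGMA d:UNIV. degree_indices k d) (multi_indices k)"
  by (rule bij_betwI[where g = "\<lambda>\<alpha>. (deg k \<alpha>, \<alpha>)"]) (auto simp: degree_indices_def)

text \<open>An unconditional sum may be regrouped by total degree, each group being finite. This
  turns the sum over multi-indices into an ordinary series.\<close>

lemma hom_part_sums:
  assumes "converges k c R" "x \<in> cbox_at_0 k R"
  shows "(\<lambda>d. hom_part k c d x) sums power_series k c x"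
proof -
  have "((\<lambda>p. c (snd p) * monomial_at k (snd p) x) has_sum power_series k c x)
      (SIGMA d:UNIV. degree_indices k d)"
    using power_series_has_sum[OF assms]
      has_sum_reindex_bij_betw[OF bij_betw_degree_indices[of k],
        of "\<lambda>\<alpha>. c \<alpha> * monomial_at k \<alpha> x" "power_series k c x"] by simp
  then have "((\<lambda>d. hom_part k c d x) has_sum power_series k c x) UNIV"
  proof (rule has_sum_SigmaD)
    show "((\<lambda>\<alpha>. c (snd (d, \<alpha>)) * monomial_at k (snd (d, \<alpha>)) x) has_sum hom_part k c d x)
        (degree_indices k d)" for d
      unfolding hom_part_def snd_conv by (rule has_sum_finite) simp
  qed
  then show ?thesis by (rule has_sum_imp_sums)
qed

text \<open>Under a linear substitution only the sum of the absolute coefficients of each degree is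
  controlled; this criterion converts such bounds into convergence.\<close>

lemma converges_iff_degreewise:
  assumes "0 < R"
  shows "converges k c R
    \<longleftrightarrow> (\<lambda>d. (\<Sum>\<alpha>\<in>degree_indices k d. \<bar>c \<alpha>\<bar>) * R ^ d) summable_on UNIV"
proof -
  let ?f = "\<lambda>\<alpha>. \<bar>c \<alpha>\<bar> * R ^ deg k \<alpha>"
  have "converges k c R \<longleftrightarrow> (\<lambda>\<alpha>. norm (?f \<alpha>)) summable_on multi_indices k"
    using assms by (simp add: converges_def)
  also have "\<dots> \<longleftrightarrow> (\<lambda>p. norm (?f (snd p))) summable_on (SIGMA d:UNIV. degree_indices k d)"
    by (rule summable_on_reindex_bij_betw[OF bij_betw_degree_indices, symmetric])
  also have "\<dots> \<longleftrightarrow> (\<lambda>d. norm (\<Sum>\<^sub>\<infinity>\<alpha>\<in>degree_indices k d. norm (?f \<alpha>))) summable_on UNIV"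
    using Infinite_Sum.abs_summable_on_Sigma_iff[of "\<lambda>p. ?f (snd p)" UNIV "degree_indices k"] by simp
  also have "\<dots> \<longleftrightarrow> (\<lambda>d. (\<Sum>\<alpha>\<in>degree_indices k d. \<bar>c \<alpha>\<bar>) * R ^ d) summable_on UNIV"
  proof (rule summable_on_cong)
    fix d
    have "(\<Sum>\<alpha>\<in>degree_indices k d. norm (?f \<alpha>)) = (\<Sum>\<alpha>\<in>degree_indices k d. \<bar>c \<alpha>\<bar>) * R ^ d"
      using assms by (auto simp: sum_distrib_right degree_indices_def intro!: sum.cong)
    then show "norm (\<Sum>\<^sub>\<infinity>\<alpha>\<in>degree_indices k d. norm (?f \<alpha>))
        = (\<Sum>\<alpha>\<in>degree_indices k d. \<bar>c \<alpha>\<bar>) * R ^ d"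
      using assms by (simp add: sum_nonneg)
  qed
  finally show ?thesis .
qed

text \<open>Writing n^2 q^n as the square of n (sqrt q)^n reduces the bound to the known limit of n
  z^n for |z| < 1.\<close>

lemma polynomial_times_geometric_bounded:
  assumes "0 \<le> q" "q < (1::real)"
  obtains K where "K \<ge> 0" "\<And>n. real n ^ 2 * q ^ n \<le> K"
proof -
  have "norm (sqrt q) < 1" using assms by simp
  from tendsto_power[OF powser_times_n_limit_0[OF this], of 2]
  have "(\<lambda>n. (real n * sqrt q ^ n) ^ 2) \<longlonglongrightarrow> 0" by simp
  moreover have "(real n * sqrt q ^ n) ^ 2 = real n ^ 2 * q ^ n" for n
  proof -
    have "(sqrt q ^ n) ^ 2 = (sqrt q ^ 2) ^ n" by (metis mult.commute power_mult)
    then show ?thesis using assms(1) by (simp add: power_mult_distrib)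
  qed
  ultimately have "(\<lambda>n. real n ^ 2 * q ^ n) \<longlonglongrightarrow> 0" by simp
  then have "Bseq (\<lambda>n. real n ^ 2 * q ^ n)"
    by (intro convergent_imp_Bseq convergentI)
  then obtain K where "\<And>n. norm (real n ^ 2 * q ^ n) \<le> K" "K > 0"
    by (auto simp: Bseq_def)
  then show ?thesis by (intro that[of K]) (auto simp: abs_le_iff)
qed

text \<open>Shrinking the radius pays for the factor deg^2, which is the constant in the
  second-order Taylor estimate of a monomial and also dominates the factor produced by one
  differentiation.\<close>

lemma converges_degree_square:
  assumes "converges k c R" "0 < \<rho>" "\<rho> < R"
  shows "(\<lambda>\<alpha>. \<bar>c \<alpha>\<bar> * real (deg k \<alpha>) ^ 2 * \<rho> ^ deg k \<alpha>) summable_on multi_indices k"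
proof -
  have R: "0 < R" using assms by simp
  obtain K where K: "K \<ge> 0" "\<And>n. real n ^ 2 * (\<rho> / R) ^ n \<le> K"
    using polynomial_times_geometric_bounded[of "\<rho> / R"] assms R by auto
  have bnd: "real n ^ 2 * \<rho> ^ n \<le> K * R ^ n" for n
    using K(2)[of n] R by (simp add: power_divide field_simps)
  show ?thesis
  proof (rule summable_on_comparison_test)
    show "(\<lambda>\<alpha>. K * (\<bar>c \<alpha>\<bar> * R ^ deg k \<alpha>)) summable_on multi_indices k"
      using assms(1) by (intro summable_on_cmult_right) (simp add: converges_def)
    show "\<bar>c \<alpha>\<bar> * real (deg k \<alpha>) ^ 2 * \<rho> ^ deg k \<alpha> \<le> K * (\<bar>c \<alpha>\<bar> * R ^ deg k \<alpha>)" for \<alpha>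
      using mult_left_mono[OF bnd[of "deg k \<alpha>"], of "\<bar>c \<alpha>\<bar>"] by (simp add: mult_ac)
    show "0 \<le> \<bar>c \<alpha>\<bar> * real (deg k \<alpha>) ^ 2 * \<rho> ^ deg k \<alpha>" for \<alpha>
      using assms by simp
  qed
qed

lemma bij_betw_deriv_index:
  assumes "i \<in> {1..k}"
  shows "bij_betw (\<lambda>\<beta>. \<beta>(i := Suc (\<beta> i))) (multi_indices k) {\<alpha> \<in> multi_indices k. \<alpha> i > 0}"
proof (rule bij_betwI[where g = "\<lambda>\<alpha>. \<alpha>(i := \<alpha> i - 1)"])
  show "(\<lambda>\<beta>. \<beta>(i := Suc (\<beta> i))) \<in> multi_indices k \<rightarrow> {\<alpha> \<in> multi_indices k. \<alpha> i > 0}"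
    using assms by (auto simp: multi_indices_def)
qed (auto simp: multi_indices_def)

lemma deg_fun_upd_Suc:
  assumes "i \<in> {1..k}"
  shows "deg k (\<beta>(i := Suc (\<beta> i))) = Suc (deg k \<beta>)"
  using assms by (simp add: multi_degree_def sum.remove[of _ i])

lemma converges_deriv_coeffs:
  assumes "converges k c R" "0 < \<rho>" "\<rho> < R" and i: "i \<in> {1..k}"
  shows "converges k (deriv_coeffs i c) \<rho>"
proof -
  let ?g = "\<lambda>\<alpha>. (1 / \<rho>) * (\<bar>c \<alpha>\<bar> * real (deg k \<alpha>) ^ 2 * \<rho> ^ deg k \<alpha>)"
  have "?g summable_on {\<alpha> \<in> multi_indices k. \<alpha> i > 0}"
    by (intro summable_on_cmult_right summable_on_subset[OF converges_degree_square[OF assms(1-3)]]) auto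
  then have S: "(\<lambda>\<beta>. ?g (\<beta>(i := Suc (\<beta> i)))) summable_on multi_indices k"
    by (subst summable_on_reindex_bij_betw[OF bij_betw_deriv_index[OF i]])
  have "(\<lambda>\<beta>. \<bar>deriv_coeffs i c \<beta>\<bar> * \<rho> ^ deg k \<beta>) summable_on multi_indices k"
  proof (rule summable_on_comparison_test[OF S])
    fix \<beta> assume "\<beta> \<in> multi_indices k"
    have "\<beta> i \<le> deg k \<beta>"
      using i unfolding multi_degree_def by (intro member_le_sum) auto
    then have "real (Suc (\<beta> i)) \<le> real (Suc (deg k \<beta>))" by simp
    also have "\<dots> \<le> real (Suc (deg k \<beta>)) ^ 2"
      by (simp add: power2_eq_square)
    finally have le: "real (Suc (\<beta> i)) \<le> real (Suc (deg k \<beta>)) ^ 2" .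
    have "\<bar>deriv_coeffs i c \<beta>\<bar> * \<rho> ^ deg k \<beta>
        = real (Suc (\<beta> i)) * (\<bar>c (\<beta>(i := Suc (\<beta> i)))\<bar> * \<rho> ^ deg k \<beta>)"
      by (simp add: deriv_coeffs_def abs_mult)
    also have "\<dots> \<le> real (Suc (deg k \<beta>)) ^ 2 * (\<bar>c (\<beta>(i := Suc (\<beta> i)))\<bar> * \<rho> ^ deg k \<beta>)"
      using assms(2) by (intro mult_right_mono le) auto
    also have "\<dots> = ?g (\<beta>(i := Suc (\<beta> i)))"
      using assms(2) by (simp add: deg_fun_upd_Suc[OF i] field_simps)
    finally show "\<bar>deriv_coeffs i c \<beta>\<bar> * \<rho> ^ deg k \<beta> \<le> ?g (\<beta>(i := Suc (\<beta> i)))" .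
  qed (use assms(2) in auto)
  then show ?thesis using assms(2) by (simp add: converges_def)
qed

text \<open>The derivative is indexed by the exponents of the original series, so that it can be
  subtracted termwise in the Taylor estimate. Where \<open>\<alpha> i = 0\<close> the truncated
  exponent is harmless, since the factor \<open>\<alpha> i\<close> vanishes.\<close>

lemma power_series_deriv_has_sum:
  assumes "converges k c R" "0 < \<rho>" "\<rho> < R" and i: "i \<in> {1..k}" and x: "x \<in> cbox_at_0 k \<rho>"
  shows "((\<lambda>\<alpha>. c \<alpha> * (real (\<alpha> i) * monomial_at k (\<alpha>(i := \<alpha> i - 1)) x))
      has_sum power_series k (deriv_coeffs i c) x) (multi_indices k)"
proof -
  let ?g = "\<lambda>\<alpha>. c \<alpha> * (real (\<alpha> i) * monomial_at k (\<alpha>(i := \<alpha> i - 1)) x)"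
  have "((\<lambda>\<beta>. ?g (\<beta>(i := Suc (\<beta> i)))) has_sum power_series k (deriv_coeffs i c) x) (multi_indices k)"
    using power_series_has_sum[OF converges_deriv_coeffs[OF assms(1-4)] x]
    by (simp add: deriv_coeffs_def mult_ac)
  then have "(?g has_sum power_series k (deriv_coeffs i c) x) {\<alpha> \<in> multi_indices k. \<alpha> i > 0}"
    by (subst (asm) has_sum_reindex_bij_betw[OF bij_betw_deriv_index[OF i]])
  then show ?thesis
    by (subst (asm) has_sum_cong_neutral[where T = "multi_indices k" and g = ?g]) auto
qed

section \<open>Quadratic Taylor remainders, uniform on a box\<close>

lemma has_sum_subtract:
  fixes f g :: "'a \<Rightarrow> real"
  assumes "(f has_sum a) A" "(g has_sum b) A"
  shows "((\<lambda>x. f x - g x) has_sum (a - b)) A"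
  using has_sum_add[OF assms(1), of "\<lambda>x. - g x" "- b"] assms(2) by (simp add: has_sum_uminus)

lemma has_sum_abs_bound:
  fixes f g :: "'a \<Rightarrow> real"
  assumes "(f has_sum a) A" "(g has_sum b) A" "\<And>x. norm (f x) \<le> g x"
  shows "\<bar>a\<bar> \<le> b"
proof -
  have "a \<le> b" by (rule has_sum_mono[OF assms(1,2)]) (use assms(3) in \<open>simp add: abs_le_iff\<close>)
  moreover have "- a \<le> b"
  proof (rule has_sum_mono[OF _ assms(2)])
    show "((\<lambda>x. - f x) has_sum - a) A" using assms(1) by (simp add: has_sum_uminus)
  qed (use assms(3) in \<open>simp add: abs_le_iff\<close>)
  ultimately show ?thesis by linarith
qed

text \<open>A Leibniz rule for remainders: bounds of the shape n A eps and n^2 A eps^2 are stable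
  under products, with n + m in place of n, because n^2 + m^2 + n m <= (n + m)^2. Hence the constant
  for a monomial depends on its total degree only.\<close>

lemma product_taylor_step:
  fixes a a' b b' da db A B \<epsilon> n m :: real
  assumes "\<bar>a\<bar> \<le> A" "\<bar>b\<bar> \<le> B" "\<bar>b'\<bar> \<le> B"
    and "\<bar>a' - a\<bar> \<le> n * A * \<epsilon>" "\<bar>b' - b\<bar> \<le> m * B * \<epsilon>"
    and "\<bar>a' - a - da\<bar> \<le> n\<^sup>2 * A * \<epsilon>\<^sup>2" "\<bar>b' - b - db\<bar> \<le> m\<^sup>2 * B * \<epsilon>\<^sup>2"
    and "0 \<le> n" "0 \<le> m" "0 \<le> \<epsilon>"
  shows "\<bar>a' * b' - a * b\<bar> \<le> (n + m) * (A * B) * \<epsilon>"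
    and "\<bar>a' * b' - a * b - (da * b + a * db)\<bar> \<le> (n + m)\<^sup>2 * (A * B) * \<epsilon>\<^sup>2"
proof -
  have A: "0 \<le> A" and B: "0 \<le> B" using assms(1,2) by linarith+
  have 0: "(a' - a) * b' + a * (b' - b) = a' * b' - a * b" by (simp add: algebra_simps)
  have 1: "\<bar>a' * b' - a * b\<bar> \<le> \<bar>a' - a\<bar> * \<bar>b'\<bar> + \<bar>a\<bar> * \<bar>b' - b\<bar>"
    using abs_triangle_ineq[of "(a' - a) * b'" "a * (b' - b)"] unfolding 0 abs_mult .
  have 2: "\<bar>a' - a\<bar> * \<bar>b'\<bar> + \<bar>a\<bar> * \<bar>b' - b\<bar> \<le> (n * A * \<epsilon>) * B + A * (m * B * \<epsilon>)"
    by (intro add_mono mult_mono assms abs_ge_zero A B mult_nonneg_nonneg zero_le_power2)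
  have 3: "(n * A * \<epsilon>) * B + A * (m * B * \<epsilon>) = (n + m) * (A * B) * \<epsilon>" by (simp add: algebra_simps)
  show "\<bar>a' * b' - a * b\<bar> \<le> (n + m) * (A * B) * \<epsilon>"
    using order_trans[OF 1 2] unfolding 3 .
  have step: "(a' - a - da) * b + a * (b' - b - db) + (a' - a) * (b' - b)
      = a' * b' - a * b - (da * b + a * db)"
    by (simp add: algebra_simps)
  have "\<bar>u + v + w\<bar> \<le> \<bar>u\<bar> + \<bar>v\<bar> + \<bar>w\<bar>" for u v w :: real
    by linarith
  from this[of "(a' - a - da) * b" "a * (b' - b - db)" "(a' - a) * (b' - b)"]
  have 1: "\<bar>a' * b' - a * b - (da * b + a * db)\<bar>
      \<le> \<bar>a' - a - da\<bar> * \<bar>b\<bar> + \<bar>a\<bar> * \<bar>b' - b - db\<bar> + \<bar>a' - a\<bar> * \<bar>b' - b\<bar>"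
    unfolding step abs_mult .
  have 2: "\<bar>a' - a - da\<bar> * \<bar>b\<bar> + \<bar>a\<bar> * \<bar>b' - b - db\<bar> + \<bar>a' - a\<bar> * \<bar>b' - b\<bar>
      \<le> (n\<^sup>2 * A * \<epsilon>\<^sup>2) * B + A * (m\<^sup>2 * B * \<epsilon>\<^sup>2) + (n * A * \<epsilon>) * (m * B * \<epsilon>)"
    by (intro add_mono mult_mono assms abs_ge_zero A B mult_nonneg_nonneg zero_le_power2)
  have 3: "(n\<^sup>2 * A * \<epsilon>\<^sup>2) * B + A * (m\<^sup>2 * B * \<epsilon>\<^sup>2) + (n * A * \<epsilon>) * (m * B * \<epsilon>)
      = (n\<^sup>2 + m\<^sup>2 + n * m) * (A * B * \<epsilon>\<^sup>2)"
    by (simp add: algebra_simps power2_eq_square)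
  have 4: "(n\<^sup>2 + m\<^sup>2 + n * m) * (A * B * \<epsilon>\<^sup>2) \<le> (n + m)\<^sup>2 * (A * B * \<epsilon>\<^sup>2)"
  proof (rule mult_right_mono)
    have "0 \<le> n * m" using assms by simp
    then show "n\<^sup>2 + m\<^sup>2 + n * m \<le> (n + m)\<^sup>2" by (simp add: power2_sum mult.commute[of n m])
    show "0 \<le> A * B * \<epsilon>\<^sup>2" using A B by simp
  qed
  show "\<bar>a' * b' - a * b - (da * b + a * db)\<bar> \<le> (n + m)\<^sup>2 * (A * B) * \<epsilon>\<^sup>2"
    using order_trans[OF order_trans[OF 1 2] 4[folded 3]] by (simp only: mult.assoc)
qed

text \<open>Induction by \<open>product_taylor_step\<close>, the new factor having degree one and no
  remainder. In the base case the term with exponent \<open>n - 1\<close> carries the factor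
  0.\<close>

lemma power_taylor:
  fixes x y \<rho> \<epsilon> :: real
  assumes "\<bar>x\<bar> \<le> \<rho>" "\<bar>y\<bar> \<le> \<rho>" "\<bar>y - x\<bar> \<le> \<rho> * \<epsilon>" "0 \<le> \<epsilon>"
  shows "\<bar>x ^ n\<bar> \<le> \<rho> ^ n \<and> \<bar>y ^ n\<bar> \<le> \<rho> ^ n \<and> \<bar>y ^ n - x ^ n\<bar> \<le> real n * \<rho> ^ n * \<epsilon>
    \<and> \<bar>y ^ n - x ^ n - real n * x ^ (n - 1) * (y - x)\<bar> \<le> (real n)\<^sup>2 * \<rho> ^ n * \<epsilon>\<^sup>2"
proof (induction n)
  case (Suc n)
  have \<rho>: "0 \<le> \<rho>" using assms(1) by linarith
  have 1: "\<bar>y - x\<bar> \<le> 1 * \<rho> * \<epsilon>" "\<bar>y - x - (y - x)\<bar> \<le> 1\<^sup>2 * \<rho> * \<epsilon>\<^sup>2"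
    using assms \<rho> by auto
  from Suc.IH have IH: "\<bar>x ^ n\<bar> \<le> \<rho> ^ n" "\<bar>y ^ n - x ^ n\<bar> \<le> real n * \<rho> ^ n * \<epsilon>"
    "\<bar>y ^ n - x ^ n - real n * x ^ (n - 1) * (y - x)\<bar> \<le> (real n)\<^sup>2 * \<rho> ^ n * \<epsilon>\<^sup>2" by blast+
  note P = product_taylor_step[OF IH(1) assms(1,2) IH(2) 1(1) IH(3) 1(2) of_nat_0_le_iff zero_le_one assms(4)]
  have "real n * x ^ (n - 1) * (y - x) * x + x ^ n * (y - x) = real (Suc n) * x ^ n * (y - x)"
    by (cases n) (auto simp: algebra_simps)
  note D = this
  have P12: "\<bar>y ^ n * y - x ^ n * x\<bar> \<le> (real n + 1) * (\<rho> ^ n * \<rho>) * \<epsilon>"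
    "\<bar>y ^ n * y - x ^ n * x - real (Suc n) * x ^ n * (y - x)\<bar> \<le> (real n + 1)\<^sup>2 * (\<rho> ^ n * \<rho>) * \<epsilon>\<^sup>2"
    using P unfolding D by blast+
  have x_y: "\<bar>x ^ Suc n\<bar> \<le> \<rho> ^ Suc n" "\<bar>y ^ Suc n\<bar> \<le> \<rho> ^ Suc n"
    unfolding power_abs by (simp_all only: power_mono[OF assms(1) abs_ge_zero] power_mono[OF assms(2) abs_ge_zero])
  have S: "real (Suc n) = real n + 1" "z ^ Suc n = z ^ n * z" "Suc n - 1 = n" for z :: real
    by simp_all
  show ?case
    unfolding S(3) using x_y P12 unfolding S(1,2) by blast
qed auto

lemma monomial_taylor_aux:
  fixes x y :: "nat \<Rightarrow> real" and \<rho> \<epsilon> :: real and I :: "nat set" and \<alpha> :: "nat \<Rightarrow> nat"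
  assumes "finite I" "\<And>i. i \<in> I \<Longrightarrow> \<bar>x i\<bar> \<le> \<rho> \<and> \<bar>y i\<bar> \<le> \<rho> \<and> \<bar>y i - x i\<bar> \<le> \<rho> * \<epsilon>" "0 \<le> \<epsilon>"
  defines "n \<equiv> real (\<Sum>i\<in>I. \<alpha> i)" and "P \<equiv> \<rho> ^ (\<Sum>i\<in>I. \<alpha> i)"
  shows "\<bar>\<Prod>i\<in>I. x i ^ \<alpha> i\<bar> \<le> P
    \<and> \<bar>(\<Prod>i\<in>I. y i ^ \<alpha> i) - (\<Prod>i\<in>I. x i ^ \<alpha> i)\<bar> \<le> n * P * \<epsilon>
    \<and> \<bar>(\<Prod>i\<in>I. y i ^ \<alpha> i) - (\<Prod>i\<in>I. x i ^ \<alpha> i)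
       - (\<Sum>i\<in>I. real (\<alpha> i) * x i ^ (\<alpha> i - 1) * (\<Prod>j\<in>I - {i}. x j ^ \<alpha> j) * (y i - x i))\<bar>
      \<le> n\<^sup>2 * P * \<epsilon>\<^sup>2"
  using assms(1,2) unfolding n_def P_def
proof (induction I rule: finite_induct)
  case (insert l I)
  let ?X = "\<Prod>i\<in>I. x i ^ \<alpha> i" and ?Y = "\<Prod>i\<in>I. y i ^ \<alpha> i"
  let ?D = "\<Sum>i\<in>I. real (\<alpha> i) * x i ^ (\<alpha> i - 1) * (\<Prod>j\<in>I - {i}. x j ^ \<alpha> j) * (y i - x i)"
  let ?m = "\<Sum>i\<in>I. \<alpha> i"
  have IH: "\<bar>?X\<bar> \<le> \<rho> ^ ?m" "\<bar>?Y - ?X\<bar> \<le> real ?m * \<rho> ^ ?m * \<epsilon>"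
    "\<bar>?Y - ?X - ?D\<bar> \<le> (real ?m)\<^sup>2 * \<rho> ^ ?m * \<epsilon>\<^sup>2"
    using insert.IH insert.prems by blast+
  have pow: "\<bar>x l ^ \<alpha> l\<bar> \<le> \<rho> ^ \<alpha> l" "\<bar>y l ^ \<alpha> l\<bar> \<le> \<rho> ^ \<alpha> l"
    "\<bar>y l ^ \<alpha> l - x l ^ \<alpha> l\<bar> \<le> real (\<alpha> l) * \<rho> ^ \<alpha> l * \<epsilon>"
    "\<bar>y l ^ \<alpha> l - x l ^ \<alpha> l - real (\<alpha> l) * x l ^ (\<alpha> l - 1) * (y l - x l)\<bar>
      \<le> (real (\<alpha> l))\<^sup>2 * \<rho> ^ \<alpha> l * \<epsilon>\<^sup>2"
    using power_taylor[of "x l" \<rho> "y l" \<epsilon> "\<alpha> l"] insert.prems[of l] assms(3) by blast+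
  note S = product_taylor_step[OF IH(1) pow(1,2) IH(2) pow(3) IH(3) pow(4) of_nat_0_le_iff of_nat_0_le_iff assms(3)]
  have "(\<Sum>i\<in>insert l I. real (\<alpha> i) * x i ^ (\<alpha> i - 1) * (\<Prod>j\<in>insert l I - {i}. x j ^ \<alpha> j) * (y i - x i))
      = real (\<alpha> l) * x l ^ (\<alpha> l - 1) * ?X * (y l - x l)
        + (\<Sum>i\<in>I. real (\<alpha> i) * x i ^ (\<alpha> i - 1) * (x l ^ \<alpha> l * (\<Prod>j\<in>I - {i}. x j ^ \<alpha> j)) * (y i - x i))"
  proof -
    have "insert l I - {i} = insert l (I - {i})" if "i \<in> I" for i
      using that insert.hyps by auto
    then have "(\<Prod>j\<in>insert l I - {i}. x j ^ \<alpha> j) = x l ^ \<alpha> l * (\<Prod>j\<in>I - {i}. x j ^ \<alpha> j)" if "i \<in> I" for i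
      using that insert.hyps by simp
    moreover have "insert l I - {l} = I" using insert.hyps by auto
    ultimately show ?thesis using insert.hyps by simp
  qed
  also have "\<dots> = ?D * x l ^ \<alpha> l + ?X * (real (\<alpha> l) * x l ^ (\<alpha> l - 1) * (y l - x l))"
    by (simp add: sum_distrib_left sum_distrib_right mult_ac)
  finally have D: "(\<Sum>i\<in>insert l I. real (\<alpha> i) * x i ^ (\<alpha> i - 1) * (\<Prod>j\<in>insert l I - {i}. x j ^ \<alpha> j) * (y i - x i))
      = ?D * x l ^ \<alpha> l + ?X * (real (\<alpha> l) * x l ^ (\<alpha> l - 1) * (y l - x l))" .
  have abs: "\<bar>?X * x l ^ \<alpha> l\<bar> \<le> \<rho> ^ ?m * \<rho> ^ \<alpha> l"
    unfolding abs_mult using assms(3) by (intro mult_mono IH(1) pow(1) abs_ge_zero order_trans[OF abs_ge_zero IH(1)])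
  have ins: "(\<Prod>i\<in>insert l I. z i ^ \<alpha> i) = (\<Prod>i\<in>I. z i ^ \<alpha> i) * z l ^ \<alpha> l" for z :: "nat \<Rightarrow> real"
    using insert.hyps by (simp add: mult.commute)
  have sm: "(\<Sum>i\<in>insert l I. \<alpha> i) = ?m + \<alpha> l" using insert.hyps by simp
  show ?case
    unfolding D unfolding ins sm power_add of_nat_add using S abs by blast
qed (use assms(3) in simp)

lemma monomial_taylor:
  assumes "x \<in> cbox_at_0 k \<rho>" "y \<in> cbox_at_0 k \<rho>" "0 < \<rho>" "0 \<le> \<delta>"
    and \<delta>: "\<And>i. i \<in> {1..k} \<Longrightarrow> \<bar>y i - x i\<bar> \<le> \<delta>"
  shows "\<bar>monomial_at k \<alpha> y - monomial_at k \<alpha> x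
      - (\<Sum>i=1..k. (real (\<alpha> i) * monomial_at k (\<alpha>(i := \<alpha> i - 1)) x) * (y i - x i))\<bar>
    \<le> (real (deg k \<alpha>))\<^sup>2 * \<rho> ^ deg k \<alpha> * (\<delta> / \<rho>)\<^sup>2"
proof -
  have E: "monomial_at k (\<alpha>(i := \<alpha> i - 1)) x = x i ^ (\<alpha> i - 1) * (\<Prod>j\<in>{1..k} - {i}. x j ^ \<alpha> j)"
    if "i \<in> {1..k}" for i
    using that unfolding monomial_at_def by (simp add: prod.remove[of _ i])
  have S: "(\<Sum>i=1..k. (real (\<alpha> i) * monomial_at k (\<alpha>(i := \<alpha> i - 1)) x) * (y i - x i))
      = (\<Sum>i=1..k. real (\<alpha> i) * x i ^ (\<alpha> i - 1) * (\<Prod>j\<in>{1..k} - {i}. x j ^ \<alpha> j) * (y i - x i))"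
    by (rule sum.cong) (simp_all add: E)
  have "\<bar>x i\<bar> \<le> \<rho> \<and> \<bar>y i\<bar> \<le> \<rho> \<and> \<bar>y i - x i\<bar> \<le> \<rho> * (\<delta> / \<rho>)" if "i \<in> {1..k}" for i
    using that assms \<delta>[OF that] by (auto simp: cbox_at_0_def)
  from monomial_taylor_aux[OF finite_atLeastAtMost this, where \<alpha> = \<alpha>] assms(3,4)
  show ?thesis
    unfolding S by (simp only: monomial_at_def multi_degree_def divide_nonneg_pos)
qed

text \<open>The monomial estimates are summed; the constant S / rho^2 is finite because the radius
  has been shrunk. The chain rule and the Lipschitz bounds below both rest on this estimate.\<close>

lemma power_series_taylor:
  assumes "converges k c R" "0 < \<rho>" "\<rho> < R"
  shows "\<exists>C\<ge>0. \<forall>x\<in>cbox_at_0 k \<rho>. \<forall>y\<in>cbox_at_0 k \<rho>. \<forall>\<delta>\<ge>0.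
      (\<forall>i\<in>{1..k}. \<bar>y i - x i\<bar> \<le> \<delta>) \<longrightarrow>
      \<bar>power_series k c y - power_series k c x
        - (\<Sum>i=1..k. power_series k (deriv_coeffs i c) x * (y i - x i))\<bar> \<le> C * \<delta>\<^sup>2"
proof -
  define S where "S = (\<Sum>\<^sub>\<infinity>\<alpha>\<in>multi_indices k. \<bar>c \<alpha>\<bar> * real (deg k \<alpha>) ^ 2 * \<rho> ^ deg k \<alpha>)"
  have S: "((\<lambda>\<alpha>. \<bar>c \<alpha>\<bar> * real (deg k \<alpha>) ^ 2 * \<rho> ^ deg k \<alpha>) has_sum S) (multi_indices k)"
    unfolding S_def by (rule has_sum_infsum[OF converges_degree_square[OF assms]])
  have S0: "0 \<le> S" unfolding S_def using assms(2) by (intro infsum_nonneg) auto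
  have conv: "converges k c \<rho>" using assms by (auto intro: converges_mono)
  show ?thesis
  proof (intro exI[of _ "S / \<rho>\<^sup>2"] conjI ballI allI impI)
    show "0 \<le> S / \<rho>\<^sup>2" using S0 by simp
    fix x y \<delta>
    assume x: "x \<in> cbox_at_0 k \<rho>" and y: "y \<in> cbox_at_0 k \<rho>" and d: "0 \<le> \<delta>"
      and xy0: "\<forall>i\<in>{1..k}. \<bar>y i - x i\<bar> \<le> \<delta>"
    note xy = bspec[OF xy0]
    let ?T = "\<lambda>\<alpha>. c \<alpha> * (monomial_at k \<alpha> y - monomial_at k \<alpha> x
      - (\<Sum>i=1..k. (real (\<alpha> i) * monomial_at k (\<alpha>(i := \<alpha> i - 1)) x) * (y i - x i)))"
    let ?L = "power_series k c y - power_series k c x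
        - (\<Sum>i=1..k. power_series k (deriv_coeffs i c) x * (y i - x i))"
    have has_sum_sum: "((\<lambda>\<alpha>. \<Sum>i\<in>I. f i \<alpha>) has_sum (\<Sum>i\<in>I. s i)) A"
      if "finite I" "\<And>i. i \<in> I \<Longrightarrow> (f i has_sum s i) A" for I and f :: "nat \<Rightarrow> (nat \<Rightarrow> nat) \<Rightarrow> real" and s A
      using that by (induction I rule: finite_induct) (simp_all add: has_sum_add)
    have sm: "((\<lambda>\<alpha>. \<Sum>i=1..k. c \<alpha> * (real (\<alpha> i) * monomial_at k (\<alpha>(i := \<alpha> i - 1)) x) * (y i - x i))
        has_sum (\<Sum>i=1..k. power_series k (deriv_coeffs i c) x * (y i - x i))) (multi_indices k)"
      by (rule has_sum_sum) (simp_all only: has_sum_cmult_left power_series_deriv_has_sum[OF assms _ x] finite_atLeastAtMost)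
    have "(?T has_sum ?L) (multi_indices k)"
      using has_sum_subtract[OF has_sum_subtract[OF power_series_has_sum[OF conv y] power_series_has_sum[OF conv x]] sm]
      by (simp add: algebra_simps sum_distrib_left)
    moreover have "((\<lambda>\<alpha>. \<bar>c \<alpha>\<bar> * real (deg k \<alpha>) ^ 2 * \<rho> ^ deg k \<alpha> * (\<delta> / \<rho>)\<^sup>2) has_sum S * (\<delta> / \<rho>)\<^sup>2)
        (multi_indices k)"
      by (rule has_sum_cmult_left[OF S])
    moreover have T: "norm (?T \<alpha>) \<le> \<bar>c \<alpha>\<bar> * real (deg k \<alpha>) ^ 2 * \<rho> ^ deg k \<alpha> * (\<delta> / \<rho>)\<^sup>2" for \<alpha>
      using mult_left_mono[OF monomial_taylor[OF x y assms(2) d xy], of "\<bar>c \<alpha>\<bar>" \<alpha>]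
      by (simp add: abs_mult mult_ac)
    ultimately have "\<bar>?L\<bar> \<le> S * (\<delta> / \<rho>)\<^sup>2"
      by (rule has_sum_abs_bound)
    then show "\<bar>?L\<bar> \<le> S / \<rho>\<^sup>2 * \<delta>\<^sup>2"
      by (simp add: power_divide)
  qed
qed

section \<open>Polynomials with controlled support, and linear substitution in power series\<close>

definition poly_supported ::
    "nat \<Rightarrow> (nat \<Rightarrow> nat) set \<Rightarrow> real \<Rightarrow> (point \<Rightarrow> real) \<Rightarrow> bool" where
  "poly_supported k S C P \<longleftrightarrow> finite S \<and> S \<subseteq> multi_indices k \<and>
     (\<exists>q. (\<forall>x. P x = (\<Sum>\<beta>\<in>S. q \<beta> * monomial_at k \<beta> x)) \<and> (\<Sum>\<beta>\<in>S. \<bar>q \<beta>\<bar>) \<le> C)"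

lemma monomial_at_add:
  "monomial_at k (\<lambda>i. \<alpha> i + \<beta> i) x = monomial_at k \<alpha> x * monomial_at k \<beta> x"
  by (simp add: monomial_at_def power_add prod.distrib)

text \<open>The sum of absolute coefficients serves as the norm in \<open>poly_supported\<close>
  because it is submultiplicative: multiplication convolves the coefficients and adds the
  exponents.\<close>

lemma poly_supported_mult:
  assumes "poly_supported k S C P" "poly_supported k S' C' P'"
    and T: "finite T" "T \<subseteq> multi_indices k" "\<And>\<alpha> \<beta>. \<alpha> \<in> S \<Longrightarrow> \<beta> \<in> S' \<Longrightarrow> (\<lambda>i. \<alpha> i + \<beta> i) \<in> T"
  shows "poly_supported k T (C * C') (\<lambda>x. P x * P' x)"
proof -
  obtain q q' where fin: "finite S" "finite S'"
    and q: "\<And>x. P x = (\<Sum>\<beta>\<in>S. q \<beta> * monomial_at k \<beta> x)" "(\<Sum>\<beta>\<in>S. \<bar>q \<beta>\<bar>) \<le> C"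
    and q': "\<And>x. P' x = (\<Sum>\<beta>\<in>S'. q' \<beta> * monomial_at k \<beta> x)" "(\<Sum>\<beta>\<in>S'. \<bar>q' \<beta>\<bar>) \<le> C'"
    using assms(1,2) unfolding poly_supported_def by blast
  define g :: "(nat \<Rightarrow> nat) \<times> (nat \<Rightarrow> nat) \<Rightarrow> nat \<Rightarrow> nat" where "g = (\<lambda>p i. fst p i + snd p i)"
  define r where "r \<delta> = (\<Sum>p\<in>{p \<in> S \<times> S'. g p = \<delta>}. q (fst p) * q' (snd p))" for \<delta>
  have sub: "g ` (S \<times> S') \<subseteq> T" using T(3) by (auto simp: g_def)
  have fin2: "finite (S \<times> S')" using fin by simp
  have "P x * P' x = (\<Sum>\<delta>\<in>T. r \<delta> * monomial_at k \<delta> x)" for x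
  proof -
    have "P x * P' x = (\<Sum>p\<in>S \<times> S'. q (fst p) * q' (snd p) * monomial_at k (g p) x)"
      unfolding q q' sum_product sum.cartesian_product
      by (rule sum.cong) (auto simp: g_def monomial_at_add)
    also have "\<dots> = (\<Sum>\<delta>\<in>T. \<Sum>p\<in>{p \<in> S \<times> S'. g p = \<delta>}. q (fst p) * q' (snd p) * monomial_at k (g p) x)"
      by (rule sum.group[OF fin2 T(1) sub, symmetric])
    also have "\<dots> = (\<Sum>\<delta>\<in>T. r \<delta> * monomial_at k \<delta> x)"
      by (simp add: r_def sum_distrib_right)
    finally show ?thesis .
  qed
  moreover have "(\<Sum>\<delta>\<in>T. \<bar>r \<delta>\<bar>) \<le> C * C'"
  proof -
    have "(\<Sum>\<delta>\<in>T. \<bar>r \<delta>\<bar>) \<le> (\<Sum>\<delta>\<in>T. \<Sum>p\<in>{p \<in> S \<times> S'. g p = \<delta>}. \<bar>q (fst p) * q' (snd p)\<bar>)"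
      unfolding r_def by (rule sum_mono) (rule sum_abs)
    also have "\<dots> = (\<Sum>p\<in>S \<times> S'. \<bar>q (fst p) * q' (snd p)\<bar>)"
      by (rule sum.group[OF fin2 T(1) sub])
    also have "\<dots> = (\<Sum>\<beta>\<in>S. \<bar>q \<beta>\<bar>) * (\<Sum>\<beta>\<in>S'. \<bar>q' \<beta>\<bar>)"
      by (simp add: sum_product sum.cartesian_product case_prod_beta abs_mult)
    also have "\<dots> \<le> C * C'"
      by (rule mult_mono[OF q(2) q'(2)]) (auto intro: order_trans[OF _ q(2)] sum_nonneg)
    finally show ?thesis .
  qed
  ultimately show ?thesis
    using T(1,2) unfolding poly_supported_def by blast
qed

lemma poly_supported_add:
  assumes "poly_supported k S C P" "poly_supported k S C' P'"
  shows "poly_supported k S (C + C') (\<lambda>x. P x + P' x)"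
proof -
  obtain q q' where fin: "finite S" "S \<subseteq> multi_indices k"
    and q: "\<And>x. P x = (\<Sum>\<beta>\<in>S. q \<beta> * monomial_at k \<beta> x)" "(\<Sum>\<beta>\<in>S. \<bar>q \<beta>\<bar>) \<le> C"
    and q': "\<And>x. P' x = (\<Sum>\<beta>\<in>S. q' \<beta> * monomial_at k \<beta> x)" "(\<Sum>\<beta>\<in>S. \<bar>q' \<beta>\<bar>) \<le> C'"
    using assms unfolding poly_supported_def by blast
  have "\<forall>x. P x + P' x = (\<Sum>\<beta>\<in>S. (q \<beta> + q' \<beta>) * monomial_at k \<beta> x)"
    by (simp add: q q' sum.distrib distrib_right)
  moreover have "(\<Sum>\<beta>\<in>S. \<bar>q \<beta> + q' \<beta>\<bar>) \<le> C + C'"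
  proof -
    have "(\<Sum>\<beta>\<in>S. \<bar>q \<beta> + q' \<beta>\<bar>) \<le> (\<Sum>\<beta>\<in>S. \<bar>q \<beta>\<bar> + \<bar>q' \<beta>\<bar>)"
      by (rule sum_mono) (rule abs_triangle_ineq)
    with q(2) q'(2) show ?thesis by (simp add: sum.distrib)
  qed
  ultimately show ?thesis
    using fin unfolding poly_supported_def by (intro conjI exI[of _ "\<lambda>\<beta>. q \<beta> + q' \<beta>"])
qed

lemma poly_supported_cmult:
  assumes "poly_supported k S C P"
  shows "poly_supported k S (\<bar>a\<bar> * C) (\<lambda>x. a * P x)"
proof -
  obtain q where fin: "finite S" "S \<subseteq> multi_indices k"
    and q: "\<And>x. P x = (\<Sum>\<beta>\<in>S. q \<beta> * monomial_at k \<beta> x)" "(\<Sum>\<beta>\<in>S. \<bar>q \<beta>\<bar>) \<le> C"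
    using assms unfolding poly_supported_def by blast
  have "\<forall>x. a * P x = (\<Sum>\<beta>\<in>S. (a * q \<beta>) * monomial_at k \<beta> x)"
    by (simp add: q sum_distrib_left mult_ac)
  moreover have "(\<Sum>\<beta>\<in>S. \<bar>a * q \<beta>\<bar>) \<le> \<bar>a\<bar> * C"
    using mult_left_mono[OF q(2), of "\<bar>a\<bar>"] by (simp add: abs_mult sum_distrib_left)
  ultimately show ?thesis
    using fin unfolding poly_supported_def by (intro conjI exI[of _ "\<lambda>\<beta>. a * q \<beta>"])
qed

lemma poly_supported_0:
  assumes "finite S" "S \<subseteq> multi_indices k" "0 \<le> C"
  shows "poly_supported k S C (\<lambda>x. 0)"
  unfolding poly_supported_def using assms by (intro conjI exI[of _ "\<lambda>_. 0"]) auto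

lemma poly_supported_sum:
  assumes "finite I" "\<And>i. i \<in> I \<Longrightarrow> poly_supported k S (C i) (P i)"
    and "finite S" "S \<subseteq> multi_indices k"
  shows "poly_supported k S (\<Sum>i\<in>I. C i) (\<lambda>x. \<Sum>i\<in>I. P i x)"
  using assms(1,2)
proof (induction I rule: finite_induct)
  case empty
  then show ?case using poly_supported_0[OF assms(3,4)] by simp
next
  case (insert l I)
  then show ?case
    using poly_supported_add[of k S "C l" "P l" "\<Sum>i\<in>I. C i" "\<lambda>x. \<Sum>i\<in>I. P i x"] by simp
qed

lemma poly_supported_mono:
  assumes "poly_supported k S C P" "C \<le> C'" "S \<subseteq> S'" "finite S'" "S' \<subseteq> multi_indices k"
  shows "poly_supported k S' C' P"
proof -
  obtain q where q: "\<And>x. P x = (\<Sum>\<beta>\<in>S. q \<beta> * monomial_at k \<beta> x)" "(\<Sum>\<beta>\<in>S. \<bar>q \<beta>\<bar>) \<le> C"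
    using assms unfolding poly_supported_def by blast
  define r where "r \<beta> = (if \<beta> \<in> S then q \<beta> else 0)" for \<beta>
  have "\<forall>x. P x = (\<Sum>\<beta>\<in>S'. r \<beta> * monomial_at k \<beta> x)"
    unfolding q(1) r_def using assms(3,4) by (intro allI sum.mono_neutral_cong_left) auto
  moreover have "(\<Sum>\<beta>\<in>S'. \<bar>r \<beta>\<bar>) = (\<Sum>\<beta>\<in>S. \<bar>q \<beta>\<bar>)"
    unfolding r_def using assms(3,4) by (intro sum.mono_neutral_cong_right) auto
  ultimately show ?thesis
    using q(2) assms unfolding poly_supported_def by (metis order_trans)
qed

definition unit_index :: "nat \<Rightarrow> nat \<Rightarrow> nat" where
  "unit_index i = (\<lambda>j. if j = i then 1 else 0)"

lemma monomial_at_unit_index: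
  assumes "i \<in> {1..k}"
  shows "monomial_at k (unit_index i) x = x i"
proof -
  have "monomial_at k (unit_index i) x = (\<Prod>j\<in>{1..k}. if j = i then x i else 1)"
    unfolding monomial_at_def unit_index_def by (rule prod.cong) auto
  then show ?thesis using assms by simp
qed

lemma unit_index_in_multi_indices: "i \<in> {1..k} \<Longrightarrow> unit_index i \<in> multi_indices k"
  by (auto simp: unit_index_def multi_indices_def)

lemma deg_unit_index: "i \<in> {1..k} \<Longrightarrow> deg k (unit_index i) = 1"
  by (simp add: unit_index_def multi_degree_def)

lemma deg_add: "deg k (\<lambda>i. \<alpha> i + \<beta> i) = deg k \<alpha> + deg k \<beta>"
  by (simp add: multi_degree_def sum.distrib)

lemma multi_indices_add: "\<alpha> \<in> multi_indices k \<Longrightarrow> \<beta> \<in> multi_indices k \<Longrightarrow> (\<lambda>i. \<alpha> i + \<beta> i) \<in> multi_indices k"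
  by (simp add: multi_indices_def)

lemma poly_supported_coordinate:
  assumes "i \<in> {1..k}" "unit_index i \<in> S" "finite S" "S \<subseteq> multi_indices k"
  shows "poly_supported k S 1 (\<lambda>x. x i)"
proof -
  have "poly_supported k {unit_index i} 1 (\<lambda>x. x i)"
    unfolding poly_supported_def using assms
    by (intro conjI exI[of _ "\<lambda>_. 1"]) (auto simp: monomial_at_unit_index)
  then show ?thesis by (rule poly_supported_mono) (use assms in auto)
qed

lemma degree_indices_subset: "degree_indices k d \<subseteq> multi_indices k"
  by (auto simp: degree_indices_def)

lemma poly_supported_homogeneous_mult:
  assumes "poly_supported k (degree_indices k d) C P" "poly_supported k (degree_indices k e) C' P'"
  shows "poly_supported k (degree_indices k (d + e)) (C * C') (\<lambda>x. P x * P' x)"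
  by (rule poly_supported_mult[OF assms])
    (simp_all add: degree_indices_subset, simp add: degree_indices_def deg_add multi_indices_add)

lemma poly_supported_1: "poly_supported k (degree_indices k 0) 1 (\<lambda>x. 1)"
proof -
  have "degree_indices k 0 = {\<lambda>_. 0}"
    by (auto simp: degree_indices_def multi_indices_def multi_degree_def fun_eq_iff)
      (metis atLeastAtMost_iff)
  then show ?thesis
    unfolding poly_supported_def
    by (intro conjI exI[of _ "\<lambda>_. 1"]) (auto simp: monomial_at_def multi_indices_def)
qed

lemma poly_supported_homogeneous_power:
  assumes "poly_supported k (degree_indices k d) C P"
  shows "poly_supported k (degree_indices k (d * n)) (C ^ n) (\<lambda>x. P x ^ n)"
proof (induction n)
  case 0
  then show ?case using poly_supported_1 by simp
next
  case (Suc n)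
  from poly_supported_homogeneous_mult[OF assms this] show ?case by simp
qed

lemma poly_supported_homogeneous_prod:
  assumes "finite I" "\<And>i. i \<in> I \<Longrightarrow> poly_supported k (degree_indices k (d i)) (C i) (P i)"
  shows "poly_supported k (degree_indices k (\<Sum>i\<in>I. d i)) (\<Prod>i\<in>I. C i) (\<lambda>x. \<Prod>i\<in>I. P i x)"
  using assms
proof (induction I rule: finite_induct)
  case empty
  then show ?case using poly_supported_1 by simp
next
  case (insert l I)
  then show ?case
    using poly_supported_homogeneous_mult[of k "d l" "C l" "P l" "\<Sum>i\<in>I. d i" "\<Prod>i\<in>I. C i" "\<lambda>x. \<Prod>i\<in>I. P i x"]
    by simp
qed

text \<open>\<open>B j i\<close> is the entry in row j and column i, and k counts columns: the same
  matrix with a smaller k amounts to putting the remaining variables equal to 0.\<close>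

definition lin_map :: "nat \<Rightarrow> (nat \<Rightarrow> nat \<Rightarrow> real) \<Rightarrow> point \<Rightarrow> point" where
  "lin_map k B x = (\<lambda>j. \<Sum>i=1..k. B j i * x i)"

lemma monomial_at_lin_map_supported:
  assumes "\<And>j. j \<in> {1..n} \<Longrightarrow> (\<Sum>i=1..k. \<bar>B j i\<bar>) \<le> b"
  shows "poly_supported k (degree_indices k (deg n \<alpha>)) (b ^ deg n \<alpha>)
    (\<lambda>x. monomial_at n \<alpha> (lin_map k B x))"
proof -
  have lin: "poly_supported k (degree_indices k 1) b (\<lambda>x. lin_map k B x j)" if j: "j \<in> {1..n}" for j
  proof -
    have "poly_supported k (degree_indices k 1) (\<bar>B j i\<bar> * 1) (\<lambda>x. B j i * x i)" if "i \<in> {1..k}" for i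
    proof -
      have "unit_index i \<in> degree_indices k 1"
        using that by (simp add: degree_indices_def deg_unit_index unit_index_in_multi_indices)
      then show ?thesis
        by (rule poly_supported_cmult[OF poly_supported_coordinate[OF that _ finite_degree_indices degree_indices_subset]])
    qed
    then have "poly_supported k (degree_indices k 1) (\<Sum>i=1..k. \<bar>B j i\<bar> * 1) (\<lambda>x. \<Sum>i=1..k. B j i * x i)"
      by (intro poly_supported_sum) (auto simp: degree_indices_subset)
    then show ?thesis
      unfolding lin_map_def
      by (rule poly_supported_mono) (use assms[OF j] degree_indices_subset in auto)
  qed
  have "poly_supported k (degree_indices k (\<Sum>j\<in>{1..n}. 1 * \<alpha> j)) (\<Prod>j\<in>{1..n}. b ^ \<alpha> j)
      (\<lambda>x. \<Prod>j\<in>{1..n}. lin_map k B x j ^ \<alpha> j)"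
    by (intro poly_supported_homogeneous_prod poly_supported_homogeneous_power lin) auto
  then show ?thesis
    unfolding monomial_at_def multi_degree_def by (simp add: power_sum)
qed

lemma lin_map_cbox:
  assumes "\<And>j. j \<in> {1..n} \<Longrightarrow> (\<Sum>i=1..k. \<bar>B j i\<bar>) \<le> b" "x \<in> cbox_at_0 k r" "0 \<le> r"
  shows "lin_map k B x \<in> cbox_at_0 n (b * r)"
proof -
  have "\<bar>lin_map k B x j\<bar> \<le> b * r" if j: "j \<in> {1..n}" for j
  proof -
    have "\<bar>lin_map k B x j\<bar> \<le> (\<Sum>i=1..k. \<bar>B j i * x i\<bar>)"
      unfolding lin_map_def by (rule sum_abs)
    also have "\<dots> \<le> (\<Sum>i=1..k. \<bar>B j i\<bar> * r)"
      using assms(2) by (intro sum_mono) (auto simp: abs_mult cbox_at_0_def intro: mult_left_mono)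
    also have "\<dots> \<le> b * r"
      unfolding sum_distrib_right[symmetric] by (rule mult_right_mono[OF assms(1)[OF j] assms(3)])
    finally show ?thesis .
  qed
  then show ?thesis by (simp add: cbox_at_0_def)
qed

text \<open>If b bounds the absolute row sums, the substitution multiplies the sum of the absolute
  coefficients of degree d by at most b^d, so the radius R becomes R / b.\<close>

lemma power_series_lin_map:
  assumes conv: "converges n c R" and b: "\<And>j. j \<in> {1..n} \<Longrightarrow> (\<Sum>i=1..k. \<bar>B j i\<bar>) \<le> b" "0 < b"
  obtains c' where "converges k c' (R / b)"
    and "\<And>d x. hom_part k c' d x = hom_part n c d (lin_map k B x)"
    and "\<And>x. x \<in> cbox_at_0 k (R / b) \<Longrightarrow> power_series k c' x = power_series n c (lin_map k B x)"
proof -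
  have R: "0 < R" using conv by (simp add: converges_def)
  have "poly_supported k (degree_indices k d) (\<Sum>\<alpha>\<in>degree_indices n d. \<bar>c \<alpha>\<bar> * b ^ d)
      (\<lambda>x. \<Sum>\<alpha>\<in>degree_indices n d. c \<alpha> * monomial_at n \<alpha> (lin_map k B x))" for d
  proof (rule poly_supported_sum)
    fix \<alpha> assume "\<alpha> \<in> degree_indices n d"
    then have "deg n \<alpha> = d" by (simp add: degree_indices_def)
    moreover have "poly_supported k (degree_indices k (deg n \<alpha>)) (b ^ deg n \<alpha>)
        (\<lambda>x. monomial_at n \<alpha> (lin_map k B x))"
      by (rule monomial_at_lin_map_supported) (rule b(1))
    ultimately show "poly_supported k (degree_indices k d) (\<bar>c \<alpha>\<bar> * b ^ d) (\<lambda>x. c \<alpha> * monomial_at n \<alpha> (lin_map k B x))"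
      using poly_supported_cmult by blast
  qed (simp_all add: degree_indices_subset)
  then have "\<exists>q. (\<forall>x. hom_part n c d (lin_map k B x) = (\<Sum>\<beta>\<in>degree_indices k d. q \<beta> * monomial_at k \<beta> x))
      \<and> (\<Sum>\<beta>\<in>degree_indices k d. \<bar>q \<beta>\<bar>) \<le> (\<Sum>\<alpha>\<in>degree_indices n d. \<bar>c \<alpha>\<bar> * b ^ d)" for d
    unfolding hom_part_def poly_supported_def by blast
  then have "\<exists>q. \<forall>d. (\<forall>x. hom_part n c d (lin_map k B x) = (\<Sum>\<beta>\<in>degree_indices k d. q d \<beta> * monomial_at k \<beta> x))
      \<and> (\<Sum>\<beta>\<in>degree_indices k d. \<bar>q d \<beta>\<bar>) \<le> (\<Sum>\<alpha>\<in>degree_indices n d. \<bar>c \<alpha>\<bar> * b ^ d)"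
    by (intro choice allI)
  then obtain q where q: "\<And>d x. hom_part n c d (lin_map k B x) = (\<Sum>\<beta>\<in>degree_indices k d. q d \<beta> * monomial_at k \<beta> x)"
    and qb: "\<And>d. (\<Sum>\<beta>\<in>degree_indices k d. \<bar>q d \<beta>\<bar>) \<le> (\<Sum>\<alpha>\<in>degree_indices n d. \<bar>c \<alpha>\<bar> * b ^ d)"
    by blast
  \<comment> \<open>The polynomials of the single degrees are glued: every multi-index takes its
    coefficient from the polynomial of its own degree.\<close>
  define c' where "c' \<beta> = q (deg k \<beta>) \<beta>" for \<beta>
  have c'q: "c' \<beta> = q d \<beta>" if "\<beta> \<in> degree_indices k d" for \<beta> d
    using that by (simp add: c'_def degree_indices_def)
  have hom: "hom_part k c' d x = hom_part n c d (lin_map k B x)" for d x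
    unfolding q hom_part_def[of k] by (rule sum.cong) (simp_all add: c'q)
  have "(\<lambda>d. (\<Sum>\<beta>\<in>degree_indices k d. \<bar>c' \<beta>\<bar>) * (R / b) ^ d) summable_on UNIV"
  proof (rule summable_on_comparison_test)
    show "(\<lambda>d. (\<Sum>\<alpha>\<in>degree_indices n d. \<bar>c \<alpha>\<bar>) * R ^ d) summable_on UNIV"
      using conv converges_iff_degreewise[OF R] by blast
    fix d
    have "(\<Sum>\<beta>\<in>degree_indices k d. \<bar>c' \<beta>\<bar>) = (\<Sum>\<beta>\<in>degree_indices k d. \<bar>q d \<beta>\<bar>)"
      by (rule sum.cong) (simp_all add: c'q)
    also have "\<dots> \<le> (\<Sum>\<alpha>\<in>degree_indices n d. \<bar>c \<alpha>\<bar>) * b ^ d"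
      using qb[of d] by (simp add: sum_distrib_right)
    finally have "(\<Sum>\<beta>\<in>degree_indices k d. \<bar>c' \<beta>\<bar>) * (R / b) ^ d
        \<le> ((\<Sum>\<alpha>\<in>degree_indices n d. \<bar>c \<alpha>\<bar>) * b ^ d) * (R / b) ^ d"
      using R b(2) by (intro mult_right_mono) auto
    then show "(\<Sum>\<beta>\<in>degree_indices k d. \<bar>c' \<beta>\<bar>) * (R / b) ^ d \<le> (\<Sum>\<alpha>\<in>degree_indices n d. \<bar>c \<alpha>\<bar>) * R ^ d"
      using b(2) by (simp add: power_divide)
    show "0 \<le> (\<Sum>\<beta>\<in>degree_indices k d. \<bar>c' \<beta>\<bar>) * (R / b) ^ d"
      using R b(2) by (intro mult_nonneg_nonneg sum_nonneg) auto
  qed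
  then have conv': "converges k c' (R / b)"
    using converges_iff_degreewise[of "R / b" k c'] R b(2) by simp
  have "power_series k c' x = power_series n c (lin_map k B x)" if x: "x \<in> cbox_at_0 k (R / b)" for x
  proof -
    have "lin_map k B x \<in> cbox_at_0 n R"
      using lin_map_cbox[OF b(1) x] R b(2) by simp
    from hom_part_sums[OF conv this] hom_part_sums[OF conv' x] show ?thesis
      by (simp add: hom sums_unique2)
  qed
  with conv' hom show ?thesis by (intro that)
qed

lemma monomial_at_scale: "monomial_at k \<alpha> (\<lambda>i. s * x i) = s ^ deg k \<alpha> * monomial_at k \<alpha> x"
  by (simp add: monomial_at_def multi_degree_def power_mult_distrib prod.distrib power_sum)

lemma hom_part_scale: "hom_part k c d (\<lambda>i. s * x i) = s ^ d * hom_part k c d x"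
  unfolding hom_part_def sum_distrib_left
  by (rule sum.cong) (auto simp: monomial_at_scale degree_indices_def)

text \<open>On a ray the part of degree d scales by s^d, so it becomes the d-th coefficient of a
  series in one variable.\<close>

lemma power_series_ray_fps:
  assumes conv: "converges k c R"
  shows "(\<lambda>s. power_series k c (\<lambda>i. s * x i)) has_fps_expansion Abs_fps (\<lambda>d. hom_part k c d x)"
proof (rule has_fps_expansionI)
  have R: "0 < R" using conv by (simp add: converges_def)
  \<comment> \<open>The summand 1 keeps the bound positive when x is 0.\<close>
  define b where "b = 1 + (\<Sum>i=1..k. \<bar>x i\<bar>)"
  have b: "0 < b" by (simp add: b_def add_pos_nonneg sum_nonneg)
  have "(\<lambda>d. fps_nth (Abs_fps (\<lambda>d. hom_part k c d x)) d * s ^ d) sums power_series k c (\<lambda>i. s * x i)"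
    if s: "\<bar>s\<bar> < R / b" for s
  proof -
    have "\<bar>s * x i\<bar> \<le> R" if "i \<in> {1..k}" for i
    proof -
      have "\<bar>x i\<bar> \<le> (\<Sum>i=1..k. \<bar>x i\<bar>)" using that by (intro member_le_sum) auto
      then have "\<bar>x i\<bar> \<le> b" by (simp add: b_def)
      then have "\<bar>s\<bar> * \<bar>x i\<bar> \<le> (R / b) * b" using s R b by (intro mult_mono) auto
      then show ?thesis using b by (simp add: abs_mult)
    qed
    then have "(\<lambda>i. s * x i) \<in> cbox_at_0 k R" by (simp add: cbox_at_0_def)
    from hom_part_sums[OF conv this] show ?thesis by (simp add: hom_part_scale mult.commute)
  qed
  moreover have "eventually (\<lambda>s. \<bar>s\<bar> < R / b) (nhds 0)"
    using R b eventually_nhds_in_open[of "ball 0 (R / b)" "0::real"] by (auto simp: dist_norm)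
  ultimately show "\<forall>\<^sub>F s in nhds 0. (\<lambda>d. fps_nth (Abs_fps (\<lambda>d. hom_part k c d x)) d * s ^ d)
      sums power_series k c (\<lambda>i. s * x i)"
    by (auto elim: eventually_mono)
qed

subsection \<open>Changes of basis\<close>

definition mat_prod :: "nat \<Rightarrow> (nat \<Rightarrow> nat \<Rightarrow> real) \<Rightarrow> (nat \<Rightarrow> nat \<Rightarrow> real) \<Rightarrow> nat \<Rightarrow> nat \<Rightarrow> real" where
  "mat_prod n A B i j = (\<Sum>l=1..n. A i l * B l j)"

definition mat_inverse :: "nat \<Rightarrow> (nat \<Rightarrow> nat \<Rightarrow> real) \<Rightarrow> (nat \<Rightarrow> nat \<Rightarrow> real) \<Rightarrow> bool" where
  "mat_inverse n A B \<longleftrightarrow> (\<forall>i\<in>{1..n}. \<forall>j\<in>{1..n}.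
     mat_prod n A B i j = (if i = j then 1 else 0) \<and> mat_prod n B A i j = (if i = j then 1 else 0))"

definition lin_comb :: "nat \<Rightarrow> (nat \<Rightarrow> real) \<Rightarrow> (nat \<Rightarrow> real fps) \<Rightarrow> real fps" where
  "lin_comb n c \<gamma> = (\<Sum>i=1..n. fps_const (c i) * \<gamma> i)"

text \<open>The combinations run along the columns of B, as the gradient does by the chain rule
  under a substitution of B. The inverse is kept as an explicit witness because it later becomes the
  change of coordinates of the hypersurface.\<close>

definition basis_change :: "nat \<Rightarrow> (nat \<Rightarrow> real fps) \<Rightarrow> (nat \<Rightarrow> real fps) \<Rightarrow> bool" where
  "basis_change n \<gamma> \<delta> \<longleftrightarrow>
     (\<exists>B C. mat_inverse n B C \<and> (\<forall>i\<in>{1..n}. \<delta> i = lin_comb n (\<lambda>j. B j i) \<gamma>))"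

lemma mat_prod_assoc: "mat_prod n (mat_prod n A B) C i j = mat_prod n A (mat_prod n B C) i j"
  unfolding mat_prod_def sum_distrib_left sum_distrib_right
  by (subst sum.swap) (simp add: mult.assoc)

lemma mat_prod_cong:
  "(\<And>l. l \<in> {1..n} \<Longrightarrow> A i l = A' i l) \<Longrightarrow> (\<And>l. l \<in> {1..n} \<Longrightarrow> B l j = B' l j)
    \<Longrightarrow> mat_prod n A B i j = mat_prod n A' B' i j"
  unfolding mat_prod_def by (rule sum.cong) auto

lemma mat_prod_id_left:
  assumes "\<And>l. l \<in> {1..n} \<Longrightarrow> I i l = (if i = l then 1 else 0)" "i \<in> {1..n}"
  shows "mat_prod n I B i j = B i j"
proof -
  have "mat_prod n I B i j = (\<Sum>l=1..n. if i = l then B i j else 0)"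
    unfolding mat_prod_def by (rule sum.cong) (auto simp: assms(1))
  then show ?thesis using assms(2) by simp
qed

lemma mat_inverse_sym: "mat_inverse n A B \<Longrightarrow> mat_inverse n B A"
  by (simp add: mat_inverse_def)

lemma mat_inverse_prod:
  assumes "mat_inverse n A A'" "mat_inverse n B B'"
  shows "mat_inverse n (mat_prod n A B) (mat_prod n B' A')"
proof -
  have *: "mat_prod n (mat_prod n A B) (mat_prod n B' A') i j = (if i = j then 1 else 0)"
    if "mat_inverse n A A'" "mat_inverse n B B'" "i \<in> {1..n}" "j \<in> {1..n}" for A A' B B' i j
  proof -
    have "mat_prod n (mat_prod n A B) (mat_prod n B' A') i j
        = mat_prod n A (mat_prod n (mat_prod n B B') A') i j"
      unfolding mat_prod_assoc[of n A B] by (rule mat_prod_cong) (simp_all add: mat_prod_assoc)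
    also have "\<dots> = mat_prod n A A' i j"
    proof (rule mat_prod_cong)
      fix l assume "l \<in> {1..n}"
      then show "mat_prod n (mat_prod n B B') A' l j = A' l j"
        by (intro mat_prod_id_left) (use that(2) in \<open>auto simp: mat_inverse_def\<close>)
    qed simp
    finally show ?thesis using that by (simp add: mat_inverse_def)
  qed
  show ?thesis
    unfolding mat_inverse_def
    using *[OF assms] *[OF mat_inverse_sym[OF assms(2)] mat_inverse_sym[OF assms(1)]] by blast
qed

lemma lin_comb_cong: "(\<And>i. i \<in> {1..n} \<Longrightarrow> \<gamma> i = \<gamma>' i) \<Longrightarrow> lin_comb n c \<gamma> = lin_comb n c \<gamma>'"
  unfolding lin_comb_def by (rule sum.cong) auto

lemma lin_comb_lin_comb:
  "lin_comb n c (\<lambda>i. lin_comb n (\<lambda>j. B j i) \<gamma>) = lin_comb n (\<lambda>j. \<Sum>i=1..n. B j i * c i) \<gamma>"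
proof -
  have "lin_comb n c (\<lambda>i. lin_comb n (\<lambda>j. B j i) \<gamma>)
      = (\<Sum>i=1..n. \<Sum>j=1..n. fps_const (B j i * c i) * \<gamma> j)"
  proof -
    have "fps_const a * (fps_const b * g) = fps_const (b * a) * g" for a b and g :: "real fps"
      by (metis fps_const_mult mult.assoc mult.commute)
    then show ?thesis unfolding lin_comb_def sum_distrib_left by (simp only:)
  qed
  also have "\<dots> = (\<Sum>j=1..n. \<Sum>i=1..n. fps_const (B j i * c i) * \<gamma> j)"
    by (rule sum.swap)
  also have "\<dots> = lin_comb n (\<lambda>j. \<Sum>i=1..n. B j i * c i) \<gamma>"
  proof -
    have "fps_const (\<Sum>i\<in>I. f i) = (\<Sum>i\<in>I. fps_const (f i :: real))" for f and I :: "nat set"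
      by (induction I rule: infinite_finite_induct) (simp_all flip: fps_const_add)
    then show ?thesis unfolding lin_comb_def by (simp add: sum_distrib_right)
  qed
  finally show ?thesis .
qed

lemma lin_comb_unit:
  assumes "i \<in> {1..n}"
  shows "lin_comb n (\<lambda>j. if j = i then 1 else 0) \<gamma> = \<gamma> i"
proof -
  have "lin_comb n (\<lambda>j. if j = i then 1 else 0) \<gamma> = (\<Sum>j=1..n. if j = i then \<gamma> i else 0)"
    unfolding lin_comb_def by (rule sum.cong) auto
  then show ?thesis using assms by simp
qed

lemma lin_comb_cong_coeffs:
  "(\<And>i. i \<in> {1..n} \<Longrightarrow> c i = c' i) \<Longrightarrow> lin_comb n c \<gamma> = lin_comb n c' \<gamma>"
  unfolding lin_comb_def by (rule sum.cong) auto

lemma basis_change_trans: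
  assumes "basis_change n \<gamma> \<delta>" "basis_change n \<delta> \<epsilon>"
  shows "basis_change n \<gamma> \<epsilon>"
proof -
  obtain B C where B: "mat_inverse n B C" "\<And>i. i \<in> {1..n} \<Longrightarrow> \<delta> i = lin_comb n (\<lambda>j. B j i) \<gamma>"
    using assms(1) unfolding basis_change_def by blast
  obtain B' C' where B': "mat_inverse n B' C'" "\<And>i. i \<in> {1..n} \<Longrightarrow> \<epsilon> i = lin_comb n (\<lambda>j. B' j i) \<delta>"
    using assms(2) unfolding basis_change_def by blast
  have "\<epsilon> i = lin_comb n (\<lambda>j. mat_prod n B B' j i) \<gamma>" if "i \<in> {1..n}" for i
  proof -
    have "\<epsilon> i = lin_comb n (\<lambda>j. B' j i) (\<lambda>l. lin_comb n (\<lambda>j. B j l) \<gamma>)"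
      unfolding B'(2)[OF that] by (rule lin_comb_cong) (rule B(2))
    then show ?thesis unfolding lin_comb_lin_comb mat_prod_def .
  qed
  with mat_inverse_prod[OF B(1) B'(1)] show ?thesis unfolding basis_change_def by blast
qed

lemma basis_change_sym:
  assumes "basis_change n \<gamma> \<delta>"
  shows "basis_change n \<delta> \<gamma>"
proof -
  obtain B C where B: "mat_inverse n B C" "\<And>i. i \<in> {1..n} \<Longrightarrow> \<delta> i = lin_comb n (\<lambda>j. B j i) \<gamma>"
    using assms(1) unfolding basis_change_def by blast
  have "\<gamma> i = lin_comb n (\<lambda>j. C j i) \<delta>" if "i \<in> {1..n}" for i
  proof -
    have "lin_comb n (\<lambda>j. C j i) \<delta> = lin_comb n (\<lambda>j. C j i) (\<lambda>l. lin_comb n (\<lambda>j. B j l) \<gamma>)"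
      by (rule lin_comb_cong) (rule B(2))
    also have "\<dots> = lin_comb n (\<lambda>j. if j = i then 1 else 0) \<gamma>"
      unfolding lin_comb_lin_comb
      by (rule lin_comb_cong_coeffs) (use B(1) that in \<open>simp add: mat_inverse_def mat_prod_def\<close>)
    finally show ?thesis by (simp only: lin_comb_unit[OF that])
  qed
  with mat_inverse_sym[OF B(1)] show ?thesis unfolding basis_change_def by blast
qed

text \<open>The permutation matrix of an involution is its own inverse.\<close>

lemma basis_change_involution:
  assumes "\<And>i. i \<in> {1..n} \<Longrightarrow> \<sigma> i \<in> {1..n}" "\<And>i. \<sigma> (\<sigma> i) = i"
  shows "basis_change n \<gamma> (\<lambda>i. \<gamma> (\<sigma> i))"
proof -
  define B where "B = (\<lambda>j i. if j = \<sigma> i then 1 else 0 :: real)"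
  have "mat_prod n B B i j = (if i = j then 1 else 0)" if "i \<in> {1..n}" "j \<in> {1..n}" for i j
  proof -
    have "mat_prod n B B i j = (\<Sum>l=1..n. if l = \<sigma> j then (if i = j then 1 else 0) else 0)"
      unfolding mat_prod_def B_def using assms(2) by (intro sum.cong refl) auto
    then show ?thesis using assms(1)[OF that(2)] by simp
  qed
  then have "mat_inverse n B B" by (simp add: mat_inverse_def)
  moreover have "\<gamma> (\<sigma> i) = lin_comb n (\<lambda>j. B j i) \<gamma>" if "i \<in> {1..n}" for i
    unfolding B_def by (rule lin_comb_unit[OF assms(1)[OF that], symmetric])
  ultimately show ?thesis unfolding basis_change_def by blast
qed

lemma basis_change_refl: "basis_change n \<gamma> \<gamma>"
  using basis_change_involution[of n "\<lambda>i. i"] by simp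

text \<open>As \<open>m a = 0\<close>, the element \<open>\<gamma> a\<close> stays untouched, so
  subtracting its multiples is undone by adding them again.\<close>

lemma basis_change_transvection:
  assumes "a \<in> {1..n}" "m a = 0"
  shows "basis_change n \<gamma> (\<lambda>i. \<gamma> i - fps_const (m i) * \<gamma> a)"
proof -
  define B where "B s = (\<lambda>j i. (if j = i then 1 else 0) + (if j = a then s * m i else 0 :: real))" for s
  have prod: "mat_prod n (B s) (B (- s)) i j = (if i = j then 1 else 0)"
    if "i \<in> {1..n}" "j \<in> {1..n}" for i j s
  proof -
    have "mat_prod n (B s) (B (- s)) i j = (\<Sum>l=1..n. (if l = j then B s i j else 0)
        + (if l = a then - s * m j * B s i a else 0))"
      unfolding mat_prod_def by (intro sum.cong refl) (auto simp: B_def algebra_simps)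
    also have "\<dots> = B s i j - s * m j * B s i a"
      using that assms(1) by (simp add: sum.distrib)
    also have "\<dots> = (if i = j then 1 else 0)"
      using assms(2) by (auto simp: B_def)
    finally show ?thesis .
  qed
  have "mat_inverse n (B (- 1)) (B 1)"
    unfolding mat_inverse_def using prod[of _ _ "- 1"] prod[of _ _ 1] by auto
  moreover have "\<gamma> i - fps_const (m i) * \<gamma> a = lin_comb n (\<lambda>j. B (- 1) j i) \<gamma>" if "i \<in> {1..n}" for i
  proof -
    have "lin_comb n (\<lambda>j. B (- 1) j i) \<gamma>
        = (\<Sum>j=1..n. (if j = i then \<gamma> i else 0) - (if j = a then fps_const (m i) * \<gamma> a else 0))"
      unfolding lin_comb_def by (intro sum.cong refl) (auto simp: B_def algebra_simps simp flip: fps_const_add fps_const_neg)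
    also have "\<dots> = \<gamma> i - fps_const (m i) * \<gamma> a"
      using that assms(1) by (simp add: sum_subtractf)
    finally show ?thesis by simp
  qed
  ultimately show ?thesis unfolding basis_change_def by blast
qed

text \<open>The constants are adjoined because the operator lowers an element of order 1 to one of
  order 0, whereas the components of the gradient all vanish at 0.\<close>

definition affine_span :: "nat \<Rightarrow> (nat \<Rightarrow> real fps) \<Rightarrow> real fps set" where
  "affine_span n \<gamma> = {fps_const a + lin_comb n c \<gamma> |a c. True}"

lemma affine_spanI: "fps_const a + lin_comb n c \<gamma> \<in> affine_span n \<gamma>"
  unfolding affine_span_def by blast

lemma affine_span_basis_change_subset:
  assumes "basis_change n \<gamma> \<delta>"
  shows "affine_span n \<delta> \<subseteq> affine_span n \<gamma>"
proof
  fix v assume "v \<in> affine_span n \<delta>"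
  then obtain a c where v: "v = fps_const a + lin_comb n c \<delta>"
    unfolding affine_span_def by blast
  obtain B where B: "\<And>i. i \<in> {1..n} \<Longrightarrow> \<delta> i = lin_comb n (\<lambda>j. B j i) \<gamma>"
    using assms(1) unfolding basis_change_def by blast
  have "lin_comb n c \<delta> = lin_comb n c (\<lambda>i. lin_comb n (\<lambda>j. B j i) \<gamma>)"
    by (rule lin_comb_cong) (rule B)
  then show "v \<in> affine_span n \<gamma>"
    unfolding v lin_comb_lin_comb by (simp only: affine_spanI)
qed

lemma affine_span_basis_change:
  "basis_change n \<gamma> \<delta> \<Longrightarrow> affine_span n \<delta> = affine_span n \<gamma>"
  using affine_span_basis_change_subset basis_change_sym by blast

subsection \<open>Orders of vanishing\<close>

definition has_order :: "nat \<Rightarrow> real fps \<Rightarrow> bool" where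
  "has_order m f \<longleftrightarrow> (\<forall>q<m. fps_nth f q = 0) \<and> fps_nth f m \<noteq> 0"

lemma has_order_exists:
  assumes "f \<noteq> 0"
  obtains m where "has_order m f"
proof (rule that[of "subdegree f"])
  show "has_order (subdegree f) f"
    unfolding has_order_def using nth_subdegree_nonzero[OF assms] nth_less_subdegree_zero[of _ f] by blast
qed

text \<open>First-order differential operators with invertible leading coefficient lower the order by one.\<close>

definition derivation_closed :: "real fps set \<Rightarrow> bool" where
  "derivation_closed V \<longleftrightarrow>
     (\<exists>\<kappa> \<mu>. fps_nth \<kappa> 0 \<noteq> 0 \<and> (\<forall>v\<in>V. \<kappa> * fps_deriv v + \<mu> * v \<in> V))"

text \<open>For w of order p + 1 the term with kappa has order exactly p and the term with mu has
  order at least p + 1, so nothing cancels the leading coefficient. Iteration passes through every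
  order below q.\<close>

lemma derivation_closed_orders:
  assumes "derivation_closed V" "v \<in> V" "has_order q v" "m \<le> q"
  shows "\<exists>w\<in>V. has_order m w"
proof -
  obtain \<kappa> \<mu> where l: "fps_nth \<kappa> 0 \<noteq> 0" "\<And>v. v \<in> V \<Longrightarrow> \<kappa> * fps_deriv v + \<mu> * v \<in> V"
    using assms(1) unfolding derivation_closed_def by blast
  have step: "has_order p (\<kappa> * fps_deriv w + \<mu> * w)" if w: "has_order (Suc p) w" for p w
  proof -
    have z: "fps_nth w r = 0" if "r \<le> p" for r using w that by (simp add: has_order_def)
    have d: "fps_nth (fps_deriv w) r = 0" if "r < p" for r using z[of "Suc r"] that by (simp add: One_nat_def)
    have "fps_nth (\<mu> * w) r = 0" if "r \<le> p" for r
      using z that by (auto simp: fps_mult_nth intro!: sum.neutral)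
    moreover have "fps_nth (\<kappa> * fps_deriv w) r = (if r = p then fps_nth \<kappa> 0 * fps_nth (fps_deriv w) p else 0)"
      if "r \<le> p" for r
    proof -
      have "fps_nth (\<kappa> * fps_deriv w) r
          = (\<Sum>i=0..r. if i = 0 then fps_nth \<kappa> 0 * fps_nth (fps_deriv w) r else 0)"
        unfolding fps_mult_nth using that by (intro sum.cong refl) (auto simp: d simp del: fps_deriv_nth)
      also have "\<dots> = fps_nth \<kappa> 0 * fps_nth (fps_deriv w) r" by simp
      finally show ?thesis using d[of r] that by auto
    qed
    moreover have "fps_nth (fps_deriv w) p \<noteq> 0" using w by (simp add: has_order_def One_nat_def)
    ultimately show ?thesis using l(1) by (simp add: has_order_def del: fps_deriv_nth)
  qed
  have "\<exists>w\<in>V. has_order (q - j) w" if "j \<le> q" for j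
    using that
  proof (induction j)
    case 0
    then show ?case using assms(2,3) by auto
  next
    case (Suc j)
    then obtain w where w: "w \<in> V" "has_order (q - j) w" by auto
    moreover have "q - j = Suc (q - Suc j)" using Suc.prems by simp
    ultimately show ?case using step[of "q - Suc j" w] l(2) by metis
  qed
  from this[of "q - m"] assms(4) show ?thesis by simp
qed

lemma lin_comb_nth: "fps_nth (lin_comb n c \<gamma>) q = (\<Sum>i=1..n. c i * fps_nth (\<gamma> i) q)"
  by (simp add: lin_comb_def fps_sum_nth)

text \<open>Coefficients are compared from below: at X^l the elements of smaller index already have
  coefficient 0 in the combination, and those of larger index do not reach down to X^l.\<close>

lemma triangular_coeffs_zero:
  assumes ord: "\<And>i. i \<in> {1..m} \<Longrightarrow> has_order i (\<delta> i)"
    and rest: "\<And>i q. i \<in> {1..n} \<Longrightarrow> m < i \<Longrightarrow> q \<le> m \<Longrightarrow> fps_nth (\<delta> i) q = 0"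
    and zero: "\<And>q. q \<le> m \<Longrightarrow> fps_nth (lin_comb n c \<delta>) q = 0"
    and l: "1 \<le> l" "l \<le> m" "m \<le> n"
  shows "c l = 0"
  using l(1,2)
proof (induction l rule: less_induct)
  case (less l)
  have "(\<Sum>i=1..n. c i * fps_nth (\<delta> i) l) = (\<Sum>i=1..n. if i = l then c l * fps_nth (\<delta> l) l else 0)"
  proof (rule sum.cong)
    fix i assume i: "i \<in> {1..n}"
    consider "i < l" | "i = l" | "l < i" "i \<le> m" | "m < i" by linarith
    then show "c i * fps_nth (\<delta> i) l = (if i = l then c l * fps_nth (\<delta> l) l else 0)"
    proof cases
      case 1
      then show ?thesis using less i by simp
    next
      case 3
      then have "fps_nth (\<delta> i) l = 0" using ord[of i] i by (simp add: has_order_def)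
      then show ?thesis using 3 by simp
    next
      case 4
      then show ?thesis using rest[OF i, of l] less.prems by simp
    qed simp
  qed simp
  then have "c l * fps_nth (\<delta> l) l = 0"
    using zero[of l] less.prems l(3) by (simp add: lin_comb_nth)
  then show ?case using ord[of l] less.prems by (simp add: has_order_def)
qed

text \<open>Gaussian elimination by order of vanishing, where closure under the operator ensures
  that no order is skipped. N is the largest number such that orders 1, ..., N are attained and the
  remaining elements vanish up to X^N. A nonzero remaining element would be lowered to order exactly
  N + 1 and supply one more pivot.\<close>

lemma echelon_basis:
  assumes V: "derivation_closed (affine_span n \<gamma>)" and \<gamma>0: "\<And>i. i \<in> {1..n} \<Longrightarrow> fps_nth (\<gamma> i) 0 = 0"
  obtains N \<delta> where "N \<le> n" "basis_change n \<gamma> \<delta>" "\<And>i. i \<in> {1..N} \<Longrightarrow> has_order i (\<delta> i)"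
    "\<And>i. i \<in> {1..n} \<Longrightarrow> N < i \<Longrightarrow> \<delta> i = 0"
proof -
  define P where "P m \<longleftrightarrow> m \<le> n \<and> (\<exists>\<delta>. basis_change n \<gamma> \<delta> \<and> (\<forall>i\<in>{1..m}. has_order i (\<delta> i))
      \<and> (\<forall>i\<in>{1..n}. m < i \<longrightarrow> (\<forall>q\<le>m. fps_nth (\<delta> i) q = 0)))" for m
  have P0: "P 0"
    unfolding P_def using \<gamma>0 basis_change_refl[of n \<gamma>] by (intro conjI exI[of _ \<gamma>]) auto
  define N where "N = (GREATEST m. P m)"
  have PN: "P N" unfolding N_def by (rule GreatestI_nat[where P = P and k = 0 and b = n, OF P0]) (simp add: P_def)
  have max: "\<not> P (Suc N)"
  proof
    assume "P (Suc N)"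
    then have "Suc N \<le> N" unfolding N_def by (rule Greatest_le_nat[of P _ n]) (simp add: P_def)
    then show False by simp
  qed
  obtain \<delta> where \<delta>: "N \<le> n" "basis_change n \<gamma> \<delta>" "\<And>i. i \<in> {1..N} \<Longrightarrow> has_order i (\<delta> i)"
    "\<And>i q. i \<in> {1..n} \<Longrightarrow> N < i \<Longrightarrow> q \<le> N \<Longrightarrow> fps_nth (\<delta> i) q = 0"
    using PN unfolding P_def by blast
  have "\<delta> i = 0" if i: "i \<in> {1..n}" "N < i" for i
  proof (rule ccontr)
    assume ne: "\<delta> i \<noteq> 0"
    then obtain q where q: "has_order q (\<delta> i)" by (rule has_order_exists)
    have "\<not> q \<le> N" using \<delta>(4)[OF i, of q] q by (auto simp: has_order_def)
    then have le: "Suc N \<le> q" by simp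
    have mem: "\<delta> i \<in> affine_span n \<gamma>"
    proof -
      have "\<delta> i = fps_const 0 + lin_comb n (\<lambda>j. if j = i then 1 else 0) \<delta>"
        by (simp add: lin_comb_unit[OF i(1)])
      then have "\<delta> i \<in> affine_span n \<delta>" using affine_spanI by metis
      then show ?thesis by (simp only: affine_span_basis_change[OF \<delta>(2)])
    qed
    obtain w where "w \<in> affine_span n \<delta>" and ow: "has_order (Suc N) w"
      using derivation_closed_orders[OF V mem q le] unfolding affine_span_basis_change[OF \<delta>(2)] by blast
    then obtain a c where w: "w = fps_const a + lin_comb n c \<delta>" unfolding affine_span_def by blast
    have \<delta>0: "fps_nth (\<delta> l) 0 = 0" if "l \<in> {1..n}" for l
      using \<delta>(3)[of l] \<delta>(4)[of l 0] that by (cases "l \<le> N") (auto simp: has_order_def)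
    have a: "a = 0"
    proof -
      have "fps_nth (lin_comb n c \<delta>) 0 = 0"
        unfolding lin_comb_nth using \<delta>0 by (intro sum.neutral) auto
      moreover have "fps_nth w 0 = 0" using ow by (simp add: has_order_def)
      ultimately show ?thesis by (simp add: w)
    qed
    have wq: "fps_nth (lin_comb n c \<delta>) q = 0" if "q \<le> N" for q
      using ow that by (simp add: w a has_order_def)
    have c0: "c l = 0" if "1 \<le> l" "l \<le> N" for l
      by (rule triangular_coeffs_zero[OF \<delta>(3,4) wq that \<delta>(1)])
    \<comment> \<open>Only elements beyond index N survive in the expansion of w, so one of them has
      a nonzero coefficient at X^(N+1). It is swapped into position N + 1, and the later ones are
      cleared at that coefficient.\<close>
    have "(\<Sum>l=1..n. c l * fps_nth (\<delta> l) (Suc N)) \<noteq> 0"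
      using ow by (simp add: w a has_order_def lin_comb_nth)
    then obtain l where l: "l \<in> {1..n}" "c l * fps_nth (\<delta> l) (Suc N) \<noteq> 0"
      by (rule sum.not_neutral_contains_not_neutral)
    then have lN: "N < l" using c0[of l] by (cases "l \<le> N") auto
    have SN: "Suc N \<in> {1..n}" using i by simp
    define \<sigma> where "\<sigma> i = (if i = l then Suc N else if i = Suc N then l else i)" for i
    define \<epsilon> where "\<epsilon> i = \<delta> (\<sigma> i)" for i
    have b1: "basis_change n \<delta> \<epsilon>"
      unfolding \<epsilon>_def by (rule basis_change_involution) (use l(1) SN in \<open>auto simp: \<sigma>_def\<close>)
    have e1: "fps_nth (\<epsilon> (Suc N)) (Suc N) \<noteq> 0" using l(2) by (auto simp: \<epsilon>_def \<sigma>_def)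
    have e2: "\<epsilon> i = \<delta> i" if "i \<le> N" for i using that lN by (simp add: \<epsilon>_def \<sigma>_def)
    have e3: "fps_nth (\<epsilon> i) q = 0" if "i \<in> {1..n}" "N < i" "q \<le> N" for i q
      using that \<delta>(4)[of i q] \<delta>(4)[OF l(1) lN, of q] \<delta>(4)[OF SN, of q] by (simp add: \<epsilon>_def \<sigma>_def)
    define m where "m i = (if i \<le> Suc N then 0 else fps_nth (\<epsilon> i) (Suc N) / fps_nth (\<epsilon> (Suc N)) (Suc N))" for i
    define \<zeta> where "\<zeta> i = \<epsilon> i - fps_const (m i) * \<epsilon> (Suc N)" for i
    have b2: "basis_change n \<epsilon> \<zeta>"
      unfolding \<zeta>_def by (rule basis_change_transvection[OF SN]) (simp add: m_def)
    have "has_order i (\<zeta> i)" if "i \<in> {1..Suc N}" for i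
    proof (cases "i = Suc N")
      case True
      then show ?thesis using e1 e3[OF SN] by (simp add: \<zeta>_def m_def has_order_def)
    next
      case False
      then show ?thesis using that \<delta>(3)[of i] e2[of i] by (simp add: \<zeta>_def m_def)
    qed
    moreover have "fps_nth (\<zeta> i) q = 0" if "i \<in> {1..n}" "Suc N < i" "q \<le> Suc N" for i q
    proof (cases "q = Suc N")
      case True
      then show ?thesis using that e1 by (simp add: \<zeta>_def m_def)
    next
      case False
      then show ?thesis using that e3[of i q] e3[OF SN, of q] by (simp add: \<zeta>_def)
    qed
    moreover have "basis_change n \<gamma> \<zeta>"
      using basis_change_trans[OF basis_change_trans[OF \<delta>(2) b1] b2] .
    ultimately have "P (Suc N)" unfolding P_def using SN by auto
    then show False using max by simp
  qed
  with \<delta> show ?thesis by (intro that[of N \<delta>])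
qed

section \<open>Jets up to order N and the adapted basis\<close>

lemma jet_interpolation:
  assumes "\<And>i. i \<in> {1..N} \<Longrightarrow> has_order i (\<delta> i)" "fps_nth f 0 = 0"
  shows "\<exists>c. fps_X ^ Suc N dvd f - lin_comb N c \<delta>"
  using assms(1)
proof (induction N)
  case 0
  have "fps_X ^ Suc 0 dvd f - lin_comb 0 (\<lambda>_. 0) \<delta>"
    unfolding fps_X_power_dvd_iff_nth lin_comb_def using assms(2) by simp
  then show ?case by blast
next
  case (Suc N)
  then obtain c where c: "fps_X ^ Suc N dvd f - lin_comb N c \<delta>" by auto
  let ?r = "f - lin_comb N c \<delta>" and ?d = "\<delta> (Suc N)"
  define c' where "c' = c(Suc N := fps_nth ?r (Suc N) / fps_nth ?d (Suc N))"
  have d: "has_order (Suc N) ?d" using Suc.prems by simp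
  have "lin_comb (Suc N) c' \<delta> = lin_comb N c \<delta> + fps_const (c' (Suc N)) * ?d"
    unfolding lin_comb_def by (simp add: c'_def)
  then have "fps_nth (f - lin_comb (Suc N) c' \<delta>) q
      = fps_nth ?r q - c' (Suc N) * fps_nth ?d q" for q by simp
  moreover have "fps_nth ?r q - c' (Suc N) * fps_nth ?d q = 0" if "q < Suc (Suc N)" for q
  proof (cases "q = Suc N")
    case True
    then show ?thesis using d by (simp add: c'_def has_order_def)
  next
    case False
    then have "q < Suc N" using that by simp
    then show ?thesis using c d unfolding fps_X_power_dvd_iff_nth has_order_def by simp
  qed
  ultimately show ?case unfolding fps_X_power_dvd_iff_nth by metis
qed

lemma lin_comb_diff: "lin_comb n c \<gamma> - lin_comb n d \<gamma> = lin_comb n (\<lambda>i. c i - d i) \<gamma>"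
  unfolding lin_comb_def sum_subtractf[symmetric]
  by (rule sum.cong) (simp_all add: left_diff_distrib flip: fps_const_sub)

lemma lin_comb_zero_upto:
  assumes "\<And>i. i \<in> {1..n} \<Longrightarrow> N < i \<Longrightarrow> \<gamma> i = 0" "N \<le> n"
  shows "lin_comb n c \<gamma> = lin_comb N c \<gamma>"
  unfolding lin_comb_def using assms by (intro sum.mono_neutral_right) auto

text \<open>The inverse matrix is obtained by interpolating the jets of delta by those of epsilon,
  hence only modulo X^(N+1). That is enough: series of orders 1, ..., N are independent already
  modulo X^(N+1), so both matrix products can be compared through jets.\<close>

lemma order_adapted_basis_change:
  assumes N: "N \<le> n"
    and \<delta>: "\<And>i. i \<in> {1..N} \<Longrightarrow> has_order i (\<delta> i)" "\<And>i. i \<in> {1..n} \<Longrightarrow> N < i \<Longrightarrow> \<delta> i = 0"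
    and \<epsilon>: "\<And>i. i \<in> {1..N} \<Longrightarrow> has_order i (\<epsilon> i)" "\<And>i. i \<in> {1..n} \<Longrightarrow> N < i \<Longrightarrow> \<epsilon> i = 0"
    and b: "\<And>i. i \<in> {1..N} \<Longrightarrow> \<epsilon> i = lin_comb N (\<lambda>j. b j i) \<delta>"
  shows "basis_change n \<delta> \<epsilon>"
proof -
  have indep: "c i = d i"
    if ord: "\<And>i. i \<in> {1..N} \<Longrightarrow> has_order i (\<alpha> i)" and z: "fps_X ^ Suc N dvd lin_comb N c \<alpha> - lin_comb N d \<alpha>"
      and i: "i \<in> {1..N}" for \<alpha> c d i
  proof -
    have "c i - d i = 0"
    proof (rule triangular_coeffs_zero[of N \<alpha> N "\<lambda>i. c i - d i"])
      show "fps_nth (lin_comb N (\<lambda>i. c i - d i) \<alpha>) q = 0" if "q \<le> N" for q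
        using z that unfolding lin_comb_diff fps_X_power_dvd_iff_nth by simp
    qed (use ord i in auto)
    then show ?thesis by simp
  qed
  have "\<exists>c. fps_X ^ Suc N dvd \<delta> i - lin_comb N c \<epsilon>" if "i \<in> {1..N}" for i
    using \<delta>(1)[OF that] that by (intro jet_interpolation[OF \<epsilon>(1)]) (auto simp: has_order_def)
  then have "\<forall>i\<in>{1..N}. \<exists>c. fps_X ^ Suc N dvd \<delta> i - lin_comb N c \<epsilon>" by blast
  from bchoice[OF this] obtain c0 where c0: "\<forall>i\<in>{1..N}. fps_X ^ Suc N dvd \<delta> i - lin_comb N (c0 i) \<epsilon>" ..
  define c where "c j i = c0 i j" for j i
  have c: "fps_X ^ Suc N dvd \<delta> i - lin_comb N (\<lambda>j. c j i) \<epsilon>" if "i \<in> {1..N}" for i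
    using c0 that by (simp add: c_def)
  have prod: "(\<Sum>l=1..N. b j l * c l i) = (if j = i then 1 else 0)" if "i \<in> {1..N}" "j \<in> {1..N}" for i j
  proof (rule indep[OF \<delta>(1) _ that(2)])
    have "lin_comb N (\<lambda>j. c j i) \<epsilon> = lin_comb N (\<lambda>j. c j i) (\<lambda>l. lin_comb N (\<lambda>j. b j l) \<delta>)"
      by (rule lin_comb_cong) (rule b)
    then have "lin_comb N (\<lambda>j. c j i) \<epsilon> = lin_comb N (\<lambda>j. \<Sum>l=1..N. b j l * c l i) \<delta>"
      unfolding lin_comb_lin_comb .
    then show "fps_X ^ Suc N dvd lin_comb N (\<lambda>j. \<Sum>l=1..N. b j l * c l i) \<delta>
        - lin_comb N (\<lambda>j. if j = i then 1 else 0) \<delta>"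
      using c[OF that(1)] unfolding lin_comb_unit[OF that(1)] by (simp only: dvd_diff_commute)
  qed
  have prod': "(\<Sum>l=1..N. c j l * b l i) = (if j = i then 1 else 0)" if "i \<in> {1..N}" "j \<in> {1..N}" for i j
  proof (rule indep[OF \<epsilon>(1) _ that(2)])
    have "fps_X ^ Suc N dvd lin_comb N (\<lambda>j. b j i) \<delta> - lin_comb N (\<lambda>j. b j i) (\<lambda>l. lin_comb N (\<lambda>j. c j l) \<epsilon>)"
      unfolding lin_comb_def[of N "\<lambda>j. b j i"] sum_subtractf[symmetric] right_diff_distrib[symmetric]
      by (rule dvd_sum) (use c in auto)
    then show "fps_X ^ Suc N dvd lin_comb N (\<lambda>j. \<Sum>l=1..N. c j l * b l i) \<epsilon>
        - lin_comb N (\<lambda>j. if j = i then 1 else 0) \<epsilon>"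
      unfolding lin_comb_lin_comb lin_comb_unit[OF that(1)] b[OF that(1), symmetric]
      by (simp only: dvd_diff_commute)
  qed
  \<comment> \<open>Beyond index N both families are zero, so the N by N matrices may be completed
    by an identity block.\<close>
  define ext where "ext M = (\<lambda>j i. if i \<in> {1..N} then (if j \<in> {1..N} then M j i else 0) else if j = i then 1 else 0 :: real)"
    for M :: "nat \<Rightarrow> nat \<Rightarrow> real"
  have ext: "mat_prod n (ext M) (ext M') j i = (if j = i then 1 else 0)"
    if M: "\<And>i j. i \<in> {1..N} \<Longrightarrow> j \<in> {1..N} \<Longrightarrow> (\<Sum>l=1..N. M j l * M' l i) = (if j = i then 1 else 0)"
      and ij: "i \<in> {1..n}" "j \<in> {1..n}" for M M' i j
  proof (cases "i \<in> {1..N}")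
    case True
    have "mat_prod n (ext M) (ext M') j i = (\<Sum>l=1..N. ext M j l * M' l i)"
      unfolding mat_prod_def ext_def using True N by (intro sum.mono_neutral_cong_right) auto
    also have "\<dots> = (if j = i then 1 else 0)"
    proof (cases "j \<in> {1..N}")
      case j: True
      have "(\<Sum>l=1..N. ext M j l * M' l i) = (\<Sum>l=1..N. M j l * M' l i)"
        by (rule sum.cong) (use j in \<open>auto simp: ext_def\<close>)
      then show ?thesis using M[OF True j] by simp
    next
      case j: False
      then have "j \<noteq> i" using True by blast
      moreover have "(\<Sum>l=1..N. ext M j l * M' l i) = 0"
        using j by (intro sum.neutral) (auto simp: ext_def)
      ultimately show ?thesis by simp
    qed
    finally show ?thesis .
  next
    case False
    have "mat_prod n (ext M) (ext M') j i = (\<Sum>l=1..n. if l = i then ext M j i else 0)"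
      unfolding mat_prod_def using False by (intro sum.cong refl) (auto simp: ext_def)
    then show ?thesis using ij False by (auto simp: ext_def)
  qed
  have "mat_inverse n (ext b) (ext c)"
    unfolding mat_inverse_def using ext[of b c, OF prod] ext[of c b, OF prod'] by blast
  moreover have "\<epsilon> i = lin_comb n (\<lambda>j. ext b j i) \<delta>" if i: "i \<in> {1..n}" for i
  proof (cases "i \<in> {1..N}")
    case True
    have "lin_comb n (\<lambda>j. ext b j i) \<delta> = lin_comb N (\<lambda>j. ext b j i) \<delta>"
      by (rule lin_comb_zero_upto[OF \<delta>(2) N])
    also have "\<dots> = lin_comb N (\<lambda>j. b j i) \<delta>"
      by (rule lin_comb_cong_coeffs) (use True in \<open>auto simp: ext_def\<close>)
    finally show ?thesis using b[OF True] by simp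
  next
    case False
    then have "lin_comb n (\<lambda>j. ext b j i) \<delta> = \<delta> i"
      using lin_comb_unit[OF i] by (simp only: ext_def if_False)
    then show ?thesis using False i \<delta>(2)[of i] \<epsilon>(2)[of i] by simp
  qed
  ultimately show ?thesis unfolding basis_change_def by blast
qed

lemma power_has_order:
  assumes "has_order 1 t"
  shows "has_order i (fps_const (1 / fact i) * t ^ i)"
proof -
  have "fps_nth t 0 = 0" "fps_nth t 1 \<noteq> 0" using assms by (auto simp: has_order_def)
  then show ?thesis
    using startsby_zero_power_prefix[of t] startsby_zero_power_nth_same[of t i]
    by (simp add: has_order_def)
qed

lemma has_order_cong:
  assumes "has_order i f" "fps_X ^ Suc N dvd g - f" "i \<le> N"
  shows "has_order i g"
  using assms unfolding fps_X_power_dvd_iff_nth has_order_def by simp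

text \<open>
  The target of the first basis element is a square root of \<open>2 \<eta>\<close>; the other targets are its
  divided powers. Since the space realises every jet of order \<open>N\<close>, all targets are attained.
\<close>

lemma adapted_basis:
  assumes V: "derivation_closed (affine_span n \<gamma>)" and \<gamma>0: "\<And>i. i \<in> {1..n} \<Longrightarrow> fps_nth (\<gamma> i) 0 = 0"
    and k: "k \<in> {1..n}" "\<gamma> k \<noteq> 0"
    and \<eta>: "fps_nth \<eta> 0 = 0" "fps_nth \<eta> 1 = 0" "fps_nth \<eta> 2 = a / 2" "0 < a"
  obtains N B C \<pi> where "1 \<le> N" "N \<le> n" "mat_inverse n B C"
    "\<And>i. i \<in> {1..n} \<Longrightarrow> \<pi> i = lin_comb n (\<lambda>j. B j i) \<gamma>"
    "\<And>i. i \<in> {1..n} \<Longrightarrow> N < i \<Longrightarrow> \<pi> i = 0"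
    "\<And>i. i \<in> {1..N} \<Longrightarrow> fps_X ^ Suc N dvd \<pi> i - fps_const (1 / fact i) * \<pi> 1 ^ i"
    "fps_X ^ Suc (Suc N) dvd \<eta> - fps_const (1/2) * \<pi> 1 ^ 2"
    "fps_nth (\<pi> 1) 0 = 0" "fps_nth (\<pi> 1) 1 = sqrt a"
proof -
  obtain N \<delta> where N: "N \<le> n" and bc: "basis_change n \<gamma> \<delta>" and \<delta>: "\<And>i. i \<in> {1..N} \<Longrightarrow> has_order i (\<delta> i)"
    "\<And>i. i \<in> {1..n} \<Longrightarrow> N < i \<Longrightarrow> \<delta> i = 0"
    using echelon_basis[where \<gamma> = \<gamma> and n = n, OF V \<gamma>0] by blast
  have N1: "1 \<le> N"
  proof (rule ccontr)
    assume "\<not> 1 \<le> N"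
    then have z: "\<delta> i = 0" if "i \<in> {1..n}" for i using \<delta>(2)[OF that] that by simp
    obtain B where "\<gamma> k = lin_comb n (\<lambda>j. B j k) \<delta>"
      using basis_change_sym[OF bc] k(1) unfolding basis_change_def by blast
    then have "\<gamma> k = 0" using z by (simp add: lin_comb_def)
    then show False using k(2) by simp
  qed
  \<comment> \<open>As eta starts with a X^2 / 2 and a > 0, the series u = 2 eta / X^2 has a square
    root s; then t = X s is an exact square root of 2 eta with linear coefficient sqrt a.\<close>
  define u where "u = fps_const 2 * fps_shift 2 \<eta>"
  have u0: "fps_nth u 0 = a" using \<eta>(3) by (simp add: u_def numeral_2_eq_2)
  have \<eta>u: "fps_const 2 * \<eta> = fps_X ^ 2 * u"
  proof -
    have "\<eta> = fps_X ^ 2 * fps_shift 2 \<eta>"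
    proof (rule fps_ext)
      fix q :: nat
      consider "q = 0" | "q = 1" | "2 \<le> q" by arith
      then show "fps_nth \<eta> q = fps_nth (fps_X ^ 2 * fps_shift 2 \<eta>) q"
      proof cases
        case 3
        then have "q - 2 + 2 = q" by simp
        then show ?thesis using 3 by (simp only: fps_X_power_mult_nth fps_shift_nth) simp
      qed (use \<eta> in \<open>simp_all add: fps_X_power_mult_nth\<close>)
    qed
    then show ?thesis unfolding u_def by (metis mult.left_commute)
  qed
  define s where "s = fps_radical (\<lambda>_. sqrt) 2 u"
  have s2: "s ^ 2 = u"
    using power_radical[of u "\<lambda>_. sqrt" 1] u0 \<eta>(4) by (simp add: s_def numeral_2_eq_2 One_nat_def)
  have s0: "fps_nth s 0 = sqrt a" using u0 by (simp add: s_def)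
  define t where "t = fps_X * s"
  have t0: "fps_nth t 0 = 0" and t1: "fps_nth t 1 = sqrt a" using s0 by (simp_all add: t_def)
  have t2: "t ^ 2 = fps_const 2 * \<eta>" by (simp add: t_def power_mult_distrib s2 \<eta>u)
  have ot: "has_order 1 t" using t0 t1 \<eta>(4) by (simp add: has_order_def)
  define T where "T i = fps_const (1 / fact i) * t ^ i" for i
  have oT: "has_order i (T i)" for i unfolding T_def by (rule power_has_order[OF ot])
  have "\<exists>c. fps_X ^ Suc N dvd T i - lin_comb N c \<delta>" if "i \<in> {1..N}" for i
    using oT[of i] that by (intro jet_interpolation[OF \<delta>(1)]) (auto simp: has_order_def)
  then have "\<forall>i\<in>{1..N}. \<exists>c. fps_X ^ Suc N dvd T i - lin_comb N c \<delta>" by blast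
  from bchoice[OF this] obtain c0 where c0: "\<forall>i\<in>{1..N}. fps_X ^ Suc N dvd T i - lin_comb N (c0 i) \<delta>" ..
  define b where "b j i = c0 i j" for j i
  have b: "fps_X ^ Suc N dvd T i - lin_comb N (\<lambda>j. b j i) \<delta>" if "i \<in> {1..N}" for i
    using c0 that by (simp add: b_def)
  \<comment> \<open>The span contains the divided powers of t only up to order N. From here on
    \<open>\<pi> 1\<close> takes the place of t.\<close>
  define \<pi> where "\<pi> i = (if i \<in> {1..N} then lin_comb N (\<lambda>j. b j i) \<delta> else 0)" for i
  have \<pi>T: "fps_X ^ Suc N dvd \<pi> i - T i" if "i \<in> {1..N}" for i
    using b[OF that] that by (simp only: \<pi>_def if_True dvd_diff_commute)
  have \<pi>0: "\<pi> i = 0" if "i \<in> {1..n}" "N < i" for i using that by (simp add: \<pi>_def)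
  have "basis_change n \<delta> \<pi>"
  proof (rule order_adapted_basis_change[OF N \<delta> _ \<pi>0])
    show "has_order i (\<pi> i)" if "i \<in> {1..N}" for i
      using has_order_cong[OF oT \<pi>T[OF that]] that by simp
    show "\<pi> i = lin_comb N (\<lambda>j. b j i) \<delta>" if "i \<in> {1..N}" for i using that by (simp add: \<pi>_def)
  qed
  from basis_change_trans[OF bc this] obtain B C where B: "mat_inverse n B C"
    "\<And>i. i \<in> {1..n} \<Longrightarrow> \<pi> i = lin_comb n (\<lambda>j. B j i) \<gamma>"
    unfolding basis_change_def by blast
  have one: "1 \<in> {1..N}" using N1 by simp
  have T1: "T 1 = t" by (simp add: T_def)
  have p1: "fps_X ^ Suc N dvd \<pi> 1 - t" using \<pi>T[OF one] by (simp add: T1)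
  have \<pi>1: "fps_nth (\<pi> 1) 0 = 0" "fps_nth (\<pi> 1) 1 = sqrt a"
    using p1 t0 t1 N1 unfolding fps_X_power_dvd_iff_nth by (auto dest: spec[of _ 0] spec[of _ 1])
  have powers: "fps_X ^ Suc N dvd \<pi> i - fps_const (1 / fact i) * \<pi> 1 ^ i" if "i \<in> {1..N}" for i
  proof -
    have "fps_X ^ Suc N dvd fps_const (1 / fact i) * (\<pi> 1 ^ i - t ^ i)"
      using dvd_trans[OF p1 diff_dvd_power_diff] by (rule dvd_mult)
    from dvd_diff[OF \<pi>T[OF that] this] show ?thesis
      by (simp add: T_def algebra_simps)
  qed
  \<comment> \<open>One order is gained over the other relations: \<open>\<pi> 1 - t\<close> is
    divisible by X^(N+1) and \<open>\<pi> 1 + t\<close> by X, so the squares agree modulo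
    X^(N+2).\<close>
  have square: "fps_X ^ Suc (Suc N) dvd \<eta> - fps_const (1/2) * \<pi> 1 ^ 2"
  proof -
    have "fps_X ^ 1 dvd \<pi> 1 + t" unfolding fps_X_power_dvd_iff_nth using \<pi>1(1) t0 by simp
    with p1 have "fps_X ^ Suc N * fps_X ^ 1 dvd (\<pi> 1 - t) * (\<pi> 1 + t)" by (rule mult_dvd_mono)
    then have "fps_X ^ Suc (Suc N) dvd fps_const (- 1/2) * ((\<pi> 1 - t) * (\<pi> 1 + t))"
      by (intro dvd_mult[of _ "(\<pi> 1 - t) * (\<pi> 1 + t)"]) (simp add: mult.commute)
    moreover have "fps_const (- 1/2) * ((\<pi> 1 - t) * (\<pi> 1 + t)) = \<eta> - fps_const (1/2) * \<pi> 1 ^ 2"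
    proof -
      have "(\<pi> 1 - t) * (\<pi> 1 + t) = \<pi> 1 ^ 2 - fps_const 2 * \<eta>"
        unfolding t2[symmetric] by (simp add: power2_eq_square algebra_simps)
      then show ?thesis by (simp add: right_diff_distrib mult.assoc[symmetric])
          (simp add: fps_eq_iff)
    qed
    ultimately show ?thesis by simp
  qed
  show ?thesis by (rule that[OF N1 N B \<pi>0 powers square \<pi>1])
qed

subsection \<open>The polynomials in the normal form\<close>

text \<open>This is psi without its constant term \<open>x 1\<close>; each power of X in it carries
  the variable whose index is larger by one.\<close>

definition tail_series :: "nat \<Rightarrow> point \<Rightarrow> real fps" where
  "tail_series N x = (\<Sum>i=2..N. fps_const (x i / fact (i - 1)) * fps_X ^ (i - 1))"

text \<open>These are the terms with at least three tail factors in the binomial expansion of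
  psi^(m+1), read at X^(m-1) and divided by (m + 1) m as in the Lagrange formula.\<close>

definition remainder_poly :: "nat \<Rightarrow> nat \<Rightarrow> point \<Rightarrow> real" where
  "remainder_poly N m x = (\<Sum>k=3..m + 1. real (m + 1 choose k) / (real (m + 1) * real m) *
     (x 1 ^ (m + 1 - k) * fps_nth (tail_series N x ^ k) (m - 1)))"

lemma tail_series_nth:
  "fps_nth (tail_series N x) w = (if 1 \<le> w \<and> w + 1 \<le> N then x (w + 1) / fact w else 0)"
proof -
  have "fps_nth (tail_series N x) w = (\<Sum>i=2..N. if i = w + 1 then x (w + 1) / fact w else 0)"
    unfolding tail_series_def fps_sum_nth fps_mult_left_const_nth fps_X_power_nth
    by (rule sum.cong) auto
  also have "\<dots> = (if w + 1 \<in> {2..N} then x (w + 1) / fact w else 0)"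
    by simp
  finally show ?thesis by simp
qed

definition tail_indices :: "nat \<Rightarrow> nat \<Rightarrow> (nat \<Rightarrow> nat) set" where
  "tail_indices K k = {\<beta> \<in> degree_indices K k. \<beta> 1 = 0}"

lemma tail_indices_finite [simp]: "finite (tail_indices K k)"
  by (simp add: tail_indices_def)

lemma tail_indices_subset: "tail_indices K k \<subseteq> multi_indices K"
  by (auto simp: tail_indices_def degree_indices_def)

text \<open>A weight count bounds the variables that occur: a factor X^j carries x_(j+1), and the
  other k - 1 factors use up at least X^(k-1), so j + 1 <= w - k + 2 <= K.\<close>

lemma tail_series_power_supported:
  assumes "1 \<le> k" "w + 2 \<le> K + k"
  shows "\<exists>C. poly_supported K (tail_indices K k) C (\<lambda>x. fps_nth (tail_series N x ^ k) w)"
  using assms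
proof (induction k arbitrary: w rule: nat_induct_at_least)
  case base
  show ?case
  proof (cases "1 \<le> w \<and> w + 1 \<le> N")
    case True
    have "unit_index (w + 1) \<in> tail_indices K 1"
      using True base by (auto simp: tail_indices_def degree_indices_def deg_unit_index unit_index_in_multi_indices)
        (simp add: unit_index_def)
    then have "poly_supported K (tail_indices K 1) (\<bar>1 / fact w\<bar> * 1) (\<lambda>x. 1 / fact w * x (w + 1))"
      by (intro poly_supported_cmult poly_supported_coordinate tail_indices_finite tail_indices_subset)
        (use base in auto)
    then show ?thesis using True by (auto simp: tail_series_nth)
  next
    case False
    then have "(\<lambda>x. fps_nth (tail_series N x ^ 1) w) = (\<lambda>x. 0)" by (auto simp: tail_series_nth)
    then show ?thesis
      using poly_supported_0[OF tail_indices_finite tail_indices_subset, of 0 K 1] by auto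
  qed
next
  case (Suc k)
  have zero: "fps_nth (tail_series N x ^ k) q = 0" if "q < k" for q x
    by (rule startsby_zero_power_prefix[rule_format]) (use that in \<open>simp_all add: tail_series_nth\<close>)
  have "\<exists>C. poly_supported K (tail_indices K (Suc k)) C
      (\<lambda>x. fps_nth (tail_series N x) j * fps_nth (tail_series N x ^ k) (w - j))" if j: "j \<in> {0..w}" for j
  proof (cases "1 \<le> j \<and> k \<le> w - j")
    case True
    have "w - j + 2 \<le> K + k" using Suc.prems Suc.hyps True by arith
    from Suc.IH[OF this]
    obtain C where C: "poly_supported K (tail_indices K k) C (\<lambda>x. fps_nth (tail_series N x ^ k) (w - j))" ..
    show ?thesis
    proof (cases "j + 1 \<le> N")
      case jN: True
      have "j + 1 \<le> K" using True Suc.prems Suc.hyps by arith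
      then have jK: "j + 1 \<in> {1..K}" by simp
      then have "unit_index (j + 1) \<in> tail_indices K 1"
        using True by (auto simp: tail_indices_def degree_indices_def deg_unit_index unit_index_in_multi_indices)
          (simp add: unit_index_def)
      then have D: "poly_supported K (tail_indices K 1) (\<bar>1 / fact j\<bar> * 1) (\<lambda>x. 1 / fact j * x (j + 1))"
        by (intro poly_supported_cmult poly_supported_coordinate tail_indices_finite tail_indices_subset jK)
      have "poly_supported K (tail_indices K (Suc k)) (\<bar>1 / fact j\<bar> * 1 * C)
          (\<lambda>x. 1 / fact j * x (j + 1) * fps_nth (tail_series N x ^ k) (w - j))"
      proof (rule poly_supported_mult[OF D C tail_indices_finite tail_indices_subset])
        fix \<alpha> \<beta> assume "\<alpha> \<in> tail_indices K 1" "\<beta> \<in> tail_indices K k"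
        then show "(\<lambda>i. \<alpha> i + \<beta> i) \<in> tail_indices K (Suc k)"
          by (simp add: tail_indices_def degree_indices_def deg_add multi_indices_add)
      qed
      moreover have "fps_nth (tail_series N x) j = 1 / fact j * x (j + 1)" for x
        using True jN by (simp add: tail_series_nth)
      ultimately show ?thesis by (auto simp only:)
    next
      case False
      then have "(\<lambda>x. fps_nth (tail_series N x) j * fps_nth (tail_series N x ^ k) (w - j)) = (\<lambda>x. 0)"
        by (auto simp: tail_series_nth)
      then show ?thesis
        using poly_supported_0[OF tail_indices_finite tail_indices_subset, of 0 K "Suc k"] by auto
    qed
  next
    case False
    then have "(\<lambda>x. fps_nth (tail_series N x) j * fps_nth (tail_series N x ^ k) (w - j)) = (\<lambda>x. 0)"
      using zero[of "w - j"] by (auto simp: tail_series_nth not_le)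
    then show ?thesis
      using poly_supported_0[OF tail_indices_finite tail_indices_subset, of 0 K "Suc k"] by auto
  qed
  then have "\<forall>j\<in>{0..w}. \<exists>C. poly_supported K (tail_indices K (Suc k)) C
      (\<lambda>x. fps_nth (tail_series N x) j * fps_nth (tail_series N x ^ k) (w - j))" by blast
  from bchoice[OF this] obtain C where C: "\<forall>j\<in>{0..w}. poly_supported K (tail_indices K (Suc k)) (C j)
      (\<lambda>x. fps_nth (tail_series N x) j * fps_nth (tail_series N x ^ k) (w - j))" ..
  have "poly_supported K (tail_indices K (Suc k)) (\<Sum>j\<in>{0..w}. C j)
      (\<lambda>x. \<Sum>j\<in>{0..w}. fps_nth (tail_series N x) j * fps_nth (tail_series N x ^ k) (w - j))"
    by (rule poly_supported_sum) (use C tail_indices_subset in auto)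
  then show ?case by (auto simp: fps_mult_nth)
qed

lemma homogeneous_poly_ord_if_supported:
  assumes "poly_supported k S C P" "S \<subseteq> {\<alpha> \<in> multi_indices k. deg k \<alpha> = d \<and> e \<le> multi_degree I \<alpha>}"
  shows "homogeneous_poly_ord k d I e P"
proof -
  let ?S = "{\<alpha>. \<alpha> \<in> multi_indices k \<and> deg k \<alpha> = d \<and> e \<le> multi_degree I \<alpha>}"
  have "finite ?S"
    by (rule finite_subset[OF _ finite_degree_indices[of k d]]) (auto simp: degree_indices_def)
  then have "poly_supported k ?S C P"
    by (intro poly_supported_mono[OF assms(1)]) (use assms(2) in auto)
  then show ?thesis unfolding poly_supported_def homogeneous_poly_ord_def by blast
qed

text \<open>The term with k tail factors has degree k in the variables other than \<open>x 1\<close>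
  and is completed by \<open>x 1 ^ (m + 1 - k)\<close>. The order 3 is the lower limit of k, and the
  weight count excludes x_m and all later variables.\<close>

lemma remainder_poly_homogeneous:
  assumes "3 \<le> m"
  shows "homogeneous_poly_ord (m - 1) (m + 1) {2..m - 1} 3 (remainder_poly N m)"
proof -
  let ?K = "m - 1"
  let ?S = "{\<alpha> \<in> multi_indices ?K. deg ?K \<alpha> = m + 1 \<and> 3 \<le> multi_degree {2..m - 1} \<alpha>}"
  have finS: "finite ?S"
    by (rule finite_subset[OF _ finite_degree_indices[of ?K "m + 1"]]) (auto simp: degree_indices_def)
  have one: "1 \<in> {1..?K}" using assms by simp
  have "\<exists>C. poly_supported ?K ?S C (\<lambda>x. real (m + 1 choose k) / (real (m + 1) * real m) *
     (x 1 ^ (m + 1 - k) * fps_nth (tail_series N x ^ k) (m - 1)))" if k: "k \<in> {3..m + 1}" for k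
  proof -
    have "1 \<le> k" "m - 1 + 2 \<le> ?K + k" using k by simp_all arith
    from tail_series_power_supported[OF this]
    obtain C where C: "poly_supported ?K (tail_indices ?K k) C (\<lambda>x. fps_nth (tail_series N x ^ k) (m - 1))" ..
    have head: "poly_supported ?K {\<lambda>j. if j = 1 then m + 1 - k else 0} 1 (\<lambda>x. x 1 ^ (m + 1 - k))"
    proof -
      have "monomial_at ?K (\<lambda>j. if j = 1 then m + 1 - k else 0) x = x 1 ^ (m + 1 - k)" for x
      proof -
        have "monomial_at ?K (\<lambda>j. if j = 1 then m + 1 - k else 0) x
            = (\<Prod>j\<in>{1..?K}. if j = 1 then x 1 ^ (m + 1 - k) else 1)"
          unfolding monomial_at_def by (rule prod.cong) auto
        then show ?thesis using one by simp
      qed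
      then show ?thesis
        unfolding poly_supported_def using one
        by (intro conjI exI[of _ "\<lambda>_. 1"]) (auto simp: multi_indices_def)
    qed
    have "poly_supported ?K ?S (1 * C) (\<lambda>x. x 1 ^ (m + 1 - k) * fps_nth (tail_series N x ^ k) (m - 1))"
    proof (rule poly_supported_mult[OF head C finS])
      show "?S \<subseteq> multi_indices ?K" by blast
      fix \<alpha> \<beta> :: "nat \<Rightarrow> nat"
      assume \<alpha>: "\<alpha> \<in> {\<lambda>j. if j = 1 then m + 1 - k else 0}" and "\<beta> \<in> tail_indices ?K k"
      then have \<beta>: "\<beta> \<in> multi_indices ?K" "deg ?K \<beta> = k" "\<beta> 1 = 0"
        by (auto simp: tail_indices_def degree_indices_def)
      have split: "{1..?K} = insert 1 {2..?K}" using assms by auto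
      have "multi_degree {2..?K} \<beta> = k"
        using \<beta>(2,3) unfolding multi_degree_def split by simp
      moreover have "multi_degree {2..?K} (\<lambda>i. \<alpha> i + \<beta> i) = multi_degree {2..?K} \<beta>"
        unfolding multi_degree_def by (rule sum.cong) (use \<alpha> in auto)
      moreover have "deg ?K \<alpha> = m + 1 - k"
        using \<alpha> unfolding multi_degree_def split by simp
      moreover have "\<alpha> \<in> multi_indices ?K" using \<alpha> one by (auto simp: multi_indices_def)
      ultimately show "(\<lambda>i. \<alpha> i + \<beta> i) \<in> ?S"
        using \<beta> k by (simp add: deg_add multi_indices_add)
    qed
    then show ?thesis using poly_supported_cmult by blast
  qed
  then have "\<forall>k\<in>{3..m + 1}. \<exists>C. poly_supported ?K ?S C (\<lambda>x. real (m + 1 choose k) / (real (m + 1) * real m) *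
     (x 1 ^ (m + 1 - k) * fps_nth (tail_series N x ^ k) (m - 1)))" by blast
  from bchoice[OF this] obtain C where C: "\<forall>k\<in>{3..m + 1}. poly_supported ?K ?S (C k)
     (\<lambda>x. real (m + 1 choose k) / (real (m + 1) * real m) *
     (x 1 ^ (m + 1 - k) * fps_nth (tail_series N x ^ k) (m - 1)))" ..
  have "poly_supported ?K ?S (\<Sum>k\<in>{3..m + 1}. C k) (remainder_poly N m)"
    unfolding remainder_poly_def by (rule poly_supported_sum) (use C finS in auto)
  then show ?thesis by (rule homogeneous_poly_ord_if_supported) auto
qed

lemma ray_polynomial_expansion:
  fixes x :: point
  assumes "1 \<le> N"
  defines "\<psi> \<equiv> (\<Sum>i=1..N. fps_const (x i / fact (i - 1)) * fps_X ^ (i - 1) :: real fps)"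
  shows "fps_nth (\<psi> ^ d) w = (\<Sum>k\<le>d. real (d choose k) * (x 1 ^ (d - k) * fps_nth (tail_series N x ^ k) w))"
proof -
  have split: "{1..N} = insert 1 {2..N}" using assms(1) by auto
  have "\<psi> = tail_series N x + fps_const (x 1)"
    unfolding \<psi>_def split tail_series_def by simp
  then have "\<psi> ^ d = (\<Sum>k\<le>d. of_nat (d choose k) * tail_series N x ^ k * fps_const (x 1) ^ (d - k))"
    by (simp add: binomial_ring)
  also have "\<dots> = (\<Sum>k\<le>d. fps_const (real (d choose k) * x 1 ^ (d - k)) * tail_series N x ^ k)"
  proof (rule sum.cong)
    show "of_nat (d choose k) * tail_series N x ^ k * fps_const (x 1) ^ (d - k)
        = fps_const (real (d choose k) * x 1 ^ (d - k)) * tail_series N x ^ k" for k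
      unfolding fps_const_power fps_of_nat[symmetric] fps_const_mult[symmetric] by (simp only: mult_ac)
  qed simp
  finally show ?thesis by (simp add: fps_sum_nth mult.assoc)
qed

lemma tail_series_square_nth:
  assumes "m \<le> N" "2 \<le> m"
  shows "fps_nth (tail_series N x ^ 2) (m - 1)
    = (\<Sum>(i, j)\<in>{(i, j). i \<ge> 2 \<and> j \<ge> 2 \<and> i + j = m + 1}. x i * x j / (fact (i - 1) * fact (j - 1)))"
proof -
  let ?f = "\<lambda>i. fps_nth (tail_series N x) i * fps_nth (tail_series N x) (m - 1 - i)"
  have "fps_nth (tail_series N x ^ 2) (m - 1) = (\<Sum>i=0..m - 1. ?f i)"
    by (simp add: power2_eq_square fps_mult_nth)
  also have "\<dots> = (\<Sum>i\<in>{1..<m - 1}. ?f i)"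
    by (rule sum.mono_neutral_right) (auto simp: tail_series_nth)
  also have "\<dots> = (\<Sum>(i, j)\<in>{(i, j). i \<ge> 2 \<and> j \<ge> 2 \<and> i + j = m + 1}. x i * x j / (fact (i - 1) * fact (j - 1)))"
  proof (rule sum.reindex_bij_witness[where i = "\<lambda>p. fst p - 1" and j = "\<lambda>i. (i + 1, m - i)"])
    fix i assume i: "i \<in> {1..<m - 1}"
    have 1: "m - i - 1 = m - 1 - i" "m - 1 - i + 1 = m - i" using i by auto
    have 2: "1 \<le> m - 1 - i" "m - i \<le> N" "1 \<le> i" "i + 1 \<le> N" using i assms by auto
    have "fps_nth (tail_series N x) i = x (i + 1) / fact i"
      "fps_nth (tail_series N x) (m - 1 - i) = x (m - i) / fact (m - 1 - i)"
      unfolding tail_series_nth 1(2) using 2 by simp_all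
    then show "(case (i + 1, m - i) of (i, j) \<Rightarrow> x i * x j / (fact (i - 1) * fact (j - 1))) = ?f i"
      by (simp add: 1(1) del: diff_diff_left)
  qed auto
  finally show ?thesis .
qed

text \<open>In the binomial expansion the term k = 0 is constant in X and does not reach X^(m-1); k
  = 1 gives x_1^m x_m / m!, k = 2 the sum over pairs, and k >= 3 the remainder.\<close>

lemma ray_polynomial_normal_form:
  fixes x :: point
  assumes "3 \<le> m" "m \<le> N"
  defines "\<psi> \<equiv> (\<Sum>i=1..N. fps_const (x i / fact (i - 1)) * fps_X ^ (i - 1) :: real fps)"
  shows "fps_nth (\<psi> ^ (m + 1)) (m - 1) / (real (m + 1) * real m)
    = x 1 ^ m * x m / fact m
      + x 1 ^ (m - 1) * (\<Sum>(i, j)\<in>{(i, j). i \<ge> 2 \<and> j \<ge> 2 \<and> i + j = m + 1}.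
          1 / 2 * (x i * x j / (fact (i - 1) * fact (j - 1))))
      + remainder_poly N m x"
proof -
  let ?M = "real (m + 1) * real m"
  let ?t = "\<lambda>k. real (m + 1 choose k) * (x 1 ^ (m + 1 - k) * fps_nth (tail_series N x ^ k) (m - 1))"
  have M: "?M \<noteq> 0" using assms(1) by simp
  have split: "{..m + 1} = insert 0 (insert 1 (insert 2 {3..m + 1}))" using assms(1) by auto
  have "fps_nth (\<psi> ^ (m + 1)) (m - 1) = ?t 0 + (?t 1 + (?t 2 + (\<Sum>k=3..m + 1. ?t k)))"
    unfolding \<psi>_def using ray_polynomial_expansion[of N x "m + 1" "m - 1"] assms(1,2)
    unfolding split by simp
  moreover have "?t 0 = 0" using assms(1) by simp
  moreover have "?t 1 / ?M = x 1 ^ m * x m / fact m"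
  proof -
    obtain l where l: "m = Suc l" using assms(1) by (cases m) auto
    have "fps_nth (tail_series N x ^ 1) (m - 1) = x m / fact (m - 1)"
      using assms(1,2) by (simp add: tail_series_nth)
    then have "?t 1 = real (m + 1) * (x 1 ^ m * (x m / fact (m - 1)))" by (simp add: One_nat_def)
    then show ?thesis using l by (simp add: field_simps del: of_nat_Suc)
  qed
  moreover have "?t 2 / ?M = x 1 ^ (m - 1) * (\<Sum>(i, j)\<in>{(i, j). i \<ge> 2 \<and> j \<ge> 2 \<and> i + j = m + 1}.
          1 / 2 * (x i * x j / (fact (i - 1) * fact (j - 1))))"
  proof -
    have "real (m + 1 choose 2) = ?M / 2"
    proof -
      have "even ((m + 1) * m)" by simp
      then have "real ((m + 1) * m div 2) = real ((m + 1) * m) / 2"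
        using real_of_nat_div[of 2 "(m + 1) * m"] by simp
      then show ?thesis by (simp add: choose_two)
    qed
    moreover have "m + 1 - 2 = m - 1" by simp
    ultimately have t2: "?t 2 = ?M / 2 * (x 1 ^ (m - 1) * fps_nth (tail_series N x ^ 2) (m - 1))"
      by (simp only:)
    have "M / 2 * a / M = 1 / 2 * a" if "M \<noteq> 0" for a M :: real using that by simp
    from this[OF M] have t2': "?t 2 / ?M = 1 / 2 * (x 1 ^ (m - 1) * fps_nth (tail_series N x ^ 2) (m - 1))"
      unfolding t2 .
    let ?S = "\<Sum>(i, j)\<in>{(i, j). i \<ge> 2 \<and> j \<ge> 2 \<and> i + j = m + 1}. x i * x j / (fact (i - 1) * fact (j - 1))"
    have sq: "fps_nth (tail_series N x ^ 2) (m - 1) = ?S"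
      by (rule tail_series_square_nth) (use assms(1,2) in auto)
    have "1 / 2 * (x 1 ^ (m - 1) * ?S) = x 1 ^ (m - 1) * (\<Sum>(i, j)\<in>{(i, j). i \<ge> 2 \<and> j \<ge> 2 \<and> i + j = m + 1}.
          1 / 2 * (x i * x j / (fact (i - 1) * fact (j - 1))))"
      unfolding mult.left_commute[of "1 / 2"] sum_distrib_left[of "1 / 2"]
      by (intro arg_cong2[where f = "(*)"] sum.cong) auto
    then show ?thesis using t2' by (simp only: sq)
  qed
  moreover have "(\<Sum>k=3..m + 1. ?t k) / ?M = remainder_poly N m x"
    unfolding remainder_poly_def sum_divide_distrib by simp
  ultimately show ?thesis by (simp only: add_divide_distrib)
qed

subsection \<open>Level sets of a first derivative\<close>

lemma power_series_bounded:
  assumes "converges k c R"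
  shows "\<exists>M. \<forall>x\<in>cbox_at_0 k R. \<bar>power_series k c x\<bar> \<le> M"
proof (intro exI ballI)
  fix x assume x: "x \<in> cbox_at_0 k R"
  show "\<bar>power_series k c x\<bar> \<le> (\<Sum>\<^sub>\<infinity>\<alpha>\<in>multi_indices k. \<bar>c \<alpha>\<bar> * R ^ deg k \<alpha>)"
  proof (rule has_sum_abs_bound[OF power_series_has_sum[OF assms x]])
    show "((\<lambda>\<alpha>. \<bar>c \<alpha>\<bar> * R ^ deg k \<alpha>) has_sum (\<Sum>\<^sub>\<infinity>\<alpha>\<in>multi_indices k. \<bar>c \<alpha>\<bar> * R ^ deg k \<alpha>))
        (multi_indices k)"
      using assms by (intro has_sum_infsum) (simp add: converges_def)
    show "norm (c \<alpha> * monomial_at k \<alpha> x) \<le> \<bar>c \<alpha>\<bar> * R ^ deg k \<alpha>" for \<alpha>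
      using mult_left_mono[OF abs_monomial_at_le[OF x] abs_ge_zero] by (simp add: abs_mult)
  qed
qed

lemma deriv_coeffs_commute: "deriv_coeffs i (deriv_coeffs j c) = deriv_coeffs j (deriv_coeffs i c)"
  by (cases "i = j") (auto simp: deriv_coeffs_def fun_upd_twist fun_eq_iff)

lemma cbox_at_0_mono: "x \<in> cbox_at_0 k r \<Longrightarrow> r \<le> r' \<Longrightarrow> x \<in> cbox_at_0 k r'"
  by (force simp: cbox_at_0_def)

text \<open>Stated for all large constants, so that finitely many such estimates can later share one
  constant.\<close>

lemma eventually_power_series_taylor:
  assumes "converges k c R" "0 < \<rho>" "\<rho> < R"
  shows "\<forall>\<^sub>F C in at_top. \<forall>x\<in>cbox_at_0 k \<rho>. \<forall>y\<in>cbox_at_0 k \<rho>. \<forall>\<delta>\<ge>0.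
      (\<forall>i\<in>{1..k}. \<bar>y i - x i\<bar> \<le> \<delta>) \<longrightarrow>
      \<bar>power_series k c y - power_series k c x
        - (\<Sum>i=1..k. power_series k (deriv_coeffs i c) x * (y i - x i))\<bar> \<le> C * \<delta>\<^sup>2"
proof -
  obtain C where "0 \<le> C" and C: "\<forall>x\<in>cbox_at_0 k \<rho>. \<forall>y\<in>cbox_at_0 k \<rho>. \<forall>\<delta>\<ge>0.
      (\<forall>i\<in>{1..k}. \<bar>y i - x i\<bar> \<le> \<delta>) \<longrightarrow>
      \<bar>power_series k c y - power_series k c x
        - (\<Sum>i=1..k. power_series k (deriv_coeffs i c) x * (y i - x i))\<bar> \<le> C * \<delta>\<^sup>2"
    using power_series_taylor[OF assms] by blast
  show ?thesis
    using eventually_ge_at_top[of C]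
  proof eventually_elim
    case (elim C')
    show ?case
    proof (intro ballI allI impI)
      fix x y \<delta>
      assume "x \<in> cbox_at_0 k \<rho>" "y \<in> cbox_at_0 k \<rho>" "0 \<le> \<delta>" "\<forall>i\<in>{1..k}. \<bar>y i - x i\<bar> \<le> \<delta>"
      then have "\<bar>power_series k c y - power_series k c x
        - (\<Sum>i=1..k. power_series k (deriv_coeffs i c) x * (y i - x i))\<bar> \<le> C * \<delta>\<^sup>2"
        using C by blast
      also have "\<dots> \<le> C' * \<delta>\<^sup>2" using elim by (rule mult_right_mono) simp
      finally show "\<bar>power_series k c y - power_series k c x
        - (\<Sum>i=1..k. power_series k (deriv_coeffs i c) x * (y i - x i))\<bar> \<le> C' * \<delta>\<^sup>2" .
    qed
  qed
qed

lemma eventually_power_series_bounded: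
  assumes "converges k c R"
  shows "\<forall>\<^sub>F C in at_top. \<forall>x\<in>cbox_at_0 k R. \<bar>power_series k c x\<bar> \<le> C"
proof -
  obtain M where M: "\<forall>x\<in>cbox_at_0 k R. \<bar>power_series k c x\<bar> \<le> M"
    using power_series_bounded[OF assms] by blast
  show ?thesis
    using eventually_ge_at_top[of M] by eventually_elim (use M in \<open>meson order_trans\<close>)
qed

lemma eventually_power_series_lipschitz:
  assumes "converges k c R" "0 < \<rho>" "\<rho> < R"
  shows "\<forall>\<^sub>F C in at_top. \<forall>x\<in>cbox_at_0 k \<rho>. \<forall>y\<in>cbox_at_0 k \<rho>. \<forall>\<delta>\<ge>0.
      (\<forall>i\<in>{1..k}. \<bar>y i - x i\<bar> \<le> \<delta>) \<longrightarrow> \<bar>power_series k c y - power_series k c x\<bar> \<le> C * \<delta>"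
proof -
  have "\<forall>\<^sub>F C in at_top. \<forall>i\<in>{1..k}. \<forall>x\<in>cbox_at_0 k \<rho>. \<bar>power_series k (deriv_coeffs i c) x\<bar> \<le> C"
    by (intro eventually_ball_finite ballI eventually_power_series_bounded
        converges_deriv_coeffs[OF assms]) auto
  then obtain M where M: "\<And>i x. i \<in> {1..k} \<Longrightarrow> x \<in> cbox_at_0 k \<rho> \<Longrightarrow> \<bar>power_series k (deriv_coeffs i c) x\<bar> \<le> M"
    unfolding eventually_at_top_linorder by blast
  obtain C where C0: "0 \<le> C" and C1: "\<forall>x\<in>cbox_at_0 k \<rho>. \<forall>y\<in>cbox_at_0 k \<rho>. \<forall>\<delta>\<ge>0.
      (\<forall>i\<in>{1..k}. \<bar>y i - x i\<bar> \<le> \<delta>) \<longrightarrow>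
      \<bar>power_series k c y - power_series k c x
        - (\<Sum>i=1..k. power_series k (deriv_coeffs i c) x * (y i - x i))\<bar> \<le> C * \<delta>\<^sup>2"
    using power_series_taylor[OF assms] by blast
  note C = C0 C1[rule_format]
  have bound: "\<bar>power_series k c y - power_series k c x\<bar> \<le> (C * (2 * \<rho>) + real k * M) * \<delta>"
    if x: "x \<in> cbox_at_0 k \<rho>" and y: "y \<in> cbox_at_0 k \<rho>" and d: "0 \<le> \<delta>"
      and xy: "\<forall>i\<in>{1..k}. \<bar>y i - x i\<bar> \<le> \<delta>" for x y \<delta>
  proof -
    \<comment> \<open>Two points of the box differ by at most 2 rho in each coordinate, so cutting
      delta off there keeps the hypothesis and makes the quadratic remainder linear in
      delta.\<close>
    define \<delta>' where "\<delta>' = min \<delta> (2 * \<rho>)"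
    have d': "0 \<le> \<delta>'" "\<delta>' \<le> \<delta>" "\<delta>' \<le> 2 * \<rho>" using d assms(2) by (auto simp: \<delta>'_def)
    have xy': "\<bar>y i - x i\<bar> \<le> \<delta>'" if i: "i \<in> {1..k}" for i
    proof -
      have "\<bar>x i\<bar> \<le> \<rho>" "\<bar>y i\<bar> \<le> \<rho>" using x y i by (auto simp: cbox_at_0_def)
      then have "\<bar>y i - x i\<bar> \<le> 2 * \<rho>" by linarith
      moreover have "\<bar>y i - x i\<bar> \<le> \<delta>" using xy i by blast
      ultimately show ?thesis unfolding \<delta>'_def by (simp only: min.bounded_iff)
    qed
    have 1: "\<bar>power_series k c y - power_series k c x
        - (\<Sum>i=1..k. power_series k (deriv_coeffs i c) x * (y i - x i))\<bar> \<le> C * \<delta>'\<^sup>2"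
      by (rule C(2)[OF x y d'(1) xy'])
    have 2: "\<bar>\<Sum>i=1..k. power_series k (deriv_coeffs i c) x * (y i - x i)\<bar> \<le> (\<Sum>i=1..k. M * \<delta>')"
      by (rule order_trans[OF sum_abs sum_mono])
        (simp only: abs_mult mult_mono[OF M[OF _ x] xy' order_trans[OF abs_ge_zero M[OF _ x]] abs_ge_zero])
    have "\<bar>power_series k c y - power_series k c x\<bar> \<le> C * \<delta>'\<^sup>2 + real k * M * \<delta>'"
      using 1 2 by simp
    also have "C * \<delta>'\<^sup>2 \<le> C * (2 * \<rho>) * \<delta>'"
      using mult_left_mono[OF mult_right_mono[OF d'(3,1)] C(1)] by (simp add: power2_eq_square mult.assoc)
    finally have "\<bar>power_series k c y - power_series k c x\<bar> \<le> (C * (2 * \<rho>) + real k * M) * \<delta>'"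
      by (simp add: distrib_right)
    also have "\<dots> \<le> (C * (2 * \<rho>) + real k * M) * \<delta>"
    proof (rule mult_left_mono[OF d'(2)])
      have "0 \<le> real k * M"
      proof (cases "k = 0")
        case False
        then have "1 \<in> {1..k}" by simp
        then have "0 \<le> M" using order_trans[OF abs_ge_zero M[OF _ x]] by blast
        then show ?thesis by simp
      qed simp
      then show "0 \<le> C * (2 * \<rho>) + real k * M" using C(1) assms(2) by simp
    qed
    finally show ?thesis .
  qed
  show ?thesis
    using eventually_ge_at_top[of "C * (2 * \<rho>) + real k * M"]
  proof eventually_elim
    case (elim C')
    show ?case
    proof (intro ballI allI impI)
      fix x y \<delta>
      assume "x \<in> cbox_at_0 k \<rho>" "y \<in> cbox_at_0 k \<rho>" and d: "0 \<le> \<delta>" and "\<forall>i\<in>{1..k}. \<bar>y i - x i\<bar> \<le> \<delta>"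
      then have "\<bar>power_series k c y - power_series k c x\<bar> \<le> (C * (2 * \<rho>) + real k * M) * \<delta>"
        by (rule bound)
      also have "\<dots> \<le> C' * \<delta>" using elim d by (rule mult_right_mono)
      finally show "\<bar>power_series k c y - power_series k c x\<bar> \<le> C' * \<delta>" .
    qed
  qed
qed

text \<open>The Taylor remainder is quadratic in the increment of the curve, and the increment is at
  most |t - t0| times the quantity q below, which converges as t tends to t0.\<close>

lemma power_series_chain_rule:
  assumes "converges k c R" and p: "\<And>i. i \<in> {1..k} \<Longrightarrow> \<bar>\<gamma> t0 i\<bar> < R"
    and \<gamma>: "\<And>i. i \<in> {1..k} \<Longrightarrow> ((\<lambda>t. \<gamma> t i) has_real_derivative v i) (at t0)"
  shows "((\<lambda>t. power_series k c (\<gamma> t)) has_real_derivative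
      (\<Sum>i=1..k. power_series k (deriv_coeffs i c) (\<gamma> t0) * v i)) (at t0)"
proof -
  have R: "0 < R" using assms(1) by (simp add: converges_def)
  have "\<exists>\<rho>. 0 < \<rho> \<and> \<rho> < R \<and> (\<forall>i\<in>{1..k}. \<bar>\<gamma> t0 i\<bar> < \<rho>)"
  proof -
    define m where "m = Max (insert 0 ((\<lambda>i. \<bar>\<gamma> t0 i\<bar>) ` {1..k}))"
    have "m < R" unfolding m_def using p R by (subst Max_less_iff) auto
    moreover have "0 \<le> m" unfolding m_def by (rule Max_ge) auto
    moreover have "\<bar>\<gamma> t0 i\<bar> \<le> m" if "i \<in> {1..k}" for i
      unfolding m_def by (rule Max_ge) (use that in auto)
    ultimately show ?thesis by (intro exI[of _ "(m + R) / 2"]) (force simp: field_simps)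
  qed
  then obtain \<rho> where \<rho>: "0 < \<rho>" "\<rho> < R" "\<And>i. i \<in> {1..k} \<Longrightarrow> \<bar>\<gamma> t0 i\<bar> < \<rho>" by blast
  obtain C where C0: "0 \<le> C" and C1: "\<forall>x\<in>cbox_at_0 k \<rho>. \<forall>y\<in>cbox_at_0 k \<rho>. \<forall>\<delta>\<ge>0.
      (\<forall>i\<in>{1..k}. \<bar>y i - x i\<bar> \<le> \<delta>) \<longrightarrow>
      \<bar>power_series k c y - power_series k c x
        - (\<Sum>i=1..k. power_series k (deriv_coeffs i c) x * (y i - x i))\<bar> \<le> C * \<delta>\<^sup>2"
    using power_series_taylor[OF assms(1) \<rho>(1,2)] by blast
  note C = C0 C1[rule_format]
  let ?f = "power_series k c" and ?D = "\<lambda>i. power_series k (deriv_coeffs i c) (\<gamma> t0)"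
  have x: "\<gamma> t0 \<in> cbox_at_0 k \<rho>" using \<rho>(3) by (auto simp: cbox_at_0_def intro: less_imp_le)
  define q where "q t = (\<Sum>i=1..k. \<bar>(\<gamma> t i - \<gamma> t0 i) / (t - t0)\<bar>)" for t
  have quot: "((\<lambda>t. (\<gamma> t i - \<gamma> t0 i) / (t - t0)) \<longlongrightarrow> v i) (at t0)" if "i \<in> {1..k}" for i
    using \<gamma>[OF that] by (simp add: has_field_derivative_iff)
  have q: "(q \<longlongrightarrow> (\<Sum>i=1..k. \<bar>v i\<bar>)) (at t0)"
    unfolding q_def by (intro tendsto_sum tendsto_rabs quot)
  have ev: "\<forall>\<^sub>F t in at t0. \<forall>i\<in>{1..k}. \<bar>\<gamma> t i\<bar> < \<rho>"
  proof (intro eventually_ball_finite ballI)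
    fix i assume i: "i \<in> {1..k}"
    have "((\<lambda>t. \<gamma> t i) \<longlongrightarrow> \<gamma> t0 i) (at t0)"
      using DERIV_isCont[OF \<gamma>[OF i]] by (simp add: isCont_def)
    then have "((\<lambda>t. \<bar>\<gamma> t i\<bar>) \<longlongrightarrow> \<bar>\<gamma> t0 i\<bar>) (at t0)" by (rule tendsto_rabs)
    then show "\<forall>\<^sub>F t in at t0. \<bar>\<gamma> t i\<bar> < \<rho>" using \<rho>(3)[OF i] by (rule order_tendstoD)
  qed simp
  have err: "((\<lambda>t. (?f (\<gamma> t) - ?f (\<gamma> t0) - (\<Sum>i=1..k. ?D i * (\<gamma> t i - \<gamma> t0 i))) / (t - t0)) \<longlongrightarrow> 0) (at t0)"
  proof (rule Lim_null_comparison)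
    have "((\<lambda>t. C * (\<bar>t - t0\<bar> * (q t)\<^sup>2)) \<longlongrightarrow> C * (\<bar>t0 - t0\<bar> * (\<Sum>i=1..k. \<bar>v i\<bar>)\<^sup>2)) (at t0)"
      by (intro tendsto_intros q)
    then show "((\<lambda>t. C * (\<bar>t - t0\<bar> * (q t)\<^sup>2)) \<longlongrightarrow> 0) (at t0)" by simp
    show "\<forall>\<^sub>F t in at t0. norm ((?f (\<gamma> t) - ?f (\<gamma> t0) - (\<Sum>i=1..k. ?D i * (\<gamma> t i - \<gamma> t0 i))) / (t - t0))
        \<le> C * (\<bar>t - t0\<bar> * (q t)\<^sup>2)"
      using ev eventually_neq_at_within[of t0 t0]
    proof eventually_elim
      case (elim t)
      have y: "\<gamma> t \<in> cbox_at_0 k \<rho>" using elim(1) by (auto simp: cbox_at_0_def intro: less_imp_le)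
      have q0: "0 \<le> q t" unfolding q_def by (rule sum_nonneg) simp
      have t: "\<bar>t - t0\<bar> > 0" using elim(2) by simp
      have "\<bar>\<gamma> t i - \<gamma> t0 i\<bar> \<le> \<bar>t - t0\<bar> * q t" if i: "i \<in> {1..k}" for i
      proof -
        have "\<bar>(\<gamma> t i - \<gamma> t0 i) / (t - t0)\<bar> \<le> q t"
          unfolding q_def by (rule member_le_sum[OF i]) auto
        then show ?thesis using t by (simp add: abs_divide field_simps)
      qed
      then have "\<bar>?f (\<gamma> t) - ?f (\<gamma> t0) - (\<Sum>i=1..k. ?D i * (\<gamma> t i - \<gamma> t0 i))\<bar> \<le> C * (\<bar>t - t0\<bar> * q t)\<^sup>2"
        using q0 t by (intro C(2)[OF x y]) auto
      also have "\<dots> = C * (\<bar>t - t0\<bar> * (q t)\<^sup>2) * \<bar>t - t0\<bar>"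
        by (simp add: power2_eq_square mult_ac)
      finally show ?case using t by (simp add: abs_divide pos_divide_le_eq)
    qed
  qed
  have "((\<lambda>t. (?f (\<gamma> t) - ?f (\<gamma> t0) - (\<Sum>i=1..k. ?D i * (\<gamma> t i - \<gamma> t0 i))) / (t - t0)
      + (\<Sum>i=1..k. ?D i * ((\<gamma> t i - \<gamma> t0 i) / (t - t0)))) \<longlongrightarrow> 0 + (\<Sum>i=1..k. ?D i * v i)) (at t0)"
    by (intro tendsto_add err tendsto_sum tendsto_mult tendsto_const quot)
  moreover have "(?f (\<gamma> t) - ?f (\<gamma> t0) - (\<Sum>i=1..k. ?D i * (\<gamma> t i - \<gamma> t0 i))) / (t - t0)
      + (\<Sum>i=1..k. ?D i * ((\<gamma> t i - \<gamma> t0 i) / (t - t0))) = (?f (\<gamma> t) - ?f (\<gamma> t0)) / (t - t0)" for t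
  proof -
    have "(\<Sum>i=1..k. ?D i * ((\<gamma> t i - \<gamma> t0 i) / (t - t0))) = (\<Sum>i=1..k. ?D i * (\<gamma> t i - \<gamma> t0 i)) / (t - t0)"
      by (simp only: sum_divide_distrib times_divide_eq_right)
    then show ?thesis by (simp only: add_divide_distrib[symmetric] diff_add_cancel)
  qed
  ultimately show ?thesis unfolding has_field_derivative_iff by simp
qed

text \<open>Increments of second order force the derivative to be zero. This is made for functions
  along a path that is known to be Lipschitz but not to be differentiable.\<close>

lemma constant_if_quadratic_increments:
  fixes f :: "real \<Rightarrow> real"
  assumes "\<And>s t. s \<in> {0..1} \<Longrightarrow> t \<in> {0..1} \<Longrightarrow> \<bar>f t - f s\<bar> \<le> M * \<bar>t - s\<bar>\<^sup>2"
  shows "\<forall>t\<in>{0..1}. f t = f 0"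
proof -
  have "(f has_field_derivative 0) (at s within {0..1})" if s: "s \<in> {0..1}" for s
    unfolding has_field_derivative_iff
  proof (rule Lim_null_comparison)
    have "((\<lambda>t. M * \<bar>t - s\<bar>) \<longlongrightarrow> M * \<bar>s - s\<bar>) (at s within {0..1})" by (intro tendsto_intros)
    then show "((\<lambda>t. M * \<bar>t - s\<bar>) \<longlongrightarrow> 0) (at s within {0..1})" by simp
    show "\<forall>\<^sub>F t in at s within {0..1}. norm ((f t - f s) / (t - s)) \<le> M * \<bar>t - s\<bar>"
      unfolding eventually_at_filter
    proof (rule always_eventually, intro allI impI)
      fix t assume t: "t \<noteq> s" "t \<in> {0..1}"
      then show "norm ((f t - f s) / (t - s)) \<le> M * \<bar>t - s\<bar>"
        using assms[OF s t(2)] by (simp add: abs_divide pos_divide_le_eq power2_eq_square mult_ac)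
    qed
  qed
  then have "\<exists>c. \<forall>s\<in>{0..1}. f s = c"
    by (intro has_field_derivative_zero_constant) auto
  then obtain c where c: "\<And>s. s \<in> {0..1} \<Longrightarrow> f s = c" by blast
  then show ?thesis by simp
qed

definition axis_pt :: "nat \<Rightarrow> real \<Rightarrow> point" where
  "axis_pt k s = (\<lambda>i. if i = k then s else 0)"

lemma power_series_cong:
  assumes "\<And>i. i \<in> {1..k} \<Longrightarrow> x i = y i"
  shows "power_series k c x = power_series k c y"
proof -
  have "monomial_at k \<alpha> x = monomial_at k \<alpha> y" for \<alpha>
    unfolding monomial_at_def by (rule prod.cong) (use assms in auto)
  then show ?thesis by (simp add: power_series_def)
qed

lemma sum_axis: "l \<in> {1..n} \<Longrightarrow> (\<Sum>i=1..n. f i * axis_pt l s i) = f l * s"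
proof -
  assume l: "l \<in> {1..n}"
  have "(\<Sum>i=1..n. f i * axis_pt l s i) = (\<Sum>i=1..n. if i = l then f l * s else 0)"
    by (rule sum.cong) (auto simp: axis_pt_def)
  then show ?thesis using l by simp
qed

text \<open>
  On a level set of the \<open>k\<close>-th partial derivative the rank condition makes all first derivatives
  constant. The level set through \<open>x\<close> is followed to the \<open>k\<close>-th axis by moving the other
  coordinates to \<open>0\<close>; the path is Lipschitz, and along it the quantities in question have
  quadratically small increments.
\<close>

lemma level_set_axis:
  fixes n k :: nat and c :: "(nat \<Rightarrow> nat) \<Rightarrow> real"
  defines "G \<equiv> power_series n c"
    and "D \<equiv> \<lambda>i. power_series n (deriv_coeffs i c)"
    and "H \<equiv> \<lambda>i j. power_series n (deriv_coeffs j (deriv_coeffs i c))"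
  assumes conv: "converges n c R" and k: "k \<in> {1..n}"
    and r0: "0 < r0" and minors: "\<And>x i j. x \<in> cbox_at_0 n r0 \<Longrightarrow> i \<in> {1..n} \<Longrightarrow> j \<in> {1..n} \<Longrightarrow>
      H i j x * H k k x = H i k x * H k j x"
    and pos: "0 < H k k (\<lambda>_. 0)"
  shows "\<exists>r>0. \<exists>K>0. \<forall>\<delta> x. 0 \<le> \<delta> \<longrightarrow> \<delta> \<le> r \<longrightarrow> x \<in> cbox_at_0 n \<delta> \<longrightarrow>
    (\<exists>\<theta>. \<bar>\<theta>\<bar> \<le> K * \<delta> \<and> (\<forall>i\<in>{1..n}. D i x = D i (axis_pt k \<theta>)) \<and>
      G x - (\<Sum>i=1..n. x i * D i x) = G (axis_pt k \<theta>) - \<theta> * D k (axis_pt k \<theta>))"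
proof -
  have R: "0 < R" using conv by (simp add: converges_def)
  \<comment> \<open>R / 4 lies below the radii R / 2 and R / 3 at which the first and the second
    derivatives converge.\<close>
  define \<rho>0 where "\<rho>0 = R / 4"
  have \<rho>0: "0 < \<rho>0" "\<rho>0 < R" "\<rho>0 < R / 2" "\<rho>0 < R / 3" using R by (simp_all add: \<rho>0_def)
  have conv1: "converges n (deriv_coeffs i c) (R / 2)" if "i \<in> {1..n}" for i
    by (rule converges_deriv_coeffs[OF conv _ _ that]) (use R in auto)
  have conv2: "converges n (deriv_coeffs j (deriv_coeffs i c)) (R / 3)" if "i \<in> {1..n}" "j \<in> {1..n}" for i j
    by (rule converges_deriv_coeffs[OF conv1[OF that(1)] _ _ that(2)]) (use R in auto)
  define a where "a = H k k (\<lambda>_. 0)"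
  have a: "0 < a" using pos by (simp add: a_def)
  define near where "near x y \<delta> \<longleftrightarrow> (\<forall>i\<in>{1..n}. \<bar>y i - x i :: real\<bar> \<le> \<delta>)" for x y :: point and \<delta>
  have ev1: "\<forall>\<^sub>F C in at_top. \<forall>x\<in>cbox_at_0 n \<rho>0. \<forall>y\<in>cbox_at_0 n \<rho>0. \<forall>\<delta>\<ge>0. near x y \<delta> \<longrightarrow>
      \<bar>G y - G x - (\<Sum>i=1..n. D i x * (y i - x i))\<bar> \<le> C * \<delta>\<^sup>2"
    unfolding near_def G_def D_def by (rule eventually_power_series_taylor[OF conv \<rho>0(1,2)])
  have ev2: "\<forall>\<^sub>F C in at_top. \<forall>i\<in>{1..n}. \<forall>x\<in>cbox_at_0 n \<rho>0. \<forall>y\<in>cbox_at_0 n \<rho>0. \<forall>\<delta>\<ge>0. near x y \<delta> \<longrightarrow>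
      \<bar>D i y - D i x - (\<Sum>j=1..n. H i j x * (y j - x j))\<bar> \<le> C * \<delta>\<^sup>2"
    unfolding near_def H_def D_def
    by (rule eventually_ball_finite[OF finite_atLeastAtMost])
      (rule ballI, rule eventually_power_series_taylor[OF conv1 \<rho>0(1,3)])
  have ev3: "\<forall>\<^sub>F C in at_top. \<forall>x\<in>cbox_at_0 n \<rho>0. \<forall>y\<in>cbox_at_0 n \<rho>0. \<forall>\<delta>\<ge>0. near x y \<delta> \<longrightarrow>
      \<bar>D k y - D k x\<bar> \<le> C * \<delta>"
    unfolding near_def D_def by (rule eventually_power_series_lipschitz[OF conv1[OF k] \<rho>0(1,3)])
  have ev4: "\<forall>\<^sub>F C in at_top. \<forall>x\<in>cbox_at_0 n \<rho>0. \<forall>y\<in>cbox_at_0 n \<rho>0. \<forall>\<delta>\<ge>0. near x y \<delta> \<longrightarrow>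
      \<bar>H k k y - H k k x\<bar> \<le> C * \<delta>"
    unfolding near_def H_def by (rule eventually_power_series_lipschitz[OF conv2[OF k k] \<rho>0(1,4)])
  have ev5: "\<forall>\<^sub>F C in at_top. \<forall>i\<in>{1..n}. \<forall>x\<in>cbox_at_0 n (R / 3). \<bar>H i k x\<bar> \<le> C"
    unfolding H_def
    by (rule eventually_ball_finite[OF finite_atLeastAtMost])
      (rule ballI, rule eventually_power_series_bounded[OF conv2[OF _ k]])
  have "\<exists>C. (\<forall>x\<in>cbox_at_0 n \<rho>0. \<forall>y\<in>cbox_at_0 n \<rho>0. \<forall>\<delta>\<ge>0. near x y \<delta> \<longrightarrow>
      \<bar>G y - G x - (\<Sum>i=1..n. D i x * (y i - x i))\<bar> \<le> C * \<delta>\<^sup>2)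
    \<and> (\<forall>i\<in>{1..n}. \<forall>x\<in>cbox_at_0 n \<rho>0. \<forall>y\<in>cbox_at_0 n \<rho>0. \<forall>\<delta>\<ge>0. near x y \<delta> \<longrightarrow>
      \<bar>D i y - D i x - (\<Sum>j=1..n. H i j x * (y j - x j))\<bar> \<le> C * \<delta>\<^sup>2)
    \<and> (\<forall>x\<in>cbox_at_0 n \<rho>0. \<forall>y\<in>cbox_at_0 n \<rho>0. \<forall>\<delta>\<ge>0. near x y \<delta> \<longrightarrow> \<bar>D k y - D k x\<bar> \<le> C * \<delta>)
    \<and> (\<forall>x\<in>cbox_at_0 n \<rho>0. \<forall>y\<in>cbox_at_0 n \<rho>0. \<forall>\<delta>\<ge>0. near x y \<delta> \<longrightarrow> \<bar>H k k y - H k k x\<bar> \<le> C * \<delta>)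
    \<and> (\<forall>i\<in>{1..n}. \<forall>x\<in>cbox_at_0 n (R / 3). \<bar>H i k x\<bar> \<le> C) \<and> 1 \<le> C" (is "\<exists>C. ?P C")
    by (rule eventually_happens'[OF trivial_limit_at_top_linorder
      eventually_conj[OF ev1 eventually_conj[OF ev2 eventually_conj[OF ev3 eventually_conj[OF ev4
        eventually_conj[OF ev5 eventually_ge_at_top]]]]]])
  then obtain C where P: "?P C" ..
  note C1 = P[THEN conjunct1, rule_format]
    and C2 = P[THEN conjunct2, THEN conjunct1, rule_format]
    and C3 = P[THEN conjunct2, THEN conjunct2, THEN conjunct1, rule_format]
    and C4 = P[THEN conjunct2, THEN conjunct2, THEN conjunct2, THEN conjunct1, rule_format]
    and C5 = P[THEN conjunct2, THEN conjunct2, THEN conjunct2, THEN conjunct2, THEN conjunct1, rule_format]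
    and C = P[THEN conjunct2, THEN conjunct2, THEN conjunct2, THEN conjunct2, THEN conjunct2]
  \<comment> \<open>Within this radius \<open>H k k\<close> differs from its value a at 0 by at most
    a / 2.\<close>
  define \<rho> where "\<rho> = min \<rho>0 (min r0 (a / (2 * C)))"
  have \<rho>: "0 < \<rho>" "\<rho> \<le> \<rho>0" "\<rho> \<le> r0" "C * \<rho> \<le> a / 2"
  proof -
    show "0 < \<rho>" using \<rho>0(1) r0 a C by (simp add: \<rho>_def)
    have "\<rho> \<le> a / (2 * C)" by (simp add: \<rho>_def)
    then show "C * \<rho> \<le> a / 2" using C by (simp add: field_simps)
  qed (simp_all add: \<rho>_def)
  have Hkk: "a / 2 \<le> H k k x" if x: "x \<in> cbox_at_0 n \<rho>" for x
  proof -
    have "\<bar>H k k x - H k k (\<lambda>_. 0)\<bar> \<le> C * \<rho>"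
      by (rule C4) (use x \<rho> \<rho>0 in \<open>auto simp: cbox_at_0_def near_def\<close>)
    then show ?thesis using \<rho>(4) unfolding a_def[symmetric] by linarith
  qed
  \<comment> \<open>Moving the k-th coordinate by K delta changes the k-th derivative by at least a
    / 2 * K * delta, which exceeds the change C delta caused by a displacement of size
    delta.\<close>
  define K where "K = 2 * C / a + 1"
  have K: "1 \<le> K" "a / 2 * K = C + a / 2" using a C by (simp_all add: K_def field_simps)
  have main: "\<exists>\<theta>. \<bar>\<theta>\<bar> \<le> K * \<delta> \<and> (\<forall>i\<in>{1..n}. D i x = D i (axis_pt k \<theta>)) \<and>
      G x - (\<Sum>i=1..n. x i * D i x) = G (axis_pt k \<theta>) - \<theta> * D k (axis_pt k \<theta>)"
    if \<delta>: "0 \<le> \<delta>" "\<delta> \<le> \<rho> / K" and x: "x \<in> cbox_at_0 n \<delta>" for \<delta> x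
  proof -
    have K\<delta>: "K * \<delta> \<le> \<rho>" using \<delta>(2) K(1) by (simp add: field_simps)
    have \<delta>K: "\<delta> \<le> K * \<delta>" using mult_right_mono[OF K(1) \<delta>(1)] by simp
    have xi: "\<bar>x i\<bar> \<le> \<delta>" if "i \<in> {1..n}" for i using x that by (simp add: cbox_at_0_def)
    define z where "z X \<tau> = (\<lambda>i. if i = k then X else \<tau> * x i)" for X \<tau> :: real
    have \<tau>x: "\<bar>\<tau> * x i\<bar> \<le> \<delta>" if "\<tau> \<in> {0..1}" "i \<in> {1..n}" for \<tau> i
      using mult_mono[of "\<bar>\<tau>\<bar>" 1 "\<bar>x i\<bar>" \<delta>] xi[OF that(2)] that(1) by (simp add: abs_mult)
    have z\<rho>: "z X \<tau> \<in> cbox_at_0 n \<rho>" if "\<bar>X\<bar> \<le> K * \<delta>" "\<tau> \<in> {0..1}" for X \<tau>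
    proof -
      have "\<bar>z X \<tau> i\<bar> \<le> \<rho>" if i: "i \<in> {1..n}" for i
        using \<tau>x[OF \<open>\<tau> \<in> {0..1}\<close> i] \<open>\<bar>X\<bar> \<le> K * \<delta>\<close> K\<delta> \<delta>K by (cases "i = k") (simp_all add: z_def)
      then show ?thesis by (simp add: cbox_at_0_def)
    qed
    have z\<rho>0: "z X \<tau> \<in> cbox_at_0 n \<rho>0" if "\<bar>X\<bar> \<le> K * \<delta>" "\<tau> \<in> {0..1}" for X \<tau>
      using cbox_at_0_mono[OF z\<rho>[OF that] \<rho>(2)] .
    have "\<delta> \<le> \<rho>0" using \<delta>K K\<delta> \<rho>(2) by linarith
    then have x\<rho>0: "x \<in> cbox_at_0 n \<rho>0" by (rule cbox_at_0_mono[OF x])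
    have deriv: "((\<lambda>X. D k (z X \<tau>)) has_real_derivative H k k (z X \<tau>)) (at X)"
      if X: "\<bar>X\<bar> \<le> K * \<delta>" and \<tau>: "\<tau> \<in> {0..1}" for X \<tau>
    proof -
      have "\<bar>z X \<tau> i\<bar> < R / 2" if "i \<in> {1..n}" for i
      proof -
        have "\<bar>z X \<tau> i\<bar> \<le> \<rho>0" using z\<rho>0[OF X \<tau>] that by (simp add: cbox_at_0_def)
        then show ?thesis using \<rho>0(3) by linarith
      qed
      moreover have "((\<lambda>X. z X \<tau> i) has_real_derivative axis_pt k 1 i) (at X)" for i
        by (cases "i = k") (auto simp: z_def axis_pt_def intro!: derivative_eq_intros)
      ultimately have "((\<lambda>X. power_series n (deriv_coeffs k c) (z X \<tau>)) has_real_derivative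
          (\<Sum>i=1..n. power_series n (deriv_coeffs i (deriv_coeffs k c)) (z X \<tau>) * axis_pt k 1 i)) (at X)"
        by (intro power_series_chain_rule[OF conv1[OF k]])
      then show ?thesis unfolding sum_axis[OF k] D_def H_def by simp
    qed
    have mono: "a / 2 * (Y - X) \<le> D k (z Y \<tau>) - D k (z X \<tau>)"
      if "\<bar>X\<bar> \<le> K * \<delta>" "\<bar>Y\<bar> \<le> K * \<delta>" "X \<le> Y" and \<tau>: "\<tau> \<in> {0..1}" for X Y \<tau>
    proof (cases "X = Y")
      case False
      then have XY: "X < Y" using that(3) by simp
      have in_range: "\<bar>w\<bar> \<le> K * \<delta>" if "X \<le> w" "w \<le> Y" for w
        using that \<open>\<bar>X\<bar> \<le> K * \<delta>\<close> \<open>\<bar>Y\<bar> \<le> K * \<delta>\<close> by linarith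
      have "\<exists>w. X < w \<and> w < Y \<and> D k (z Y \<tau>) - D k (z X \<tau>) = (Y - X) * H k k (z w \<tau>)"
        by (rule MVT2[OF XY]) (rule deriv[OF in_range \<tau>])
      then obtain w where w: "X < w" "w < Y"
        "D k (z Y \<tau>) - D k (z X \<tau>) = (Y - X) * H k k (z w \<tau>)" by blast
      have "a / 2 \<le> H k k (z w \<tau>)"
        by (rule Hkk[OF z\<rho>[OF in_range \<tau>]]) (use w in auto)
      from mult_left_mono[OF this, of "Y - X"] w(3) XY show ?thesis by (simp add: mult.commute)
    qed simp
    have "\<exists>X. \<bar>X\<bar> \<le> K * \<delta> \<and> D k (z X \<tau>) = D k x" if \<tau>: "\<tau> \<in> {0..1}" for \<tau>
    proof -
      have K\<delta>0: "0 \<le> K * \<delta>" using \<delta>(1) K(1) by simp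
      have "near x (z 0 \<tau>) \<delta>"
      proof -
        have "\<bar>z 0 \<tau> i - x i\<bar> \<le> \<delta>" if i: "i \<in> {1..n}" for i
        proof (cases "i = k")
          case False
          have "\<bar>z 0 \<tau> i - x i\<bar> = \<bar>(1 - \<tau>) * x i\<bar>" using False by (simp add: z_def algebra_simps abs_minus_commute)
          then show ?thesis using \<tau>x[of "1 - \<tau>" i] \<tau> i by simp
        qed (use xi[OF i] in \<open>simp add: z_def\<close>)
        then show ?thesis by (simp add: near_def)
      qed
      then have c: "\<bar>D k (z 0 \<tau>) - D k x\<bar> \<le> C * \<delta>"
        using K\<delta>0 by (intro C3[OF x\<rho>0 z\<rho>0 \<delta>(1)] \<tau>) auto
      have "a / 2 * (K * \<delta>) = C * \<delta> + a / 2 * \<delta>"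
        using arg_cong[OF K(2), of "\<lambda>u. u * \<delta>"] by (simp add: distrib_right mult.assoc)
      moreover have "0 \<le> a / 2 * \<delta>" using a \<delta>(1) by simp
      ultimately have Cle: "C * \<delta> \<le> a / 2 * (K * \<delta>)" by linarith
      have up: "D k x \<le> D k (z (K * \<delta>) \<tau>)"
        using mono[of 0 "K * \<delta>" \<tau>] K\<delta>0 \<tau> c Cle by simp
      have low: "D k (z (- (K * \<delta>)) \<tau>) \<le> D k x"
        using mono[of "- (K * \<delta>)" 0 \<tau>] K\<delta>0 \<tau> c Cle by simp
      have "continuous_on {- (K * \<delta>)..K * \<delta>} (\<lambda>X. D k (z X \<tau>))"
        by (rule DERIV_continuous_on, rule has_field_derivative_at_within, rule deriv[OF _ \<tau>]) auto
      from IVT'[OF low up _ this] K\<delta>0 show ?thesis by (auto simp: abs_le_iff)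
    qed
    then have "\<forall>\<tau>\<in>{0..1}. \<exists>X. \<bar>X\<bar> \<le> K * \<delta> \<and> D k (z X \<tau>) = D k x" by blast
    \<comment> \<open>The solution is selected for each tau separately; that it is Lipschitz in tau
      follows afterwards from the lower bound \<open>inj\<close>.\<close>
    from bchoice[OF this] obtain X where "\<forall>\<tau>\<in>{0..1}. \<bar>X \<tau>\<bar> \<le> K * \<delta> \<and> D k (z (X \<tau>) \<tau>) = D k x" ..
    then have X: "\<And>\<tau>. \<tau> \<in> {0..1} \<Longrightarrow> \<bar>X \<tau>\<bar> \<le> K * \<delta>" "\<And>\<tau>. \<tau> \<in> {0..1} \<Longrightarrow> D k (z (X \<tau>) \<tau>) = D k x"
      by blast+
    have inj: "a / 2 * \<bar>Y - Z\<bar> \<le> \<bar>D k (z Y \<tau>) - D k (z Z \<tau>)\<bar>"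
      if "\<bar>Y\<bar> \<le> K * \<delta>" "\<bar>Z\<bar> \<le> K * \<delta>" "\<tau> \<in> {0..1}" for Y Z \<tau>
    proof (cases "Y \<le> Z")
      case True
      then show ?thesis using mono[OF that(1,2) True that(3)] by (simp add: abs_if)
    next
      case False
      then have YZ: "Z \<le> Y" "\<bar>Y - Z\<bar> = Y - Z" by simp_all
      show ?thesis
        unfolding YZ(2) by (rule order_trans[OF mono[OF that(2,1) YZ(1) that(3)] abs_ge_self])
    qed
    define p where "p \<tau> = z (X \<tau>) \<tau>" for \<tau>
    have p\<rho>: "p \<tau> \<in> cbox_at_0 n \<rho>" and p\<rho>0: "p \<tau> \<in> cbox_at_0 n \<rho>0" if "\<tau> \<in> {0..1}" for \<tau>
      unfolding p_def using z\<rho>[OF X(1)] z\<rho>0[OF X(1)] that by blast+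
    have lip: "near (p \<sigma>) (p \<tau>) (K * \<delta> * \<bar>\<tau> - \<sigma>\<bar>)" if \<sigma>: "\<sigma> \<in> {0..1}" and \<tau>: "\<tau> \<in> {0..1}" for \<sigma> \<tau>
      unfolding near_def
    proof
      fix i assume i: "i \<in> {1..n}"
      have dx: "\<bar>\<tau> - \<sigma>\<bar> * \<bar>x i\<bar> \<le> \<bar>\<tau> - \<sigma>\<bar> * \<delta>" if "i \<in> {1..n}" for i
        by (rule mult_left_mono[OF xi[OF that]]) simp
      show "\<bar>p \<tau> i - p \<sigma> i\<bar> \<le> K * \<delta> * \<bar>\<tau> - \<sigma>\<bar>"
      proof (cases "i = k")
        case True
        have "near (z (X \<tau>) \<tau>) (z (X \<tau>) \<sigma>) (\<bar>\<tau> - \<sigma>\<bar> * \<delta>)"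
          unfolding near_def
        proof
          fix j assume j: "j \<in> {1..n}"
          have "\<bar>z (X \<tau>) \<sigma> j - z (X \<tau>) \<tau> j\<bar> \<le> \<bar>\<tau> - \<sigma>\<bar> * \<bar>x j\<bar>"
            by (simp add: z_def abs_minus_commute flip: left_diff_distrib abs_mult)
          then show "\<bar>z (X \<tau>) \<sigma> j - z (X \<tau>) \<tau> j\<bar> \<le> \<bar>\<tau> - \<sigma>\<bar> * \<delta>"
            using dx[OF j] by (rule order_trans)
        qed
        then have "\<bar>D k (z (X \<tau>) \<sigma>) - D k (z (X \<tau>) \<tau>)\<bar> \<le> C * (\<bar>\<tau> - \<sigma>\<bar> * \<delta>)"
          using \<delta>(1) by (intro C3 z\<rho>0 X(1) \<sigma> \<tau>) auto
        then have "\<bar>D k (z (X \<tau>) \<sigma>) - D k (z (X \<sigma>) \<sigma>)\<bar> \<le> C * (\<bar>\<tau> - \<sigma>\<bar> * \<delta>)"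
          by (simp only: X(2)[OF \<tau>] X(2)[OF \<sigma>])
        with inj[OF X(1)[OF \<tau>] X(1)[OF \<sigma>] \<sigma>]
        have "a / 2 * \<bar>X \<tau> - X \<sigma>\<bar> \<le> C * (\<bar>\<tau> - \<sigma>\<bar> * \<delta>)" by (rule order_trans)
        also have "\<dots> \<le> a / 2 * K * (\<bar>\<tau> - \<sigma>\<bar> * \<delta>)"
          unfolding K(2) using a \<delta>(1) by (intro mult_right_mono) auto
        finally have "\<bar>X \<tau> - X \<sigma>\<bar> \<le> K * (\<bar>\<tau> - \<sigma>\<bar> * \<delta>)" using a by (simp add: mult.assoc)
        then show ?thesis using True by (simp add: p_def z_def mult_ac)
      next
        case False
        then have "\<bar>p \<tau> i - p \<sigma> i\<bar> = \<bar>\<tau> - \<sigma>\<bar> * \<bar>x i\<bar>"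
          by (simp add: p_def z_def flip: left_diff_distrib abs_mult)
        also have "\<dots> \<le> \<bar>\<tau> - \<sigma>\<bar> * (K * \<delta>)"
          using xi[OF i] \<delta>K by (intro mult_left_mono) auto
        finally show ?thesis by (simp add: mult_ac)
      qed
    qed
    define e where "e \<sigma> \<tau> = K * \<delta> * \<bar>\<tau> - \<sigma>\<bar>" for \<sigma> \<tau> :: real
    have e0: "0 \<le> e \<sigma> \<tau>" for \<sigma> \<tau> unfolding e_def using K(1) \<delta>(1) by simp
    \<comment> \<open>The k-th derivative is constant along the path, so its linear increment is
      quadratically small. By the minors the other linear increments are multiples of it, with the
      bounded factor H i k / H k k.\<close>
    have Dinc: "\<bar>D i (p \<tau>) - D i (p \<sigma>)\<bar> \<le> (C * C * 2 / a + C) * (K * \<delta>)\<^sup>2 * \<bar>\<tau> - \<sigma>\<bar>\<^sup>2"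
      if i: "i \<in> {1..n}" and \<sigma>: "\<sigma> \<in> {0..1}" and \<tau>: "\<tau> \<in> {0..1}" for i \<sigma> \<tau>
    proof -
      let ?S = "\<lambda>i. \<Sum>j=1..n. H i j (p \<sigma>) * (p \<tau> j - p \<sigma> j)"
      have S: "\<bar>D i (p \<tau>) - D i (p \<sigma>) - ?S i\<bar> \<le> C * (e \<sigma> \<tau>)\<^sup>2" if "i \<in> {1..n}" for i
        using lip[OF \<sigma> \<tau>] by (intro C2 that p\<rho>0 \<sigma> \<tau> e0) (simp add: e_def)
      have Sk: "\<bar>?S k\<bar> \<le> C * (e \<sigma> \<tau>)\<^sup>2"
        using S[OF k] X(2)[OF \<sigma>] X(2)[OF \<tau>] by (simp add: p_def)
      have h: "a / 2 \<le> H k k (p \<sigma>)" by (rule Hkk[OF p\<rho>[OF \<sigma>]])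
      have "?S i * H k k (p \<sigma>) = (\<Sum>j=1..n. (H i j (p \<sigma>) * H k k (p \<sigma>)) * (p \<tau> j - p \<sigma> j))"
        unfolding sum_distrib_right by (rule sum.cong) (simp_all only: mult_ac)
      also have "\<dots> = (\<Sum>j=1..n. (H i k (p \<sigma>) * H k j (p \<sigma>)) * (p \<tau> j - p \<sigma> j))"
        by (rule sum.cong) (simp_all only: minors[OF cbox_at_0_mono[OF p\<rho>[OF \<sigma>] \<rho>(3)] i])
      also have "\<dots> = H i k (p \<sigma>) * ?S k" by (simp add: sum_distrib_left mult_ac)
      finally have eq0: "?S i * H k k (p \<sigma>) = H i k (p \<sigma>) * ?S k" .
      have hpos: "0 < H k k (p \<sigma>)" using h a by linarith
      have eq: "\<bar>?S i\<bar> * H k k (p \<sigma>) = \<bar>H i k (p \<sigma>)\<bar> * \<bar>?S k\<bar>"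
        using arg_cong[OF eq0, of abs] unfolding abs_mult abs_of_pos[OF hpos] .
      have "p \<sigma> \<in> cbox_at_0 n (R / 3)" using cbox_at_0_mono[OF p\<rho>0[OF \<sigma>]] \<rho>0(4) by simp
      then have "\<bar>H i k (p \<sigma>)\<bar> * \<bar>?S k\<bar> \<le> C * (C * (e \<sigma> \<tau>)\<^sup>2)"
        using C by (intro mult_mono C5[OF i] Sk) auto
      moreover have "\<bar>?S i\<bar> * (a / 2) \<le> \<bar>?S i\<bar> * H k k (p \<sigma>)" by (rule mult_left_mono[OF h]) simp
      ultimately have "\<bar>?S i\<bar> * (a / 2) \<le> C * (C * (e \<sigma> \<tau>)\<^sup>2)" using eq by linarith
      then have "\<bar>?S i\<bar> \<le> C * C * 2 / a * (e \<sigma> \<tau>)\<^sup>2" using a by (simp add: field_simps)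
      moreover have "\<bar>D i (p \<tau>) - D i (p \<sigma>)\<bar> \<le> \<bar>D i (p \<tau>) - D i (p \<sigma>) - ?S i\<bar> + \<bar>?S i\<bar>"
        by linarith
      ultimately have "\<bar>D i (p \<tau>) - D i (p \<sigma>)\<bar> \<le> C * (e \<sigma> \<tau>)\<^sup>2 + C * C * 2 / a * (e \<sigma> \<tau>)\<^sup>2"
        using S[OF i] by linarith
      then show ?thesis by (simp add: e_def power_mult_distrib distrib_right algebra_simps)
    qed
    \<comment> \<open>At tau = 1 the point x itself solves the level equation, and strict
      monotonicity in the k-th coordinate leaves no other solution in range.\<close>
    have p1: "p 1 = x"
    proof -
      have "a / 2 * \<bar>X 1 - x k\<bar> \<le> \<bar>D k (z (X 1) 1) - D k (z (x k) 1)\<bar>"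
        using xi[OF k] \<delta>K by (intro inj X(1)) auto
      moreover have zx: "z (x k) 1 = x" by (auto simp: z_def)
      ultimately have "a / 2 * \<bar>X 1 - x k\<bar> \<le> 0" using X(2)[of 1] by simp
      then have "X 1 = x k" using a by (simp add: mult_le_0_iff)
      then show ?thesis unfolding p_def using zx by simp
    qed
    have p0: "p 0 = axis_pt k (X 0)" by (auto simp: p_def z_def axis_pt_def)
    have Dconst: "D i (p \<tau>) = D i x" if "i \<in> {1..n}" "\<tau> \<in> {0..1}" for i \<tau>
    proof -
      have "\<forall>t\<in>{0..1}. D i (p t) = D i (p 0)"
        by (rule constant_if_quadratic_increments) (rule Dinc[OF that(1)])
      then have c: "D i (p t) = D i (p 0)" if "t \<in> {0..1}" for t using that by blast
      have "D i (p 1) = D i (p 0)" by (rule c) simp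
      with c[OF that(2)] show ?thesis by (simp only: p1)
    qed
    \<comment> \<open>The gradient is now known to be constant along the path, so the linear
      increment of G is that of a fixed linear form; subtracting this form leaves increments of
      second order.\<close>
    have "\<forall>t\<in>{0..1}. G (p t) - (\<Sum>i=1..n. D i x * p t i) = G (p 0) - (\<Sum>i=1..n. D i x * p 0 i)"
    proof (rule constant_if_quadratic_increments)
      fix \<sigma> \<tau> :: real assume \<sigma>: "\<sigma> \<in> {0..1}" and \<tau>: "\<tau> \<in> {0..1}"
      have "\<bar>G (p \<tau>) - G (p \<sigma>) - (\<Sum>i=1..n. D i (p \<sigma>) * (p \<tau> i - p \<sigma> i))\<bar> \<le> C * (e \<sigma> \<tau>)\<^sup>2"
        using lip[OF \<sigma> \<tau>] by (intro C1 p\<rho>0 \<sigma> \<tau> e0) (simp add: e_def)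
      moreover have "(\<Sum>i=1..n. D i (p \<sigma>) * (p \<tau> i - p \<sigma> i)) = (\<Sum>i=1..n. D i x * p \<tau> i) - (\<Sum>i=1..n. D i x * p \<sigma> i)"
        unfolding sum_subtractf[symmetric] by (rule sum.cong) (simp_all only: Dconst[OF _ \<sigma>] right_diff_distrib)
      moreover have "G (p \<tau>) - G (p \<sigma>) - ((\<Sum>i=1..n. D i x * p \<tau> i) - (\<Sum>i=1..n. D i x * p \<sigma> i))
          = (G (p \<tau>) - (\<Sum>i=1..n. D i x * p \<tau> i)) - (G (p \<sigma>) - (\<Sum>i=1..n. D i x * p \<sigma> i))" by simp
      ultimately show "\<bar>(G (p \<tau>) - (\<Sum>i=1..n. D i x * p \<tau> i)) - (G (p \<sigma>) - (\<Sum>i=1..n. D i x * p \<sigma> i))\<bar>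
          \<le> C * (K * \<delta>)\<^sup>2 * \<bar>\<tau> - \<sigma>\<bar>\<^sup>2"
        by (simp only: e_def power_mult_distrib mult.assoc)
    qed
    then have "G (p 1) - (\<Sum>i=1..n. D i x * p 1 i) = G (p 0) - (\<Sum>i=1..n. D i x * p 0 i)"
      by (rule bspec) simp
    then have "G x - (\<Sum>i=1..n. D i x * x i) = G (axis_pt k (X 0)) - (\<Sum>i=1..n. D i x * axis_pt k (X 0) i)"
      by (simp only: p0 p1)
    moreover have D0: "D i x = D i (axis_pt k (X 0))" if "i \<in> {1..n}" for i
      using Dconst[OF that, of 0] p0 by simp
    ultimately show ?thesis
      using X(1)[of 0] D0[OF k] unfolding sum_axis[OF k]
      by (intro exI[of _ "X 0"]) (simp add: mult.commute)
  qed
  show ?thesis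
    using \<rho>(1) K(1) main by (intro exI[of _ "\<rho> / K"] conjI exI[of _ K]) auto
qed

subsection \<open>Affine coordinates and homogeneity\<close>

abbreviation euc :: "nat \<Rightarrow> point set" where
  "euc N \<equiv> topspace (Euclidean_space N)"

lemma euc_iff: "x \<in> euc N \<longleftrightarrow> (\<forall>i\<ge>N. x i = 0)"
  by (simp add: topspace_Euclidean_space)

lemma openin_Euclidean_space_iff:
  "openin (Euclidean_space N) U \<longleftrightarrow> (\<exists>W. openin (powertop_real UNIV) W \<and> U = W \<inter> euc N)"
  unfolding Euclidean_space_def openin_subtopology by (simp add: Collect_mono_iff)

text \<open>The topology is a restricted product topology, so convergence of every coordinate is
  convergence.\<close>

lemma eventually_in_open:
  assumes "openin (Euclidean_space N) U" "p \<in> U"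
    and lim: "\<And>i. ((\<lambda>t. \<gamma> t i) \<longlongrightarrow> p i) F" and E: "\<forall>\<^sub>F t in F. \<gamma> t \<in> euc N"
  shows "\<forall>\<^sub>F t in F. \<gamma> t \<in> U"
proof -
  obtain W where W: "openin (powertop_real UNIV) W" "U = W \<inter> euc N"
    using assms(1) by (auto simp: openin_Euclidean_space_iff)
  have "limitin (powertop_real UNIV) \<gamma> p F"
    using lim by (simp add: limitin_componentwise)
  then have "\<forall>\<^sub>F t in F. \<gamma> t \<in> W"
    using W assms(2) by (simp add: limitin_def)
  then show ?thesis using E by eventually_elim (simp add: W(2))
qed

lemma derivative_imp_tendsto_nhds:
  fixes f :: "real \<Rightarrow> real"
  assumes "(f has_real_derivative v) (at 0)"
  shows "(f \<longlongrightarrow> f 0) (nhds 0)"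
  using DERIV_isCont[OF assms] by (simp add: isCont_def tendsto_at_iff_tendsto_nhds)

lemma tangent_space_mono_local:
  assumes "A \<inter> U \<subseteq> B" "openin (Euclidean_space N) U" "p \<in> U" "A \<subseteq> euc N"
  shows "tangent_space A p \<subseteq> tangent_space B p"
proof
  fix v assume "v \<in> tangent_space A p"
  then obtain \<gamma> where \<gamma>: "\<gamma> 0 = p" "\<forall>\<^sub>F t in nhds (0::real). \<gamma> t \<in> A"
    "\<And>i. ((\<lambda>t. \<gamma> t i) has_real_derivative v i) (at 0)"
    unfolding tangent_space_def by blast
  have "((\<lambda>t. \<gamma> t i) \<longlongrightarrow> p i) (nhds 0)" for i
    using derivative_imp_tendsto_nhds[OF \<gamma>(3)[of i]] \<gamma>(1) by simp
  moreover have "\<forall>\<^sub>F t in nhds 0. \<gamma> t \<in> euc N"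
    using \<gamma>(2) assms(4) by (auto elim: eventually_mono)
  ultimately have "\<forall>\<^sub>F t in nhds 0. \<gamma> t \<in> U"
    by (rule eventually_in_open[OF assms(2,3)])
  with \<gamma>(2) have "\<forall>\<^sub>F t in nhds 0. \<gamma> t \<in> B"
    by eventually_elim (use assms(1) in auto)
  then show "v \<in> tangent_space B p" using \<gamma>(1,3) unfolding tangent_space_def by blast
qed

lemma tangent_space_local:
  assumes "A \<inter> U = B \<inter> U" "openin (Euclidean_space N) U" "p \<in> U" "A \<subseteq> euc N" "B \<subseteq> euc N"
  shows "tangent_space A p = tangent_space B p"
  using tangent_space_mono_local[of A U B N p] tangent_space_mono_local[of B U A N p] assms by blast

lemma locally_equal_sym: "locally_equal N p A B \<Longrightarrow> locally_equal N p B A"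
  unfolding locally_equal_def by metis

lemma locally_equal_refl: "p \<in> euc N \<Longrightarrow> locally_equal N p A A"
  unfolding locally_equal_def using openin_topspace by blast

lemma locally_equal_trans:
  assumes "locally_equal N p A B" "locally_equal N p B C"
  shows "locally_equal N p A C"
proof -
  obtain U V where "openin (Euclidean_space N) U" "p \<in> U" "A \<inter> U = B \<inter> U"
    "openin (Euclidean_space N) V" "p \<in> V" "B \<inter> V = C \<inter> V"
    using assms unfolding locally_equal_def by metis
  then show ?thesis
    unfolding locally_equal_def by (intro exI[of _ "U \<inter> V"] conjI openin_Int) auto
qed

lemma sym_algebra_mono_local:
  assumes "locally_equal (Suc n) p A B" "A \<subseteq> euc (Suc n)" "B \<subseteq> euc (Suc n)"
  shows "sym_algebra n A p \<subseteq> sym_algebra n B p"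
proof
  fix L assume "L \<in> sym_algebra n A p"
  then obtain U where L: "affine_map (Suc n) L" and U: "openin (Euclidean_space (Suc n)) U" "p \<in> U"
    "\<And>q. q \<in> A \<inter> U \<Longrightarrow> L q \<in> tangent_space A q"
    unfolding sym_algebra_def by blast
  obtain V where V: "openin (Euclidean_space (Suc n)) V" "p \<in> V" "A \<inter> V = B \<inter> V"
    using assms(1) unfolding locally_equal_def by metis
  have "L q \<in> tangent_space B q" if "q \<in> B \<inter> (U \<inter> V)" for q
  proof -
    have "q \<in> A \<inter> U" "q \<in> V" using that V(3) by blast+
    then show ?thesis using U(3) tangent_space_local[OF V(3,1) _ assms(2,3)] by blast
  qed
  then show "L \<in> sym_algebra n B p"
    unfolding sym_algebra_def using L U V
    by (intro CollectI conjI exI[of _ "U \<inter> V"] openin_Int) auto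
qed

lemma affinely_homogeneous_local:
  assumes "locally_equal (Suc n) p A B" "A \<subseteq> euc (Suc n)" "B \<subseteq> euc (Suc n)"
    "affinely_homogeneous n A p"
  shows "affinely_homogeneous n B p"
proof -
  have "sym_algebra n A p = sym_algebra n B p"
    using sym_algebra_mono_local[OF assms(1-3)]
      sym_algebra_mono_local[OF locally_equal_sym[OF assms(1)] assms(3,2)] by blast
  moreover have "tangent_space A p = tangent_space B p"
    using assms(1) tangent_space_local[OF _ _ _ assms(2,3)] unfolding locally_equal_def by metis
  ultimately show ?thesis using assms(4) by (simp add: affinely_homogeneous_def)
qed

lemma real_span_superset: "S \<subseteq> real_span S"
proof
  fix v assume "v \<in> S"
  then show "v \<in> real_span S"
    unfolding real_span_def by (intro CollectI exI[of _ "{v}"] exI[of _ "\<lambda>_. 1"]) auto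
qed

lemma real_span_zero: "(\<lambda>i. 0) \<in> real_span S"
  unfolding real_span_def by (intro CollectI exI[of _ "{}"]) auto

lemma real_span_scale:
  assumes "v \<in> real_span S"
  shows "(\<lambda>i. a * v i) \<in> real_span S"
proof -
  obtain T c where T: "v = (\<lambda>i. \<Sum>w\<in>T. c w * w i)" "finite T" "T \<subseteq> S"
    using assms unfolding real_span_def by blast
  have "(\<lambda>i. a * v i) = (\<lambda>i. \<Sum>w\<in>T. (a * c w) * w i)"
    by (simp add: T(1) sum_distrib_left mult.assoc)
  with T(2,3) show ?thesis
    unfolding real_span_def by (intro CollectI exI[of _ T] exI[of _ "\<lambda>w. a * c w"] conjI)
qed

lemma real_span_add:
  assumes "v \<in> real_span S" "w \<in> real_span S"
  shows "(\<lambda>i. v i + w i) \<in> real_span S"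
proof -
  obtain T c where T: "v = (\<lambda>i. \<Sum>w\<in>T. c w * w i)" "finite T" "T \<subseteq> S"
    using assms unfolding real_span_def by blast
  obtain T' c' where T': "w = (\<lambda>i. \<Sum>w\<in>T'. c' w * w i)" "finite T'" "T' \<subseteq> S"
    using assms unfolding real_span_def by blast
  define d where "d u = (if u \<in> T then c u else 0) + (if u \<in> T' then c' u else 0)" for u
  have "v i + w i = (\<Sum>u\<in>T \<union> T'. d u * u i)" for i
  proof -
    have "v i = (\<Sum>u\<in>T \<union> T'. (if u \<in> T then c u else 0) * u i)"
      unfolding T(1) using T T' by (intro sum.mono_neutral_cong_left) auto
    moreover have "w i = (\<Sum>u\<in>T \<union> T'. (if u \<in> T' then c' u else 0) * u i)"
      unfolding T'(1) using T T' by (intro sum.mono_neutral_cong_left) auto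
    ultimately show ?thesis by (simp add: d_def sum.distrib distrib_right)
  qed
  then have "(\<lambda>i. v i + w i) = (\<lambda>i. \<Sum>u\<in>T \<union> T'. d u * u i)" by blast
  moreover have "finite (T \<union> T')" "T \<union> T' \<subseteq> S" using T T' by auto
  ultimately show ?thesis unfolding real_span_def by blast
qed

lemma real_span_sum:
  assumes "finite T" "\<And>v. v \<in> T \<Longrightarrow> f v \<in> real_span S"
  shows "(\<lambda>i. \<Sum>v\<in>T. c v * f v i) \<in> real_span S"
  using assms
proof (induction T rule: finite_induct)
  case (insert w T)
  then have "(\<lambda>i. c w * f w i + (\<Sum>v\<in>T. c v * f v i)) \<in> real_span S"
    using real_span_add[of "\<lambda>i. c w * f w i" S "\<lambda>i. \<Sum>v\<in>T. c v * f v i"] real_span_scale by blast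
  then show ?case using insert.hyps by simp
qed (simp add: real_span_zero)

section \<open>Affine maps, their differentials and inverses\<close>

definition linear_part :: "(point \<Rightarrow> point) \<Rightarrow> point \<Rightarrow> point" where
  "linear_part \<phi> v = (\<lambda>i. \<phi> v i - \<phi> (\<lambda>_. 0) i)"

lemma affine_map_matrix:
  assumes "affine_map N \<phi>"
  shows "\<exists>M b. (\<forall>p i. \<phi> p i = (if i < N then b i + (\<Sum>j<N. M i j * p j) else 0)) \<and>
    (\<forall>v i. linear_part \<phi> v i = (if i < N then (\<Sum>j<N. M i j * v j) else 0))"
proof -
  obtain M b where M: "\<And>p i. \<phi> p i = (if i < N then b i + (\<Sum>j<N. M i j * p j) else 0)"
    using assms unfolding affine_map_def by blast
  then show ?thesis by (intro exI[of _ M] exI[of _ b]) (auto simp: linear_part_def)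
qed

lemma affine_map_in_euc: "affine_map N \<phi> \<Longrightarrow> \<phi> p \<in> euc N"
  by (auto simp: affine_map_def euc_iff)

lemma affine_map_comp:
  assumes "affine_map N f" "affine_map N g"
  shows "affine_map N (\<lambda>p. f (g p))"
proof -
  obtain M b where f: "\<And>p i. f p i = (if i < N then b i + (\<Sum>j<N. M i j * p j) else 0)"
    using assms(1) unfolding affine_map_def by blast
  obtain M' b' where g: "\<And>p i. g p i = (if i < N then b' i + (\<Sum>j<N. M' i j * p j) else 0)"
    using assms(2) unfolding affine_map_def by blast
  have "f (g p) i = (if i < N then (b i + (\<Sum>j<N. M i j * b' j)) + (\<Sum>l<N. (\<Sum>j<N. M i j * M' j l) * p l) else 0)"
    for p i
  proof -
    have "(\<Sum>j<N. M i j * g p j) = (\<Sum>j<N. M i j * b' j) + (\<Sum>j<N. \<Sum>l<N. M i j * M' j l * p l)"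
      by (simp add: g distrib_left sum.distrib sum_distrib_left mult.assoc)
    also have "(\<Sum>j<N. \<Sum>l<N. M i j * M' j l * p l) = (\<Sum>l<N. (\<Sum>j<N. M i j * M' j l) * p l)"
      unfolding sum_distrib_right by (rule sum.swap)
    finally show ?thesis by (simp add: f)
  qed
  then show ?thesis unfolding affine_map_def
    by (intro exI[of _ "\<lambda>i l. \<Sum>j<N. M i j * M' j l"] exI[of _ "\<lambda>i. b i + (\<Sum>j<N. M i j * b' j)"]) blast
qed

lemma affine_map_linear_part:
  assumes "affine_map N \<phi>"
  shows "affine_map N (linear_part \<phi>)"
proof -
  obtain M where "\<And>v i. linear_part \<phi> v i = (if i < N then (\<Sum>j<N. M i j * v j) else 0)"
    using affine_map_matrix[OF assms] by blast
  then show ?thesis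
    unfolding affine_map_def by (intro exI[of _ M] exI[of _ "\<lambda>_. 0"]) simp
qed

lemma linear_part_sum:
  assumes "affine_map N \<phi>"
  shows "linear_part \<phi> (\<lambda>i. \<Sum>v\<in>T. c v * f v i) = (\<lambda>i. \<Sum>v\<in>T. c v * linear_part \<phi> (f v) i)"
proof
  fix i
  obtain M b where L: "\<And>v i. linear_part \<phi> v i = (if i < N then (\<Sum>j<N. M i j * v j) else 0)"
    using affine_map_matrix[OF assms] by blast
  have "(\<Sum>j<N. M i j * (\<Sum>v\<in>T. c v * f v j)) = (\<Sum>v\<in>T. c v * (\<Sum>j<N. M i j * f v j))"
    unfolding sum_distrib_left by (subst sum.swap) (simp add: mult_ac)
  then show "linear_part \<phi> (\<lambda>i. \<Sum>v\<in>T. c v * f v i) i = (\<Sum>v\<in>T. c v * linear_part \<phi> (f v) i)"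
    by (simp add: L)
qed

lemma linear_part_diff:
  assumes "affine_map N \<phi>"
  shows "linear_part \<phi> (\<lambda>i. p i - q i) = (\<lambda>i. \<phi> p i - \<phi> q i)"
proof
  fix i
  obtain M b where "\<And>p i. \<phi> p i = (if i < N then b i + (\<Sum>j<N. M i j * p j) else 0)"
    "\<And>v i. linear_part \<phi> v i = (if i < N then (\<Sum>j<N. M i j * v j) else 0)"
    using affine_map_matrix[OF assms] by blast
  then show "linear_part \<phi> (\<lambda>i. p i - q i) i = \<phi> p i - \<phi> q i"
    by (simp add: right_diff_distrib sum_subtractf)
qed

lemma affine_map_derivative:
  assumes "affine_map N \<phi>" "\<And>i. ((\<lambda>t. \<gamma> t i) has_real_derivative v i) (at t0)"
  shows "((\<lambda>t. \<phi> (\<gamma> t) i) has_real_derivative linear_part \<phi> v i) (at t0)"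
proof -
  obtain M b where "\<And>p i. \<phi> p i = (if i < N then b i + (\<Sum>j<N. M i j * p j) else 0)"
    "\<And>v i. linear_part \<phi> v i = (if i < N then (\<Sum>j<N. M i j * v j) else 0)"
    using affine_map_matrix[OF assms(1)] by blast
  then show ?thesis
    by (cases "i < N") (auto intro!: derivative_eq_intros assms(2) sum.cong simp: mult.commute)
qed

lemma affine_map_preimage_open:
  assumes "affine_map N \<phi>" "openin (Euclidean_space N) U"
  shows "openin (Euclidean_space N) {p \<in> euc N. \<phi> p \<in> U}"
proof -
  obtain M b where \<phi>: "\<And>p i. \<phi> p i = (if i < N then b i + (\<Sum>j<N. M i j * p j) else 0)"
    using affine_map_matrix[OF assms(1)] by blast
  have coord: "continuous_map (Euclidean_space N) euclideanreal (\<lambda>p. p i)" for i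
    unfolding Euclidean_space_def
    by (intro continuous_map_from_subtopology continuous_map_product_projection) auto
  have "continuous_map (Euclidean_space N) euclideanreal (\<lambda>p. b i + (\<Sum>j<N. M i j * p j))" for i
    by (intro continuous_intros coord) auto
  then have "continuous_map (Euclidean_space N) (Euclidean_space N)
      (\<lambda>p i. if i < N then b i + (\<Sum>j<N. M i j * p j) else 0)"
    unfolding continuous_map_componentwise_Euclidean_space by simp
  then have "continuous_map (Euclidean_space N) (Euclidean_space N) \<phi>"
    by (rule continuous_map_eq) (auto simp: \<phi>)
  then show ?thesis using assms(2) by (rule openin_continuous_map_preimage)
qed

text \<open>The set-theoretic inverse is not known to be affine. An affine map is built from its
  values at 0 and at the unit vectors; linearity makes this a right inverse, and injectivity then
  makes it a left inverse.\<close>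

lemma affine_coordinates_inverse:
  assumes "affine_coordinates N \<phi>"
  obtains \<psi> where "affine_map N \<psi>" "\<forall>p\<in>euc N. \<psi> (\<phi> p) = p" "\<forall>p\<in>euc N. \<phi> (\<psi> p) = p"
proof -
  have aff: "affine_map N \<phi>" and bij: "bij_betw \<phi> (euc N) (euc N)"
    using assms by (auto simp: affine_coordinates_def)
  obtain M b where \<phi>: "\<And>p i. \<phi> p i = (if i < N then b i + (\<Sum>j<N. M i j * p j) else 0)"
    using affine_map_matrix[OF aff] by blast
  define \<psi>0 where "\<psi>0 = inv_into (euc N) \<phi>"
  have \<psi>0: "\<phi> (\<psi>0 q) = q" if "q \<in> euc N" for q
    unfolding \<psi>0_def by (rule bij_betw_inv_into_right[OF bij that])
  define e where "e j = (\<lambda>i. if i = j then 1 else 0 :: real)" for j :: nat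
  have e: "e j \<in> euc N" if "j < N" for j using that by (auto simp: e_def euc_iff)
  have z: "(\<lambda>_. 0) \<in> euc N" by (simp add: euc_iff)
  define c where "c = \<psi>0 (\<lambda>_. 0)"
  define \<psi> where "\<psi> q = (\<lambda>i. if i < N then c i + (\<Sum>j<N. (\<psi>0 (e j) i - c i) * q j) else 0)" for q
  have aff': "affine_map N \<psi>"
    unfolding affine_map_def \<psi>_def
    by (intro exI[of _ "\<lambda>i j. \<psi>0 (e j) i - c i"] exI[of _ c]) simp
  have A: "b i + (\<Sum>l<N. M i l * c l) = 0" if "i < N" for i
    using \<psi>0[OF z] that \<phi>[of c i] by (simp add: c_def)
  have B: "b i + (\<Sum>l<N. M i l * \<psi>0 (e j) l) = e j i" if "i < N" "j < N" for i j
    using \<psi>0[OF e[OF that(2)]] that \<phi>[of "\<psi>0 (e j)" i] by simp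
  have C: "(\<Sum>l<N. M i l * (\<psi>0 (e j) l - c l)) = e j i" if "i < N" "j < N" for i j
    using A[OF that(1)] B[OF that] by (simp add: right_diff_distrib sum_subtractf)
  have inv: "\<phi> (\<psi> q) = q" if q: "q \<in> euc N" for q
  proof
    fix i
    show "\<phi> (\<psi> q) i = q i"
    proof (cases "i < N")
      case True
      have "(\<Sum>l<N. M i l * (\<Sum>j<N. (\<psi>0 (e j) l - c l) * q j))
          = (\<Sum>j<N. (\<Sum>l<N. M i l * (\<psi>0 (e j) l - c l)) * q j)"
        unfolding sum_distrib_left sum_distrib_right by (subst sum.swap) (simp add: mult.assoc)
      also have "\<dots> = (\<Sum>j<N. e j i * q j)"
        by (rule sum.cong) (simp_all add: C True)
      also have "\<dots> = (\<Sum>j<N. if j = i then q i else 0)"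
        by (rule sum.cong) (auto simp: e_def)
      also have "\<dots> = q i" using True by simp
      finally show ?thesis
        using True A[OF True] by (simp add: \<phi> \<psi>_def distrib_left sum.distrib)
    qed (use q in \<open>simp add: \<phi> euc_iff\<close>)
  qed
  moreover have "\<psi> (\<phi> p) = p" if p: "p \<in> euc N" for p
  proof -
    have "\<phi> (\<psi> (\<phi> p)) = \<phi> p" by (rule inv) (rule affine_map_in_euc[OF aff])
    then show ?thesis
      using bij p affine_map_in_euc[OF aff'] by (auto simp: bij_betw_def dest: inj_onD)
  qed
  ultimately show ?thesis using aff' by (intro that[of \<psi>] ballI)
qed

lemma affine_coordinatesI:
  assumes "affine_map N \<phi>" "affine_map N \<psi>" "\<forall>p\<in>euc N. \<psi> (\<phi> p) = p" "\<forall>p\<in>euc N. \<phi> (\<psi> p) = p"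
  shows "affine_coordinates N \<phi>"
  unfolding affine_coordinates_def
proof
  show "bij_betw \<phi> (euc N) (euc N)"
    by (rule bij_betwI[where g = \<psi>]) (use assms affine_map_in_euc in auto)
qed (rule assms(1))

lemma affine_coordinates_comp:
  assumes "affine_coordinates N f" "affine_coordinates N g"
  shows "affine_coordinates N (\<lambda>p. f (g p))"
proof -
  have "bij_betw (f \<circ> g) (euc N) (euc N)"
    using assms by (auto simp: affine_coordinates_def intro: bij_betw_trans)
  moreover have "affine_map N (\<lambda>p. f (g p))"
    using assms by (auto simp: affine_coordinates_def intro: affine_map_comp)
  ultimately show ?thesis by (simp add: affine_coordinates_def comp_def)
qed

lemma locally_equal_image:
  assumes "affine_coordinates N \<phi>" "locally_equal N p A B" "A \<subseteq> euc N" "B \<subseteq> euc N"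
  shows "locally_equal N (\<phi> p) (\<phi> ` A) (\<phi> ` B)"
proof -
  obtain \<psi> where \<psi>: "affine_map N \<psi>" "\<forall>p\<in>euc N. \<psi> (\<phi> p) = p" "\<forall>p\<in>euc N. \<phi> (\<psi> p) = p"
    using affine_coordinates_inverse[OF assms(1)] by blast
  obtain U where U: "openin (Euclidean_space N) U" "p \<in> U" "A \<inter> U = B \<inter> U"
    using assms(2) unfolding locally_equal_def by blast
  have sub: "U \<subseteq> euc N" using U(1) by (rule openin_subset)
  have aff: "affine_map N \<phi>" using assms(1) by (simp add: affine_coordinates_def)
  have "\<phi> ` X \<inter> {q \<in> euc N. \<psi> q \<in> U} = \<phi> ` (X \<inter> U)" if "X \<subseteq> euc N" for X
    using that sub \<psi> affine_map_in_euc[OF aff] by (auto 0 3 simp: subset_iff)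
  then have "\<phi> ` A \<inter> {q \<in> euc N. \<psi> q \<in> U} = \<phi> ` B \<inter> {q \<in> euc N. \<psi> q \<in> U}"
    using assms(3,4) U(3) by simp
  moreover have "openin (Euclidean_space N) {q \<in> euc N. \<psi> q \<in> U}"
    by (rule affine_map_preimage_open[OF \<psi>(1) U(1)])
  moreover have "\<phi> p \<in> {q \<in> euc N. \<psi> q \<in> U}"
    using U(2) sub \<psi>(2) affine_map_in_euc[OF aff] by auto
  ultimately show ?thesis unfolding locally_equal_def by blast
qed

lemma tangent_space_subset_euc:
  assumes "A \<subseteq> euc N"
  shows "tangent_space A p \<subseteq> euc N"
proof
  fix v assume "v \<in> tangent_space A p"
  then obtain \<gamma> where \<gamma>: "\<forall>\<^sub>F t in nhds (0::real). \<gamma> t \<in> A" "\<And>i. ((\<lambda>t. \<gamma> t i) has_real_derivative v i) (at 0)"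
    unfolding tangent_space_def by blast
  have "v i = 0" if "N \<le> i" for i
  proof -
    have "\<forall>\<^sub>F t in nhds 0. \<gamma> t i = 0"
      using \<gamma>(1) assms that by (auto elim!: eventually_mono simp: euc_iff subset_iff)
    then have "((\<lambda>t. 0) has_real_derivative v i) (at 0)"
      using \<gamma>(2)[of i] by (subst (asm) DERIV_cong_ev[where g = "\<lambda>_. 0" and y = 0 and v = "v i"]) auto
    then show ?thesis using DERIV_unique DERIV_const by blast
  qed
  then show "v \<in> euc N" by (simp add: euc_iff)
qed

lemma tangent_space_image:
  assumes "affine_map N \<phi>" "v \<in> tangent_space H p"
  shows "linear_part \<phi> v \<in> tangent_space (\<phi> ` H) (\<phi> p)"
proof -
  obtain \<gamma> where \<gamma>: "\<gamma> 0 = p" "\<forall>\<^sub>F t in nhds (0::real). \<gamma> t \<in> H"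
    "\<And>i. ((\<lambda>t. \<gamma> t i) has_real_derivative v i) (at 0)"
    using assms(2) unfolding tangent_space_def by blast
  have "\<forall>\<^sub>F t in nhds 0. \<phi> (\<gamma> t) \<in> \<phi> ` H"
    using \<gamma>(2) by (auto elim: eventually_mono)
  moreover have "\<And>i. ((\<lambda>t. \<phi> (\<gamma> t) i) has_real_derivative linear_part \<phi> v i) (at 0)"
    by (rule affine_map_derivative[OF assms(1) \<gamma>(3)])
  ultimately show ?thesis
    unfolding tangent_space_def using \<gamma>(1) by (intro CollectI exI[of _ "\<lambda>t. \<phi> (\<gamma> t)"]) auto
qed

lemma linear_part_inverse:
  assumes "affine_map N \<phi>" "affine_map N \<psi>" "\<forall>p\<in>euc N. \<phi> (\<psi> p) = p" "v \<in> euc N"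
  shows "linear_part \<phi> (linear_part \<psi> v) = v"
proof -
  have "linear_part \<phi> (linear_part \<psi> v) = (\<lambda>i. \<phi> (\<psi> v) i - \<phi> (\<psi> (\<lambda>_. 0)) i)"
    unfolding linear_part_def[of \<psi>] by (rule linear_part_diff[OF assms(1)])
  then show ?thesis using bspec[OF assms(3,4)] bspec[OF assms(3), of "\<lambda>_. 0"] by (simp add: euc_iff)
qed

text \<open>This is the push-forward of the vector field L: evaluated at the preimage point and
  mapped by the differential.\<close>

lemma sym_algebra_image:
  assumes "affine_map (Suc n) \<phi>" "affine_map (Suc n) \<psi>" "\<forall>p\<in>euc (Suc n). \<psi> (\<phi> p) = p"
    "H \<subseteq> euc (Suc n)" "p0 \<in> euc (Suc n)" "L \<in> sym_algebra n H p0"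
  shows "(\<lambda>q. linear_part \<phi> (L (\<psi> q))) \<in> sym_algebra n (\<phi> ` H) (\<phi> p0)"
proof -
  obtain U where L: "affine_map (Suc n) L" and U: "openin (Euclidean_space (Suc n)) U" "p0 \<in> U"
    "\<And>q. q \<in> H \<inter> U \<Longrightarrow> L q \<in> tangent_space H q"
    using assms(6) unfolding sym_algebra_def by blast
  let ?U = "{q \<in> euc (Suc n). \<psi> q \<in> U}"
  have "affine_map (Suc n) (\<lambda>q. linear_part \<phi> (L (\<psi> q)))"
    by (rule affine_map_comp[OF affine_map_linear_part[OF assms(1)] affine_map_comp[OF L assms(2)]])
  moreover have "openin (Euclidean_space (Suc n)) ?U"
    by (rule affine_map_preimage_open[OF assms(2) U(1)])
  moreover have "\<phi> p0 \<in> ?U" using assms(3,5) U(2) affine_map_in_euc[OF assms(1)] by simp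
  moreover have "linear_part \<phi> (L (\<psi> q)) \<in> tangent_space (\<phi> ` H) q" if q: "q \<in> \<phi> ` H \<inter> ?U" for q
  proof -
    obtain p where p: "p \<in> H" "q = \<phi> p" using q by blast
    then have "\<psi> q = p" using assms(3,4) by blast
    then show ?thesis using q p U(3)[of p] tangent_space_image[OF assms(1)] by auto
  qed
  ultimately show ?thesis unfolding sym_algebra_def by blast
qed

lemma affinely_homogeneous_image:
  assumes "affine_coordinates (Suc n) \<phi>" "H \<subseteq> euc (Suc n)" "p0 \<in> H" "affinely_homogeneous n H p0"
  shows "affinely_homogeneous n (\<phi> ` H) (\<phi> p0)"
proof -
  let ?N = "Suc n" and ?H = "\<phi> ` H" and ?q = "\<phi> p0"
  obtain \<psi> where \<psi>: "affine_map ?N \<psi>" "\<forall>p\<in>euc ?N. \<psi> (\<phi> p) = p" "\<forall>p\<in>euc ?N. \<phi> (\<psi> p) = p"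
    using affine_coordinates_inverse[OF assms(1)] by blast
  have \<phi>: "affine_map ?N \<phi>" using assms(1) by (simp add: affine_coordinates_def)
  have p0: "p0 \<in> euc ?N" using assms(2,3) by blast
  have H': "?H \<subseteq> euc ?N" using affine_map_in_euc[OF \<phi>] by blast
  have img: "\<psi> ` ?H = H" using \<psi>(2) assms(2) by (force simp: image_image)
  have T: "tangent_space H p0 = real_span {L p0 |L. L \<in> sym_algebra n H p0}"
    using assms(4) by (simp add: affinely_homogeneous_def)
  let ?S = "{L p0 |L. L \<in> sym_algebra n H p0}" and ?S' = "{L ?q |L. L \<in> sym_algebra n ?H ?q}"
  have lp: "linear_part \<phi> v \<in> ?S'" if v: "v \<in> ?S" for v
  proof -
    obtain L where L: "v = L p0" "L \<in> sym_algebra n H p0" using v by blast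
    have "linear_part \<phi> v = linear_part \<phi> (L (\<psi> ?q))" using L(1) bspec[OF \<psi>(2) p0] by simp
    then show ?thesis
      using sym_algebra_image[OF \<phi> \<psi>(1,2) assms(2) p0 L(2)]
      by (intro CollectI exI[of _ "\<lambda>q. linear_part \<phi> (L (\<psi> q))"] conjI)
  qed
  have lp': "linear_part \<psi> w \<in> ?S" if w: "w \<in> ?S'" for w
  proof -
    obtain L where L: "w = L ?q" "L \<in> sym_algebra n ?H ?q" using w by blast
    have "linear_part \<psi> w = linear_part \<psi> (L (\<phi> p0))" using L(1) by simp
    moreover have "(\<lambda>q. linear_part \<psi> (L (\<phi> q))) \<in> sym_algebra n H p0"
      using sym_algebra_image[OF \<psi>(1) \<phi> \<psi>(3) H' affine_map_in_euc[OF \<phi>] L(2)] img bspec[OF \<psi>(2) p0] by simp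
    ultimately show ?thesis
      by (intro CollectI exI[of _ "\<lambda>q. linear_part \<psi> (L (\<phi> q))"] conjI)
  qed
  have S'euc: "w \<in> euc ?N" if "w \<in> ?S'" for w
    using that affine_map_in_euc by (auto simp: sym_algebra_def)
  have "tangent_space ?H ?q \<subseteq> real_span ?S'"
  proof
    fix w assume w: "w \<in> tangent_space ?H ?q"
    then have "linear_part \<psi> w \<in> tangent_space H p0"
      using tangent_space_image[OF \<psi>(1) w] img bspec[OF \<psi>(2) p0] by simp
    then obtain c Q where Q: "linear_part \<psi> w = (\<lambda>i. \<Sum>v\<in>Q. c v * v i)" "finite Q" "Q \<subseteq> ?S"
      unfolding T real_span_def by blast
    have "w = linear_part \<phi> (linear_part \<psi> w)"
      by (rule linear_part_inverse[OF \<phi> \<psi>(1,3) subsetD[OF tangent_space_subset_euc[OF H'] w], symmetric])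
    also have "\<dots> = (\<lambda>i. \<Sum>v\<in>Q. c v * linear_part \<phi> v i)"
      unfolding Q(1) by (rule linear_part_sum[OF \<phi>])
    also have "\<dots> \<in> real_span ?S'"
      by (rule real_span_sum[OF Q(2)]) (use Q(3) lp real_span_superset in blast)
    finally show "w \<in> real_span ?S'" .
  qed
  moreover have "real_span ?S' \<subseteq> tangent_space ?H ?q"
  proof
    fix w assume "w \<in> real_span ?S'"
    then obtain c Q where Q: "w = (\<lambda>i. \<Sum>v\<in>Q. c v * v i)" "finite Q" "Q \<subseteq> ?S'"
      unfolding real_span_def by blast
    have weuc: "w \<in> euc ?N"
      using Q S'euc by (auto simp: euc_iff subset_iff)
    have "linear_part \<psi> w = (\<lambda>i. \<Sum>v\<in>Q. c v * linear_part \<psi> v i)"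
      unfolding Q(1) by (rule linear_part_sum[OF \<psi>(1)])
    also have "\<dots> \<in> real_span ?S"
      by (rule real_span_sum[OF Q(2)]) (use Q(3) lp' real_span_superset in blast)
    finally have "linear_part \<psi> w \<in> tangent_space H p0" using T by simp
    from tangent_space_image[OF \<phi> this] show "w \<in> tangent_space ?H ?q"
      using linear_part_inverse[OF \<phi> \<psi>(1,3) weuc] by simp
  qed
  ultimately show ?thesis by (simp add: affinely_homogeneous_def)
qed

section \<open>Homogeneity of the base of a cylinder\<close>

lemma truncate_in_euc: "truncate k p \<in> euc (Suc k)"
  by (simp add: truncate_def euc_iff)

lemma truncate_id: "p \<in> euc (Suc k) \<Longrightarrow> truncate k p = p"
  by (auto simp: truncate_def euc_iff fun_eq_iff)

lemma openin_Euclidean_space_Int: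
  assumes "k \<le> n" "openin (Euclidean_space n) U"
  shows "openin (Euclidean_space k) (U \<inter> euc k)"
proof -
  obtain W where W: "openin (powertop_real UNIV) W" "U = W \<inter> euc n"
    using assms(2) by (auto simp: openin_Euclidean_space_iff)
  have "U \<inter> euc k = W \<inter> euc k" using W(2) assms(1) by (auto simp: euc_iff)
  then show ?thesis using W(1) openin_Euclidean_space_iff by blast
qed

text \<open>Truncation projects the cylinder to its base and is the identity there. At base points
  it maps tangent vectors of the cylinder to tangent vectors of the base, and it turns a symmetry L
  into the composition truncate, L, truncate.\<close>

lemma affinely_homogeneous_cylinder_base:
  assumes "k \<le> n" "K \<subseteq> euc (Suc k)" "p \<in> K" "affinely_homogeneous n (cylinder n k K) p"
  shows "affinely_homogeneous k K p"
proof -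
  let ?C = "cylinder n k K"
  have KC: "K \<subseteq> ?C"
  proof
    fix q assume q: "q \<in> K"
    then have qk: "q \<in> euc (Suc k)" using assms(2) by blast
    then have "q \<in> euc (Suc n)" using assms(1) by (auto simp: euc_iff)
    then show "q \<in> ?C" using q truncate_id[OF qk] by (simp add: cylinder_def)
  qed
  have Ceuc: "?C \<subseteq> euc (Suc n)" by (auto simp: cylinder_def)
  have peuc: "p \<in> euc (Suc k)" using assms(2,3) by blast
  have up: "tangent_space K q \<subseteq> tangent_space ?C q" for q
    unfolding tangent_space_def using KC by (fastforce elim: eventually_mono)
  have down: "truncate k v \<in> tangent_space K q" if v: "v \<in> tangent_space ?C q" and q: "q \<in> euc (Suc k)" for v q
  proof -
    obtain \<gamma> where \<gamma>: "\<gamma> 0 = q" "\<forall>\<^sub>F t in nhds (0::real). \<gamma> t \<in> ?C"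
      "\<And>i. ((\<lambda>t. \<gamma> t i) has_real_derivative v i) (at 0)"
      using v unfolding tangent_space_def by blast
    have "\<forall>\<^sub>F t in nhds 0. truncate k (\<gamma> t) \<in> K"
      using \<gamma>(2) by (auto elim!: eventually_mono simp: cylinder_def)
    moreover have "((\<lambda>t. truncate k (\<gamma> t) i) has_real_derivative truncate k v i) (at 0)" for i
      using \<gamma>(3)[of i] by (simp add: truncate_def)
    moreover have "truncate k (\<gamma> 0) = q" using \<gamma>(1) truncate_id[OF q] by simp
    ultimately show ?thesis
      unfolding tangent_space_def by (intro CollectI exI[of _ "\<lambda>t. truncate k (\<gamma> t)"]) auto
  qed
  let ?S = "{L p |L. L \<in> sym_algebra n ?C p}" and ?S' = "{L p |L. L \<in> sym_algebra k K p}"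
  have T: "tangent_space ?C p = real_span ?S"
    using assms(4) by (simp add: affinely_homogeneous_def)
  have trunc_span: "truncate k v \<in> ?S'" if v: "v \<in> ?S" for v
  proof -
    obtain L where L: "v = L p" "L \<in> sym_algebra n ?C p" using v by blast
    obtain U where aff: "affine_map (Suc n) L" and U: "openin (Euclidean_space (Suc n)) U" "p \<in> U"
      "\<And>q. q \<in> ?C \<inter> U \<Longrightarrow> L q \<in> tangent_space ?C q"
      using L(2) unfolding sym_algebra_def by blast
    obtain M b where M: "\<And>q i. L q i = (if i < Suc n then b i + (\<Sum>j<Suc n. M i j * q j) else 0)"
      using affine_map_matrix[OF aff] by blast
    have "truncate k (L (truncate k q)) i = (if i < Suc k then b i + (\<Sum>j<Suc k. M i j * q j) else 0)" for q i
    proof -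
      have "(\<Sum>j<Suc n. M i j * truncate k q j) = (\<Sum>j<Suc k. M i j * q j)"
        using assms(1) by (intro sum.mono_neutral_cong_right) (auto simp: truncate_def)
      then show ?thesis using assms(1) by (auto simp: truncate_def M simp del: sum.lessThan_Suc)
    qed
    then have "affine_map (Suc k) (\<lambda>q. truncate k (L (truncate k q)))"
      unfolding affine_map_def by blast
    moreover have "truncate k (L (truncate k q)) \<in> tangent_space K q" if q: "q \<in> K \<inter> (U \<inter> euc (Suc k))" for q
    proof -
      have "L q \<in> tangent_space ?C q" using q KC U(3) by blast
      then show ?thesis using down[of "L q" q] q truncate_id[of q k] by simp
    qed
    ultimately have "(\<lambda>q. truncate k (L (truncate k q))) \<in> sym_algebra k K p"
      unfolding sym_algebra_def
      using openin_Euclidean_space_Int[OF _ U(1), of "Suc k"] assms(1) U(2) peuc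
      by (intro CollectI conjI exI[of _ "U \<inter> euc (Suc k)"]) auto
    moreover have "truncate k v = truncate k (L (truncate k p))"
      using L(1) truncate_id[OF peuc] by simp
    ultimately show ?thesis
      by (intro CollectI exI[of _ "\<lambda>q. truncate k (L (truncate k q))"] conjI)
  qed
  have "tangent_space K p \<subseteq> real_span ?S'"
  proof
    fix v assume v: "v \<in> tangent_space K p"
    then obtain c Q where Q: "v = (\<lambda>i. \<Sum>w\<in>Q. c w * w i)" "finite Q" "Q \<subseteq> ?S"
      using up[of p] unfolding T real_span_def by blast
    have "v = truncate k v"
      by (rule truncate_id[OF subsetD[OF tangent_space_subset_euc[OF assms(2)] v], symmetric])
    also have "\<dots> = (\<lambda>i. \<Sum>w\<in>Q. c w * truncate k w i)"
      unfolding Q(1) by (auto simp: truncate_def fun_eq_iff)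
    also have "\<dots> \<in> real_span ?S'"
      by (rule real_span_sum[OF Q(2)]) (use Q(3) trunc_span real_span_superset in blast)
    finally show "v \<in> real_span ?S'" .
  qed
  moreover have "real_span ?S' \<subseteq> tangent_space K p"
  proof
    fix v assume "v \<in> real_span ?S'"
    then obtain c Q where Q: "v = (\<lambda>i. \<Sum>w\<in>Q. c w * w i)" "finite Q" "Q \<subseteq> ?S'"
      unfolding real_span_def by blast
    have Qt: "w \<in> tangent_space K p" if "w \<in> Q" for w
      using that Q(3) assms(3) unfolding sym_algebra_def by blast
    \<comment> \<open>\<open>tangent_space\<close> is not linear by definition. Linear combinations
      are therefore formed in the tangent space of the cylinder, which homogeneity identifies with a
      span, and then projected back.\<close>
    have "v \<in> real_span ?S"
      unfolding Q(1) using real_span_sum[OF Q(2), of "\<lambda>w. w"] Qt up[of p] T by blast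
    then have "truncate k v \<in> tangent_space K p"
      using down[OF _ peuc] T by blast
    moreover have "w i = 0" if "w \<in> Q" "Suc k \<le> i" for w i
      using subsetD[OF tangent_space_subset_euc[OF assms(2)] Qt[OF that(1)]] that(2) by (simp add: euc_iff)
    then have "v \<in> euc (Suc k)" unfolding Q(1) by (auto simp: euc_iff intro!: sum.neutral)
    ultimately show "v \<in> tangent_space K p" using truncate_id by simp
  qed
  ultimately show ?thesis by (simp add: affinely_homogeneous_def)
qed

subsection \<open>Expansions along rays\<close>

definition ray_series :: "nat \<Rightarrow> ((nat \<Rightarrow> nat) \<Rightarrow> real) \<Rightarrow> point \<Rightarrow> real fps" where
  "ray_series n c y = Abs_fps (\<lambda>d. hom_part n c d y)"

text \<open>Let q be the order of F. The quotient of f by s^q tends to the nonzero leading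
  coefficient, but if q < m the bound forces it to 0.\<close>

lemma fps_vanishing_order:
  fixes f :: "real \<Rightarrow> real"
  assumes F: "f has_fps_expansion F" and bound: "\<forall>\<^sub>F s in nhds 0. \<bar>f s\<bar> \<le> C * \<bar>s\<bar> ^ m"
  shows "fps_X ^ m dvd F"
proof (cases "F = 0")
  case False
  have "m \<le> subdegree F"
  proof (rule ccontr)
    assume "\<not> m \<le> subdegree F"
    then have lt: "subdegree F < m" by simp
    define q where "q = subdegree F"
    define g where "g x = (if x = 0 then fps_nth F q else f x / x ^ q)" for x
    have "g has_fps_expansion fps_shift q F"
      unfolding g_def by (rule has_fps_expansion_shift[OF F]) (auto simp: q_def)
    then have "continuous (at 0 within UNIV) g" by (rule has_fps_expansion_imp_continuous)
    then have "(g \<longlongrightarrow> g 0) (at 0)" by (simp add: continuous_at isCont_def)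
    moreover have "(g \<longlongrightarrow> 0) (at 0)"
    proof (rule Lim_null_comparison)
      have "((\<lambda>s. C * \<bar>s\<bar> ^ (m - q)) \<longlongrightarrow> C * \<bar>0\<bar> ^ (m - q)) (at (0::real))"
        by (intro tendsto_intros)
      then show "((\<lambda>s. C * \<bar>s\<bar> ^ (m - q)) \<longlongrightarrow> 0) (at (0::real))"
        using lt by (simp add: q_def power_0_left)
      have "\<forall>\<^sub>F s in at 0. \<bar>f s\<bar> \<le> C * \<bar>s\<bar> ^ m"
        using bound by (rule eventually_nhds_conv_at[THEN iffD1, THEN conjunct1])
      then show "\<forall>\<^sub>F s in at 0. norm (g s) \<le> C * \<bar>s\<bar> ^ (m - q)"
        using eventually_neq_at_within[of 0 0]
      proof eventually_elim
        case (elim s)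
        have "\<bar>s\<bar> ^ m = \<bar>s\<bar> ^ (m - q) * \<bar>s\<bar> ^ q"
          using lt by (simp add: q_def flip: power_add)
        then show ?case using elim by (simp add: g_def abs_divide power_abs pos_divide_le_eq mult.assoc)
      qed
    qed
    ultimately have "g 0 = 0" using tendsto_unique trivial_limit_at by blast
    then show False using False by (simp add: g_def q_def)
  qed
  then show ?thesis using False by (simp add: fps_dvd_iff)
qed simp

text \<open>The difference vanishes near 0, hence to every order.\<close>

lemma has_fps_expansion_unique_real:
  fixes f g :: "real \<Rightarrow> real"
  assumes "f has_fps_expansion F" "g has_fps_expansion G" "\<forall>\<^sub>F s in nhds 0. f s = g s"
  shows "F = G"
proof -
  have "(\<lambda>s. f s - g s) has_fps_expansion (F - G)"
    by (rule has_fps_expansion_diff[OF assms(1,2)])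
  moreover have "\<forall>\<^sub>F s in nhds 0. \<bar>f s - g s\<bar> \<le> 0 * \<bar>s\<bar> ^ m" for m
    using assms(3) by (rule eventually_mono) simp
  ultimately have "fps_X ^ m dvd F - G" for m by (rule fps_vanishing_order)
  then have "fps_nth (F - G) q = 0" for q
    unfolding fps_X_power_dvd_iff_nth by (metis lessI)
  then show ?thesis by (simp add: fps_eq_iff)
qed

lemma ray_series_expansion:
  assumes "converges n c R"
  shows "(\<lambda>s. power_series n c (\<lambda>i. s * y i)) has_fps_expansion ray_series n c y"
  unfolding ray_series_def by (rule power_series_ray_fps[OF assms])

lemma ray_series_nth_0:
  assumes "converges n c R"
  shows "fps_nth (ray_series n c y) 0 = power_series n c (\<lambda>_. 0)"
proof -
  have "\<forall>\<^sub>F s in nhds 0. eval_fps (ray_series n c y) s = power_series n c (\<lambda>i. s * y i)"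
    using ray_series_expansion[OF assms, of y] by (simp add: has_fps_expansion_def)
  from eventually_nhds_x_imp_x[OF this] show ?thesis by (simp add: eval_fps_at_0)
qed

lemma eventually_small_scale:
  assumes "0 < (R::real)"
  shows "\<forall>\<^sub>F s in nhds 0. \<forall>i\<in>{1..n::nat}. \<bar>s * y i\<bar> < R"
proof (intro eventually_ball_finite ballI)
  fix i
  have "((\<lambda>s. \<bar>s * y i\<bar>) \<longlongrightarrow> \<bar>0 * y i\<bar>) (nhds 0)" by (intro tendsto_intros filterlim_ident)
  then show "\<forall>\<^sub>F s in nhds 0. \<bar>s * y i\<bar> < R" by (rule order_tendstoD) (use assms in simp)
qed simp

lemma ray_series_deriv:
  assumes "converges n c R"
  shows "fps_deriv (ray_series n c y) = (\<Sum>i=1..n. fps_const (y i) * ray_series n (deriv_coeffs i c) y)"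
proof (rule has_fps_expansion_unique_real)
  have R: "0 < R" using assms by (simp add: converges_def)
  show "deriv (\<lambda>s. power_series n c (\<lambda>i. s * y i)) has_fps_expansion fps_deriv (ray_series n c y)"
    by (rule has_fps_expansion_deriv[OF ray_series_expansion[OF assms]])
  have "converges n (deriv_coeffs i c) (R / 2)" if "i \<in> {1..n}" for i
    by (rule converges_deriv_coeffs[OF assms _ _ that]) (use R in auto)
  then show "(\<lambda>s. \<Sum>i=1..n. y i * power_series n (deriv_coeffs i c) (\<lambda>j. s * y j)) has_fps_expansion
      (\<Sum>i=1..n. fps_const (y i) * ray_series n (deriv_coeffs i c) y)"
    by (intro has_fps_expansion_sum has_fps_expansion_cmult_left ray_series_expansion)
  show "\<forall>\<^sub>F s in nhds 0. deriv (\<lambda>s. power_series n c (\<lambda>i. s * y i)) s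
      = (\<Sum>i=1..n. y i * power_series n (deriv_coeffs i c) (\<lambda>j. s * y j))"
    using eventually_small_scale[OF R]
  proof (rule eventually_mono)
    fix s assume s: "\<forall>i\<in>{1..n}. \<bar>s * y i\<bar> < R"
    have "((\<lambda>s. power_series n c (\<lambda>i. s * y i)) has_real_derivative
      (\<Sum>i=1..n. power_series n (deriv_coeffs i c) (\<lambda>i. s * y i) * y i)) (at s)"
      by (rule power_series_chain_rule[OF assms]) (use s in \<open>auto intro!: derivative_eq_intros\<close>)
    then show "deriv (\<lambda>s. power_series n c (\<lambda>i. s * y i)) s
      = (\<Sum>i=1..n. y i * power_series n (deriv_coeffs i c) (\<lambda>j. s * y j))"
      by (simp add: DERIV_imp_deriv mult.commute)
  qed
qed

lemma axis_pt_scale: "(\<lambda>i. s * axis_pt k 1 i) = axis_pt k s"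
  by (auto simp: axis_pt_def)

abbreviation axis_series :: "nat \<Rightarrow> ((nat \<Rightarrow> nat) \<Rightarrow> real) \<Rightarrow> nat \<Rightarrow> real fps" where
  "axis_series n c k \<equiv> ray_series n c (axis_pt k 1)"

lemma axis_series_expansion:
  "converges n c R \<Longrightarrow> (\<lambda>s. power_series n c (axis_pt k s)) has_fps_expansion axis_series n c k"
  using ray_series_expansion[of n c R "axis_pt k 1"] by (simp add: axis_pt_scale)

lemma axis_series_deriv:
  assumes "converges n c R" "k \<in> {1..n}"
  shows "fps_deriv (axis_series n c k) = axis_series n (deriv_coeffs k c) k"
proof -
  have "fps_deriv (axis_series n c k)
      = (\<Sum>i=1..n. if i = k then axis_series n (deriv_coeffs k c) k else 0)"
    unfolding ray_series_deriv[OF assms(1)] by (rule sum.cong) (auto simp: axis_pt_def)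
  then show ?thesis using assms(2) by simp
qed

subsection \<open>Infinitesimal symmetries of a graph\<close>

lemma tangent_space_graph:
  assumes conv: "converges n c R" and p: "\<And>i. i \<in> {1..n} \<Longrightarrow> \<bar>p i\<bar> < R"
    and v: "v \<in> tangent_space (graph_of n (power_series n c)) p"
  shows "v 0 = (\<Sum>i=1..n. power_series n (deriv_coeffs i c) p * v i)"
proof -
  obtain \<gamma> where \<gamma>: "\<gamma> 0 = p" "\<forall>\<^sub>F t in nhds (0::real). \<gamma> t \<in> graph_of n (power_series n c)"
    "\<And>i. ((\<lambda>t. \<gamma> t i) has_real_derivative v i) (at 0)"
    using v unfolding tangent_space_def by blast
  have deriv: "((\<lambda>t. power_series n c (\<gamma> t)) has_real_derivative
      (\<Sum>i=1..n. power_series n (deriv_coeffs i c) (\<gamma> 0) * v i)) (at 0)"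
    by (rule power_series_chain_rule[OF conv _ \<gamma>(3)]) (use p \<gamma>(1) in auto)
  have "\<forall>\<^sub>F t in nhds 0. \<gamma> t 0 = power_series n c (\<gamma> t)"
    using \<gamma>(2) by (auto elim!: eventually_mono simp: graph_of_def)
  then have "((\<lambda>t. \<gamma> t 0) has_real_derivative
      (\<Sum>i=1..n. power_series n (deriv_coeffs i c) (\<gamma> 0) * v i)) (at 0)"
    by (rule DERIV_cong_ev[OF refl _ refl, THEN iffD2, OF _ deriv])
  with \<gamma>(3)[of 0] show ?thesis using DERIV_unique \<gamma>(1) by blast
qed

text \<open>A point of x-space may have arbitrary entries at index 0 and beyond n; they are
  overwritten so that the result lies on the graph.\<close>

definition graph_pt :: "nat \<Rightarrow> (point \<Rightarrow> real) \<Rightarrow> point \<Rightarrow> point" where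
  "graph_pt n F x = (\<lambda>i. if i = 0 then F x else if i \<le> n then x i else 0)"

lemma graph_pt_in_graph: "graph_pt n (power_series n c) x \<in> graph_of n (power_series n c)"
proof -
  have "power_series n c (graph_pt n (power_series n c) x) = power_series n c x"
    by (rule power_series_cong) (auto simp: graph_pt_def)
  then show ?thesis by (simp add: graph_of_def euc_iff) (simp add: graph_pt_def)
qed

lemma graph_pt_derivative:
  assumes conv: "converges n c R" and p: "\<And>i. i \<in> {1..n} \<Longrightarrow> \<bar>\<gamma> t0 i\<bar> < R"
    and \<gamma>: "\<And>i. ((\<lambda>t. \<gamma> t i) has_real_derivative v i) (at t0)"
  shows "((\<lambda>t. graph_pt n (power_series n c) (\<gamma> t) i) has_real_derivative
    (if i = 0 then \<Sum>j=1..n. power_series n (deriv_coeffs j c) (\<gamma> t0) * v j else if i \<le> n then v i else 0)) (at t0)"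
  using power_series_chain_rule[OF conv p \<gamma>] \<gamma> by (simp add: graph_pt_def)

lemma eventually_graph_pt_in_open:
  assumes conv: "converges n c R" and p: "\<And>i. i \<in> {1..n} \<Longrightarrow> \<bar>\<gamma> 0 i\<bar> < R"
    and \<gamma>: "\<And>i. ((\<lambda>t. \<gamma> t i) has_real_derivative v i) (at 0)"
    and U: "openin (Euclidean_space (Suc n)) U" "graph_pt n (power_series n c) (\<gamma> 0) \<in> U"
  shows "\<forall>\<^sub>F t in nhds 0. graph_pt n (power_series n c) (\<gamma> t) \<in> U"
proof (rule eventually_in_open[OF U])
  show "((\<lambda>t. graph_pt n (power_series n c) (\<gamma> t) i) \<longlongrightarrow> graph_pt n (power_series n c) (\<gamma> 0) i) (nhds 0)" for i
    using derivative_imp_tendsto_nhds[OF graph_pt_derivative[where \<gamma> = \<gamma>, OF conv p \<gamma>]] .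
  show "\<forall>\<^sub>F t in nhds 0. graph_pt n (power_series n c) (\<gamma> t) \<in> euc (Suc n)"
    by (rule always_eventually) (simp add: graph_pt_def euc_iff)
qed

text \<open>
  Differentiating the tangency condition of an affine vector field in the direction \<open>x\<^sub>l\<close> and
  restricting to the axis turns it, by the rank condition, into a linear differential equation
  for the \<open>l\<close>-th first derivative along the axis.
\<close>

lemma homogeneous_derivation_closed:
  fixes n k :: nat and c :: "(nat \<Rightarrow> nat) \<Rightarrow> real"
  defines "G \<equiv> power_series n c"
    and "D \<equiv> \<lambda>i. power_series n (deriv_coeffs i c)"
    and "H \<equiv> \<lambda>i j. power_series n (deriv_coeffs j (deriv_coeffs i c))"
  assumes conv: "converges n c R" and k: "k \<in> {1..n}"
    and G0: "G (\<lambda>_. 0) = 0" and D0: "\<And>i. i \<in> {1..n} \<Longrightarrow> D i (\<lambda>_. 0) = 0"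
    and r0: "0 < r0" and minors: "\<And>x i j. x \<in> cbox_at_0 n r0 \<Longrightarrow> i \<in> {1..n} \<Longrightarrow> j \<in> {1..n} \<Longrightarrow>
      H i j x * H k k x = H i k x * H k j x"
    and pos: "0 < H k k (\<lambda>_. 0)"
    and hom: "affinely_homogeneous n (graph_of n G) (\<lambda>_. 0)"
  shows "derivation_closed (affine_span n (\<lambda>i. axis_series n (deriv_coeffs i c) k))"
proof -
  have R: "0 < R" using conv by (simp add: converges_def)
  have conv1: "converges n (deriv_coeffs i c) (R / 2)" if "i \<in> {1..n}" for i
    by (rule converges_deriv_coeffs[OF conv _ _ that]) (use R in auto)
  have conv2: "converges n (deriv_coeffs j (deriv_coeffs i c)) (R / 3)" if "i \<in> {1..n}" "j \<in> {1..n}" for i j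
    by (rule converges_deriv_coeffs[OF conv1[OF that(1)] _ _ that(2)]) (use R in auto)
  define \<Gamma> where "\<Gamma> = graph_of n G"
  have ax0: "axis_pt l 0 = (\<lambda>_. 0)" for l by (auto simp: axis_pt_def)
  have daxis: "((\<lambda>t. axis_pt l t i) has_real_derivative axis_pt l 1 i) (at t)" for l i t
    by (cases "i = l") (auto simp: axis_pt_def)
  \<comment> \<open>\<open>\<xi>\<close> is the differential at 0 of the k-th derivative, so it
    detects transversality to the level sets. It is positive on the k-th axis direction, which is
    tangent to the graph, and homogeneity then yields a symmetry on which it is not zero.\<close>
  define \<xi> where "\<xi> v = (\<Sum>i=1..n. H i k (\<lambda>_. 0) * v i)" for v :: point
  have pt0: "graph_pt n G (axis_pt k 0) = (\<lambda>_. 0)"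
    using G0 by (auto simp: graph_pt_def ax0)
  have "axis_pt k 1 \<in> tangent_space \<Gamma> (\<lambda>_. 0)"
  proof -
    have "((\<lambda>t. graph_pt n G (axis_pt k t) i) has_real_derivative axis_pt k 1 i) (at 0)" for i
    proof -
      have eq: "(if i = 0 then \<Sum>j=1..n. D j (axis_pt k 0) * axis_pt k 1 j else if i \<le> n then axis_pt k 1 i else 0)
          = axis_pt k 1 i"
        using k unfolding sum_axis[OF k] ax0 by (auto simp: D0 axis_pt_def)
      have "((\<lambda>t. graph_pt n G (axis_pt k t) i) has_real_derivative
         (if i = 0 then \<Sum>j=1..n. D j (axis_pt k 0) * axis_pt k 1 j else if i \<le> n then axis_pt k 1 i else 0)) (at 0)"
        unfolding G_def D_def by (rule graph_pt_derivative[OF conv _ daxis]) (use R in \<open>simp add: ax0\<close>)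
      then show ?thesis unfolding eq .
    qed
    then show ?thesis
      unfolding tangent_space_def \<Gamma>_def using pt0 graph_pt_in_graph[of n c]
      by (intro CollectI exI[of _ "\<lambda>t. graph_pt n G (axis_pt k t)"]) (auto simp: G_def)
  qed
  then have "axis_pt k 1 \<in> real_span {L (\<lambda>_. 0) |L. L \<in> sym_algebra n \<Gamma> (\<lambda>_. 0)}"
    using hom by (simp add: affinely_homogeneous_def \<Gamma>_def)
  then obtain Q q where Q: "axis_pt k 1 = (\<lambda>i. \<Sum>v\<in>Q. q v * v i)"
    "Q \<subseteq> {L (\<lambda>_. 0) |L. L \<in> sym_algebra n \<Gamma> (\<lambda>_. 0)}"
    unfolding real_span_def by blast
  have "\<xi> (axis_pt k 1) = (\<Sum>v\<in>Q. q v * \<xi> v)"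
    unfolding Q(1) \<xi>_def sum_distrib_left by (subst sum.swap) (simp add: mult_ac)
  moreover have "\<xi> (axis_pt k 1) \<noteq> 0"
    unfolding \<xi>_def sum_axis[OF k] using pos by simp
  ultimately have "(\<Sum>v\<in>Q. q v * \<xi> v) \<noteq> 0" by simp
  then obtain v where "v \<in> Q" "q v * \<xi> v \<noteq> 0"
    by (rule sum.not_neutral_contains_not_neutral)
  then obtain L where L: "L \<in> sym_algebra n \<Gamma> (\<lambda>_. 0)" "\<xi> (L (\<lambda>_. 0)) \<noteq> 0"
    using Q(2) by auto
  obtain U where aff: "affine_map (Suc n) L" and U: "openin (Euclidean_space (Suc n)) U" "(\<lambda>_. 0) \<in> U"
    and tan: "\<And>p. p \<in> \<Gamma> \<inter> U \<Longrightarrow> L p \<in> tangent_space \<Gamma> p"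
    using L(1) unfolding sym_algebra_def by blast
  obtain M b where M: "\<And>p i. L p i = (if i < Suc n then b i + (\<Sum>j<Suc n. M i j * p j) else 0)"
    using aff unfolding affine_map_def by blast
  have Lpt: "L (graph_pt n G x) i = b i + M i 0 * G x + (\<Sum>j=1..n. M i j * x j)" if "i \<le> n" for x i
  proof -
    have "{..<Suc n} = insert 0 {1..n}" by auto
    then have "(\<Sum>j<Suc n. M i j * graph_pt n G x j) = M i 0 * G x + (\<Sum>j=1..n. M i j * graph_pt n G x j)"
      by (simp add: graph_pt_def)
    also have "(\<Sum>j=1..n. M i j * graph_pt n G x j) = (\<Sum>j=1..n. M i j * x j)"
      by (rule sum.cong) (auto simp: graph_pt_def)
    finally show ?thesis using that by (simp add: M)
  qed
  \<comment> \<open>The defect of tangency of L at the graph point over x. It vanishes identically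
    near 0, so its derivatives vanish too.\<close>
  define \<Phi> where "\<Phi> x = L (graph_pt n G x) 0 - (\<Sum>i=1..n. D i x * L (graph_pt n G x) i)" for x
  have \<Phi>0: "\<Phi> x = 0" if "graph_pt n G x \<in> U" "\<And>i. i \<in> {1..n} \<Longrightarrow> \<bar>x i\<bar> < R" for x
  proof -
    have "L (graph_pt n G x) \<in> tangent_space (graph_of n (power_series n c)) (graph_pt n G x)"
      using tan[of "graph_pt n G x"] that(1) graph_pt_in_graph[of n c x] by (simp add: \<Gamma>_def G_def)
    then have "L (graph_pt n G x) 0 = (\<Sum>i=1..n. D i (graph_pt n G x) * L (graph_pt n G x) i)"
      unfolding D_def by (rule tangent_space_graph[OF conv, rotated]) (use that(2) in \<open>simp add: graph_pt_def\<close>)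
    moreover have "D i (graph_pt n G x) = D i x" for i
      unfolding D_def by (rule power_series_cong) (simp add: graph_pt_def)
    ultimately show ?thesis by (simp add: \<Phi>_def)
  qed
  define Lk where "Lk i s = b i + M i 0 * G (axis_pt k s) + M i k * s" for i s
  have Lk: "L (graph_pt n G (axis_pt k s)) i = Lk i s" if "i \<le> n" for i s
    unfolding Lpt[OF that] sum_axis[OF k] Lk_def ..
  have linear_ode: "\<forall>\<^sub>F s in nhds 0. M 0 0 * D l (axis_pt k s) + M 0 l
      - (\<Sum>i=1..n. H i l (axis_pt k s) * Lk i s + D i (axis_pt k s) * (M i 0 * D l (axis_pt k s) + M i l)) = 0"
    if l: "l \<in> {1..n}" for l
  proof -
    have "\<forall>\<^sub>F s in nhds 0. graph_pt n G (axis_pt k s) \<in> U"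
      unfolding G_def
      by (rule eventually_graph_pt_in_open[OF conv _ daxis U(1)]) (use pt0 U(2) R in \<open>simp_all add: ax0 G_def\<close>)
    moreover have "\<forall>\<^sub>F s in nhds 0. \<forall>i\<in>{1..n}. \<bar>s * axis_pt k 1 i\<bar> < R / 3"
      using R by (intro eventually_small_scale) simp
    ultimately show ?thesis
    proof eventually_elim
      case (elim s)
      define x where "x t = (\<lambda>i. axis_pt k s i + axis_pt l t i)" for t
      have x0: "x 0 = axis_pt k s" by (auto simp: x_def ax0)
      have small: "\<bar>x 0 i\<bar> < R / 3" if "i \<in> {1..n}" for i
        using elim(2) that fun_cong[OF axis_pt_scale[of s k], of i] unfolding x0 by metis
      have dx: "((\<lambda>t. x t i) has_real_derivative axis_pt l 1 i) (at t)" for i t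
        using DERIV_add[OF DERIV_const daxis[of l i t]] by (simp add: x_def)
      have smallR: "\<bar>x 0 i\<bar> < R" "\<bar>x 0 i\<bar> < R / 2" if "i \<in> {1..n}" for i
        using small[OF that] R by linarith+
      have "\<forall>\<^sub>F t in nhds 0. graph_pt n G (x t) \<in> U"
        unfolding G_def
        by (rule eventually_graph_pt_in_open[OF conv smallR(1) dx U(1)]) (use elim(1) in \<open>simp_all add: x0 G_def\<close>)
      moreover have "\<forall>\<^sub>F t in nhds 0. \<forall>i\<in>{1..n}. \<bar>x t i\<bar> < R"
      proof (intro eventually_ball_finite ballI)
        fix i assume i: "i \<in> {1..n}"
        have "((\<lambda>t. \<bar>x t i\<bar>) \<longlongrightarrow> \<bar>x 0 i\<bar>) (nhds 0)"
          by (intro tendsto_rabs derivative_imp_tendsto_nhds[OF dx])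
        then show "\<forall>\<^sub>F t in nhds 0. \<bar>x t i\<bar> < R" using smallR(1)[OF i] by (rule order_tendstoD)
      qed simp
      ultimately have "\<forall>\<^sub>F t in nhds 0. \<Phi> (x t) = 0"
        by eventually_elim (rule \<Phi>0, auto)
      then have "((\<lambda>t. \<Phi> (x t)) has_real_derivative 0) (at 0)"
        by (rule DERIV_cong_ev[OF refl _ refl, THEN iffD2, OF _ DERIV_const])
      moreover have "((\<lambda>t. \<Phi> (x t)) has_real_derivative (M 0 0 * D l (x 0) + M 0 l
        - (\<Sum>i=1..n. H i l (x 0) * Lk i s + D i (x 0) * (M i 0 * D l (x 0) + M i l)))) (at 0)"
      proof -
        have dG: "((\<lambda>t. G (x t)) has_real_derivative D l (x 0)) (at 0)"
          using power_series_chain_rule[where \<gamma> = x, OF conv smallR(1) dx]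
          unfolding sum_axis[OF l] G_def D_def by simp
        have dD: "((\<lambda>t. D i (x t)) has_real_derivative H i l (x 0)) (at 0)" if "i \<in> {1..n}" for i
          using power_series_chain_rule[where \<gamma> = x, OF conv1[OF that] smallR(2) dx]
          unfolding sum_axis[OF l] H_def D_def by simp
        have dL: "((\<lambda>t. L (graph_pt n G (x t)) i) has_real_derivative M i 0 * D l (x 0) + M i l) (at 0)"
          if "i \<le> n" for i
        proof -
          have "((\<lambda>t. b i + M i 0 * G (x t) + (\<Sum>j=1..n. M i j * x t j)) has_real_derivative
              0 + M i 0 * D l (x 0) + (\<Sum>j=1..n. M i j * axis_pt l 1 j)) (at 0)"
            by (intro DERIV_add DERIV_const DERIV_cmult dG DERIV_sum dx)
          then show ?thesis unfolding Lpt[OF that] sum_axis[OF l] by simp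
        qed
        have "((\<lambda>t. \<Phi> (x t)) has_real_derivative (M 0 0 * D l (x 0) + M 0 l
          - (\<Sum>i=1..n. H i l (x 0) * L (graph_pt n G (x 0)) i + (M i 0 * D l (x 0) + M i l) * D i (x 0)))) (at 0)"
          unfolding \<Phi>_def by (intro DERIV_diff DERIV_sum DERIV_mult dD dL) auto
        moreover have "(\<Sum>i=1..n. H i l (x 0) * L (graph_pt n G (x 0)) i + (M i 0 * D l (x 0) + M i l) * D i (x 0))
          = (\<Sum>i=1..n. H i l (x 0) * Lk i s + D i (x 0) * (M i 0 * D l (x 0) + M i l))"
          unfolding x0 by (rule sum.cong) (auto simp: Lk mult.commute)
        ultimately show ?thesis by simp
      qed
      ultimately show ?case using DERIV_unique unfolding x0 by blast
    qed
  qed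
  define g where "g i = axis_series n (deriv_coeffs i c) k" for i
  define h where "h i j = axis_series n (deriv_coeffs j (deriv_coeffs i c)) k" for i j
  define F where "F = axis_series n c k"
  have gx: "(\<lambda>s. D i (axis_pt k s)) has_fps_expansion g i" if "i \<in> {1..n}" for i
    unfolding D_def g_def by (rule axis_series_expansion[OF conv1[OF that]])
  have hx: "(\<lambda>s. H i j (axis_pt k s)) has_fps_expansion h i j" if "i \<in> {1..n}" "j \<in> {1..n}" for i j
    unfolding H_def h_def by (rule axis_series_expansion[OF conv2[OF that]])
  have Fx: "(\<lambda>s. G (axis_pt k s)) has_fps_expansion F"
    unfolding G_def F_def by (rule axis_series_expansion[OF conv])
  define Lh where "Lh i = fps_const (b i) + fps_const (M i 0) * F + fps_const (M i k) * fps_X" for i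
  have Lx: "(\<lambda>s. Lk i s) has_fps_expansion Lh i" for i
    unfolding Lk_def Lh_def by (intro fps_expansion_intros Fx)
  define \<mu> where "\<mu> = (\<Sum>i=1..n. fps_const (M i 0) * g i)"
  define w where "w l = fps_const (M 0 0) * g l + fps_const (M 0 l) - (\<Sum>i=1..n. fps_const (M i l) * g i)" for l
  define \<Lambda> where "\<Lambda> = (\<Sum>i=1..n. h i k * Lh i)"
  have gl: "fps_deriv (g l) = h k l" if l: "l \<in> {1..n}" for l
    unfolding g_def h_def axis_series_deriv[OF conv1[OF l] k] by (simp only: deriv_coeffs_commute)
  \<comment> \<open>By the minors H i l H k k = H i k H k l. After multiplication by H k k the sum
    of the H i l Lk i therefore splits into Lambda and H k l, and H k l is the derivative of
    \<open>g l\<close> along the axis.\<close>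
  have key: "\<Lambda> * fps_deriv (g l) = h k k * (w l - \<mu> * g l)" if l: "l \<in> {1..n}" for l
  proof (rule has_fps_expansion_unique_real)
    show "(\<lambda>s. (\<Sum>i=1..n. H i k (axis_pt k s) * Lk i s) * H k l (axis_pt k s)) has_fps_expansion \<Lambda> * fps_deriv (g l)"
      unfolding \<Lambda>_def gl[OF l] by (intro has_fps_expansion_mult has_fps_expansion_sum hx Lx k l)
    show "(\<lambda>s. H k k (axis_pt k s) * ((M 0 0 * D l (axis_pt k s) + M 0 l - (\<Sum>i=1..n. M i l * D i (axis_pt k s)))
        - (\<Sum>i=1..n. M i 0 * D i (axis_pt k s)) * D l (axis_pt k s))) has_fps_expansion h k k * (w l - \<mu> * g l)"
      unfolding w_def \<mu>_def
      by (intro has_fps_expansion_mult has_fps_expansion_sum has_fps_expansion_diff has_fps_expansion_add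
          has_fps_expansion_cmult_left has_fps_expansion_const hx gx k l)
    have "\<forall>\<^sub>F s in nhds 0. \<forall>i\<in>{1..n}. \<bar>s * axis_pt k 1 i\<bar> < r0" by (rule eventually_small_scale[OF r0])
    then show "\<forall>\<^sub>F s in nhds 0. (\<Sum>i=1..n. H i k (axis_pt k s) * Lk i s) * H k l (axis_pt k s)
      = H k k (axis_pt k s) * ((M 0 0 * D l (axis_pt k s) + M 0 l - (\<Sum>i=1..n. M i l * D i (axis_pt k s)))
        - (\<Sum>i=1..n. M i 0 * D i (axis_pt k s)) * D l (axis_pt k s))"
      using linear_ode[OF l]
    proof eventually_elim
      case (elim s)
      let ?x = "axis_pt k s"
      have "?x \<in> cbox_at_0 n r0"
        using elim(1) unfolding axis_pt_scale[of s k, symmetric] by (auto simp: cbox_at_0_def intro: less_imp_le)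
      then have "(\<Sum>i=1..n. H i k ?x * Lk i s) * H k l ?x = H k k ?x * (\<Sum>i=1..n. H i l ?x * Lk i s)"
        unfolding sum_distrib_left sum_distrib_right
        by (intro sum.cong refl) (metis (no_types, lifting) minors l mult.assoc mult.commute)
      moreover have "(\<Sum>i=1..n. H i l ?x * Lk i s) = M 0 0 * D l ?x + M 0 l
          - (\<Sum>i=1..n. D i ?x * (M i 0 * D l ?x + M i l))"
        using elim(2) by (simp add: sum.distrib)
      moreover have "(\<Sum>i=1..n. D i ?x * (M i 0 * D l ?x + M i l))
          = (\<Sum>i=1..n. M i l * D i ?x) + (\<Sum>i=1..n. M i 0 * D i ?x) * D l ?x"
        unfolding sum_distrib_right sum.distrib[symmetric] by (rule sum.cong) (auto simp: algebra_simps)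
      ultimately show ?case by (simp add: diff_diff_eq)
    qed
  qed
  have hkk0: "fps_nth (h k k) 0 \<noteq> 0"
    unfolding h_def ray_series_nth_0[OF conv2[OF k k]] using pos by (simp add: H_def)
  \<comment> \<open>Transversality enters here: the constant term of Lambda is \<open>\<xi>\<close>
    of the symmetry at 0. So Lambda / h k k is a unit and can serve as kappa.\<close>
  have \<Lambda>0: "fps_nth \<Lambda> 0 \<noteq> 0"
  proof -
    have "fps_nth (Lh i) 0 = b i" for i
      using G0 by (simp add: Lh_def F_def ray_series_nth_0[OF conv] G_def)
    moreover have "fps_nth (h i k) 0 = H i k (\<lambda>_. 0)" if "i \<in> {1..n}" for i
      unfolding h_def H_def by (rule ray_series_nth_0[OF conv2[OF that k]])
    moreover have "L (\<lambda>_. 0) i = b i" if "i \<in> {1..n}" for i using that by (simp add: M)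
    ultimately have "fps_nth \<Lambda> 0 = \<xi> (L (\<lambda>_. 0))"
      unfolding \<Lambda>_def \<xi>_def fps_sum_nth by (intro sum.cong) auto
    then show ?thesis using L(2) by simp
  qed
  define \<kappa> where "\<kappa> = inverse (h k k) * \<Lambda>"
  have \<kappa>0: "fps_nth \<kappa> 0 \<noteq> 0" using hkk0 \<Lambda>0 by (simp add: \<kappa>_def)
  have ode: "\<kappa> * fps_deriv (g l) + \<mu> * g l = w l" if "l \<in> {1..n}" for l
  proof -
    have "\<kappa> * fps_deriv (g l) = (inverse (h k k) * h k k) * (w l - \<mu> * g l)"
      unfolding \<kappa>_def mult.assoc key[OF that] ..
    then show ?thesis using inverse_mult_eq_1[OF hkk0] by simp
  qed
  \<comment> \<open>The operator maps 1 to \<open>\<mu>\<close> and \<open>g l\<close> to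
    \<open>w l\<close>, and both lie in the span; what follows collects the coefficients.\<close>
  have "\<kappa> * fps_deriv v + \<mu> * v \<in> affine_span n g" if v: "v \<in> affine_span n g" for v
  proof -
    obtain a q where v: "v = fps_const a + lin_comb n q g" using v unfolding affine_span_def by blast
    have "fps_deriv v = (\<Sum>l=1..n. fps_const (q l) * fps_deriv (g l))"
      by (simp add: v lin_comb_def fps_deriv_sum)
    then have "\<kappa> * fps_deriv v + \<mu> * v = fps_const a * \<mu> + (\<Sum>l=1..n. fps_const (q l) * (\<kappa> * fps_deriv (g l) + \<mu> * g l))"
      by (simp add: v lin_comb_def sum_distrib_left algebra_simps sum.distrib)
    also have "(\<Sum>l=1..n. fps_const (q l) * (\<kappa> * fps_deriv (g l) + \<mu> * g l)) = (\<Sum>l=1..n. fps_const (q l) * w l)"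
      by (rule sum.cong) (simp_all add: ode)
    also have "\<dots> = (\<Sum>l=1..n. fps_const (q l * M 0 l)) + (lin_comb n (\<lambda>i. M 0 0 * q i) g
        - lin_comb n q (\<lambda>l. lin_comb n (\<lambda>i. M i l) g))"
      unfolding lin_comb_def sum_subtractf[symmetric] sum.distrib[symmetric]
      by (rule sum.cong) (simp_all add: w_def algebra_simps flip: fps_const_mult)
    also have "(\<Sum>l=1..n. fps_const (q l * M 0 l)) = fps_const (\<Sum>l=1..n. q l * M 0 l)"
      by (simp add: fps_eq_iff fps_sum_nth)
    also have "fps_const a * \<mu> = lin_comb n (\<lambda>i. a * M i 0) g"
      unfolding \<mu>_def lin_comb_def sum_distrib_left by (rule sum.cong) (simp_all add: mult.assoc[symmetric])
    also have "lin_comb n (\<lambda>i. a * M i 0) g + (fps_const (\<Sum>l=1..n. q l * M 0 l) + (lin_comb n (\<lambda>i. M 0 0 * q i) g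
        - lin_comb n q (\<lambda>l. lin_comb n (\<lambda>i. M i l) g)))
      = fps_const (\<Sum>l=1..n. q l * M 0 l) + (lin_comb n (\<lambda>i. a * M i 0) g + lin_comb n (\<lambda>i. M 0 0 * q i) g
        - lin_comb n q (\<lambda>l. lin_comb n (\<lambda>i. M i l) g))" by simp
    also have "lin_comb n (\<lambda>i. a * M i 0) g + lin_comb n (\<lambda>i. M 0 0 * q i) g
        - lin_comb n q (\<lambda>l. lin_comb n (\<lambda>i. M i l) g)
        = lin_comb n (\<lambda>i. a * M i 0 + M 0 0 * q i - (\<Sum>l=1..n. M i l * q l)) g"
      unfolding lin_comb_lin_comb unfolding lin_comb_def sum_subtractf[symmetric] sum.distrib[symmetric]
      by (rule sum.cong) (simp_all add: distrib_right left_diff_distrib flip: fps_const_add fps_const_sub)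
    finally show ?thesis by (simp only: affine_spanI)
  qed
  then have "derivation_closed (affine_span n g)"
    unfolding derivation_closed_def using \<kappa>0 by blast
  then show ?thesis by (simp only: g_def[abs_def])
qed

subsection \<open>Matrices of rank one\<close>

text \<open>A nonzero minor would make the columns j and l independent: eliminating one coefficient
  of a vanishing combination between the rows i and k leaves the other one times the minor.\<close>

lemma rank_one_minors:
  fixes A :: "real Matrix.mat"
  assumes A: "A \<in> carrier_mat n n" and rank: "vec_space.rank n A = 1"
    and ij: "i < n" "j < n" "k < n" "l < n"
  shows "A $$ (i, j) * A $$ (k, l) = A $$ (i, l) * A $$ (k, j)"
proof (rule ccontr)
  assume neq: "A $$ (i, j) * A $$ (k, l) \<noteq> A $$ (i, l) * A $$ (k, j)"
  interpret vec_space "TYPE(real)" n .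
  let ?u = "col A j" and ?w = "col A l"
  have u: "?u \<in> carrier_vec n" and w: "?w \<in> carrier_vec n" using A by auto
  have uw: "?u \<noteq> ?w"
  proof
    assume "?u = ?w"
    then have "?u $ i = ?w $ i" "?u $ k = ?w $ k" by simp_all
    then show False using neq A ij by (simp add: mult.commute)
  qed
  have sub: "{?u, ?w} \<subseteq> set (cols A)"
    using A ij nth_mem[of j "cols A"] nth_mem[of l "cols A"] by simp
  have "lin_indpt {?u, ?w}"
  proof (rule finite_lin_indpt2)
    show "{?u, ?w} \<subseteq> carrier_vec n" using u w by simp
    fix a assume a: "lincomb a {?u, ?w} = 0\<^sub>v n"
    have eq: "a ?u * A $$ (m, j) + a ?w * A $$ (m, l) = 0" if "m < n" for m
    proof -
      have "lincomb a {?u, ?w} $ m = (\<Sum>x\<in>{?u, ?w}. a x * x $ m)"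
        by (rule lincomb_index[OF that]) (use u w in blast)
      also have "\<dots> = a ?u * ?u $ m + a ?w * ?w $ m" using uw by simp
      finally have "a ?u * ?u $ m + a ?w * ?w $ m = 0" unfolding a using that by simp
      moreover have "?u $ m = A $$ (m, j)" "?w $ m = A $$ (m, l)"
        using that A ij by auto
      ultimately show ?thesis by simp
    qed
    have "(a ?u) * (A $$ (i, j) * A $$ (k, l) - A $$ (i, l) * A $$ (k, j)) =
        A $$ (k, l) * (a ?u * A $$ (i, j) + a ?w * A $$ (i, l)) - A $$ (i, l) * (a ?u * A $$ (k, j) + a ?w * A $$ (k, l))"
      by (simp add: algebra_simps)
    moreover have "(a ?w) * (A $$ (i, j) * A $$ (k, l) - A $$ (i, l) * A $$ (k, j)) =
        A $$ (i, j) * (a ?u * A $$ (k, j) + a ?w * A $$ (k, l)) - A $$ (k, j) * (a ?u * A $$ (i, j) + a ?w * A $$ (i, l))"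
      by (simp add: algebra_simps)
    ultimately have *: "(a ?u) * (A $$ (i, j) * A $$ (k, l) - A $$ (i, l) * A $$ (k, j)) = 0"
      "(a ?w) * (A $$ (i, j) * A $$ (k, l) - A $$ (i, l) * A $$ (k, j)) = 0"
      unfolding eq[OF ij(1)] eq[OF ij(3)] by simp_all
    show "\<forall>v\<in>{?u, ?w}. a v = 0" using * neq by simp
  qed simp
  then have "card {?u, ?w} \<le> rank A"
    by (rule rank_ge_card_indpt[OF A sub])
  then show False using uw rank by simp
qed

lemma rank_one_nonzero_entry:
  fixes A :: "real Matrix.mat"
  assumes A: "A \<in> carrier_mat n n" and rank: "vec_space.rank n A = 1"
  obtains i j where "i < n" "j < n" "A $$ (i, j) \<noteq> 0"
proof (rule ccontr)
  assume "\<not> thesis"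
  then have "A = 0\<^sub>m n n" using A that by (intro eq_matI) auto
  moreover have "vec_space.rank n (0\<^sub>m n n :: real Matrix.mat) = 0" by (rule vec_space.rank_0I)
  ultimately show False using rank by simp
qed

text \<open>If the entry (i, j) is not zero, the minor of the rows and columns i, j and symmetry
  give A(i,i) A(j,j) = A(i,j)^2, which is not zero.\<close>

lemma rank_one_symmetric_diagonal:
  fixes A :: "real Matrix.mat"
  assumes A: "A \<in> carrier_mat n n" and rank: "vec_space.rank n A = 1"
    and sym: "\<And>i j. i < n \<Longrightarrow> j < n \<Longrightarrow> A $$ (i, j) = A $$ (j, i)"
  obtains i where "i < n" "A $$ (i, i) \<noteq> 0"
proof -
  obtain i j where ij: "i < n" "j < n" "A $$ (i, j) \<noteq> 0"
    using rank_one_nonzero_entry[OF A rank] .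
  have "A $$ (i, i) * A $$ (j, j) = A $$ (i, j) * A $$ (j, i)"
    by (rule rank_one_minors[OF A rank ij(1,1,2,2)])
  then have "A $$ (i, i) \<noteq> 0" using ij sym[OF ij(1,2)] by auto
  then show ?thesis using ij(1) that by blast
qed

subsection \<open>Derivatives and normalisation of a power series\<close>

lemma power_series_at_0: "power_series n c (\<lambda>_. 0) = c (\<lambda>_. 0)"
proof -
  have "monomial_at n \<alpha> (\<lambda>_. 0) = 0" if mi: "\<alpha> \<in> multi_indices n" and nz: "\<alpha> \<noteq> (\<lambda>_. 0)" for \<alpha>
  proof -
    obtain i where "\<alpha> i \<noteq> 0" using nz by (auto simp: fun_eq_iff)
    then have "i \<in> {1..n}" "\<alpha> i > 0" using mi by (auto simp: multi_indices_def)
    then show ?thesis unfolding monomial_at_def by (intro prod_zero) auto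
  qed
  then have "power_series n c (\<lambda>_. 0) = (\<Sum>\<^sub>\<infinity>\<alpha>\<in>{\<lambda>_. 0}. c \<alpha> * monomial_at n \<alpha> (\<lambda>_. 0))"
    unfolding power_series_def by (intro infsum_cong_neutral) (auto simp: multi_indices_def)
  then show ?thesis by (simp add: monomial_at_def)
qed

lemma degree_indices_0: "degree_indices n 0 = {\<lambda>_. 0}"
  by (auto simp: degree_indices_def multi_indices_def multi_degree_def fun_eq_iff)
    (metis atLeastAtMost_iff)

lemma degree_indices_1: "degree_indices n 1 = unit_index ` {1..n}"
proof (intro equalityI subsetI)
  fix \<alpha> assume "\<alpha> \<in> degree_indices n 1"
  then have \<alpha>: "\<And>i. i \<notin> {1..n} \<Longrightarrow> \<alpha> i = 0" "(\<Sum>i\<in>{1..n}. \<alpha> i) = 1"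
    by (auto simp: degree_indices_def multi_indices_def multi_degree_def)
  then obtain i where i: "i \<in> {1..n}" "\<alpha> i = 1" "\<And>j. j \<in> {1..n} \<Longrightarrow> i \<noteq> j \<Longrightarrow> \<alpha> j = 0"
    using sum_eq_1_iff[of "{1..n}" \<alpha>] by auto
  have "\<alpha> j = unit_index i j" for j
    using \<alpha>(1)[of j] i by (cases "j \<in> {1..n}") (auto simp: unit_index_def)
  then show "\<alpha> \<in> unit_index ` {1..n}" using i(1) by blast
next
  fix \<alpha> assume "\<alpha> \<in> unit_index ` {1..n}"
  then show "\<alpha> \<in> degree_indices n 1"
    by (auto simp: degree_indices_def deg_unit_index unit_index_in_multi_indices)
qed

lemma hom_part_0: "hom_part n c 0 x = c (\<lambda>_. 0)"
  by (simp add: hom_part_def degree_indices_0 monomial_at_def)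

lemma hom_part_1: "hom_part n c 1 x = (\<Sum>i=1..n. c (unit_index i) * x i)"
proof -
  have "inj_on unit_index {1..n}"
    by (rule inj_onI) (metis unit_index_def zero_neq_one)
  then show ?thesis
    unfolding hom_part_def degree_indices_1
    by (simp add: sum.reindex monomial_at_unit_index)
qed

text \<open>The affine part is discarded, and what remains is multiplied by a sign chosen later to
  make one second derivative positive.\<close>

definition normalized_coeffs :: "nat \<Rightarrow> real \<Rightarrow> ((nat \<Rightarrow> nat) \<Rightarrow> real) \<Rightarrow> (nat \<Rightarrow> nat) \<Rightarrow> real" where
  "normalized_coeffs n \<sigma> c \<alpha> = (if deg n \<alpha> \<le> 1 then 0 else \<sigma> * c \<alpha>)"

lemma converges_normalized:
  assumes "converges n c R"
  shows "converges n (normalized_coeffs n \<sigma> c) R"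
proof -
  have R: "0 < R" using assms by (simp add: converges_def)
  have "(\<lambda>\<alpha>. \<bar>normalized_coeffs n \<sigma> c \<alpha>\<bar> * R ^ deg n \<alpha>) summable_on multi_indices n"
  proof (rule summable_on_comparison_test)
    show "(\<lambda>\<alpha>. \<bar>\<sigma>\<bar> * (\<bar>c \<alpha>\<bar> * R ^ deg n \<alpha>)) summable_on multi_indices n"
      using assms by (intro summable_on_cmult_right) (simp add: converges_def)
  qed (use R in \<open>auto simp: normalized_coeffs_def abs_mult\<close>)
  then show ?thesis using R by (simp add: converges_def)
qed

lemma power_series_normalized:
  assumes "converges n c R" "x \<in> cbox_at_0 n R" "\<sigma> * \<sigma> = 1"
  shows "power_series n c x = c (\<lambda>_. 0) + (\<Sum>i=1..n. c (unit_index i) * x i)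
    + \<sigma> * power_series n (normalized_coeffs n \<sigma> c) x"
proof -
  let ?c = "normalized_coeffs n \<sigma> c"
  have hom: "\<sigma> * hom_part n ?c d x = (if d \<le> 1 then 0 else hom_part n c d x)" for d
  proof -
    have "\<sigma> * hom_part n ?c d x = (\<Sum>\<alpha>\<in>degree_indices n d. if d \<le> 1 then 0 else (\<sigma> * \<sigma>) * (c \<alpha> * monomial_at n \<alpha> x))"
      unfolding hom_part_def sum_distrib_left
      by (rule sum.cong) (auto simp: normalized_coeffs_def degree_indices_def mult_ac)
    then show ?thesis by (simp add: hom_part_def assms(3))
  qed
  have "(\<lambda>d. \<sigma> * hom_part n ?c d x) sums (\<sigma> * power_series n ?c x)"
    by (intro sums_mult hom_part_sums[OF converges_normalized[OF assms(1)] assms(2)])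
  then have "(\<lambda>d. if d \<in> {0, 1} then 0 else hom_part n c d x) sums (\<sigma> * power_series n ?c x)"
    by (rule sums_cong[THEN iffD1, rotated]) (auto simp: hom le_Suc_eq One_nat_def)
  moreover have "(\<lambda>d. if d \<in> {0, 1} then hom_part n c d x else 0) sums (\<Sum>d\<in>{0, 1}. hom_part n c d x)"
    by (rule sums_If_finite_set) simp
  ultimately have "(\<lambda>d. (if d \<in> {0, 1} then hom_part n c d x else 0) + (if d \<in> {0, 1} then 0 else hom_part n c d x))
      sums ((\<Sum>d\<in>{0, 1}. hom_part n c d x) + \<sigma> * power_series n ?c x)"
    by (rule sums_add[rotated])
  moreover have "(if d \<in> {0, 1} then hom_part n c d x else 0) + (if d \<in> {0, 1} then 0 else hom_part n c d x)
      = hom_part n c d x" for d by simp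
  ultimately have "(\<lambda>d. hom_part n c d x) sums ((\<Sum>d\<in>{0, 1}. hom_part n c d x) + \<sigma> * power_series n ?c x)"
    by simp
  from sums_unique2[OF hom_part_sums[OF assms(1,2)] this]
  show ?thesis by (simp add: hom_part_0 hom_part_1)
qed

lemma second_deriv_normalized:
  assumes "i \<in> {1..n}" "j \<in> {1..n}"
  shows "deriv_coeffs j (deriv_coeffs i (normalized_coeffs n \<sigma> c)) = (\<lambda>\<alpha>. \<sigma> * deriv_coeffs j (deriv_coeffs i c) \<alpha>)"
proof
  fix \<alpha>
  let ?\<beta> = "\<alpha>(j := Suc (\<alpha> j))"
  let ?\<gamma> = "?\<beta>(i := Suc (?\<beta> i))"
  have "deg n ?\<gamma> = Suc (Suc (deg n \<alpha>))"
    by (simp only: deg_fun_upd_Suc[OF assms(1)] deg_fun_upd_Suc[OF assms(2)])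
  then have "normalized_coeffs n \<sigma> c ?\<gamma> = \<sigma> * c ?\<gamma>" by (simp add: normalized_coeffs_def)
  then show "deriv_coeffs j (deriv_coeffs i (normalized_coeffs n \<sigma> c)) \<alpha> = \<sigma> * deriv_coeffs j (deriv_coeffs i c) \<alpha>"
    unfolding deriv_coeffs_def by (simp only: mult.left_commute)
qed

lemma power_series_cmult: "power_series n (\<lambda>\<alpha>. \<sigma> * c \<alpha>) x = \<sigma> * power_series n c x"
  unfolding power_series_def by (simp add: mult.assoc infsum_cmult_right')

lemma partial_power_series:
  assumes conv: "converges n c R" and F: "\<And>x. x \<in> xbox n a R \<Longrightarrow> F x = power_series n c (\<lambda>i. x i - a i)"
    and x: "x \<in> xbox n a R" and i: "i \<in> {1..n}"
  shows "partial i F x = power_series n (deriv_coeffs i c) (\<lambda>i. x i - a i)"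
proof -
  define \<gamma> where "\<gamma> t = (\<lambda>j. (x(i := t)) j - a j)" for t
  have \<gamma>x: "\<gamma> (x i) = (\<lambda>i. x i - a i)" by (simp add: \<gamma>_def)
  have "((\<lambda>t. power_series n c (\<gamma> t)) has_real_derivative
      (\<Sum>j=1..n. power_series n (deriv_coeffs j c) (\<gamma> (x i)) * axis_pt i 1 j)) (at (x i))"
  proof (rule power_series_chain_rule[OF conv])
    show "\<bar>\<gamma> (x i) j\<bar> < R" if "j \<in> {1..n}" for j
      using x that by (simp add: \<gamma>x xbox_def)
    show "((\<lambda>t. \<gamma> t j) has_real_derivative axis_pt i 1 j) (at (x i))" for j
      by (cases "j = i") (auto simp: \<gamma>_def axis_pt_def intro!: derivative_eq_intros)
  qed
  then have der: "((\<lambda>t. power_series n c (\<gamma> t)) has_real_derivative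
      power_series n (deriv_coeffs i c) (\<lambda>i. x i - a i)) (at (x i))"
    unfolding sum_axis[OF i] \<gamma>x by simp
  have "\<forall>\<^sub>F t in nhds (x i). F (x(i := t)) = power_series n c (\<gamma> t)"
  proof (rule eventually_mono)
    have "((\<lambda>t. \<bar>t - a i\<bar>) \<longlongrightarrow> \<bar>x i - a i\<bar>) (nhds (x i))"
      by (intro tendsto_intros filterlim_ident)
    then show "\<forall>\<^sub>F t in nhds (x i). \<bar>t - a i\<bar> < R"
      by (rule order_tendstoD) (use x i in \<open>simp add: xbox_def\<close>)
    fix t assume "\<bar>t - a i\<bar> < R"
    then have "x(i := t) \<in> xbox n a R" using x by (auto simp: xbox_def)
    then show "F (x(i := t)) = power_series n c (\<gamma> t)" unfolding \<gamma>_def by (rule F)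
  qed
  then have "((\<lambda>t. F (x(i := t))) has_real_derivative
      power_series n (deriv_coeffs i c) (\<lambda>i. x i - a i)) (at (x i))"
    by (rule DERIV_cong_ev[OF refl _ refl, THEN iffD2, OF _ der])
  then show ?thesis unfolding partial_def by (rule DERIV_imp_deriv)
qed

lemma hessian_power_series:
  assumes conv: "converges n c R" and F: "\<And>x. x \<in> xbox n a R \<Longrightarrow> F x = power_series n c (\<lambda>i. x i - a i)"
    and x: "x \<in> xbox n a (R / 2)" and ij: "i < n" "j < n"
  shows "hessian n F x $$ (i, j)
    = power_series n (deriv_coeffs (Suc j) (deriv_coeffs (Suc i) c)) (\<lambda>i. x i - a i)"
proof -
  have R: "0 < R" using conv by (simp add: converges_def)
  have i: "Suc i \<in> {1..n}" and j: "Suc j \<in> {1..n}" using ij by auto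
  have conv1: "converges n (deriv_coeffs (Suc i) c) (R / 2)"
    by (rule converges_deriv_coeffs[OF conv _ _ i]) (use R in auto)
  have "partial (Suc i) F y = power_series n (deriv_coeffs (Suc i) c) (\<lambda>i. y i - a i)"
    if "y \<in> xbox n a (R / 2)" for y
    by (rule partial_power_series[OF conv F _ i]) (use that R in \<open>auto simp: xbox_def\<close>)
  from partial_power_series[OF conv1 this x j]
  show ?thesis using ij by (simp add: hessian_def)
qed

subsection \<open>Affine changes of the graphing coordinates\<close>

text \<open>The new x-coordinates do not involve u, so that graphs over x can be carried to graphs
  over x; the new u may absorb an affine function of x.\<close>

definition block_map ::
    "nat \<Rightarrow> real \<Rightarrow> (nat \<Rightarrow> real) \<Rightarrow> real \<Rightarrow> (nat \<Rightarrow> nat \<Rightarrow> real) \<Rightarrow> (nat \<Rightarrow> real) \<Rightarrow> point \<Rightarrow> point" where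
  "block_map n \<sigma> l t M b p = (\<lambda>i. if i = 0 then \<sigma> * p 0 + (\<Sum>j=1..n. l j * p j) + t
     else if i \<le> n then (\<Sum>j=1..n. M i j * p j) + b i else 0)"

lemma affine_map_block_map: "affine_map (Suc n) (block_map n \<sigma> l t M b)"
proof -
  have split: "{..<Suc n} = insert 0 {1..n}" by auto
  define A where "A i j = (if i = 0 then (if j = 0 then \<sigma> else l j) else (if j = 0 then 0 else M i j))" for i j
  have "block_map n \<sigma> l t M b p i = (if i < Suc n then (if i = 0 then t else b i) + (\<Sum>j<Suc n. A i j * p j) else 0)" for p i
  proof -
    have "(\<Sum>j<Suc n. A i j * p j) = A i 0 * p 0 + (\<Sum>j=1..n. A i j * p j)"
      unfolding split by simp
    also have "(\<Sum>j=1..n. A i j * p j) = (\<Sum>j=1..n. (if i = 0 then l j else M i j) * p j)"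
      by (rule sum.cong) (auto simp: A_def)
    finally show ?thesis by (auto simp: block_map_def A_def)
  qed
  then show ?thesis
    unfolding affine_map_def by (intro exI[of _ A] exI[of _ "\<lambda>i. if i = 0 then t else b i"]) blast
qed

definition id_mat :: "nat \<Rightarrow> nat \<Rightarrow> real" where
  "id_mat i j = (if i = j then 1 else 0)"

lemma sum_id_mat: "i \<in> {1..n} \<Longrightarrow> (\<Sum>j=1..n. id_mat i j * x j) = x i"
proof -
  assume i: "i \<in> {1..n}"
  have "(\<Sum>j=1..n. id_mat i j * x j) = (\<Sum>j=1..n. if i = j then x i else 0)"
    by (rule sum.cong) (auto simp: id_mat_def)
  then show ?thesis using i by simp
qed

lemma openin_box:
  assumes "k \<le> n"
  shows "openin (Euclidean_space (Suc n)) {p \<in> euc (Suc n). \<forall>i\<in>{1..k}. \<bar>p i\<bar> < r}"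
proof -
  have "openin (powertop_real UNIV) {p. \<bar>p i\<bar> < r}" for i :: nat
  proof -
    have "openin (powertop_real UNIV) {p \<in> topspace (powertop_real (UNIV :: nat set)). p i \<in> {- r<..<r}}"
      by (rule openin_continuous_map_preimage[OF continuous_map_product_projection]) auto
    moreover have "{p \<in> topspace (powertop_real (UNIV :: nat set)). p i \<in> {- r<..<r}} = {p. \<bar>p i\<bar> < r}"
      by auto
    ultimately show ?thesis by simp
  qed
  then have "openin (powertop_real UNIV) (\<Inter>i\<in>{1..k}. {p. \<bar>p i\<bar> < r})"
  proof (cases "{1..k} = {}")
    case False
    then show ?thesis using \<open>\<And>i. openin (powertop_real UNIV) {p. \<bar>p i\<bar> < r}\<close>
      by (intro openin_INT2) auto
  next
    case True
    then show ?thesis using openin_topspace[of "powertop_real (UNIV :: nat set)"] by simp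
  qed
  moreover have "{p \<in> euc (Suc n). \<forall>i\<in>{1..k}. \<bar>p i\<bar> < r} = (\<Inter>i\<in>{1..k}. {p. \<bar>p i\<bar> < r}) \<inter> euc (Suc n)"
    by auto
  ultimately show ?thesis using openin_Euclidean_space_iff by blast
qed

lemma locally_equal_box:
  assumes "0 < r" "\<And>p. p \<in> euc (Suc n) \<Longrightarrow> (\<And>i. i \<in> {1..n} \<Longrightarrow> \<bar>p i\<bar> < r) \<Longrightarrow> p \<in> A \<longleftrightarrow> p \<in> B"
  shows "locally_equal (Suc n) (\<lambda>_. 0) A B"
proof -
  let ?U = "{p \<in> euc (Suc n). \<forall>i\<in>{1..n}. \<bar>p i\<bar> < r}"
  have "openin (Euclidean_space (Suc n)) ?U" by (rule openin_box) simp
  moreover have "(\<lambda>_. 0) \<in> ?U" using assms(1) by (simp add: euc_iff)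
  moreover have "A \<inter> ?U = B \<inter> ?U" using assms(2) by blast
  ultimately show ?thesis unfolding locally_equal_def by blast
qed

lemma graph_of_subset: "graph_of n F \<subseteq> euc (Suc n)"
  by (auto simp: graph_of_def)

text \<open>The coordinate change subtracts the tangent hyperplane at \<open>a\<close> and translates \<open>a\<close> to \<open>0\<close>.\<close>

lemma tangent_normalization:
  assumes \<sigma>: "\<sigma> * \<sigma> = (1::real)" and a: "a \<in> euc (Suc n)" and r: "0 < r"
    and F: "\<And>p. (\<And>i. i \<in> {1..n} \<Longrightarrow> \<bar>p i - a i\<bar> < r) \<Longrightarrow>
      F p = a 0 + (\<Sum>j=1..n. l j * (p j - a j)) + \<sigma> * G (\<lambda>i. p i - a i)"
    and G: "\<And>x y. (\<And>i. i \<in> {1..n} \<Longrightarrow> x i = y i) \<Longrightarrow> G x = G y"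
  shows "\<exists>\<phi>. affine_coordinates (Suc n) \<phi> \<and> \<phi> a = (\<lambda>_. 0) \<and>
    locally_equal (Suc n) (\<lambda>_. 0) (\<phi> ` graph_of n F) (graph_of n G)"
proof -
  define \<phi> where "\<phi> = block_map n \<sigma> (\<lambda>j. - \<sigma> * l j) (- \<sigma> * a 0 + \<sigma> * (\<Sum>j=1..n. l j * a j)) id_mat (\<lambda>i. - a i)"
  define \<psi> where "\<psi> = block_map n \<sigma> l (a 0) id_mat a"
  have \<phi>0: "\<phi> p 0 = \<sigma> * (p 0 - a 0 - (\<Sum>j=1..n. l j * (p j - a j)))" for p
    by (simp add: \<phi>_def block_map_def right_diff_distrib sum_subtractf sum_distrib_left sum_negf mult.assoc)
  have \<phi>i: "\<phi> p i = p i - a i" if "i \<in> {1..n}" for p i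
    using that by (simp add: \<phi>_def block_map_def sum_id_mat)
  have \<psi>0: "\<psi> q 0 = \<sigma> * q 0 + (\<Sum>j=1..n. l j * q j) + a 0" for q
    by (simp add: \<psi>_def block_map_def)
  have \<psi>i: "\<psi> q i = q i + a i" if "i \<in> {1..n}" for q i
    using that by (simp add: \<psi>_def block_map_def sum_id_mat)
  have aff: "affine_map (Suc n) \<phi>" "affine_map (Suc n) \<psi>"
    unfolding \<phi>_def \<psi>_def by (rule affine_map_block_map)+
  have ext: "p = q" if "p \<in> euc (Suc n)" "q \<in> euc (Suc n)" "p 0 = q 0" "\<And>i. i \<in> {1..n} \<Longrightarrow> p i = q i" for p q
  proof
    fix i
    consider "i = 0" | "i \<in> {1..n}" | "Suc n \<le> i" unfolding atLeastAtMost_iff by arith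
    then show "p i = q i" using that by cases (auto simp: euc_iff)
  qed
  have s1: "(\<Sum>j=1..n. l j * \<phi> p j) = (\<Sum>j=1..n. l j * (p j - a j))" for p
    by (rule sum.cong) (simp_all only: \<phi>i)
  have s2: "(\<Sum>j=1..n. l j * (\<psi> q j - a j)) = (\<Sum>j=1..n. l j * q j)" for q
    by (rule sum.cong) (simp_all only: \<psi>i add_diff_cancel_right')
  have \<psi>\<phi>: "\<psi> (\<phi> p) = p" if p: "p \<in> euc (Suc n)" for p
  proof (rule ext[OF affine_map_in_euc[OF aff(2)] p])
    show "\<psi> (\<phi> p) 0 = p 0"
      unfolding \<psi>0 s1 \<phi>0 mult.assoc[symmetric] \<sigma> by simp
  qed (simp add: \<psi>i \<phi>i)
  have \<phi>\<psi>: "\<phi> (\<psi> q) = q" if q: "q \<in> euc (Suc n)" for q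
  proof (rule ext[OF affine_map_in_euc[OF aff(1)] q])
    show "\<phi> (\<psi> q) 0 = q 0"
      unfolding \<phi>0 s2 \<psi>0 using \<sigma> by (simp add: mult.assoc[symmetric])
  qed (simp add: \<psi>i \<phi>i)
  have ac: "affine_coordinates (Suc n) \<phi>"
    by (rule affine_coordinatesI[OF aff]) (intro ballI \<psi>\<phi> \<phi>\<psi>; assumption)+
  have "\<phi> a = (\<lambda>_. 0)"
    by (rule ext[OF affine_map_in_euc[OF aff(1)]]) (simp_all add: euc_iff \<phi>0 \<phi>i)
  moreover have "locally_equal (Suc n) (\<lambda>_. 0) (\<phi> ` graph_of n F) (graph_of n G)"
  proof (rule locally_equal_box[OF r])
    fix q assume q: "q \<in> euc (Suc n)" and small: "\<And>i. i \<in> {1..n} \<Longrightarrow> \<bar>q i\<bar> < r"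
    have "F (\<psi> q) = a 0 + (\<Sum>j=1..n. l j * (\<psi> q j - a j)) + \<sigma> * G (\<lambda>i. \<psi> q i - a i)"
      by (rule F) (simp add: \<psi>i small)
    also have "G (\<lambda>i. \<psi> q i - a i) = G q" by (rule G) (simp add: \<psi>i)
    finally have F\<psi>: "F (\<psi> q) = a 0 + (\<Sum>j=1..n. l j * q j) + \<sigma> * G q" unfolding s2 .
    have "q \<in> \<phi> ` graph_of n F \<longleftrightarrow> \<psi> q \<in> graph_of n F"
    proof
      assume "q \<in> \<phi> ` graph_of n F"
      then obtain p where p: "p \<in> graph_of n F" "q = \<phi> p" by blast
      then have "p \<in> euc (Suc n)" using graph_of_subset by blast
      from \<psi>\<phi>[OF this] show "\<psi> q \<in> graph_of n F" using p by simp
    next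
      assume "\<psi> q \<in> graph_of n F"
      then show "q \<in> \<phi> ` graph_of n F" using \<phi>\<psi>[OF q] by (metis image_eqI)
    qed
    also have "\<dots> \<longleftrightarrow> \<psi> q 0 = F (\<psi> q)"
      using affine_map_in_euc[OF aff(2)] by (simp add: graph_of_def)
    also have "\<dots> \<longleftrightarrow> \<sigma> * q 0 = \<sigma> * G q" unfolding F\<psi> \<psi>0 by auto
    also have "\<dots> \<longleftrightarrow> q 0 = G q" using \<sigma> by auto
    finally show "q \<in> \<phi> ` graph_of n F \<longleftrightarrow> q \<in> graph_of n G"
      using q by (simp add: graph_of_def)
  qed
  ultimately show ?thesis using ac by blast
qed

text \<open>The function is pulled back by B, hence the points of its graph are moved by the inverse
  C.\<close>

lemma linear_change_of_variables:
  assumes inv: "\<And>i j. i \<in> {1..n} \<Longrightarrow> j \<in> {1..n} \<Longrightarrow> (\<Sum>l=1..n. B i l * C l j) = id_mat i j"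
      "\<And>i j. i \<in> {1..n} \<Longrightarrow> j \<in> {1..n} \<Longrightarrow> (\<Sum>l=1..n. C i l * B l j) = id_mat i j"
    and r: "0 < r"
    and G: "\<And>x y. (\<And>i. i \<in> {1..n} \<Longrightarrow> x i = y i) \<Longrightarrow> G x = G y"
    and F: "\<And>q. (\<And>i. i \<in> {1..n} \<Longrightarrow> \<bar>q i\<bar> < r) \<Longrightarrow> F q = G (\<lambda>j. \<Sum>i=1..n. B j i * q i)"
  shows "\<exists>\<phi>. affine_coordinates (Suc n) \<phi> \<and> \<phi> (\<lambda>_. 0) = (\<lambda>_. 0) \<and>
    locally_equal (Suc n) (\<lambda>_. 0) (\<phi> ` graph_of n G) (graph_of n F)"
proof -
  define \<phi> where "\<phi> M = block_map n 1 (\<lambda>_. 0) 0 M (\<lambda>_. 0)" for M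
  have \<phi>0: "\<phi> M p 0 = p 0" for M p by (simp add: \<phi>_def block_map_def)
  have \<phi>i: "\<phi> M p i = (\<Sum>j=1..n. M i j * p j)" if "i \<in> {1..n}" for M p i
    using that by (simp add: \<phi>_def block_map_def)
  have aff: "affine_map (Suc n) (\<phi> M)" for M unfolding \<phi>_def by (rule affine_map_block_map)
  have comp: "\<phi> M (\<phi> M' p) = p" if p: "p \<in> euc (Suc n)"
    and MM: "\<And>i j. i \<in> {1..n} \<Longrightarrow> j \<in> {1..n} \<Longrightarrow> (\<Sum>l=1..n. M i l * M' l j) = id_mat i j" for M M' p
  proof
    fix i
    consider "i = 0" | "i \<in> {1..n}" | "Suc n \<le> i" unfolding atLeastAtMost_iff by arith
    then show "\<phi> M (\<phi> M' p) i = p i"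
    proof cases
      case 2
      have "\<phi> M (\<phi> M' p) i = (\<Sum>l=1..n. M i l * (\<Sum>j=1..n. M' l j * p j))"
        unfolding \<phi>i[OF 2] by (rule sum.cong) (simp_all only: \<phi>i)
      also have "\<dots> = (\<Sum>j=1..n. (\<Sum>l=1..n. M i l * M' l j) * p j)"
        unfolding sum_distrib_left sum_distrib_right by (subst sum.swap) (simp only: mult.assoc)
      also have "\<dots> = (\<Sum>j=1..n. id_mat i j * p j)"
        by (rule sum.cong) (simp_all only: MM[OF 2])
      finally show ?thesis by (simp only: sum_id_mat[OF 2])
    next
      case 3
      then show ?thesis using p affine_map_in_euc[OF aff] by (simp add: euc_iff)
    qed (simp add: \<phi>0)
  qed
  have ac: "affine_coordinates (Suc n) (\<phi> C)"
    by (rule affine_coordinatesI[OF aff[of C] aff[of B]]) (intro ballI comp inv; assumption)+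
  have "\<phi> C (\<lambda>_. 0) = (\<lambda>_. 0)" by (auto simp: \<phi>_def block_map_def)
  moreover have "locally_equal (Suc n) (\<lambda>_. 0) (\<phi> C ` graph_of n G) (graph_of n F)"
  proof (rule locally_equal_box[OF r])
    fix q assume q: "q \<in> euc (Suc n)" and small: "\<And>i. i \<in> {1..n} \<Longrightarrow> \<bar>q i\<bar> < r"
    have GF: "G (\<phi> B q) = F q"
    proof -
      have "F q = G (\<lambda>j. \<Sum>i=1..n. B j i * q i)" by (rule F) (rule small)
      also have "\<dots> = G (\<phi> B q)" by (rule G) (simp only: \<phi>i)
      finally show ?thesis by simp
    qed
    have "q \<in> \<phi> C ` graph_of n G \<longleftrightarrow> \<phi> B q \<in> graph_of n G"
    proof
      assume "q \<in> \<phi> C ` graph_of n G"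
      then obtain p where p: "p \<in> graph_of n G" "q = \<phi> C p" by blast
      have "\<phi> B (\<phi> C p) = p"
        by (rule comp) (use p(1) graph_of_subset inv(1) in auto)
      then show "\<phi> B q \<in> graph_of n G" using p by simp
    next
      assume *: "\<phi> B q \<in> graph_of n G"
      have "\<phi> C (\<phi> B q) = q" by (rule comp[OF q inv(2)])
      then show "q \<in> \<phi> C ` graph_of n G" using * by (metis image_eqI)
    qed
    also have "\<dots> \<longleftrightarrow> \<phi> B q 0 = G (\<phi> B q)"
      using affine_map_in_euc[OF aff] by (simp add: graph_of_def)
    also have "\<dots> \<longleftrightarrow> q \<in> graph_of n F" using q by (simp add: GF \<phi>0 graph_of_def)
    finally show "q \<in> \<phi> C ` graph_of n G \<longleftrightarrow> q \<in> graph_of n F" .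
  qed
  ultimately show ?thesis using ac by blast
qed

subsection \<open>From the axis to all rays\<close>

lemma has_fps_expansion_power_real:
  fixes f :: "real \<Rightarrow> real"
  assumes "f has_fps_expansion F"
  shows "(\<lambda>s. f s ^ m) has_fps_expansion F ^ m"
  by (induction m) (simp_all add: assms has_fps_expansion_mult)

lemma lin_comb_expansion:
  assumes "\<And>j. j \<in> {1..n} \<Longrightarrow> f j has_fps_expansion F j"
  shows "(\<lambda>s. \<Sum>j=1..n. b j * f j s) has_fps_expansion lin_comb n b F"
  unfolding lin_comb_def
  by (rule has_fps_expansion_sum) (rule has_fps_expansion_cmult_left[OF assms])

text \<open>The converse of \<open>fps_vanishing_order\<close>: the cofactor of X^m converges and is
  therefore bounded near 0.\<close>

lemma has_fps_expansion_order_bound: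
  fixes f :: "real \<Rightarrow> real"
  assumes f: "f has_fps_expansion F" and dvd: "fps_X ^ m dvd F"
  shows "\<exists>C. \<forall>\<^sub>F s in nhds 0. \<bar>f s\<bar> \<le> C * \<bar>s\<bar> ^ m"
proof -
  obtain F' where F': "F = fps_X ^ m * F'" using dvd by (rule dvdE)
  then have "F' = fps_shift m F" by (simp add: mult.commute)
  then have "fps_conv_radius F' > 0" using f by (simp add: has_fps_expansion_def)
  then have g: "eval_fps F' has_fps_expansion F'" by (simp add: has_fps_expansion_def)
  have "(\<lambda>s. s ^ m * eval_fps F' s) has_fps_expansion F"
    unfolding F' by (rule has_fps_expansion_mult[OF has_fps_expansion_fps_X_power g])
  then have "\<forall>\<^sub>F s in nhds 0. eval_fps F s = s ^ m * eval_fps F' s"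
    by (simp add: has_fps_expansion_def)
  moreover have "\<forall>\<^sub>F s in nhds 0. eval_fps F s = f s"
    using f by (simp add: has_fps_expansion_def)
  moreover have "\<forall>\<^sub>F s in nhds 0. \<bar>eval_fps F' s\<bar> < \<bar>eval_fps F' 0\<bar> + 1"
  proof -
    have "continuous (at 0 within UNIV) (eval_fps F')"
      by (rule has_fps_expansion_imp_continuous[OF g])
    then have "(eval_fps F' \<longlongrightarrow> eval_fps F' 0) (nhds 0)"
      by (simp add: continuous_at tendsto_at_iff_tendsto_nhds)
    then have "((\<lambda>s. \<bar>eval_fps F' s\<bar>) \<longlongrightarrow> \<bar>eval_fps F' 0\<bar>) (nhds 0)"
      by (rule tendsto_rabs)
    then show ?thesis by (rule order_tendstoD) simp
  qed
  ultimately have "\<forall>\<^sub>F s in nhds 0. \<bar>f s\<bar> \<le> (\<bar>eval_fps F' 0\<bar> + 1) * \<bar>s\<bar> ^ m"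
  proof eventually_elim
    case (elim s)
    have "\<bar>f s\<bar> = \<bar>eval_fps F' s\<bar> * \<bar>s\<bar> ^ m"
      using elim(1,2) by (simp add: abs_mult power_abs mult.commute)
    also have "\<dots> \<le> (\<bar>eval_fps F' 0\<bar> + 1) * \<bar>s\<bar> ^ m"
      by (rule mult_right_mono) (use elim(3) in auto)
    finally show ?case .
  qed
  then show ?thesis by blast
qed

text \<open>The substitution s to theta may fail to be continuous; only the linear bound is known.
  Divisibility is therefore carried over as an order estimate: to a bound for P, through theta to a
  bound for Q, and back to the series of Q.\<close>

lemma fps_dvd_transfer:
  fixes P Q :: "real \<Rightarrow> real"
  assumes P: "P has_fps_expansion F" "fps_X ^ m dvd F" and Q: "Q has_fps_expansion F'"
    and PQ: "\<forall>\<^sub>F s in nhds 0. \<exists>\<theta>. \<bar>\<theta>\<bar> \<le> K * \<bar>s\<bar> \<and> Q s = P \<theta>"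
  shows "fps_X ^ m dvd F'"
proof -
  obtain C where "\<forall>\<^sub>F s in nhds 0. \<bar>P s\<bar> \<le> C * \<bar>s\<bar> ^ m"
    using has_fps_expansion_order_bound[OF P] by blast
  then obtain \<epsilon> where \<epsilon>: "0 < \<epsilon>" "\<And>s. \<bar>s\<bar> < \<epsilon> \<Longrightarrow> \<bar>P s\<bar> \<le> C * \<bar>s\<bar> ^ m"
    unfolding eventually_nhds_metric by auto
  have "((\<lambda>s. K * \<bar>s\<bar>) \<longlongrightarrow> K * \<bar>0\<bar>) (nhds (0::real))"
    by (intro tendsto_intros filterlim_ident)
  then have "\<forall>\<^sub>F s in nhds (0::real). K * \<bar>s\<bar> < \<epsilon>"
    by (rule order_tendstoD) (use \<epsilon>(1) in simp)
  then have "\<forall>\<^sub>F s in nhds 0. \<bar>Q s\<bar> \<le> (\<bar>C\<bar> * \<bar>K\<bar> ^ m) * \<bar>s\<bar> ^ m"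
    using PQ
  proof eventually_elim
    case (elim s)
    then obtain \<theta> where \<theta>: "\<bar>\<theta>\<bar> \<le> K * \<bar>s\<bar>" "Q s = P \<theta>" by blast
    have "\<bar>\<theta>\<bar> \<le> \<bar>K\<bar> * \<bar>s\<bar>"
      using \<theta>(1) mult_right_mono[OF abs_ge_self[of K] abs_ge_zero[of s]] by linarith
    then have le: "\<bar>\<theta>\<bar> ^ m \<le> (\<bar>K\<bar> * \<bar>s\<bar>) ^ m" by (rule power_mono) simp
    have "\<bar>Q s\<bar> \<le> C * \<bar>\<theta>\<bar> ^ m" using \<epsilon>(2)[of \<theta>] \<theta> elim(1) by simp
    also have "\<dots> \<le> \<bar>C\<bar> * \<bar>\<theta>\<bar> ^ m" by (rule mult_right_mono) auto
    also have "\<dots> \<le> \<bar>C\<bar> * (\<bar>K\<bar> * \<bar>s\<bar>) ^ m" by (rule mult_left_mono[OF le]) simp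
    finally show ?case by (simp add: power_mult_distrib mult.assoc)
  qed
  then show ?thesis by (rule fps_vanishing_order[OF Q])
qed

text \<open>The rank hypothesis is kept only as the vanishing of the minors through one diagonal
  entry of the Hessian that is positive at 0.\<close>

locale rank_one_graph =
  fixes n k :: nat and c :: "(nat \<Rightarrow> nat) \<Rightarrow> real" and R r0 :: real
  assumes conv: "converges n c R" and k: "k \<in> {1..n}" and r0: "0 < r0"
    and minors: "\<And>x i j. x \<in> cbox_at_0 n r0 \<Longrightarrow> i \<in> {1..n} \<Longrightarrow> j \<in> {1..n} \<Longrightarrow>
      power_series n (deriv_coeffs j (deriv_coeffs i c)) x * power_series n (deriv_coeffs k (deriv_coeffs k c)) x
      = power_series n (deriv_coeffs k (deriv_coeffs i c)) x * power_series n (deriv_coeffs j (deriv_coeffs k c)) x"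
    and pos: "0 < power_series n (deriv_coeffs k (deriv_coeffs k c)) (\<lambda>_. 0)"
    and G0: "power_series n c (\<lambda>_. 0) = 0"
    and D0: "\<And>i. i \<in> {1..n} \<Longrightarrow> power_series n (deriv_coeffs i c) (\<lambda>_. 0) = 0"
begin

abbreviation "G \<equiv> power_series n c"
abbreviation "D i \<equiv> power_series n (deriv_coeffs i c)"
abbreviation "e1 \<equiv> axis_pt k 1"

section \<open>Combinations of first derivatives along rays\<close>

definition grad_comb :: "point \<Rightarrow> point \<Rightarrow> real \<Rightarrow> real" where
  "grad_comb b y s = (\<Sum>j=1..n. b j * D j (\<lambda>i. s * y i))"

definition grad_series :: "point \<Rightarrow> point \<Rightarrow> real fps" where
  "grad_series b y = lin_comb n b (\<lambda>j. ray_series n (deriv_coeffs j c) y)"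

definition hess_row :: "point \<Rightarrow> real" where
  "hess_row b = (\<Sum>j=1..n. b j * power_series n (deriv_coeffs k (deriv_coeffs j c)) (\<lambda>_. 0))"

lemma conv1: "i \<in> {1..n} \<Longrightarrow> converges n (deriv_coeffs i c) (R / 2)"
  by (rule converges_deriv_coeffs[OF conv]) (use conv in \<open>auto simp: converges_def\<close>)

lemma conv2: "i \<in> {1..n} \<Longrightarrow> j \<in> {1..n} \<Longrightarrow> converges n (deriv_coeffs j (deriv_coeffs i c)) (R / 3)"
  by (rule converges_deriv_coeffs[OF conv1]) (use conv in \<open>auto simp: converges_def\<close>)

lemma grad_comb_expansion: "grad_comb b y has_fps_expansion grad_series b y"
  unfolding grad_comb_def[abs_def] grad_series_def
  by (rule lin_comb_expansion) (rule ray_series_expansion[OF conv1])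

lemma grad_series_deriv: "fps_deriv (ray_series n c y) = grad_series y y"
  by (simp add: ray_series_deriv[OF conv] grad_series_def lin_comb_def)

lemma grad_series_nth_0: "fps_nth (grad_series b y) 0 = 0"
proof -
  have "fps_nth (ray_series n (deriv_coeffs j c) y) 0 = 0" if "j \<in> {1..n}" for j
    by (simp add: ray_series_nth_0[OF conv1[OF that]] D0[OF that])
  then show ?thesis by (simp add: grad_series_def lin_comb_def fps_sum_nth)
qed

text \<open>The linear coefficient is the Hessian form at 0 applied to b and y. Since the minors
  vanish, H k k times this form is the product of the k-th row applied to b and to y.\<close>

lemma grad_series_nth_1:
  "power_series n (deriv_coeffs k (deriv_coeffs k c)) (\<lambda>_. 0) * fps_nth (grad_series b y) 1
    = hess_row b * hess_row y"
proof -
  define h where "h j l = power_series n (deriv_coeffs l (deriv_coeffs j c)) (\<lambda>_. 0)" for j l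
  have "fps_nth (ray_series n (deriv_coeffs j c) y) 1 = (\<Sum>l=1..n. y l * h j l)" if j: "j \<in> {1..n}" for j
  proof -
    have "fps_nth (ray_series n (deriv_coeffs j c) y) 1 = fps_nth (fps_deriv (ray_series n (deriv_coeffs j c) y)) 0"
      by (simp add: fps_deriv_nth)
    also have "\<dots> = (\<Sum>l=1..n. y l * fps_nth (ray_series n (deriv_coeffs l (deriv_coeffs j c)) y) 0)"
      unfolding ray_series_deriv[OF conv1[OF j]] by (simp add: fps_sum_nth)
    also have "\<dots> = (\<Sum>l=1..n. y l * h j l)"
      unfolding h_def by (rule sum.cong) (simp_all only: ray_series_nth_0[OF conv2[OF j]])
    finally show ?thesis .
  qed
  then have "fps_nth (grad_series b y) 1 = (\<Sum>j=1..n. b j * (\<Sum>l=1..n. y l * h j l))"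
    by (simp add: grad_series_def lin_comb_def fps_sum_nth)
  then have "h k k * fps_nth (grad_series b y) 1 = (\<Sum>j=1..n. \<Sum>l=1..n. b j * y l * (h j l * h k k))"
    by (simp add: sum_distrib_left mult_ac)
  also have "\<dots> = (\<Sum>j=1..n. \<Sum>l=1..n. b j * y l * (h j k * h l k))"
  proof (intro sum.cong refl)
    fix j l assume "j \<in> {1..n}" "l \<in> {1..n}"
    then have "h j l * h k k = h j k * h k l"
      unfolding h_def by (intro minors) (use r0 in \<open>simp_all add: cbox_at_0_def\<close>)
    moreover have "h k l = h l k" by (simp add: h_def deriv_coeffs_commute[of k l])
    ultimately show "b j * y l * (h j l * h k k) = b j * y l * (h j k * h l k)" by simp
  qed
  also have "\<dots> = hess_row b * hess_row y"
    unfolding hess_row_def h_def[symmetric] sum_product by (intro sum.cong refl) (simp only: mult_ac)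
  finally show ?thesis unfolding h_def .
qed

text \<open>The radius |s| times the sum of the |y i| turns the bound of
  \<open>level_set_axis\<close> into one linear in |s|. A single theta serves all combinations b and
  the Legendre expression, so relations among them can be carried over.\<close>

lemma level_ray:
  "\<exists>K. \<forall>\<^sub>F s in nhds 0. \<exists>\<theta>. \<bar>\<theta>\<bar> \<le> K * \<bar>s\<bar> \<and> (\<forall>b. grad_comb b y s = grad_comb b e1 \<theta>) \<and>
    s * grad_comb y y s - G (\<lambda>i. s * y i) = \<theta> * grad_comb e1 e1 \<theta> - G (\<lambda>i. \<theta> * e1 i)"
proof -
  obtain r K where r: "0 < r" "0 < K" and lev: "\<forall>\<delta> x. 0 \<le> \<delta> \<longrightarrow> \<delta> \<le> r \<longrightarrow> x \<in> cbox_at_0 n \<delta> \<longrightarrow>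
    (\<exists>\<theta>. \<bar>\<theta>\<bar> \<le> K * \<delta> \<and> (\<forall>i\<in>{1..n}. D i x = D i (axis_pt k \<theta>)) \<and>
      G x - (\<Sum>i=1..n. x i * D i x) = G (axis_pt k \<theta>) - \<theta> * D k (axis_pt k \<theta>))"
    using level_set_axis[OF conv k r0 minors pos] by blast
  define M where "M = (\<Sum>i=1..n. \<bar>y i\<bar>)"
  have "((\<lambda>s. \<bar>s\<bar> * M) \<longlongrightarrow> \<bar>0\<bar> * M) (nhds (0::real))"
    by (intro tendsto_intros filterlim_ident)
  then have "\<forall>\<^sub>F s in nhds (0::real). \<bar>s\<bar> * M < r"
    by (rule order_tendstoD) (use r(1) in simp)
  then have "\<forall>\<^sub>F s in nhds 0. \<exists>\<theta>. \<bar>\<theta>\<bar> \<le> (K * M) * \<bar>s\<bar> \<and> (\<forall>b. grad_comb b y s = grad_comb b e1 \<theta>) \<and>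
    s * grad_comb y y s - G (\<lambda>i. s * y i) = \<theta> * grad_comb e1 e1 \<theta> - G (\<lambda>i. \<theta> * e1 i)"
  proof (rule eventually_mono)
    fix s :: real assume s: "\<bar>s\<bar> * M < r"
    have yM: "\<bar>y i\<bar> \<le> M" if "i \<in> {1..n}" for i
      unfolding M_def by (rule member_le_sum[OF that]) simp_all
    have "(\<lambda>i. s * y i) \<in> cbox_at_0 n (\<bar>s\<bar> * M)"
      unfolding cbox_at_0_def by (intro CollectI ballI) (simp only: abs_mult mult_left_mono yM abs_ge_zero)
    moreover have "0 \<le> \<bar>s\<bar> * M" by (simp add: M_def sum_nonneg)
    ultimately have "\<exists>\<theta>. \<bar>\<theta>\<bar> \<le> K * (\<bar>s\<bar> * M) \<and> (\<forall>i\<in>{1..n}. D i (\<lambda>i. s * y i) = D i (axis_pt k \<theta>)) \<and>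
        G (\<lambda>i. s * y i) - (\<Sum>i=1..n. s * y i * D i (\<lambda>i. s * y i)) = G (axis_pt k \<theta>) - \<theta> * D k (axis_pt k \<theta>)"
      by (intro lev[rule_format] less_imp_le[OF s])
    then obtain \<theta> where \<theta>: "\<bar>\<theta>\<bar> \<le> K * (\<bar>s\<bar> * M)" "\<forall>i\<in>{1..n}. D i (\<lambda>i. s * y i) = D i (axis_pt k \<theta>)"
      "G (\<lambda>i. s * y i) - (\<Sum>i=1..n. s * y i * D i (\<lambda>i. s * y i)) = G (axis_pt k \<theta>) - \<theta> * D k (axis_pt k \<theta>)"
      by blast
    have "grad_comb b y s = grad_comb b e1 \<theta>" for b
      unfolding grad_comb_def axis_pt_scale by (rule sum.cong) (simp_all add: \<theta>(2))
    moreover have "(\<Sum>i=1..n. s * y i * D i (\<lambda>i. s * y i)) = s * grad_comb y y s"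
      by (simp add: grad_comb_def sum_distrib_left mult.assoc)
    moreover have "grad_comb e1 e1 \<theta> = D k (axis_pt k \<theta>)"
      using sum_axis[OF k, of "\<lambda>i. D i (axis_pt k \<theta>)" 1] by (simp add: grad_comb_def axis_pt_scale mult.commute)
    ultimately show "\<exists>\<theta>. \<bar>\<theta>\<bar> \<le> (K * M) * \<bar>s\<bar> \<and> (\<forall>b. grad_comb b y s = grad_comb b e1 \<theta>) \<and>
        s * grad_comb y y s - G (\<lambda>i. s * y i) = \<theta> * grad_comb e1 e1 \<theta> - G (\<lambda>i. \<theta> * e1 i)"
      using \<theta>(1,3) by (intro exI[of _ \<theta>]) (simp add: axis_pt_scale mult_ac)
  qed
  then show ?thesis by blast
qed

lemma power_relation_on_rays:
  assumes "fps_X ^ m dvd grad_series b e1 - fps_const q * grad_series b1 e1 ^ i"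
  shows "fps_X ^ m dvd grad_series b y - fps_const q * grad_series b1 y ^ i"
proof -
  have exp: "(\<lambda>s. grad_comb b y s - q * grad_comb b1 y s ^ i)
      has_fps_expansion grad_series b y - fps_const q * grad_series b1 y ^ i" for y
    by (intro has_fps_expansion_diff has_fps_expansion_cmult_left has_fps_expansion_power_real grad_comb_expansion)
  obtain K where K: "\<forall>\<^sub>F s in nhds 0. \<exists>\<theta>. \<bar>\<theta>\<bar> \<le> K * \<bar>s\<bar> \<and> (\<forall>b. grad_comb b y s = grad_comb b e1 \<theta>) \<and>
    s * grad_comb y y s - G (\<lambda>i. s * y i) = \<theta> * grad_comb e1 e1 \<theta> - G (\<lambda>i. \<theta> * e1 i)"
    using level_ray by blast
  show ?thesis
  proof (rule fps_dvd_transfer[OF exp assms exp, of K], rule eventually_mono[OF K])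
    fix s
    assume "\<exists>\<theta>. \<bar>\<theta>\<bar> \<le> K * \<bar>s\<bar> \<and> (\<forall>b. grad_comb b y s = grad_comb b e1 \<theta>) \<and>
      s * grad_comb y y s - G (\<lambda>i. s * y i) = \<theta> * grad_comb e1 e1 \<theta> - G (\<lambda>i. \<theta> * e1 i)"
    then obtain \<theta> where \<theta>: "\<bar>\<theta>\<bar> \<le> K * \<bar>s\<bar>" "\<And>b. grad_comb b y s = grad_comb b e1 \<theta>"
      "s * grad_comb y y s - G (\<lambda>i. s * y i) = \<theta> * grad_comb e1 e1 \<theta> - G (\<lambda>i. \<theta> * e1 i)"
      by blast
    show "\<exists>\<theta>. \<bar>\<theta>\<bar> \<le> K * \<bar>s\<bar> \<and> grad_comb b y s - q * grad_comb b1 y s ^ i = grad_comb b e1 \<theta> - q * grad_comb b1 e1 \<theta> ^ i"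
      by (rule exI[of _ \<theta>], rule conjI[OF \<theta>(1)]) (simp only: \<theta>(2)[of b] \<theta>(2)[of b1] \<theta>(3))
  qed
qed

lemma legendre_relation_on_rays:
  assumes "fps_X ^ m dvd fps_X * grad_series e1 e1 - ray_series n c e1 - fps_const q * grad_series b1 e1 ^ i"
  shows "fps_X ^ m dvd fps_X * grad_series y y - ray_series n c y - fps_const q * grad_series b1 y ^ i"
proof -
  have exp: "(\<lambda>s. s * grad_comb y y s - G (\<lambda>i. s * y i) - q * grad_comb b1 y s ^ i)
      has_fps_expansion fps_X * grad_series y y - ray_series n c y - fps_const q * grad_series b1 y ^ i" for y
    by (intro has_fps_expansion_diff has_fps_expansion_mult has_fps_expansion_cmult_left
        has_fps_expansion_power_real grad_comb_expansion has_fps_expansion_fps_X ray_series_expansion[OF conv])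
  obtain K where K: "\<forall>\<^sub>F s in nhds 0. \<exists>\<theta>. \<bar>\<theta>\<bar> \<le> K * \<bar>s\<bar> \<and> (\<forall>b. grad_comb b y s = grad_comb b e1 \<theta>) \<and>
    s * grad_comb y y s - G (\<lambda>i. s * y i) = \<theta> * grad_comb e1 e1 \<theta> - G (\<lambda>i. \<theta> * e1 i)"
    using level_ray by blast
  show ?thesis
  proof (rule fps_dvd_transfer[OF exp assms exp, of K], rule eventually_mono[OF K])
    fix s
    assume "\<exists>\<theta>. \<bar>\<theta>\<bar> \<le> K * \<bar>s\<bar> \<and> (\<forall>b. grad_comb b y s = grad_comb b e1 \<theta>) \<and>
      s * grad_comb y y s - G (\<lambda>i. s * y i) = \<theta> * grad_comb e1 e1 \<theta> - G (\<lambda>i. \<theta> * e1 i)"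
    then obtain \<theta> where \<theta>: "\<bar>\<theta>\<bar> \<le> K * \<bar>s\<bar>" "\<And>b. grad_comb b y s = grad_comb b e1 \<theta>"
      "s * grad_comb y y s - G (\<lambda>i. s * y i) = \<theta> * grad_comb e1 e1 \<theta> - G (\<lambda>i. \<theta> * e1 i)"
      by blast
    show "\<exists>\<theta>. \<bar>\<theta>\<bar> \<le> K * \<bar>s\<bar> \<and> s * grad_comb y y s - G (\<lambda>i. s * y i) - q * grad_comb b1 y s ^ i = \<theta> * grad_comb e1 e1 \<theta> - G (\<lambda>i. \<theta> * e1 i) - q * grad_comb b1 e1 \<theta> ^ i"
      by (rule exI[of _ \<theta>], rule conjI[OF \<theta>(1)]) (simp only: \<theta>(2)[of b1] \<theta>(3))
  qed
qed

lemma adapted_coordinates: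
  assumes hom: "affinely_homogeneous n (graph_of n G) (\<lambda>_. 0)"
  obtains N B C where "1 \<le> N" "N \<le> n" "mat_inverse n B C"
    "\<And>i. i \<in> {1..n} \<Longrightarrow> N < i \<Longrightarrow> grad_series (\<lambda>j. B j i) e1 = 0"
    "\<And>i. i \<in> {1..N} \<Longrightarrow> fps_X ^ Suc N dvd
      grad_series (\<lambda>j. B j i) e1 - fps_const (1 / fact i) * grad_series (\<lambda>j. B j 1) e1 ^ i"
    "fps_X ^ Suc (Suc N) dvd
      fps_X * grad_series e1 e1 - ray_series n c e1 - fps_const (1/2) * grad_series (\<lambda>j. B j 1) e1 ^ 2"
    "fps_nth (grad_series (\<lambda>j. B j 1) e1) 1
      = sqrt (power_series n (deriv_coeffs k (deriv_coeffs k c)) (\<lambda>_. 0))"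
proof -
  define a where "a = power_series n (deriv_coeffs k (deriv_coeffs k c)) (\<lambda>_. 0)"
  define \<gamma> where "\<gamma> i = axis_series n (deriv_coeffs i c) k" for i
  have V: "derivation_closed (affine_span n \<gamma>)"
    unfolding \<gamma>_def[abs_def] by (rule homogeneous_derivation_closed[OF conv k G0 D0 r0 minors pos hom])
  have \<gamma>0: "fps_nth (\<gamma> i) 0 = 0" if "i \<in> {1..n}" for i
    by (simp add: \<gamma>_def ray_series_nth_0[OF conv1[OF that]] D0[OF that])
  have \<gamma>k: "grad_series e1 e1 = \<gamma> k"
    using grad_series_deriv[of e1] axis_series_deriv[OF conv k] by (simp add: \<gamma>_def)
  have \<gamma>1: "fps_nth (\<gamma> k) 1 = a"
  proof -
    have "fps_nth (\<gamma> k) 1 = fps_nth (fps_deriv (\<gamma> k)) 0" by (simp add: fps_deriv_nth)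
    also have "fps_deriv (\<gamma> k) = axis_series n (deriv_coeffs k (deriv_coeffs k c)) k"
      unfolding \<gamma>_def by (rule axis_series_deriv[OF conv1[OF k] k])
    finally show ?thesis by (simp add: ray_series_nth_0[OF conv2[OF k k]] a_def)
  qed
  have a: "0 < a" using pos by (simp add: a_def)
  have nz: "\<gamma> k \<noteq> 0" using \<gamma>1 a by auto
  \<comment> \<open>The Legendre expression on the axis. Its coefficient at X^2 is a - a / 2: the
    gradient contributes a and the function a / 2.\<close>
  define \<eta> where "\<eta> = fps_X * \<gamma> k - axis_series n c k"
  have ax: "fps_nth (axis_series n c k) 0 = 0" "fps_nth (axis_series n c k) 1 = 0"
    "fps_nth (axis_series n c k) 2 = a / 2"
  proof -
    have d: "fps_nth (\<gamma> k) q = real (q + 1) * fps_nth (axis_series n c k) (q + 1)" for q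
      using axis_series_deriv[OF conv k] by (metis \<gamma>_def fps_deriv_nth)
    show "fps_nth (axis_series n c k) 0 = 0" by (simp add: ray_series_nth_0[OF conv] G0)
    show "fps_nth (axis_series n c k) 1 = 0" using d[of 0] \<gamma>0[OF k] by simp
    show "fps_nth (axis_series n c k) 2 = a / 2" using d[of 1] \<gamma>1 by simp
  qed
  have \<eta>: "fps_nth \<eta> 0 = 0" "fps_nth \<eta> 1 = 0" "fps_nth \<eta> 2 = a / 2"
    using ax \<gamma>0[OF k] \<gamma>1 by (simp_all add: \<eta>_def fps_X_mult_nth One_nat_def)
  obtain N B C \<pi> where 1: "1 \<le> N" "N \<le> n" "mat_inverse n B C"
    and \<pi>: "\<And>i. i \<in> {1..n} \<Longrightarrow> \<pi> i = lin_comb n (\<lambda>j. B j i) \<gamma>"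
    and 2: "\<And>i. i \<in> {1..n} \<Longrightarrow> N < i \<Longrightarrow> \<pi> i = 0"
    "\<And>i. i \<in> {1..N} \<Longrightarrow> fps_X ^ Suc N dvd \<pi> i - fps_const (1 / fact i) * \<pi> 1 ^ i"
    "fps_X ^ Suc (Suc N) dvd \<eta> - fps_const (1/2) * \<pi> 1 ^ 2"
    "fps_nth (\<pi> 1) 0 = 0" "fps_nth (\<pi> 1) 1 = sqrt a"
    using adapted_basis[OF V \<gamma>0 k nz \<eta> a] by blast
  have \<pi>': "grad_series (\<lambda>j. B j i) e1 = \<pi> i" if "i \<in> {1..n}" for i
    unfolding grad_series_def \<pi>[OF that] \<gamma>_def[abs_def] ..
  have one_in: "1 \<in> {1..n}" using k by simp
  show thesis
  proof (rule that[OF 1])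
    show "grad_series (\<lambda>j. B j i) e1 = 0" if "i \<in> {1..n}" "N < i" for i
      using 2(1)[OF that] \<pi>'[OF that(1)] by simp
    show "fps_X ^ Suc N dvd
        grad_series (\<lambda>j. B j i) e1 - fps_const (1 / fact i) * grad_series (\<lambda>j. B j 1) e1 ^ i"
      if "i \<in> {1..N}" for i
    proof -
      have "i \<in> {1..n}" using that 1(2) by simp
      then show ?thesis using 2(2)[OF that] by (simp only: \<pi>' one_in)
    qed
    show "fps_X ^ Suc (Suc N) dvd
        fps_X * grad_series e1 e1 - ray_series n c e1 - fps_const (1/2) * grad_series (\<lambda>j. B j 1) e1 ^ 2"
      using 2(3) by (simp only: \<pi>'[OF one_in] \<gamma>k \<eta>_def)
    show "fps_nth (grad_series (\<lambda>j. B j 1) e1) 1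
        = sqrt (power_series n (deriv_coeffs k (deriv_coeffs k c)) (\<lambda>_. 0))"
      using 2(5) by (simp only: \<pi>'[OF one_in] a_def)
  qed
qed

lemma normal_form_on_rays:
  assumes B: "1 \<le> N" "N \<le> n"
    and pi: "\<And>i. i \<in> {1..N} \<Longrightarrow> fps_X ^ Suc N dvd
      grad_series (\<lambda>j. B j i) e1 - fps_const (1 / fact i) * grad_series (\<lambda>j. B j 1) e1 ^ i"
    and leg: "fps_X ^ Suc (Suc N) dvd
      fps_X * grad_series e1 e1 - ray_series n c e1 - fps_const (1/2) * grad_series (\<lambda>j. B j 1) e1 ^ 2"
    and pi1: "fps_nth (grad_series (\<lambda>j. B j 1) e1) 1
      = sqrt (power_series n (deriv_coeffs k (deriv_coeffs k c)) (\<lambda>_. 0))"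
    and x1: "x 1 \<noteq> 0" and d: "2 \<le> d" "d \<le> Suc N"
  shows "hom_part n c d (lin_map N B x)
    = fps_nth ((\<Sum>i=1..N. fps_const (x i / fact (i - 1)) * fps_X ^ (i - 1)) ^ d) (d - 2) / (real d * real (d - 1))"
proof -
  define a where "a = power_series n (deriv_coeffs k (deriv_coeffs k c)) (\<lambda>_. 0)"
  have a: "0 < a" using pos by (simp add: a_def)
  define y where "y = lin_map N B x"
  define \<phi> where "\<phi> i = grad_series (\<lambda>j. B j i) y" for i
  have row_e1: "hess_row e1 = a"
    using sum_axis[OF k, of "\<lambda>j. power_series n (deriv_coeffs k (deriv_coeffs j c)) (\<lambda>_. 0)" 1]
    by (simp add: hess_row_def a_def mult.commute)
  have row: "hess_row b = fps_nth (grad_series b e1) 1" for b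
    using grad_series_nth_1[of b e1] a unfolding row_e1 a_def[symmetric] by simp
  have row_1: "hess_row (\<lambda>j. B j 1) = sqrt a" using pi1 by (simp add: row a_def)
  \<comment> \<open>For i >= 2 the i-th adapted series has no linear term on the axis, so the k-th
    Hessian row at 0 annihilates the i-th column of B.\<close>
  have row_0: "hess_row (\<lambda>j. B j i) = 0" if i: "i \<in> {1..N}" "i \<noteq> 1" for i
  proof -
    let ?b = "grad_series (\<lambda>j. B j 1) e1"
    have "fps_nth (grad_series (\<lambda>j. B j i) e1 - fps_const (1 / fact i) * ?b ^ i) 1 = 0"
      using pi[OF i(1)] B(1) unfolding fps_X_power_dvd_iff_nth by simp
    moreover have "fps_nth (?b ^ i) 1 = 0"
    proof -
      have "i \<ge> 2" using i by simp
      then show ?thesis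
        using startsby_zero_power_prefix[OF grad_series_nth_0[of "\<lambda>j. B j 1" e1], of i] by simp
    qed
    ultimately show ?thesis by (simp add: row)
  qed
  have row_y: "hess_row y = x 1 * sqrt a"
  proof -
    have "hess_row y = (\<Sum>i=1..N. x i * hess_row (\<lambda>j. B j i))"
      unfolding hess_row_def y_def lin_map_def sum_distrib_left sum_distrib_right
      by (subst sum.swap) (intro sum.cong refl, simp only: mult_ac)
    also have "\<dots> = (\<Sum>i=1..N. if i = 1 then x 1 * sqrt a else 0)"
      by (rule sum.cong) (auto simp: row_1 row_0)
    finally show ?thesis using B(1) by simp
  qed
  have "fps_nth (ray_series n c y) d
      = fps_nth ((\<Sum>i=1..N. fps_const (x i / fact (i - 1)) * fps_X ^ (i - 1)) ^ d) (d - 2) / (real d * real (d - 1))"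
  proof (rule ray_coefficients[OF B(1), of "ray_series n c y" x \<phi> "\<phi> 1"])
    show "fps_deriv (ray_series n c y) = (\<Sum>i=1..N. fps_const (x i) * \<phi> i)"
    proof -
      have "fps_deriv (ray_series n c y) = (\<Sum>j=1..n. \<Sum>i=1..N. fps_const (B j i * x i) * ray_series n (deriv_coeffs j c) y)"
        unfolding grad_series_deriv grad_series_def lin_comb_def
        unfolding y_def lin_map_def
        by (intro sum.cong refl) (simp add: fps_eq_iff fps_sum_nth sum_distrib_right)
      also have "\<dots> = (\<Sum>i=1..N. fps_const (x i) * \<phi> i)"
        unfolding \<phi>_def grad_series_def lin_comb_def sum_distrib_left
        by (subst sum.swap) (intro sum.cong refl, simp add: mult.assoc[symmetric] mult.commute)
      finally show ?thesis .
    qed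
    show "fps_X ^ Suc N dvd \<phi> i - fps_const (1 / fact i) * \<phi> 1 ^ i" if "i \<in> {1..N}" for i
      unfolding \<phi>_def by (rule power_relation_on_rays[OF pi[OF that]])
    show "fps_X ^ Suc (Suc N) dvd fps_X * fps_deriv (ray_series n c y) - ray_series n c y - fps_const (1/2) * \<phi> 1 ^ 2"
      unfolding \<phi>_def grad_series_deriv by (rule legendre_relation_on_rays[OF leg])
    show "fps_nth (\<phi> 1) 0 = 0" unfolding \<phi>_def by (rule grad_series_nth_0)
    \<comment> \<open>By the factorization of the Hessian, a times this coefficient is sqrt a times
      \<open>x 1 * sqrt a\<close>; the scaling of the first column by sqrt a was made for
      this.\<close>
    show "fps_nth (\<phi> 1) 1 = x 1"
      using grad_series_nth_1[of "\<lambda>j. B j 1" y] a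
      unfolding row_1 row_y a_def[symmetric] \<phi>_def[symmetric]
      by (simp add: mult.commute[of "x 1"] mult.assoc[symmetric])
  qed (fact x1 d)+
  then show ?thesis by (simp add: ray_series_def y_def)
qed

text \<open>The inversion argument on a ray divides by \<open>x 1\<close>. Both sides are polynomial
  in \<open>x 1\<close>, so the case \<open>x 1 = 0\<close> follows by continuity.\<close>

lemma normal_form_hom_part:
  assumes B: "1 \<le> N" "N \<le> n"
    and pi: "\<And>i. i \<in> {1..N} \<Longrightarrow> fps_X ^ Suc N dvd
      grad_series (\<lambda>j. B j i) e1 - fps_const (1 / fact i) * grad_series (\<lambda>j. B j 1) e1 ^ i"
    and leg: "fps_X ^ Suc (Suc N) dvd
      fps_X * grad_series e1 e1 - ray_series n c e1 - fps_const (1/2) * grad_series (\<lambda>j. B j 1) e1 ^ 2"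
    and pi1: "fps_nth (grad_series (\<lambda>j. B j 1) e1) 1
      = sqrt (power_series n (deriv_coeffs k (deriv_coeffs k c)) (\<lambda>_. 0))"
    and d: "2 \<le> d" "d \<le> Suc N"
  shows "hom_part n c d (lin_map N B x)
    = fps_nth ((\<Sum>i=1..N. fps_const (x i / fact (i - 1)) * fps_X ^ (i - 1)) ^ d) (d - 2) / (real d * real (d - 1))"
proof (cases "x 1 = 0")
  case False
  show ?thesis by (rule normal_form_on_rays[where B = B and N = N and x = x and d = d, OF B pi leg pi1 False d])
next
  case True
  define xt where "xt t = x(1 := t)" for t :: real
  define p where "p z = hom_part n c d (lin_map N B z)" for z
  define q where "q z = fps_nth ((\<Sum>i=1..N. fps_const (z i / fact (i - 1)) * fps_X ^ (i - 1) :: real fps) ^ d) (d - 2)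
      / (real d * real (d - 1))" for z :: point
  have xt: "isCont (\<lambda>t. xt t i) t" for i t
    by (cases "i = 1") (simp_all add: xt_def)
  have "isCont (\<lambda>t. p (xt t)) 0"
    unfolding p_def hom_part_def monomial_at_def lin_map_def by (intro continuous_intros xt)
  moreover have "isCont (\<lambda>t. q (xt t)) 0"
  proof -
    have tail: "tail_series N (xt t) = tail_series N x" for t
      unfolding tail_series_def by (rule sum.cong) (auto simp: xt_def)
    have "q (xt t) = (\<Sum>k\<le>d. real (d choose k) * (t ^ (d - k) * fps_nth (tail_series N x ^ k) (d - 2))) / (real d * real (d - 1))" for t
      unfolding q_def ray_polynomial_expansion[OF B(1)] tail by (simp add: xt_def)
    then show ?thesis by (simp only:) (intro continuous_intros; use d in simp)
  qed
  moreover have "\<forall>\<^sub>F t in at 0. p (xt t) = q (xt t)"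
    using eventually_neq_at_within[of 0 0]
  proof (rule eventually_mono)
    fix t :: real assume "t \<noteq> 0"
    then have nz: "xt t 1 \<noteq> 0" by (simp add: xt_def)
    show "p (xt t) = q (xt t)"
      unfolding p_def q_def by (rule normal_form_on_rays[where B = B and N = N and x = "xt t" and d = d, OF B pi leg pi1 nz d])
  qed
  ultimately have "((\<lambda>t. q (xt t)) \<longlongrightarrow> p (xt 0)) (at 0)" "((\<lambda>t. q (xt t)) \<longlongrightarrow> q (xt 0)) (at 0)"
    unfolding isCont_def by (simp_all only: tendsto_cong)
  then have "p (xt 0) = q (xt 0)" by (rule tendsto_unique[OF trivial_limit_at])
  moreover have "xt 0 = x" using True by (auto simp: xt_def)
  ultimately show ?thesis by (simp only: p_def q_def)
qed

text \<open>The combinations beyond N have zero series on the axis, hence vanish there as functions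
  near 0, and the level sets spread this to a full neighbourhood. The derivative of G along the
  segment that switches off the later variables is therefore zero.\<close>

lemma independence_of_complement:
  assumes N: "N \<le> n" and zero: "\<And>i. i \<in> {1..n} \<Longrightarrow> N < i \<Longrightarrow> grad_series (\<lambda>j. B j i) e1 = 0"
  shows "\<exists>\<rho>>0. \<forall>x\<in>cbox_at_0 n \<rho>. G (lin_map n B x) = G (lin_map N B x)"
proof -
  obtain r K where r: "0 < r" "0 < K" and lev: "\<forall>\<delta> x. 0 \<le> \<delta> \<longrightarrow> \<delta> \<le> r \<longrightarrow> x \<in> cbox_at_0 n \<delta> \<longrightarrow>
    (\<exists>\<theta>. \<bar>\<theta>\<bar> \<le> K * \<delta> \<and> (\<forall>i\<in>{1..n}. D i x = D i (axis_pt k \<theta>)) \<and>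
      G x - (\<Sum>i=1..n. x i * D i x) = G (axis_pt k \<theta>) - \<theta> * D k (axis_pt k \<theta>))"
    using level_set_axis[OF conv k r0 minors pos] by blast
  have R: "0 < R" using conv by (simp add: converges_def)
  have "\<forall>\<^sub>F \<theta> in nhds 0. \<forall>i\<in>{i\<in>{1..n}. N < i}. grad_comb (\<lambda>j. B j i) e1 \<theta> = 0"
  proof (rule eventually_ball_finite)
    show "\<forall>i\<in>{i\<in>{1..n}. N < i}. \<forall>\<^sub>F \<theta> in nhds 0. grad_comb (\<lambda>j. B j i) e1 \<theta> = 0"
    proof
      fix i assume "i \<in> {i\<in>{1..n}. N < i}"
      then have "grad_comb (\<lambda>j. B j i) e1 has_fps_expansion 0"
        using grad_comb_expansion[of "\<lambda>j. B j i" e1] zero[of i] by simp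
      then have "\<forall>\<^sub>F \<theta> in nhds 0. 0 = grad_comb (\<lambda>j. B j i) e1 \<theta>"
        by (simp add: has_fps_expansion_def)
      then show "\<forall>\<^sub>F \<theta> in nhds 0. grad_comb (\<lambda>j. B j i) e1 \<theta> = 0"
        by (rule eventually_mono) (rule sym)
    qed
  qed simp
  then obtain \<epsilon> where \<epsilon>: "0 < \<epsilon>"
    "\<And>\<theta> i. \<bar>\<theta>\<bar> < \<epsilon> \<Longrightarrow> i \<in> {1..n} \<Longrightarrow> N < i \<Longrightarrow> grad_comb (\<lambda>j. B j i) e1 \<theta> = 0"
    unfolding eventually_nhds_metric by (auto simp: dist_real_def)
  \<comment> \<open>Small enough for the level sets, for the chain rule, and for theta to stay where
    the combinations beyond N vanish.\<close>
  define \<delta> where "\<delta> = min (min r (R / 2)) (\<epsilon> / (2 * K))"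
  have \<delta>: "0 < \<delta>" "\<delta> \<le> r" "\<delta> < R" "K * \<delta> < \<epsilon>"
  proof -
    show "0 < \<delta>" "\<delta> \<le> r" using r R \<epsilon>(1) by (simp_all add: \<delta>_def)
    have "\<delta> \<le> R / 2" by (simp add: \<delta>_def)
    then show "\<delta> < R" using R by simp
    have "K * \<delta> \<le> K * (\<epsilon> / (2 * K))" by (rule mult_left_mono) (use r in \<open>simp_all add: \<delta>_def\<close>)
    also have "\<dots> < \<epsilon>" using r \<epsilon>(1) by simp
    finally show "K * \<delta> < \<epsilon>" .
  qed
  define b where "b = 1 + (\<Sum>j=1..n. \<Sum>i=1..n. \<bar>B j i\<bar>)"
  have b0: "0 < b" unfolding b_def by (intro add_pos_nonneg sum_nonneg) simp_all
  have b: "(\<Sum>i=1..n. \<bar>B j i\<bar>) \<le> b" if j: "j \<in> {1..n}" for j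
  proof -
    have "(\<Sum>i=1..n. \<bar>B j i\<bar>) \<le> (\<Sum>j=1..n. \<Sum>i=1..n. \<bar>B j i\<bar>)"
      by (rule member_le_sum[OF j]) (simp_all add: sum_nonneg)
    then show ?thesis by (simp add: b_def)
  qed
  have "G (lin_map n B x) = G (lin_map N B x)" if x: "x \<in> cbox_at_0 n (\<delta> / b)" for x
  proof -
    define z where "z t = (\<lambda>i. if i \<le> N then x i else t * x i)" for t :: real
    have decomp: "lin_map n B (z t) j = lin_map N B x j + t * (\<Sum>i\<in>{N+1..n}. B j i * x i)" for t j
    proof -
      have "{1..n} = {1..N} \<union> {N+1..n}" using N by auto
      then have "lin_map n B (z t) j = (\<Sum>i=1..N. B j i * z t i) + (\<Sum>i\<in>{N+1..n}. B j i * z t i)"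
        by (simp add: lin_map_def sum.union_disjoint)
      moreover have "(\<Sum>i=1..N. B j i * z t i) = lin_map N B x j"
        unfolding lin_map_def by (rule sum.cong) (auto simp: z_def)
      moreover have "(\<Sum>i\<in>{N+1..n}. B j i * z t i) = t * (\<Sum>i\<in>{N+1..n}. B j i * x i)"
        unfolding sum_distrib_left by (rule sum.cong) (auto simp: z_def)
      ultimately show ?thesis by simp
    qed
    have deriv: "((\<lambda>t. G (lin_map n B (z t))) has_real_derivative 0) (at t within {0..1})"
      if t: "t \<in> {0..1}" for t
    proof -
      have "z t \<in> cbox_at_0 n (\<delta> / b)"
        unfolding cbox_at_0_def
      proof (intro CollectI ballI)
        fix i assume "i \<in> {1..n}"
        then have "\<bar>x i\<bar> \<le> \<delta> / b" using x by (simp add: cbox_at_0_def)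
        moreover have "\<bar>t * x i\<bar> \<le> 1 * \<bar>x i\<bar>"
          unfolding abs_mult by (rule mult_right_mono) (use t in auto)
        ultimately show "\<bar>z t i\<bar> \<le> \<delta> / b" by (simp add: z_def)
      qed
      from lin_map_cbox[OF b this] have zt: "lin_map n B (z t) \<in> cbox_at_0 n \<delta>"
        using \<delta>(1) b0 by simp
      have "\<exists>\<theta>. \<bar>\<theta>\<bar> \<le> K * \<delta> \<and> (\<forall>i\<in>{1..n}. D i (lin_map n B (z t)) = D i (axis_pt k \<theta>)) \<and>
          G (lin_map n B (z t)) - (\<Sum>i=1..n. lin_map n B (z t) i * D i (lin_map n B (z t)))
            = G (axis_pt k \<theta>) - \<theta> * D k (axis_pt k \<theta>)"
        by (intro lev[rule_format] zt \<delta> less_imp_le[OF \<delta>(1)])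
      then obtain \<theta> where \<theta>: "\<bar>\<theta>\<bar> \<le> K * \<delta>" "\<And>i. i \<in> {1..n} \<Longrightarrow> D i (lin_map n B (z t)) = D i (axis_pt k \<theta>)"
        by blast
      have \<theta>\<epsilon>: "\<bar>\<theta>\<bar> < \<epsilon>" using \<theta>(1) \<delta>(4) by simp
      have "((\<lambda>t. G (lin_map n B (z t))) has_real_derivative
          (\<Sum>j=1..n. D j (lin_map n B (z t)) * (\<Sum>i\<in>{N+1..n}. B j i * x i))) (at t)"
      proof (rule power_series_chain_rule[OF conv])
        show "\<bar>lin_map n B (z t) j\<bar> < R" if "j \<in> {1..n}" for j
          using zt that \<delta>(3) by (auto simp: cbox_at_0_def intro: le_less_trans)
        show "((\<lambda>t. lin_map n B (z t) j) has_real_derivative (\<Sum>i\<in>{N+1..n}. B j i * x i)) (at t)" for j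
          unfolding decomp by (auto intro!: derivative_eq_intros)
      qed
      also have "(\<Sum>j=1..n. D j (lin_map n B (z t)) * (\<Sum>i\<in>{N+1..n}. B j i * x i))
          = (\<Sum>i\<in>{N+1..n}. x i * grad_comb (\<lambda>j. B j i) e1 \<theta>)"
        unfolding grad_comb_def axis_pt_scale sum_distrib_left
        by (subst sum.swap) (intro sum.cong refl, simp add: \<theta>(2) mult_ac)
      also have "\<dots> = 0"
        by (rule sum.neutral) (use \<epsilon>(2)[OF \<theta>\<epsilon>] in auto)
      finally show ?thesis by (rule has_field_derivative_at_within)
    qed
    obtain v where v: "\<And>t. t \<in> {0..1} \<Longrightarrow> G (lin_map n B (z t)) = v"
      using has_field_derivative_zero_constant[OF convex_real_interval(5) deriv] by blast
    have "z 1 = x" by (auto simp: z_def)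
    moreover have "lin_map n B (z 0) = lin_map N B x" by (rule HOL.ext) (simp add: decomp)
    ultimately show ?thesis using v[of 1] v[of 0] by simp
  qed
  moreover have "0 < \<delta> / b" using \<delta>(1) b0 by simp
  ultimately show ?thesis by blast
qed

theorem rank_one_normal_form:
  assumes hom: "affinely_homogeneous n (graph_of n G) (\<lambda>_. 0)"
  shows "\<exists>N B C c' \<rho>. 1 \<le> N \<and> N \<le> n \<and> mat_inverse n B C \<and> converges N c' \<rho> \<and>
    (\<forall>x\<in>cbox_at_0 n \<rho>. G (lin_map n B x) = power_series N c' x) \<and>
    (\<forall>x. hom_part N c' 0 x = 0 \<and> hom_part N c' 1 x = 0) \<and>
    (\<forall>d x. 2 \<le> d \<longrightarrow> d \<le> Suc N \<longrightarrow> hom_part N c' d x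
      = fps_nth ((\<Sum>i=1..N. fps_const (x i / fact (i - 1)) * fps_X ^ (i - 1)) ^ d) (d - 2) / (real d * real (d - 1)))"
proof -
  obtain N B C where N: "1 \<le> N" "N \<le> n" and BC: "mat_inverse n B C"
    and zero: "\<And>i. i \<in> {1..n} \<Longrightarrow> N < i \<Longrightarrow> grad_series (\<lambda>j. B j i) e1 = 0"
    and pi: "\<And>i. i \<in> {1..N} \<Longrightarrow> fps_X ^ Suc N dvd
      grad_series (\<lambda>j. B j i) e1 - fps_const (1 / fact i) * grad_series (\<lambda>j. B j 1) e1 ^ i"
    and leg: "fps_X ^ Suc (Suc N) dvd
      fps_X * grad_series e1 e1 - ray_series n c e1 - fps_const (1/2) * grad_series (\<lambda>j. B j 1) e1 ^ 2"
    and pi1: "fps_nth (grad_series (\<lambda>j. B j 1) e1) 1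
      = sqrt (power_series n (deriv_coeffs k (deriv_coeffs k c)) (\<lambda>_. 0))"
    using adapted_coordinates[OF hom] by metis
  obtain \<rho>1 where \<rho>1: "0 < \<rho>1" "\<And>x. x \<in> cbox_at_0 n \<rho>1 \<Longrightarrow> G (lin_map n B x) = G (lin_map N B x)"
    using independence_of_complement[where B = B, OF N(2) zero] by blast
  define b where "b = 1 + (\<Sum>j=1..n. \<Sum>i=1..N. \<bar>B j i\<bar>)"
  have b0: "0 < b" unfolding b_def by (intro add_pos_nonneg sum_nonneg) simp_all
  have b: "(\<Sum>i=1..N. \<bar>B j i\<bar>) \<le> b" if j: "j \<in> {1..n}" for j
  proof -
    have "(\<Sum>i=1..N. \<bar>B j i\<bar>) \<le> (\<Sum>j=1..n. \<Sum>i=1..N. \<bar>B j i\<bar>)"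
      by (rule member_le_sum[OF j]) (simp_all add: sum_nonneg)
    then show ?thesis by (simp add: b_def)
  qed
  obtain c' where c': "converges N c' (R / b)"
    "\<And>d x. hom_part N c' d x = hom_part n c d (lin_map N B x)"
    "\<And>x. x \<in> cbox_at_0 N (R / b) \<Longrightarrow> power_series N c' x = power_series n c (lin_map N B x)"
    using power_series_lin_map[where B = B and k = N, OF conv b b0] by blast
  define \<rho> where "\<rho> = min \<rho>1 (R / b)"
  have Rb: "0 < R / b" using c'(1) by (simp add: converges_def)
  have "converges N c' \<rho>"
    by (rule converges_mono[OF c'(1)]) (use \<rho>1(1) Rb in \<open>simp_all add: \<rho>_def\<close>)
  moreover have "G (lin_map n B x) = power_series N c' x" if x: "x \<in> cbox_at_0 n \<rho>" for x
  proof -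
    have "x \<in> cbox_at_0 n \<rho>1" by (rule cbox_at_0_mono[OF x]) (simp add: \<rho>_def)
    moreover have "x \<in> cbox_at_0 N (R / b)" using x N(2) by (auto simp: cbox_at_0_def \<rho>_def)
    ultimately show ?thesis using \<rho>1(2) c'(3) by simp
  qed
  moreover have "hom_part N c' 0 x = 0 \<and> hom_part N c' 1 x = 0" for x
  proof -
    let ?f = "ray_series n c (lin_map N B x)"
    have "fps_nth ?f 0 = 0" by (simp add: ray_series_nth_0[OF conv] G0)
    moreover have "fps_nth ?f 1 = fps_nth (fps_deriv ?f) 0" by (simp add: fps_deriv_nth)
    then have "fps_nth ?f 1 = 0" unfolding grad_series_deriv grad_series_nth_0 .
    ultimately show ?thesis by (simp add: c'(2) ray_series_def)
  qed
  moreover have "\<forall>d x. 2 \<le> d \<longrightarrow> d \<le> Suc N \<longrightarrow> hom_part N c' d x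
      = fps_nth ((\<Sum>i=1..N. fps_const (x i / fact (i - 1)) * fps_X ^ (i - 1)) ^ d) (d - 2) / (real d * real (d - 1))"
    unfolding c'(2) by (intro allI impI normal_form_hom_part[where B = B, OF N pi leg pi1])
  ultimately show ?thesis using N BC by blast
qed

end

subsection \<open>The normal form\<close>

text \<open>The index m of the displayed sum is the degree minus one. Degrees 2 and 3 are written
  out separately, and degrees from N + 2 on form the unspecified tail.\<close>

lemma normal_form_expansion:
  fixes x :: point
  assumes conv: "converges N c \<rho>" and x: "x \<in> cbox_at_0 N \<rho>" and N: "1 \<le> N"
    and h01: "hom_part N c 0 x = 0" "hom_part N c 1 x = 0"
    and hd: "\<And>d. 2 \<le> d \<Longrightarrow> d \<le> Suc N \<Longrightarrow> hom_part N c d x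
      = fps_nth ((\<Sum>i=1..N. fps_const (x i / fact (i - 1)) * fps_X ^ (i - 1)) ^ d) (d - 2) / (real d * real (d - 1))"
  shows "summable (\<lambda>m. hom_part N c (m + (N + 2)) x)"
    and "power_series N c x = (x 1)\<^sup>2 / 2 + (if N \<ge> 2 then (x 1)\<^sup>2 * x 2 / 2 else 0)
      + (\<Sum>m = 3..N. x 1 ^ m * x m / fact m
           + x 1 ^ (m - 1) *
             (\<Sum>(i, j)\<in>{(i, j). i \<ge> 2 \<and> j \<ge> 2 \<and> i + j = m + 1}.
                1 / 2 * (x i * x j / (fact (i - 1) * fact (j - 1))))
           + remainder_poly N m x)
      + (\<Sum>m. hom_part N c (m + (N + 2)) x)"
proof -
  define h where "h d = hom_part N c d x" for d
  define \<psi> where "\<psi> = (\<Sum>i=1..N. fps_const (x i / fact (i - 1)) * fps_X ^ (i - 1) :: real fps)"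
  have sums: "h sums power_series N c x"
    unfolding h_def by (rule hom_part_sums[OF conv x])
  then have summable: "summable h" by (rule sums_summable)
  then show "summable (\<lambda>m. hom_part N c (m + (N + 2)) x)"
    using summable_ignore_initial_segment[of h "N + 2"] by (simp add: h_def)
  have \<psi>0: "fps_nth \<psi> 0 = x 1"
  proof -
    have "fps_nth \<psi> 0 = (\<Sum>i=1..N. if i = 1 then x 1 else 0)"
      unfolding \<psi>_def fps_sum_nth by (rule sum.cong) (auto simp: fps_X_power_nth)
    then show ?thesis using N by simp
  qed
  have \<psi>1: "fps_nth \<psi> 1 = x 2" if "2 \<le> N"
  proof -
    have "fps_nth \<psi> 1 = (\<Sum>i=1..N. if i = 2 then x 2 else 0)"
      unfolding \<psi>_def fps_sum_nth
    proof (rule sum.cong)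
      fix i assume "i \<in> {1..N}"
      then have "1 = i - 1 \<longleftrightarrow> i = 2" by auto
      then show "fps_nth (fps_const (x i / fact (i - 1)) * fps_X ^ (i - 1)) 1 = (if i = 2 then x 2 else 0)"
        by (simp add: fps_X_power_nth)
    qed simp
    then show ?thesis using that by simp
  qed
  have m1: "fps_nth (f * g) 1 = fps_nth f 0 * fps_nth g 1 + fps_nth f 1 * fps_nth g 0" for f g :: "real fps"
    by (simp add: fps_mult_nth One_nat_def)
  have h2: "h 2 = (x 1)\<^sup>2 / 2"
    using hd[of 2] N by (simp add: h_def \<psi>_def[symmetric] power2_eq_square \<psi>0)
  have h3: "h 3 = (x 1)\<^sup>2 * x 2 / 2" if "2 \<le> N"
  proof -
    have "h 3 = fps_nth (\<psi> * \<psi> * \<psi>) 1 / 6"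
    proof -
      have "h 3 = fps_nth (\<psi> ^ 3) (3 - 2) / (real 3 * real (3 - 1))"
        unfolding h_def \<psi>_def by (rule hd) (use that in auto)
      moreover have "3 - 2 = (1::nat)" "real 3 * real (3 - 1) = 6" by simp_all
      ultimately show ?thesis by (simp only: power3_eq_cube)
    qed
    then show ?thesis by (simp add: m1 \<psi>0 \<psi>1[OF that] power2_eq_square algebra_simps)
  qed
  have hm: "h (Suc m) = x 1 ^ m * x m / fact m
           + x 1 ^ (m - 1) *
             (\<Sum>(i, j)\<in>{(i, j). i \<ge> 2 \<and> j \<ge> 2 \<and> i + j = m + 1}.
                1 / 2 * (x i * x j / (fact (i - 1) * fact (j - 1))))
           + remainder_poly N m x" if m: "m \<in> {3..N}" for m
  proof -
    have "h (m + 1) = fps_nth (\<psi> ^ (m + 1)) (m - 1) / (real (m + 1) * real m)"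
    proof -
      have "h (m + 1) = fps_nth (\<psi> ^ (m + 1)) (m + 1 - 2) / (real (m + 1) * real (m + 1 - 1))"
        unfolding h_def \<psi>_def by (rule hd) (use m in auto)
      moreover have "m + 1 - 2 = m - 1" "m + 1 - 1 = m" by simp_all
      ultimately show ?thesis by (simp only:)
    qed
    also have "\<dots> = x 1 ^ m * x m / fact m
           + x 1 ^ (m - 1) *
             (\<Sum>(i, j)\<in>{(i, j). i \<ge> 2 \<and> j \<ge> 2 \<and> i + j = m + 1}.
                1 / 2 * (x i * x j / (fact (i - 1) * fact (j - 1))))
           + remainder_poly N m x"
      unfolding \<psi>_def by (rule ray_polynomial_normal_form) (use m in auto)
    finally show ?thesis by (simp only: Suc_eq_plus1)
  qed
  have "(\<Sum>d<N + 2. h d) = (x 1)\<^sup>2 / 2 + (if N \<ge> 2 then (x 1)\<^sup>2 * x 2 / 2 else 0) + (\<Sum>m=3..N. h (Suc m))"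
  proof (cases "2 \<le> N")
    case True
    have "{..<N + 2} = {0, 1, 2, 3} \<union> {Suc 3..Suc N}" using True by auto
    then have "(\<Sum>d<N + 2. h d) = (\<Sum>d\<in>{0, 1, 2, 3}. h d) + (\<Sum>d=Suc 3..Suc N. h d)"
      by (simp only:) (rule sum.union_disjoint; auto)
    also have "(\<Sum>d\<in>{0, 1, 2, 3}. h d) = (x 1)\<^sup>2 / 2 + (x 1)\<^sup>2 * x 2 / 2"
      using h01 h2 h3[OF True] by (simp add: h_def[of 0] h_def[of 1])
    finally show ?thesis using True by (simp only: sum.shift_bounds_cl_Suc_ivl if_True)
  next
    case False
    then have "N = 1" using N by simp
    then have "{..<N + 2} = {0, 1, 2}" by auto
    then show ?thesis using \<open>N = 1\<close> h01 h2 by (simp add: h_def[of 0] h_def[of 1])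
  qed
  moreover have "power_series N c x = (\<Sum>m. h (m + (N + 2))) + (\<Sum>d<N + 2. h d)"
    using suminf_split_initial_segment[OF summable, of "N + 2"] sums_unique[OF sums] by simp
  moreover have "(\<Sum>m=3..N. h (Suc m)) = (\<Sum>m = 3..N. x 1 ^ m * x m / fact m
           + x 1 ^ (m - 1) *
             (\<Sum>(i, j)\<in>{(i, j). i \<ge> 2 \<and> j \<ge> 2 \<and> i + j = m + 1}.
                1 / 2 * (x i * x j / (fact (i - 1) * fact (j - 1))))
           + remainder_poly N m x)"
    by (rule sum.cong[OF refl hm])
  ultimately show "power_series N c x = (x 1)\<^sup>2 / 2 + (if N \<ge> 2 then (x 1)\<^sup>2 * x 2 / 2 else 0)
      + (\<Sum>m = 3..N. x 1 ^ m * x m / fact m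
           + x 1 ^ (m - 1) *
             (\<Sum>(i, j)\<in>{(i, j). i \<ge> 2 \<and> j \<ge> 2 \<and> i + j = m + 1}.
                1 / 2 * (x i * x j / (fact (i - 1) * fact (j - 1))))
           + remainder_poly N m x)
      + (\<Sum>m. hom_part N c (m + (N + 2)) x)"
    unfolding h_def by linarith
qed

section \<open>Translation into the notions of the statement\<close>

lemma homogeneous_poly_hom_part: "homogeneous_poly k d (hom_part k c d)"
  unfolding homogeneous_poly_def hom_part_def degree_indices_def by (intro exI[of _ c]) simp

lemma analytic_at_power_series:
  assumes "converges k c R"
  shows "analytic_at k (power_series k c) (\<lambda>_. 0)"
  unfolding analytic_at_def
proof (intro exI conjI ballI)
  show "0 < R" using assms by (simp add: converges_def)
  fix x assume "x \<in> xbox k (\<lambda>_. 0) R"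
  then have "x \<in> cbox_at_0 k R" by (auto simp: xbox_def cbox_at_0_def intro: less_imp_le)
  from power_series_has_sum[OF assms this]
  show "((\<lambda>\<alpha>. c \<alpha> * monomial_at k \<alpha> (\<lambda>i. x i - 0)) has_sum power_series k c x) (multi_indices k)"
    by simp
qed

text \<open>The point with all coordinates shifted by r / 2 lies in the open box, and convergence
  there is absolute convergence on the closed box of half the radius.\<close>

lemma analytic_at_power_seriesE:
  assumes "analytic_at k F a"
  obtains c R where "converges k c R" "\<And>x. x \<in> xbox k a R \<Longrightarrow> F x = power_series k c (\<lambda>i. x i - a i)"
proof -
  obtain c r where r: "0 < r" and c: "\<And>x. x \<in> xbox k a r \<Longrightarrow>
      ((\<lambda>\<alpha>. c \<alpha> * monomial_at k \<alpha> (\<lambda>i. x i - a i)) has_sum F x) (multi_indices k)"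
    using assms unfolding analytic_at_def by blast
  have "(\<lambda>i. a i + r / 2) \<in> xbox k a r" using r by (simp add: xbox_def)
  from c[OF this] have "converges k c (r / 2)"
    by (intro converges_if_has_sum) (use r in simp_all)
  moreover have "F x = power_series k c (\<lambda>i. x i - a i)" if "x \<in> xbox k a (r / 2)" for x
  proof -
    have "x \<in> xbox k a r" using that r by (force simp: xbox_def)
    then show ?thesis unfolding power_series_def by (rule infsumI[OF c, symmetric])
  qed
  ultimately show thesis by (rule that)
qed

lemma cylinder_graph_of:
  assumes "\<And>x y. (\<And>i. i \<in> {1..k} \<Longrightarrow> x i = y i) \<Longrightarrow> F x = F y"
  shows "cylinder n k (graph_of k F) = graph_of n F"
proof -
  have "F (truncate k p) = F p" for p by (rule assms) (simp add: truncate_def)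
  then show ?thesis
    by (auto simp: cylinder_def graph_of_def truncate_in_euc simp del: topspace_Euclidean_space)
      (simp_all add: truncate_def)
qed

text \<open>\<open>affine_map\<close> demands entries 0 beyond k at every argument, which the
  identity function violates; truncation acts as the identity on \<open>euc (Suc k)\<close> and
  satisfies it.\<close>

lemma truncate_coordinates: "affine_coordinates (Suc k) (truncate k)"
proof -
  have "affine_map (Suc k) (truncate k)"
    unfolding affine_map_def
  proof (intro exI allI)
    fix p :: point and i
    show "truncate k p i = (if i < Suc k then 0 + (\<Sum>j<Suc k. (if j = i then 1 else 0) * p j) else 0)"
      by (simp add: truncate_def if_distrib[of "\<lambda>z. z * _"] cong: if_cong del: sum.lessThan_Suc)
  qed
  moreover have "truncate k (truncate k p) = p" if "p \<in> euc (Suc k)" for p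
    by (simp only: truncate_id[OF that])
  ultimately show ?thesis
    by (intro affine_coordinatesI[of _ _ "truncate k"]) blast+
qed

lemma graph_hypersurface:
  assumes "converges k c R" "power_series k c (\<lambda>_. 0) = 0"
  shows "local_analytic_hypersurface k (graph_of k (power_series k c)) (\<lambda>_. 0)"
proof -
  let ?K = "graph_of k (power_series k c)"
  have t0: "truncate k (\<lambda>_. 0) = (\<lambda>_. 0)" by (simp add: truncate_def)
  have "truncate k ` ?K = ?K"
    using graph_of_subset[of k "power_series k c"] truncate_id by (force simp del: topspace_Euclidean_space)
  moreover have "(\<lambda>_. 0) \<in> euc (Suc k)" by (simp add: euc_iff del: topspace_Euclidean_space)
  ultimately have "graphed_in k ?K (\<lambda>_. 0) (truncate k) (power_series k c)"
    unfolding graphed_in_def t0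
    using truncate_coordinates analytic_at_power_series[OF assms(1)] locally_equal_refl by simp
  moreover have "(\<lambda>_. 0) \<in> ?K" using assms(2) by (simp add: graph_of_def euc_iff)
  ultimately show ?thesis
    unfolding local_analytic_hypersurface_def using graph_of_subset by blast
qed

text \<open>A nonzero diagonal entry of the Hessian at the base point selects k. Subtracting the
  tangent hyperplane leaves the second derivatives unchanged, and reversing u where necessary makes
  this entry positive.\<close>

lemma rank_one_normalization:
  assumes F: "analytic_at n F a" and a: "a \<in> euc (Suc n)" "a 0 = F a"
    and rank: "0 < \<epsilon>" "\<And>x. x \<in> xbox n a \<epsilon> \<Longrightarrow> vec_space.rank n (hessian n F x) = 1"
  obtains k c R r0 \<phi> where "rank_one_graph n k c R r0"
    "affine_coordinates (Suc n) \<phi>" "\<phi> a = (\<lambda>_. 0)"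
    "locally_equal (Suc n) (\<lambda>_. 0) (\<phi> ` graph_of n F) (graph_of n (power_series n c))"
proof -
  obtain c0 R where conv0: "converges n c0 R"
    and F0: "\<And>x. x \<in> xbox n a R \<Longrightarrow> F x = power_series n c0 (\<lambda>i. x i - a i)"
    using analytic_at_power_seriesE[OF F] by blast
  have R: "0 < R" using conv0 by (simp add: converges_def)
  define H where "H i j = power_series n (deriv_coeffs j (deriv_coeffs i c0))" for i j
  \<comment> \<open>Half of the minimum yields a closed box inside the open boxes of the rank
    hypothesis and of the second derivatives.\<close>
  define r0 where "r0 = min \<epsilon> (R / 2) / 2"
  have r0: "0 < r0" "r0 < \<epsilon>" "r0 < R / 2" using rank(1) R by (auto simp: r0_def)
  have car: "hessian n F x \<in> carrier_mat n n" for x by (simp add: hessian_def)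
  have hess: "hessian n F (\<lambda>i. a i + y i) $$ (i, j) = H (Suc i) (Suc j) y"
    if y: "y \<in> cbox_at_0 n r0" and "i < n" "j < n" for y i j
  proof -
    have "(\<lambda>i. a i + y i) \<in> xbox n a (R / 2)"
      using y r0(3) by (force simp: xbox_def cbox_at_0_def)
    from hessian_power_series[OF conv0 F0 this that(2,3)] show ?thesis by (simp add: H_def)
  qed
  have rk: "vec_space.rank n (hessian n F (\<lambda>i. a i + y i)) = 1" if y: "y \<in> cbox_at_0 n r0" for y
    by (rule rank(2)) (use y r0(2) in \<open>force simp: xbox_def cbox_at_0_def\<close>)
  have minors: "H i j y * H p q y = H i q y * H p j y"
    if y: "y \<in> cbox_at_0 n r0" and ij: "i \<in> {1..n}" "j \<in> {1..n}" "p \<in> {1..n}" "q \<in> {1..n}" for y i j p q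
  proof -
    have i: "i - 1 < n" "j - 1 < n" "p - 1 < n" "q - 1 < n" using ij by auto
    have S: "Suc (i - 1) = i" "Suc (j - 1) = j" "Suc (p - 1) = p" "Suc (q - 1) = q" using ij by auto
    from rank_one_minors[OF car rk[OF y] i] show ?thesis
      unfolding hess[OF y i(1,2)] hess[OF y i(3,4)] hess[OF y i(1,4)] hess[OF y i(3,2)] S .
  qed
  have y0: "(\<lambda>_. 0) \<in> cbox_at_0 n r0" using r0(1) by (simp add: cbox_at_0_def)
  obtain k' where k': "k' < n" "hessian n F (\<lambda>i. a i + 0) $$ (k', k') \<noteq> 0"
  proof (rule rank_one_symmetric_diagonal[OF car rk[OF y0]])
    show "hessian n F (\<lambda>i. a i + 0) $$ (i, j) = hessian n F (\<lambda>i. a i + 0) $$ (j, i)" if "i < n" "j < n" for i j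
      unfolding hess[OF y0 that] hess[OF y0 that(2,1)] H_def by (simp add: deriv_coeffs_commute)
  qed blast
  define k where "k = Suc k'"
  have k: "k \<in> {1..n}" using k'(1) by (simp add: k_def One_nat_def)
  have Hk: "H k k (\<lambda>_. 0) \<noteq> 0" using k'(2) unfolding hess[OF y0 k'(1) k'(1)] by (simp add: k_def)
  define \<sigma> where "\<sigma> = sgn (H k k (\<lambda>_. 0))"
  have \<sigma>: "\<sigma> * \<sigma> = 1" using Hk by (simp add: \<sigma>_def sgn_mult[symmetric] sgn_if)
  define c where "c = normalized_coeffs n \<sigma> c0"
  have conv: "converges n c R" unfolding c_def by (rule converges_normalized[OF conv0])
  have Hc: "power_series n (deriv_coeffs j (deriv_coeffs i c)) y = \<sigma> * H i j y"
    if "i \<in> {1..n}" "j \<in> {1..n}" for i j y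
    unfolding c_def second_deriv_normalized[OF that] H_def by (rule power_series_cmult)
  have graph: "rank_one_graph n k c R r0"
  proof
    show "power_series n (deriv_coeffs j (deriv_coeffs i c)) x * power_series n (deriv_coeffs k (deriv_coeffs k c)) x
      = power_series n (deriv_coeffs k (deriv_coeffs i c)) x * power_series n (deriv_coeffs j (deriv_coeffs k c)) x"
      if "x \<in> cbox_at_0 n r0" "i \<in> {1..n}" "j \<in> {1..n}" for x i j
    proof -
      have "(\<sigma> * H i j x) * (\<sigma> * H k k x) = (\<sigma> * \<sigma>) * (H i j x * H k k x)" by (simp add: mult_ac)
      also have "\<dots> = (\<sigma> * \<sigma>) * (H i k x * H k j x)" by (simp only: minors[OF that k k])
      also have "\<dots> = (\<sigma> * H i k x) * (\<sigma> * H k j x)" by (simp add: mult_ac)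
      finally show ?thesis by (simp only: Hc that k)
    qed
    have "\<sigma> * H k k (\<lambda>_. 0) = \<bar>H k k (\<lambda>_. 0)\<bar>"
      unfolding \<sigma>_def by (simp add: abs_sgn mult.commute)
    then show "0 < power_series n (deriv_coeffs k (deriv_coeffs k c)) (\<lambda>_. 0)"
      using Hk by (simp add: Hc[OF k k])
    show "power_series n c (\<lambda>_. 0) = 0"
      by (simp add: power_series_at_0 c_def normalized_coeffs_def multi_degree_def)
    show "power_series n (deriv_coeffs i c) (\<lambda>_. 0) = 0" if "i \<in> {1..n}" for i
    proof -
      have "deg n ((\<lambda>_. 0)(i := Suc 0)) = Suc (deg n (\<lambda>_. 0))"
        using deg_fun_upd_Suc[OF that, of "\<lambda>_. 0"] by simp
      then have "deg n ((\<lambda>_. 0)(i := Suc 0)) \<le> 1" by (simp add: multi_degree_def One_nat_def)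
      then show ?thesis by (simp add: power_series_at_0 deriv_coeffs_def c_def normalized_coeffs_def)
    qed
  qed (fact conv k r0(1))+
  have "\<exists>\<phi>. affine_coordinates (Suc n) \<phi> \<and> \<phi> a = (\<lambda>_. 0) \<and>
    locally_equal (Suc n) (\<lambda>_. 0) (\<phi> ` graph_of n F) (graph_of n (power_series n c))"
  proof (rule tangent_normalization[OF \<sigma> a(1) R, of _ "\<lambda>j. c0 (unit_index j)"])
    fix p :: point assume p: "\<And>i. i \<in> {1..n} \<Longrightarrow> \<bar>p i - a i\<bar> < R"
    have "a \<in> xbox n a R" using R by (simp add: xbox_def)
    from F0[OF this] have c00: "c0 (\<lambda>_. 0) = a 0" by (simp add: power_series_at_0 a(2))
    have "p \<in> xbox n a R" using p by (simp add: xbox_def)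
    then have "F p = power_series n c0 (\<lambda>i. p i - a i)" by (rule F0)
    also have "\<dots> = c0 (\<lambda>_. 0) + (\<Sum>j=1..n. c0 (unit_index j) * (p j - a j))
        + \<sigma> * power_series n c (\<lambda>i. p i - a i)"
      unfolding c_def
      by (rule power_series_normalized[OF conv0 _ \<sigma>]) (use p in \<open>simp add: cbox_at_0_def less_imp_le\<close>)
    finally show "F p = a 0 + (\<Sum>j=1..n. c0 (unit_index j) * (p j - a j))
        + \<sigma> * power_series n c (\<lambda>i. p i - a i)"
      unfolding c00 .
  next
    show "power_series n c x = power_series n c y" if "\<And>i. i \<in> {1..n} \<Longrightarrow> x i = y i" for x y
      using that by (rule power_series_cong)
  qed
  then show thesis using graph that by blast
qed

theorem theorem1p4:
  fixes n :: nat and H :: "point set" and p0 :: point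
  assumes "n \<ge> 1"
    and "local_analytic_hypersurface n H p0"
    and "affinely_homogeneous n H p0"
    and "constant_hessian_rank n H p0 1"
  shows "\<exists>nH \<phi> F K.
    1 \<le> nH \<and> nH \<le> n \<and>
    affine_coordinates (Suc n) \<phi> \<and> \<phi> p0 = (\<lambda>_. 0) \<and>
    local_analytic_hypersurface nH K (\<lambda>_. 0) \<and>
    affinely_homogeneous nH K (\<lambda>_. 0) \<and>
    locally_equal (Suc n) (\<lambda>_. 0) (\<phi> ` H) (cylinder n nH K) \<and>
    analytic_at nH F (\<lambda>_. 0) \<and>
    locally_equal (Suc n) (\<lambda>_. 0) (\<phi> ` H) (graph_of n F) \<and>
    locally_equal (Suc nH) (\<lambda>_. 0) K (graph_of nH F) \<and>
    (\<exists>R E :: nat \<Rightarrow> point \<Rightarrow> real.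
       (\<forall>m\<in>{3..nH}. homogeneous_poly_ord (m - 1) (m + 1) {2..m - 1} 3 (R m)) \<and>
       (\<forall>m\<ge>nH + 2. homogeneous_poly nH m (E m)) \<and>
       (\<exists>r>0. \<forall>x\<in>xbox nH (\<lambda>_. 0) r.
          summable (\<lambda>m. E (m + (nH + 2)) x) \<and>
          F x = (x 1)\<^sup>2 / 2 + (if nH \<ge> 2 then (x 1)\<^sup>2 * x 2 / 2 else 0)
            + (\<Sum>m = 3..nH. x 1 ^ m * x m / fact m
                 + x 1 ^ (m - 1) *
                   (\<Sum>(i, j)\<in>{(i, j). i \<ge> 2 \<and> j \<ge> 2 \<and> i + j = m + 1}.
                      1 / 2 * (x i * x j / (fact (i - 1) * fact (j - 1))))
                 + R m x)
            + (\<Sum>m. E (m + (nH + 2)) x)))"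
proof -
  have HE: "H \<subseteq> euc (Suc n)" "p0 \<in> H"
    using assms(2) unfolding local_analytic_hypersurface_def by blast+
  obtain \<phi>0 F0 \<epsilon> where g: "graphed_in n H p0 \<phi>0 F0" and \<epsilon>: "0 < \<epsilon>"
    and rank: "\<And>x. x \<in> xbox n (\<phi>0 p0) \<epsilon> \<Longrightarrow> vec_space.rank n (hessian n F0 x) = 1"
    using assms(4) unfolding constant_hessian_rank_def by blast
  define a where "a = \<phi>0 p0"
  have \<phi>0: "affine_coordinates (Suc n) \<phi>0" and F0: "analytic_at n F0 a"
    and le0: "locally_equal (Suc n) a (\<phi>0 ` H) (graph_of n F0)"
    using g unfolding graphed_in_def a_def by blast+
  have sub: "f ` A \<subseteq> euc (Suc n)" if "affine_coordinates (Suc n) f" for f A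
    using that affine_map_in_euc unfolding affine_coordinates_def by blast
  have aH: "a \<in> \<phi>0 ` H" using HE(2) by (simp add: a_def)
  have ag: "a \<in> graph_of n F0"
    using le0 aH unfolding locally_equal_def by blast
  have a: "a \<in> euc (Suc n)" "a 0 = F0 a"
    using ag graph_of_subset by (blast, simp add: graph_of_def)
  obtain k c R r0 \<phi>1 where graph: "rank_one_graph n k c R r0"
    and \<phi>1: "affine_coordinates (Suc n) \<phi>1" "\<phi>1 a = (\<lambda>_. 0)"
    and le1: "locally_equal (Suc n) (\<lambda>_. 0) (\<phi>1 ` graph_of n F0) (graph_of n (power_series n c))"
    using rank_one_normalization[OF F0 a \<epsilon> rank[folded a_def]] by blast
  interpret rank_one_graph n k c R r0 by (rule graph)
  have hom0: "affinely_homogeneous n (graph_of n F0) a"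
    by (rule affinely_homogeneous_local[OF le0 sub[OF \<phi>0] graph_of_subset])
      (unfold a_def, rule affinely_homogeneous_image[OF \<phi>0 HE assms(3)])
  have homG: "affinely_homogeneous n (graph_of n G) (\<lambda>_. 0)"
    using affinely_homogeneous_image[OF \<phi>1(1) graph_of_subset ag hom0]
    unfolding \<phi>1(2) by (rule affinely_homogeneous_local[OF le1 sub[OF \<phi>1(1)] graph_of_subset])
  obtain N B C c' \<rho> where N: "1 \<le> N" "N \<le> n" and BC: "mat_inverse n B C" and conv': "converges N c' \<rho>"
    and GF: "\<forall>x\<in>cbox_at_0 n \<rho>. G (lin_map n B x) = power_series N c' x"
    and h: "\<forall>x. hom_part N c' 0 x = 0 \<and> hom_part N c' 1 x = 0"
    and hd: "\<forall>d x. 2 \<le> d \<longrightarrow> d \<le> Suc N \<longrightarrow> hom_part N c' d x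
      = fps_nth ((\<Sum>i=1..N. fps_const (x i / fact (i - 1)) * fps_X ^ (i - 1)) ^ d) (d - 2) / (real d * real (d - 1))"
    using rank_one_normal_form[OF homG] by (elim exE conjE) (rule that)
  have h01: "hom_part N c' 0 x = 0" "hom_part N c' 1 x = 0" for x using h by blast+
  have \<rho>: "0 < \<rho>" using conv' by (simp add: converges_def)
  define F where "F = power_series N c'"
  have Fcong: "F x = F y" if "\<And>i. i \<in> {1..N} \<Longrightarrow> x i = y i" for x y
    unfolding F_def using that by (rule power_series_cong)
  have F00: "F (\<lambda>_. 0) = 0"
    unfolding F_def power_series_at_0 using h01(1) by (simp add: hom_part_0)
  have "\<exists>\<phi>. affine_coordinates (Suc n) \<phi> \<and> \<phi> (\<lambda>_. 0) = (\<lambda>_. 0) \<and>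
    locally_equal (Suc n) (\<lambda>_. 0) (\<phi> ` graph_of n G) (graph_of n F)"
  proof (rule linear_change_of_variables[OF _ _ \<rho>])
    show "(\<Sum>l=1..n. B i l * C l j) = id_mat i j" "(\<Sum>l=1..n. C i l * B l j) = id_mat i j"
      if "i \<in> {1..n}" "j \<in> {1..n}" for i j
      using BC that by (simp_all add: mat_inverse_def mat_prod_def id_mat_def)
    show "G x = G y" if "\<And>i. i \<in> {1..n} \<Longrightarrow> x i = y i" for x y
      using that by (rule power_series_cong)
    show "F q = G (\<lambda>j. \<Sum>i=1..n. B j i * q i)" if "\<And>i. i \<in> {1..n} \<Longrightarrow> \<bar>q i\<bar> < \<rho>" for q
    proof -
      have "q \<in> cbox_at_0 n \<rho>" using that by (simp add: cbox_at_0_def less_imp_le)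
      then show ?thesis using GF[rule_format, of q] by (simp add: F_def lin_map_def)
    qed
  qed
  then obtain \<phi>2 where \<phi>2: "affine_coordinates (Suc n) \<phi>2" "\<phi>2 (\<lambda>_. 0) = (\<lambda>_. 0)"
    and le2: "locally_equal (Suc n) (\<lambda>_. 0) (\<phi>2 ` graph_of n G) (graph_of n F)"
    by blast
  \<comment> \<open>Graphing coordinates, then removal of the tangent hyperplane, then the linear
    change adapted to the orders of vanishing.\<close>
  define \<phi> where "\<phi> p = \<phi>2 (\<phi>1 (\<phi>0 p))" for p
  define K where "K = graph_of N F"
  have \<phi>: "affine_coordinates (Suc n) \<phi>"
    unfolding \<phi>_def[abs_def] by (rule affine_coordinates_comp[OF \<phi>2(1) affine_coordinates_comp[OF \<phi>1(1) \<phi>0]])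
  have \<phi>p0: "\<phi> p0 = (\<lambda>_. 0)" by (simp add: \<phi>_def a_def[symmetric] \<phi>1(2) \<phi>2(2))
  have "locally_equal (Suc n) (\<lambda>_. 0) (\<phi>1 ` \<phi>0 ` H) (graph_of n G)"
    using locally_equal_image[OF \<phi>1(1) le0 sub[OF \<phi>0] graph_of_subset] le1
    unfolding \<phi>1(2) by (rule locally_equal_trans)
  from locally_equal_image[OF \<phi>2(1) this sub[OF \<phi>1(1)] graph_of_subset]
  have "locally_equal (Suc n) (\<lambda>_. 0) (\<phi>2 ` \<phi>1 ` \<phi>0 ` H) (\<phi>2 ` graph_of n G)"
    unfolding \<phi>2(2) .
  from locally_equal_trans[OF this le2]
  have le: "locally_equal (Suc n) (\<lambda>_. 0) (\<phi> ` H) (graph_of n F)"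
    by (simp add: \<phi>_def[abs_def] image_image)
  have "(\<lambda>_. 0) \<in> graph_of n G" by (simp add: graph_of_def euc_iff G0)
  from affinely_homogeneous_image[OF \<phi>2(1) graph_of_subset this homG]
  have homF: "affinely_homogeneous n (graph_of n F) (\<lambda>_. 0)"
    unfolding \<phi>2(2) by (rule affinely_homogeneous_local[OF le2 sub[OF \<phi>2(1)] graph_of_subset])
  \<comment> \<open>F depends on the first N variables only, so its graph over n variables is the
    cylinder over its graph over N variables. The splitting and the homogeneity of the base both
    come from this identity.\<close>
  have cyl: "cylinder n N K = graph_of n F"
    unfolding K_def by (rule cylinder_graph_of[OF Fcong])
  have K0: "(\<lambda>_. 0) \<in> K" by (simp add: K_def graph_of_def euc_iff F00)
  have homK: "affinely_homogeneous N K (\<lambda>_. 0)"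
    by (rule affinely_homogeneous_cylinder_base[OF N(2) _ K0])
      (unfold cyl, unfold K_def, rule graph_of_subset, rule homF)
  have hypK: "local_analytic_hypersurface N K (\<lambda>_. 0)"
    unfolding K_def F_def by (rule graph_hypersurface[OF conv']) (use F00 in \<open>simp add: F_def\<close>)
  have anF: "analytic_at N F (\<lambda>_. 0)"
    unfolding F_def by (rule analytic_at_power_series[OF conv'])
  have leK: "locally_equal (Suc N) (\<lambda>_. 0) K (graph_of N F)"
    unfolding K_def by (rule locally_equal_refl) (simp add: euc_iff)
  have exp: "summable (\<lambda>m. hom_part N c' (m + (N + 2)) x) \<and>
          F x = (x 1)\<^sup>2 / 2 + (if N \<ge> 2 then (x 1)\<^sup>2 * x 2 / 2 else 0)
            + (\<Sum>m = 3..N. x 1 ^ m * x m / fact m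
                 + x 1 ^ (m - 1) *
                   (\<Sum>(i, j)\<in>{(i, j). i \<ge> 2 \<and> j \<ge> 2 \<and> i + j = m + 1}.
                      1 / 2 * (x i * x j / (fact (i - 1) * fact (j - 1))))
                 + remainder_poly N m x)
            + (\<Sum>m. hom_part N c' (m + (N + 2)) x)"
    if "x \<in> xbox N (\<lambda>_. 0) \<rho>" for x
  proof -
    have x: "x \<in> cbox_at_0 N \<rho>" using that by (simp add: xbox_def cbox_at_0_def less_imp_le)
    show ?thesis
      unfolding F_def by (rule conjI; rule normal_form_expansion[OF conv' x N(1) h01 hd[rule_format]])
  qed
  have rem: "\<forall>m\<in>{3..N}. homogeneous_poly_ord (m - 1) (m + 1) {2..m - 1} 3 (remainder_poly N m)"
    by (intro ballI remainder_poly_homogeneous) simp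
  show ?thesis
  proof (intro exI[of _ N] exI[of _ \<phi>] exI[of _ F] exI[of _ K] conjI)
    show "locally_equal (Suc n) (\<lambda>_. 0) (\<phi> ` H) (cylinder n N K)" unfolding cyl by (rule le)
    show "\<exists>R E :: nat \<Rightarrow> point \<Rightarrow> real.
       (\<forall>m\<in>{3..N}. homogeneous_poly_ord (m - 1) (m + 1) {2..m - 1} 3 (R m)) \<and>
       (\<forall>m\<ge>N + 2. homogeneous_poly N m (E m)) \<and>
       (\<exists>r>0. \<forall>x\<in>xbox N (\<lambda>_. 0) r.
          summable (\<lambda>m. E (m + (N + 2)) x) \<and>
          F x = (x 1)\<^sup>2 / 2 + (if N \<ge> 2 then (x 1)\<^sup>2 * x 2 / 2 else 0)
            + (\<Sum>m = 3..N. x 1 ^ m * x m / fact m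
                 + x 1 ^ (m - 1) *
                   (\<Sum>(i, j)\<in>{(i, j). i \<ge> 2 \<and> j \<ge> 2 \<and> i + j = m + 1}.
                      1 / 2 * (x i * x j / (fact (i - 1) * fact (j - 1))))
                 + R m x)
            + (\<Sum>m. E (m + (N + 2)) x))"
      by (intro exI[of _ "remainder_poly N"] exI[of _ "hom_part N c'"] conjI rem)
        (simp add: homogeneous_poly_hom_part, intro exI[of _ \<rho>] conjI ballI \<rho> exp[THEN conjunct1] exp[THEN conjunct2])
  qed (fact N \<phi> \<phi>p0 hypK homK anF le leK)+
qed

end
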